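(* Let $G$ and $H$ be locally compact, locally Hausdorff, étale groupoids with locally compact Hausdorff unit spaces, let $p\in[1,\infty]$, and let $Z$ be a groupoid correspondence from $G$ to $H$. Assume, in addition, that either 1. $p\in\{1,\infty\}$; or 2. $1<p<\infty$ and the left $G$-action on $Z$ is proper. Then the Banach $\bigl(F^p_{\mathrm{red}}(G),F^p_{\mathrm{red}}(H)\bigr)$-correspondence associated with $Z$ is a Morita cycle if and only if $Z$ is proper, i.e. if and only if the map $r_*:Z/H\to G^{(0)}$ induced by $r_Z$ is proper.
   Context: **Groupoids.** For a locally compact, locally Hausdorff space $X$, $\mathcal C(X)=\mathrm{span}\{f\in C_c(U):U\subseteq X\text{ open Hausdorff}\}$ (extension by zero). For an étale groupoid $G$, $\mathcal C(G)$ is an algebra under $(f*g)(\gamma)=\sum_{r(\eta)=r(\gamma)}f(\eta)g(\eta^{-1}\gamma)$. With $G_u=s^{-1}(u)$, $F^p_{\mathrm{red}}(G)$ is the completion of $\mathcal C(G)$ in $\sup_{u\in G^{(0)}}\|\lambda_u(f)\|_{B(\ell^p(G_u))}$, where $\lambda_u(f)\xi(\gamma)=\sum_{r(\eta)=r(\gamma)}f(\eta)\xi(\eta^{-1}\gamma)$. **Correspondences.** A groupoid correspondence from $G$ to $H$ is a topological space $Z$ with commuting continuous left $G$-action (anchor $r_Z:Z\to G^{(0)}$, continuous, not necessarily open) and continuous right $H$-action (anchor $s_Z:Z\to H^{(0)}$), such that $s_Z$ is a local homeomorphism and the right $H$-action is free ($zh=z$ implies $h=s_Z(z)$) and proper.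 A left action is proper if $\{(\gamma,z):s(\gamma)=r_Z(z)\}\to Z\times Z$, $(\gamma,z)\mapsto(\gamma z,z)$, is a proper map (closed, with compact inverse images of compact sets); similarly for right actions. $Z$ is called proper if $r_*:Z/H\to G^{(0)}$ is proper. **The associated Banach pair.** Put $B=F^p_{\mathrm{red}}(H)$, $Z_v=s_Z^{-1}(v)$, $H_v=s^{-1}(v)$, $E_H^p=\bigoplus^p_{v\in H^{(0)}}\ell^p(H_v)$, $E_Z^p=\bigoplus^p_{v\in H^{(0)}}\ell^p(Z_v)$ ($\ell^\infty$-sums if $p=\infty$). $B$ is isometrically represented on $E_H^p$ by $\lambda_H^p=\bigoplus_v\lambda_v$. Let $Z^{op}=\{\bar z:z\in Z\}$ be a homeomorphic copy of $Z$. For $\phi\in\mathcal C(Z)$, $\psi\in\mathcal C(Z^{op})$ define bounded operators $T_\phi:E_H^p\to E_Z^p$, $(T_\phi\xi)(z)=\sum_{h\in H_{s_Z(z)}}\phi(zh^{-1})\xi(h)$, and $S_\psi:E_Z^p\to E_H^p$, $(S_\psi\zeta)(h)=\sum_{z\in Z_{s(h)}}\psi(\overline{zh^{-1}})\zeta(z)$. The maps $\phi\mapsto T_\phi$, $\psi\mapsto S_\psi$ are injective; $\mathsf Y_Z$ and $\mathsf X_Z$ are the operator-norm closures of $\{T_\phi\}$ and $\{S_\psi\}$. With operator composition as $B$-module actions and pairing $\langle S,T\rangle_B=ST$, $(\mathsf X_Z,\mathsf Y_Z)$ is a Banach $B$-pair. **Left action.** $\mathcal C(G)$ acts by $(a\cdot\phi)(z)=\sum_{r(\gamma)=r_Z(z)}a(\gamma)\phi(\gamma^{-1}z)$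 on $\mathcal C(Z)$ and $(\psi\cdot a)(\bar z)=\sum_{r(\gamma)=r_Z(z)}\psi(\overline{\gamma^{-1}z})a(\gamma^{-1})$ on $\mathcal C(Z^{op})$. Under hypothesis 1 or 2 this extends to a contractive homomorphism $\pi_Z:F^p_{\mathrm{red}}(G)\to\mathcal L_B(\mathsf X_Z,\mathsf Y_Z)$; the Banach correspondence associated with $Z$ is $((\mathsf X_Z,\mathsf Y_Z),\pi_Z)$. **Banach-algebraic notions.** A Banach $B$-pair $(\mathsf X,\mathsf Y)$ is a left Banach $B$-module $\mathsf X$ and a right Banach $B$-module $\mathsf Y$ (contractive actions) with a bilinear pairing $\langle\cdot,\cdot\rangle_B:\mathsf X\times\mathsf Y\to B$ that is left $B$-linear in $\mathsf X$, right $B$-linear in $\mathsf Y$, and satisfies $\|\langle x,y\rangle\|\le\|x\|\|y\|$. $\mathcal L_B(\mathsf X,\mathsf Y)$ is the Banach algebra of pairs $T=(T^l,T^r)$ of bounded $B$-module maps $T^l:\mathsf X\to\mathsf X$, $T^r:\mathsf Y\to\mathsf Y$ with $\langle T^lx,y\rangle=\langle x,T^ry\rangle$, norm $\max(\|T^l\|,\|T^r\|)$, product $TS=(S^lT^l,T^rS^r)$. $\mathcal K_B(\mathsf X,\mathsf Y)$ is the closed span of the operators $\theta_{w,x}$ ($w\in\mathsf Y,x\in\mathsf X$), $\theta_{w,x}^l(v)=\langle v,w\rangle x$, $\theta^r_{w,x}(y)=w\langle x,y\rangle$. A Banach $(A,B)$-correspondence is a Banach $B$-pair with a contractive homomorphism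 $\pi_A:A\to\mathcal L_B(\mathsf X,\mathsf Y)$, where $x\cdot a=\pi_A(a)^l(x)$, $a\cdot y=\pi_A(a)^r(y)$. A Morita cycle from $A$ to $B$ is a Banach $(A,B)$-correspondence that is nondegenerate ($\mathrm{span}(B\mathsf X)$, $\mathrm{span}(\mathsf XA)$ dense in $\mathsf X$ and $\mathrm{span}(\mathsf YB)$, $\mathrm{span}(A\mathsf Y)$ dense in $\mathsf Y$) with $\pi_A(A)\subseteq\mathcal K_B(\mathsf X,\mathsf Y)$. *)

theory Defs
  imports "HOL-Analysis.Analysis"
begin

section \<open>Complex vector spaces, normed spaces and normed algebras on carrier sets\<close>

record 'a cvs =
  carrier :: "'a set"
  vadd :: "'a \<Rightarrow> 'a \<Rightarrow> 'a"
  vzero :: 'a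
  vscale :: "complex \<Rightarrow> 'a \<Rightarrow> 'a"

record 'a cns = "'a cvs" +
  vnorm :: "'a \<Rightarrow> real"

record 'a cna = "'a cns" +
  amult :: "'a \<Rightarrow> 'a \<Rightarrow> 'a"

definition vdiff :: "('a, 'm) cvs_scheme \<Rightarrow> 'a \<Rightarrow> 'a \<Rightarrow> 'a" where
  "vdiff V x y = vadd V x (vscale V (- 1) y)"

locale complex_vspace =
  fixes V :: "('a, 'm) cvs_scheme"
  assumes zero_closed: "vzero V \<in> carrier V"
    and add_closed: "\<lbrakk>x \<in> carrier V; y \<in> carrier V\<rbrakk> \<Longrightarrow> vadd V x y \<in> carrier V"
    and scale_closed: "x \<in> carrier V \<Longrightarrow> vscale V c x \<in> carrier V"
    and add_assoc: "\<lbrakk>x \<in> carrier V; y \<in> carrier V; z \<in> carrier V\<rbrakk>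
      \<Longrightarrow> vadd V (vadd V x y) z = vadd V x (vadd V y z)"
    and add_commute: "\<lbrakk>x \<in> carrier V; y \<in> carrier V\<rbrakk> \<Longrightarrow> vadd V x y = vadd V y x"
    and add_zero: "x \<in> carrier V \<Longrightarrow> vadd V x (vzero V) = x"
    and add_uminus: "x \<in> carrier V \<Longrightarrow> vadd V x (vscale V (- 1) x) = vzero V"
    and scale_one: "x \<in> carrier V \<Longrightarrow> vscale V 1 x = x"
    and scale_scale: "x \<in> carrier V \<Longrightarrow> vscale V c (vscale V d x) = vscale V (c * d) x"
    and scale_add_left: "x \<in> carrier V
      \<Longrightarrow> vscale V (c + d) x = vadd V (vscale V c x) (vscale V d x)"
    and scale_add_right: "\<lbrakk>x \<in> carrier V; y \<in> carrier V\<rbrakk>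
      \<Longrightarrow> vscale V c (vadd V x y) = vadd V (vscale V c x) (vscale V c y)"

locale complex_normed_space = complex_vspace V for V :: "('a, 'm) cns_scheme" +
  assumes norm_nonneg: "x \<in> carrier V \<Longrightarrow> 0 \<le> vnorm V x"
    and norm_eq_zero: "x \<in> carrier V \<Longrightarrow> vnorm V x = 0 \<longleftrightarrow> x = vzero V"
    and norm_triangle: "\<lbrakk>x \<in> carrier V; y \<in> carrier V\<rbrakk>
      \<Longrightarrow> vnorm V (vadd V x y) \<le> vnorm V x + vnorm V y"
    and norm_scale: "x \<in> carrier V \<Longrightarrow> vnorm V (vscale V c x) = cmod c * vnorm V x"

locale complex_banach_space = complex_normed_space +
  assumes complete: "\<lbrakk>range \<sigma> \<subseteq> carrier V;
      \<forall>e>0. \<exists>N::nat. \<forall>m\<ge>N. \<forall>n\<ge>N. vnorm V (vdiff V (\<sigma> m) (\<sigma> n)) < e\<rbrakk>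
    \<Longrightarrow> \<exists>x\<in>carrier V. (\<lambda>n. vnorm V (vdiff V (\<sigma> n) x)) \<longlonglongrightarrow> 0"

definition linear_map :: "('a, 'm) cvs_scheme \<Rightarrow> ('b, 'n) cvs_scheme \<Rightarrow> ('a \<Rightarrow> 'b) \<Rightarrow> bool" where
  "linear_map V W T \<longleftrightarrow>
     T \<in> carrier V \<rightarrow> carrier W \<and>
     (\<forall>x\<in>carrier V. \<forall>y\<in>carrier V. T (vadd V x y) = vadd W (T x) (T y)) \<and>
     (\<forall>c. \<forall>x\<in>carrier V. T (vscale V c x) = vscale W c (T x))"

definition bilinear_map ::
  "('a, 'm) cvs_scheme \<Rightarrow> ('b, 'n) cvs_scheme \<Rightarrow> ('c, 'k) cvs_scheme \<Rightarrow> ('a \<Rightarrow> 'b \<Rightarrow> 'c) \<Rightarrow> bool" where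
  "bilinear_map U V W f \<longleftrightarrow>
     (\<forall>x\<in>carrier U. linear_map V W (f x)) \<and> (\<forall>y\<in>carrier V. linear_map U W (\<lambda>x. f x y))"

definition bounded_linear_map ::
  "('a, 'm) cns_scheme \<Rightarrow> ('b, 'n) cns_scheme \<Rightarrow> ('a \<Rightarrow> 'b) \<Rightarrow> bool" where
  "bounded_linear_map V W T \<longleftrightarrow>
     linear_map V W T \<and> (\<exists>C. \<forall>x\<in>carrier V. vnorm W (T x) \<le> C * vnorm V x)"

definition opnorm :: "('a, 'm) cns_scheme \<Rightarrow> ('b, 'n) cns_scheme \<Rightarrow> ('a \<Rightarrow> 'b) \<Rightarrow> real" where
  "opnorm V W T = Sup {vnorm W (T x) | x. x \<in> carrier V \<and> vnorm V x \<le> 1}"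

text \<open>Operators are \<^const>\<open>extensional\<close> functions, so that equality of operators is equality
  on the carrier of the domain.\<close>

definition op_space :: "('a, 'm) cns_scheme \<Rightarrow> ('b, 'n) cns_scheme \<Rightarrow> ('a \<Rightarrow> 'b) cns" where
  "op_space V W =
     \<lparr>carrier = {T \<in> extensional (carrier V). bounded_linear_map V W T},
      vadd = (\<lambda>S T. \<lambda>x\<in>carrier V. vadd W (S x) (T x)),
      vzero = (\<lambda>x\<in>carrier V. vzero W),
      vscale = (\<lambda>c T. \<lambda>x\<in>carrier V. vscale W c (T x)),
      vnorm = opnorm V W\<rparr>"

definition op_algebra :: "('a, 'm) cns_scheme \<Rightarrow> ('a \<Rightarrow> 'a) cna" where
  "op_algebra V =
     cns.extend (op_space V V) (cna.fields (\<lambda>S T. compose (carrier V) S T))"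

inductive_set lin_span :: "('a, 'm) cvs_scheme \<Rightarrow> 'a set \<Rightarrow> 'a set" for V S where
  zero: "vzero V \<in> lin_span V S"
| add: "\<lbrakk>x \<in> lin_span V S; y \<in> S\<rbrakk> \<Longrightarrow> vadd V x (vscale V c y) \<in> lin_span V S"

definition closure_in :: "('a, 'm) cns_scheme \<Rightarrow> 'a set \<Rightarrow> 'a set" where
  "closure_in V S = {x \<in> carrier V. \<forall>e>0. \<exists>y\<in>S. vnorm V (vdiff V x y) < e}"


section \<open>Banach algebras, Banach pairs, correspondences and Morita cycles\<close>

locale complex_banach_algebra = complex_banach_space A for A :: "('a, 'm) cna_scheme" +
  assumes mult_bilinear: "bilinear_map A A A (amult A)"
    and mult_assoc: "\<lbrakk>a \<in> carrier A; b \<in> carrier A; c \<in> carrier A\<rbrakk>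
      \<Longrightarrow> amult A (amult A a b) c = amult A a (amult A b c)"
    and norm_mult: "\<lbrakk>a \<in> carrier A; b \<in> carrier A\<rbrakk>
      \<Longrightarrow> vnorm A (amult A a b) \<le> vnorm A a * vnorm A b"

record ('b, 'x, 'y) pair_data =
  lspace :: "'x cns"
  rspace :: "'y cns"
  left_mul :: "'b \<Rightarrow> 'x \<Rightarrow> 'x"
  right_mul :: "'y \<Rightarrow> 'b \<Rightarrow> 'y"
  pairing :: "'x \<Rightarrow> 'y \<Rightarrow> 'b"

locale banach_pair =
  B: complex_banach_algebra B +
  X: complex_banach_space "lspace P" +
  Y: complex_banach_space "rspace P"
  for B :: "('b, 'm) cna_scheme" and P :: "('b, 'x, 'y) pair_data" +
  assumes left_bilinear: "bilinear_map B (lspace P) (lspace P) (left_mul P)"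
    and left_assoc: "\<lbrakk>a \<in> carrier B; b \<in> carrier B; x \<in> carrier (lspace P)\<rbrakk>
      \<Longrightarrow> left_mul P (amult B a b) x = left_mul P a (left_mul P b x)"
    and left_contractive: "\<lbrakk>b \<in> carrier B; x \<in> carrier (lspace P)\<rbrakk>
      \<Longrightarrow> vnorm (lspace P) (left_mul P b x) \<le> vnorm B b * vnorm (lspace P) x"
    and right_bilinear: "bilinear_map (rspace P) B (rspace P) (right_mul P)"
    and right_assoc: "\<lbrakk>a \<in> carrier B; b \<in> carrier B; y \<in> carrier (rspace P)\<rbrakk>
      \<Longrightarrow> right_mul P y (amult B a b) = right_mul P (right_mul P y a) b"
    and right_contractive: "\<lbrakk>b \<in> carrier B; y \<in> carrier (rspace P)\<rbrakk>
      \<Longrightarrow> vnorm (rspace P) (right_mul P y b) \<le> vnorm (rspace P) y * vnorm B b"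
    and pairing_bilinear: "bilinear_map (lspace P) (rspace P) B (pairing P)"
    and pairing_left: "\<lbrakk>b \<in> carrier B; x \<in> carrier (lspace P); y \<in> carrier (rspace P)\<rbrakk>
      \<Longrightarrow> pairing P (left_mul P b x) y = amult B b (pairing P x y)"
    and pairing_right: "\<lbrakk>b \<in> carrier B; x \<in> carrier (lspace P); y \<in> carrier (rspace P)\<rbrakk>
      \<Longrightarrow> pairing P x (right_mul P y b) = amult B (pairing P x y) b"
    and pairing_norm: "\<lbrakk>x \<in> carrier (lspace P); y \<in> carrier (rspace P)\<rbrakk>
      \<Longrightarrow> vnorm B (pairing P x y) \<le> vnorm (lspace P) x * vnorm (rspace P) y"

text \<open>The Banach algebra of adjointable pairs \<open>(T\<^sup>l, T\<^sup>r)\<close>; the left component composes in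
  the reverse order.\<close>

definition adjointable_algebra ::
  "('b, 'm) cna_scheme \<Rightarrow> ('b, 'x, 'y) pair_data \<Rightarrow> (('x \<Rightarrow> 'x) \<times> ('y \<Rightarrow> 'y)) cna" where
  "adjointable_algebra B P =
    (let X = lspace P; Y = rspace P; LX = op_space X X; LY = op_space Y Y in
     \<lparr>carrier = {(Tl, Tr). Tl \<in> carrier LX \<and> Tr \<in> carrier LY \<and>
          (\<forall>b\<in>carrier B. \<forall>x\<in>carrier X. Tl (left_mul P b x) = left_mul P b (Tl x)) \<and>
          (\<forall>b\<in>carrier B. \<forall>y\<in>carrier Y. Tr (right_mul P y b) = right_mul P (Tr y) b) \<and>
          (\<forall>x\<in>carrier X. \<forall>y\<in>carrier Y. pairing P (Tl x) y = pairing P x (Tr y))},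
      vadd = (\<lambda>S T. (vadd LX (fst S) (fst T), vadd LY (snd S) (snd T))),
      vzero = (vzero LX, vzero LY),
      vscale = (\<lambda>c T. (vscale LX c (fst T), vscale LY c (snd T))),
      vnorm = (\<lambda>T. max (opnorm X X (fst T)) (opnorm Y Y (snd T))),
      amult = (\<lambda>T S. (compose (carrier X) (fst S) (fst T), compose (carrier Y) (snd T) (snd S)))\<rparr>)"

definition theta :: "('b, 'x, 'y) pair_data \<Rightarrow> 'y \<Rightarrow> 'x \<Rightarrow> ('x \<Rightarrow> 'x) \<times> ('y \<Rightarrow> 'y)" where
  "theta P w x =
     (\<lambda>v\<in>carrier (lspace P). left_mul P (pairing P v w) x,
      \<lambda>y\<in>carrier (rspace P). right_mul P w (pairing P x y))"

definition compact_operators ::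
  "('b, 'm) cna_scheme \<Rightarrow> ('b, 'x, 'y) pair_data \<Rightarrow> (('x \<Rightarrow> 'x) \<times> ('y \<Rightarrow> 'y)) set" where
  "compact_operators B P =
     closure_in (adjointable_algebra B P)
       (lin_span (adjointable_algebra B P)
         {theta P w x | w x. w \<in> carrier (rspace P) \<and> x \<in> carrier (lspace P)})"

definition contractive_hom :: "('a, 'm) cna_scheme \<Rightarrow> ('b, 'n) cna_scheme \<Rightarrow> ('a \<Rightarrow> 'b) \<Rightarrow> bool" where
  "contractive_hom A B \<pi> \<longleftrightarrow>
     linear_map A B \<pi> \<and>
     (\<forall>a\<in>carrier A. \<forall>b\<in>carrier A. \<pi> (amult A a b) = amult B (\<pi> a) (\<pi> b)) \<and>
     (\<forall>a\<in>carrier A. vnorm B (\<pi> a) \<le> vnorm A a)"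

locale banach_correspondence =
  A: complex_banach_algebra A + banach_pair B P
  for A :: "('a, 'k) cna_scheme" and B :: "('b, 'm) cna_scheme" and P :: "('b, 'x, 'y) pair_data" +
  fixes \<pi> :: "'a \<Rightarrow> ('x \<Rightarrow> 'x) \<times> ('y \<Rightarrow> 'y)"
  assumes hom: "contractive_hom A (adjointable_algebra B P) \<pi>"

locale morita_cycle = banach_correspondence +
  assumes nondegenerate_BX:
      "closure_in (lspace P) (lin_span (lspace P)
         {left_mul P b x | b x. b \<in> carrier B \<and> x \<in> carrier (lspace P)}) = carrier (lspace P)"
    and nondegenerate_XA:
      "closure_in (lspace P) (lin_span (lspace P)
         {fst (\<pi> a) x | a x. a \<in> carrier A \<and> x \<in> carrier (lspace P)}) = carrier (lspace P)"
    and nondegenerate_YB: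
      "closure_in (rspace P) (lin_span (rspace P)
         {right_mul P y b | b y. b \<in> carrier B \<and> y \<in> carrier (rspace P)}) = carrier (rspace P)"
    and nondegenerate_AY:
      "closure_in (rspace P) (lin_span (rspace P)
         {snd (\<pi> a) y | a y. a \<in> carrier A \<and> y \<in> carrier (rspace P)}) = carrier (rspace P)"
    and compact_action: "\<pi> ` carrier A \<subseteq> compact_operators B P"


section \<open>Topological preliminaries\<close>

definition locally_Hausdorff_space :: "'a topology \<Rightarrow> bool" where
  "locally_Hausdorff_space X \<longleftrightarrow>
     (\<forall>x\<in>topspace X. \<exists>U. openin X U \<and> x \<in> U \<and> Hausdorff_space (subtopology X U))"

definition local_homeomorphism_map :: "'a topology \<Rightarrow> 'b topology \<Rightarrow> ('a \<Rightarrow> 'b) \<Rightarrow> bool" where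
  "local_homeomorphism_map X Y f \<longleftrightarrow>
     f \<in> topspace X \<rightarrow> topspace Y \<and>
     (\<forall>x\<in>topspace X. \<exists>U V. openin X U \<and> x \<in> U \<and> openin Y V \<and>
        homeomorphic_map (subtopology X U) (subtopology Y V) f)"

definition quotient_topology :: "'a topology \<Rightarrow> ('a \<Rightarrow> 'b) \<Rightarrow> 'b topology" where
  "quotient_topology X q =
     topology (\<lambda>U. U \<subseteq> q ` topspace X \<and> openin X {x \<in> topspace X. q x \<in> U})"

lemma openin_quotient_topology:
  "openin (quotient_topology X q) U \<longleftrightarrow>
     U \<subseteq> q ` topspace X \<and> openin X {x \<in> topspace X. q x \<in> U}"
proof -
  have "istopology (\<lambda>U. U \<subseteq> q ` topspace X \<and> openin X {x \<in> topspace X. q x \<in> U})"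
    unfolding istopology_def
  proof (intro conjI allI impI)
    fix S T
    assume S: "S \<subseteq> q ` topspace X \<and> openin X {x \<in> topspace X. q x \<in> S}"
      and T: "T \<subseteq> q ` topspace X \<and> openin X {x \<in> topspace X. q x \<in> T}"
    show "S \<inter> T \<subseteq> q ` topspace X" using S by blast
    have "{x \<in> topspace X. q x \<in> S \<inter> T} = {x \<in> topspace X. q x \<in> S} \<inter> {x \<in> topspace X. q x \<in> T}"
      by blast
    then show "openin X {x \<in> topspace X. q x \<in> S \<inter> T}" using S T by auto
  next
    fix K
    assume K: "\<forall>S\<in>K. S \<subseteq> q ` topspace X \<and> openin X {x \<in> topspace X. q x \<in> S}"
    show "\<Union>K \<subseteq> q ` topspace X" using K by blast
    have "{x \<in> topspace X. q x \<in> \<Union>K} = (\<Union>S\<in>K. {x \<in> topspace X. q x \<in> S})" by blast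
    then show "openin X {x \<in> topspace X. q x \<in> \<Union>K}" using K by auto
  qed
  then show ?thesis by (simp add: quotient_topology_def)
qed

lemma topspace_quotient_topology [simp]: "topspace (quotient_topology X q) = q ` topspace X"
proof
  show "topspace (quotient_topology X q) \<subseteq> q ` topspace X"
    using openin_quotient_topology[of X q "topspace (quotient_topology X q)"] by simp
  have "{x \<in> topspace X. q x \<in> q ` topspace X} = topspace X" by blast
  then have "openin (quotient_topology X q) (q ` topspace X)"
    by (simp add: openin_quotient_topology)
  then show "q ` topspace X \<subseteq> topspace (quotient_topology X q)" by (rule openin_subset)
qed

lemma quotient_map_quotient_topology: "quotient_map X (quotient_topology X q) q"
  by (auto simp: quotient_map_def openin_quotient_topology)

definition fun_space :: "'a set \<Rightarrow> ('a \<Rightarrow> complex) cvs" where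
  "fun_space S =
     \<lparr>carrier = {f. \<forall>x. x \<notin> S \<longrightarrow> f x = 0},
      vadd = (\<lambda>f g x. f x + g x),
      vzero = (\<lambda>x. 0),
      vscale = (\<lambda>c f x. c * f x)\<rparr>"

text \<open>\<open>C\<^sub>c(U)\<close> for an open Hausdorff set \<open>U\<close>, extended by zero; the support is the closure
  taken inside \<open>U\<close>.\<close>

definition Cc_on :: "'a topology \<Rightarrow> 'a set \<Rightarrow> ('a \<Rightarrow> complex) set" where
  "Cc_on X U = {f. (\<forall>x. x \<notin> U \<longrightarrow> f x = 0) \<and>
      continuous_map (subtopology X U) euclidean f \<and>
      compactin (subtopology X U) (subtopology X U closure_of {x \<in> U. f x \<noteq> 0})}"

definition Cspan :: "'a topology \<Rightarrow> ('a \<Rightarrow> complex) set" where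
  "Cspan X = lin_span (fun_space (topspace X))
     (\<Union>{Cc_on X U | U. openin X U \<and> Hausdorff_space (subtopology X U)})"


section \<open>Spaces of \<open>p\<close>-summable functions\<close>

definition in_lp :: "ennreal \<Rightarrow> 'i set \<Rightarrow> ('i \<Rightarrow> 'b::real_normed_vector) \<Rightarrow> bool" where
  "in_lp p I f \<longleftrightarrow>
     (if p = \<infinity> then bounded (f ` I) else (\<lambda>i. norm (f i) powr enn2real p) summable_on I)"

text \<open>The inserted \<open>0\<close> only matters for an empty index set.\<close>

definition lp_norm :: "ennreal \<Rightarrow> 'i set \<Rightarrow> ('i \<Rightarrow> 'b::real_normed_vector) \<Rightarrow> real" where
  "lp_norm p I f =
     (if p = \<infinity> then Sup (insert 0 ((\<lambda>i. norm (f i)) ` I))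
      else (\<Sum>\<^sub>\<infinity>i\<in>I. norm (f i) powr enn2real p) powr (1 / enn2real p))"

definition lp_space :: "ennreal \<Rightarrow> 'i set \<Rightarrow> ('i \<Rightarrow> complex) cns" where
  "lp_space p I =
     \<lparr>carrier = {f. (\<forall>i. i \<notin> I \<longrightarrow> f i = 0) \<and> in_lp p I f},
      vadd = (\<lambda>f g i. f i + g i),
      vzero = (\<lambda>i. 0),
      vscale = (\<lambda>c f i. c * f i),
      vnorm = lp_norm p I\<rparr>"

text \<open>The \<open>\<ell>\<^sup>p\<close>-direct sum of the spaces \<open>\<ell>\<^sup>p(F v)\<close>, \<open>v \<in> V\<close>, for pairwise disjoint \<open>F v\<close>.
  A family \<open>(\<xi>\<^sub>v)\<close> is encoded as the single function on \<open>\<Union>v\<in>V. F v\<close> restricting to \<open>\<xi>\<^sub>v\<close> on \<open>F v\<close>.\<close>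

definition lp_sum :: "ennreal \<Rightarrow> 'v set \<Rightarrow> ('v \<Rightarrow> 'i set) \<Rightarrow> ('i \<Rightarrow> complex) cns" where
  "lp_sum p V F =
     \<lparr>carrier = {f. (\<forall>i. i \<notin> (\<Union>v\<in>V. F v) \<longrightarrow> f i = 0) \<and> (\<forall>v\<in>V. in_lp p (F v) f) \<and>
        in_lp p V (\<lambda>v. lp_norm p (F v) f)},
      vadd = (\<lambda>f g i. f i + g i),
      vzero = (\<lambda>i. 0),
      vscale = (\<lambda>c f i. c * f i),
      vnorm = (\<lambda>f. lp_norm p V (\<lambda>v. lp_norm p (F v) f))\<rparr>"


lemma lp_norm_cong: "(\<And>i. i \<in> I \<Longrightarrow> norm (f i) = norm (g i)) \<Longrightarrow> lp_norm p I f = lp_norm p I g"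
  unfolding lp_norm_def by (simp cong: infsum_cong image_cong)

lemma in_lp_cong:
  assumes "\<And>i. i \<in> I \<Longrightarrow> norm (f i) = norm (g i)"
  shows "in_lp p I f \<longleftrightarrow> in_lp p I g"
proof -
  have "bounded (f ` I) \<longleftrightarrow> bounded (g ` I)"
    using assms by (auto simp: bounded_iff)
  moreover have "(\<lambda>i. norm (f i) powr enn2real p) summable_on I
      \<longleftrightarrow> (\<lambda>i. norm (g i) powr enn2real p) summable_on I"
    using assms by (intro summable_on_cong) auto
  ultimately show ?thesis by (simp add: in_lp_def)
qed

lemma enn2real_exponent_pos: "1 \<le> p \<Longrightarrow> p \<noteq> \<infinity> \<Longrightarrow> 0 < enn2real p"
  using less_le_trans[OF zero_less_one, of p] by (simp add: enn2real_positive_iff less_top)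

lemma in_lp_infinity_bdd: "in_lp \<infinity> I f \<Longrightarrow> bdd_above (insert 0 ((\<lambda>i. norm (f i)) ` I))"
  using bdd_above_norm[of "f ` I"] by (simp add: in_lp_def image_image)

lemma norm_le_lp_norm:
  assumes "1 \<le> p" "in_lp p I f" "i \<in> I"
  shows "norm (f i) \<le> lp_norm p I f"
proof (cases "p = \<infinity>")
  case True
  with assms show ?thesis
    by (auto simp: lp_norm_def intro!: cSup_upper in_lp_infinity_bdd)
next
  case False
  then have q: "0 < enn2real p" using assms(1) by (rule enn2real_exponent_pos[rotated])
  have sm: "(\<lambda>i. norm (f i) powr enn2real p) summable_on I"
    using assms(2) False by (simp add: in_lp_def)
  have "infsum (\<lambda>i. norm (f i) powr enn2real p) {i} \<le> infsum (\<lambda>i. norm (f i) powr enn2real p) I"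
    using sm assms(3) by (intro infsum_mono_neutral) auto
  then have "(norm (f i) powr enn2real p) powr (1 / enn2real p) \<le> lp_norm p I f"
    using False q by (auto simp: lp_norm_def intro!: powr_mono2)
  then show ?thesis using q by (simp add: powr_powr)
qed

lemma lp_norm_nonneg:
  assumes "in_lp p I f" shows "0 \<le> lp_norm p I f"
proof (cases "p = \<infinity>")
  case True
  with assms show ?thesis
    by (auto simp: lp_norm_def intro!: cSup_upper in_lp_infinity_bdd)
qed (simp add: lp_norm_def)

lemma lp_mono:
  assumes p: "1 \<le> p" and h: "in_lp p I h" and M: "0 \<le> M"
    and le: "\<And>i. i \<in> I \<Longrightarrow> norm (g i) \<le> M * norm (h i)"
  shows "in_lp p I g" and "lp_norm p I g \<le> M * lp_norm p I h"
proof -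
  have pw: "norm (g i) powr enn2real p \<le> M powr enn2real p * norm (h i) powr enn2real p"
    if "i \<in> I" for i
  proof -
    have "norm (g i) powr enn2real p \<le> (M * norm (h i)) powr enn2real p"
      by (rule powr_mono2) (use le[OF that] in auto)
    also have "\<dots> = M powr enn2real p * norm (h i) powr enn2real p"
      by (rule powr_mult)
    finally show ?thesis .
  qed
  show g: "in_lp p I g"
  proof (cases "p = \<infinity>")
    case True
    obtain B where B: "\<And>i. i \<in> I \<Longrightarrow> norm (h i) \<le> B"
      using h True by (auto simp: in_lp_def bounded_iff)
    have "norm (g i) \<le> M * B" if "i \<in> I" for i
      using le[OF that] B[OF that] M by (meson mult_left_mono order_trans)
    then show ?thesis using True by (auto simp: in_lp_def bounded_iff)
  next
    case False
    have sm: "(\<lambda>i. norm (h i) powr enn2real p) summable_on I"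
      using h False by (simp add: in_lp_def)
    have "(\<lambda>i. norm (g i) powr enn2real p) summable_on I"
    proof (rule summable_on_comparison_test)
      show "(\<lambda>i. M powr enn2real p * norm (h i) powr enn2real p) summable_on I"
        using sm by (rule summable_on_cmult_right)
      show "norm (g i) powr enn2real p \<le> M powr enn2real p * norm (h i) powr enn2real p"
        if "i \<in> I" for i
        by (rule pw[OF that])
    qed auto
    then show ?thesis using False by (simp add: in_lp_def)
  qed
  show "lp_norm p I g \<le> M * lp_norm p I h"
  proof (cases "p = \<infinity>")
    case True
    have "norm (g i) \<le> M * lp_norm p I h" if "i \<in> I" for i
      using le[OF that] norm_le_lp_norm[OF p h that] M by (meson mult_left_mono order_trans)
    moreover have "0 \<le> M * lp_norm p I h" using M lp_norm_nonneg[OF h] by simp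
    ultimately show ?thesis
      using True unfolding lp_norm_def[of p I g] by (auto intro!: cSup_least)
  next
    case False
    then have q: "0 < enn2real p" using p by (rule enn2real_exponent_pos[rotated])
    have smh: "(\<lambda>i. norm (h i) powr enn2real p) summable_on I"
      using h False by (simp add: in_lp_def)
    have smg: "(\<lambda>i. norm (g i) powr enn2real p) summable_on I"
      using g False by (simp add: in_lp_def)
    have "(\<Sum>\<^sub>\<infinity>i\<in>I. norm (g i) powr enn2real p)
        \<le> (\<Sum>\<^sub>\<infinity>i\<in>I. M powr enn2real p * norm (h i) powr enn2real p)"
    proof (rule infsum_mono[OF smg summable_on_cmult_right[OF smh]])
      show "norm (g i) powr enn2real p \<le> M powr enn2real p * norm (h i) powr enn2real p"
        if "i \<in> I" for i
        by (rule pw[OF that])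
    qed
    also have "\<dots> = M powr enn2real p * (\<Sum>\<^sub>\<infinity>i\<in>I. norm (h i) powr enn2real p)"
      by (rule infsum_cmult_right') 
    finally have "(\<Sum>\<^sub>\<infinity>i\<in>I. norm (g i) powr enn2real p) powr (1 / enn2real p)
        \<le> (M powr enn2real p * (\<Sum>\<^sub>\<infinity>i\<in>I. norm (h i) powr enn2real p)) powr (1 / enn2real p)"
      using q by (intro powr_mono2) (auto intro!: infsum_nonneg)
    also have "\<dots> = M * (\<Sum>\<^sub>\<infinity>i\<in>I. norm (h i) powr enn2real p) powr (1 / enn2real p)"
      using q M by (subst powr_mult) (auto simp: powr_powr intro!: infsum_nonneg)
    finally show ?thesis using False by (simp add: lp_norm_def)
  qed
qed

lemma in_lp_zero: "in_lp p I (\<lambda>i. 0)"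
  by (auto simp: in_lp_def bounded_iff)

lemma lp_norm_zero: "1 \<le> p \<Longrightarrow> lp_norm p I (\<lambda>i. 0) = 0"
  by (rule order_antisym[OF lp_mono(2)[of p I "\<lambda>i. 0 :: real" 0, simplified] lp_norm_nonneg])
    (auto simp: in_lp_zero)

lemma lp_norm_single:
  fixes a :: real
  assumes p: "1 \<le> p" and "v \<in> I" "0 \<le> a"
  shows "in_lp p I (\<lambda>i. if i = v then a else 0)" and "lp_norm p I (\<lambda>i. if i = v then a else 0) = a"
proof -
  let ?f = "\<lambda>i. if i = v then a else 0"
  have eq: "norm (?f i) powr enn2real p = (if i = v then a powr enn2real p else 0)" for i
    using assms by auto
  have f: "finite {v}" by simp
  have sm: "(\<lambda>i. norm (?f i) powr enn2real p) summable_on I"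
    unfolding eq by (rule finite_nonzero_values_imp_summable_on) (rule finite_subset[OF _ f], auto)
  show mem: "in_lp p I ?f"
    using sm by (auto simp: in_lp_def bounded_iff)
  show "lp_norm p I ?f = a"
  proof (cases "p = \<infinity>")
    case True
    have "lp_norm p I ?f \<le> a"
      using True assms by (auto simp: lp_norm_def intro!: cSup_least)
    moreover have "a \<le> lp_norm p I ?f"
      using norm_le_lp_norm[OF p mem \<open>v \<in> I\<close>] assms by simp
    ultimately show ?thesis by simp
  next
    case False
    then have q: "0 < enn2real p" using p by (rule enn2real_exponent_pos[rotated])
    have "(\<Sum>\<^sub>\<infinity>i\<in>I. if i = v then a powr enn2real p else 0)
        = (\<Sum>\<^sub>\<infinity>i\<in>{v}. if i = v then a powr enn2real p else 0)"
      using assms by (intro infsum_cong_neutral) auto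
    then show ?thesis
      using False q assms unfolding lp_norm_def eq by (simp add: powr_powr)
  qed
qed

lemma opnorm_bound:
  fixes T :: "('i \<Rightarrow> complex) \<Rightarrow> ('i \<Rightarrow> complex)"
  assumes p: "1 \<le> p" and T: "bounded_linear_map (lp_space p I) (lp_space p I) T"
  shows "bdd_above {lp_norm p I (T x) | x. x \<in> carrier (lp_space p I) \<and> lp_norm p I x \<le> 1}"
    and "0 \<le> opnorm (lp_space p I) (lp_space p I) T"
    and "x \<in> carrier (lp_space p I)
      \<Longrightarrow> lp_norm p I (T x) \<le> opnorm (lp_space p I) (lp_space p I) T * lp_norm p I x"
proof -
  let ?V = "lp_space p I"
  let ?S = "{lp_norm p I (T x) | x. x \<in> carrier ?V \<and> lp_norm p I x \<le> 1}"
  have op: "opnorm ?V ?V T = Sup ?S" by (simp add: opnorm_def lp_space_def)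
  obtain C where C: "\<And>x. x \<in> carrier ?V \<Longrightarrow> lp_norm p I (T x) \<le> C * lp_norm p I x"
    using T by (auto simp: bounded_linear_map_def lp_space_def)
  have mem: "in_lp p I x" if "x \<in> carrier ?V" for x
    using that by (simp add: lp_space_def)
  have Tmem: "T x \<in> carrier ?V" if "x \<in> carrier ?V" for x
    using T that by (auto simp: bounded_linear_map_def linear_map_def)
  have nonneg: "0 \<le> lp_norm p I x" if "x \<in> carrier ?V" for x
    using mem[OF that] by (rule lp_norm_nonneg)
  show bdd: "bdd_above ?S"
  proof (rule bdd_aboveI)
    fix y assume "y \<in> ?S"
    then obtain x where x: "y = lp_norm p I (T x)" "x \<in> carrier ?V" "lp_norm p I x \<le> 1" by auto
    have "lp_norm p I (T x) \<le> C * lp_norm p I x" by (rule C[OF x(2)])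
    also have "\<dots> \<le> \<bar>C\<bar> * 1"
      using x nonneg[OF x(2)] by (intro mult_mono) auto
    finally show "y \<le> \<bar>C\<bar>" using x by simp
  qed
  have upper: "lp_norm p I (T x) \<le> opnorm ?V ?V T" if "x \<in> carrier ?V" "lp_norm p I x \<le> 1" for x
    unfolding op using that bdd by (intro cSup_upper) auto
  have z: "(\<lambda>i. 0) \<in> carrier ?V" by (simp add: lp_space_def in_lp_zero)
  show ge0: "0 \<le> opnorm ?V ?V T"
    using upper[OF z] nonneg[OF Tmem[OF z]] by (simp add: lp_norm_zero[OF p])
  show "lp_norm p I (T x) \<le> opnorm ?V ?V T * lp_norm p I x" if x: "x \<in> carrier ?V"
  proof (cases "lp_norm p I x = 0")
    case True
    then show ?thesis using C[OF x] by simp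
  next
    case False
    define c where "c = inverse (lp_norm p I x)"
    have n: "0 < lp_norm p I x" using False nonneg[OF x] by simp
    have c: "0 < c" using n by (simp add: c_def)
    let ?y = "\<lambda>i. of_real c * x i"
    have scale: "(\<lambda>i. of_real c * u i) \<in> carrier ?V"
        "lp_norm p I (\<lambda>i. of_real c * u i) = c * lp_norm p I u" if u: "u \<in> carrier ?V" for u
    proof -
      have 1: "in_lp p I (\<lambda>i. of_real c * u i)"
        and 2: "lp_norm p I (\<lambda>i. of_real c * u i) \<le> c * lp_norm p I u"
        using lp_mono[OF p mem[OF u], of c "\<lambda>i. of_real c * u i"] c by (auto simp: norm_mult)
      have 3: "lp_norm p I u \<le> inverse c * lp_norm p I (\<lambda>i. of_real c * u i)"
        using c by (intro lp_mono(2)[OF p 1]) (auto simp: norm_mult field_simps)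
      show "(\<lambda>i. of_real c * u i) \<in> carrier ?V" using u 1 by (simp add: lp_space_def)
      show "lp_norm p I (\<lambda>i. of_real c * u i) = c * lp_norm p I u"
        using 2 3 c by (simp add: field_simps)
    qed
    have "T ?y = (\<lambda>i. of_real c * T x i)"
      using T x by (auto simp: bounded_linear_map_def linear_map_def lp_space_def)
    then have "c * lp_norm p I (T x) = lp_norm p I (T ?y)"
      using scale(2)[OF Tmem[OF x]] by simp
    also have "\<dots> \<le> opnorm ?V ?V T"
      using scale[OF x] n by (intro upper) (auto simp: c_def)
    finally show ?thesis using n by (simp add: c_def field_simps)
  qed
qed


section \<open>Etale groupoids and their reduced \<open>L\<^sup>p\<close>-operator algebras\<close>

text \<open>Units are identified with the corresponding arrows, and \<open>gmult G g h\<close> is meaningful only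
  if \<open>gsrc G g = grng G h\<close>.\<close>

record 'g groupoid =
  gtop :: "'g topology"
  gsrc :: "'g \<Rightarrow> 'g"
  grng :: "'g \<Rightarrow> 'g"
  gmult :: "'g \<Rightarrow> 'g \<Rightarrow> 'g"
  ginv :: "'g \<Rightarrow> 'g"

abbreviation arrows :: "'g groupoid \<Rightarrow> 'g set" where
  "arrows G \<equiv> topspace (gtop G)"

definition units :: "'g groupoid \<Rightarrow> 'g set" where
  "units G = gsrc G ` arrows G"

definition unit_space :: "'g groupoid \<Rightarrow> 'g topology" where
  "unit_space G = subtopology (gtop G) (units G)"

definition src_fibre :: "'g groupoid \<Rightarrow> 'g \<Rightarrow> 'g set" where
  "src_fibre G u = {g \<in> arrows G. gsrc G g = u}"

locale etale_groupoid =
  fixes G :: "'g groupoid"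
  assumes src_closed: "g \<in> arrows G \<Longrightarrow> gsrc G g \<in> arrows G"
    and rng_closed: "g \<in> arrows G \<Longrightarrow> grng G g \<in> arrows G"
    and src_src: "g \<in> arrows G \<Longrightarrow> gsrc G (gsrc G g) = gsrc G g"
    and rng_src: "g \<in> arrows G \<Longrightarrow> grng G (gsrc G g) = gsrc G g"
    and src_rng: "g \<in> arrows G \<Longrightarrow> gsrc G (grng G g) = grng G g"
    and rng_rng: "g \<in> arrows G \<Longrightarrow> grng G (grng G g) = grng G g"
    and mult_closed: "\<lbrakk>g \<in> arrows G; h \<in> arrows G; gsrc G g = grng G h\<rbrakk> \<Longrightarrow> gmult G g h \<in> arrows G"
    and src_mult: "\<lbrakk>g \<in> arrows G; h \<in> arrows G; gsrc G g = grng G h\<rbrakk>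
      \<Longrightarrow> gsrc G (gmult G g h) = gsrc G h"
    and rng_mult: "\<lbrakk>g \<in> arrows G; h \<in> arrows G; gsrc G g = grng G h\<rbrakk>
      \<Longrightarrow> grng G (gmult G g h) = grng G g"
    and mult_assoc: "\<lbrakk>g \<in> arrows G; h \<in> arrows G; k \<in> arrows G;
        gsrc G g = grng G h; gsrc G h = grng G k\<rbrakk>
      \<Longrightarrow> gmult G (gmult G g h) k = gmult G g (gmult G h k)"
    and mult_src: "g \<in> arrows G \<Longrightarrow> gmult G g (gsrc G g) = g"
    and rng_mult_self: "g \<in> arrows G \<Longrightarrow> gmult G (grng G g) g = g"
    and inv_closed: "g \<in> arrows G \<Longrightarrow> ginv G g \<in> arrows G"
    and src_inv: "g \<in> arrows G \<Longrightarrow> gsrc G (ginv G g) = grng G g"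
    and rng_inv: "g \<in> arrows G \<Longrightarrow> grng G (ginv G g) = gsrc G g"
    and inv_mult: "g \<in> arrows G \<Longrightarrow> gmult G (ginv G g) g = gsrc G g"
    and mult_inv: "g \<in> arrows G \<Longrightarrow> gmult G g (ginv G g) = grng G g"
    and continuous_mult:
      "continuous_map
         (subtopology (prod_topology (gtop G) (gtop G)) {(g, h). gsrc G g = grng G h})
         (gtop G) (\<lambda>(g, h). gmult G g h)"
    and continuous_inv: "continuous_map (gtop G) (gtop G) (ginv G)"
    and src_local_homeo: "local_homeomorphism_map (gtop G) (unit_space G) (gsrc G)"
    and rng_local_homeo: "local_homeomorphism_map (gtop G) (unit_space G) (grng G)"

text \<open>The sums here and below have only finitely many nonzero terms for functions in
  \<^const>\<open>Cspan\<close>, by etaleness and, for correspondences, by freeness and properness.\<close>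

definition lambda_at ::
  "ennreal \<Rightarrow> 'g groupoid \<Rightarrow> 'g \<Rightarrow> ('g \<Rightarrow> complex) \<Rightarrow> (('g \<Rightarrow> complex) \<Rightarrow> ('g \<Rightarrow> complex))" where
  "lambda_at p G u f =
     (\<lambda>\<xi>\<in>carrier (lp_space p (src_fibre G u)). \<lambda>g.
        if g \<in> src_fibre G u
        then \<Sum>\<^sub>\<infinity>k\<in>{k \<in> arrows G. grng G k = grng G g}. f k * \<xi> (gmult G (ginv G k) g)
        else 0)"

definition reduced_norm :: "ennreal \<Rightarrow> 'g groupoid \<Rightarrow> ('g \<Rightarrow> complex) \<Rightarrow> real" where
  "reduced_norm p G f =
     Sup (insert 0 ((\<lambda>u. opnorm (lp_space p (src_fibre G u)) (lp_space p (src_fibre G u))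
       (lambda_at p G u f)) ` units G))"

definition E_groupoid :: "ennreal \<Rightarrow> 'g groupoid \<Rightarrow> ('g \<Rightarrow> complex) cns" where
  "E_groupoid p G = lp_sum p (units G) (src_fibre G)"

definition lambda_rep ::
  "ennreal \<Rightarrow> 'g groupoid \<Rightarrow> ('g \<Rightarrow> complex) \<Rightarrow> (('g \<Rightarrow> complex) \<Rightarrow> ('g \<Rightarrow> complex))" where
  "lambda_rep p G f =
     (\<lambda>\<xi>\<in>carrier (E_groupoid p G). \<lambda>g.
        if g \<in> arrows G
        then lambda_at p G (gsrc G g) f (\<lambda>k. if k \<in> src_fibre G (gsrc G g) then \<xi> k else 0) g
        else 0)"

text \<open>The representation \<^const>\<open>lambda_rep\<close> is isometric for \<^const>\<open>reduced_norm\<close>.\<close>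

lemma opnorm_lambda_rep:
  fixes G :: "'g groupoid"
  assumes p: "1 \<le> p"
    and bl: "\<And>u. u \<in> units G \<Longrightarrow>
      bounded_linear_map (lp_space p (src_fibre G u)) (lp_space p (src_fibre G u)) (lambda_at p G u f)"
    and bdd: "bdd_above ((\<lambda>u. opnorm (lp_space p (src_fibre G u)) (lp_space p (src_fibre G u))
      (lambda_at p G u f)) ` units G)"
  shows "opnorm (E_groupoid p G) (E_groupoid p G) (lambda_rep p G f) = reduced_norm p G f"
proof -
  let ?F = "src_fibre G" and ?E = "E_groupoid p G" and ?L = "lambda_rep p G f"
  let ?N = "\<lambda>u. opnorm (lp_space p (?F u)) (lp_space p (?F u)) (lambda_at p G u f)"
  let ?r = "\<lambda>u \<xi> k. if k \<in> ?F u then \<xi> k else 0"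
  define M where "M = reduced_norm p G f"
  have bdd0: "bdd_above (insert 0 (?N ` units G))" using bdd by simp
  have M0: "0 \<le> M" and NM: "\<And>u. u \<in> units G \<Longrightarrow> ?N u \<le> M"
    unfolding M_def reduced_norm_def using bdd0 by (auto intro!: cSup_upper)
  have fib: "?F u \<subseteq> arrows G" for u by (auto simp: src_fibre_def)
  have un: "(\<Union>v\<in>units G. ?F v) = arrows G" by (auto simp: src_fibre_def units_def)
  have Enorm: "vnorm ?E \<xi> = lp_norm p (units G) (\<lambda>v. lp_norm p (?F v) \<xi>)" for \<xi>
    by (simp add: E_groupoid_def lp_sum_def)
  have Ecar: "\<xi> \<in> carrier ?E \<longleftrightarrow> (\<forall>i. i \<notin> arrows G \<longrightarrow> \<xi> i = 0) \<and>
      (\<forall>v\<in>units G. in_lp p (?F v) \<xi>) \<and> in_lp p (units G) (\<lambda>v. lp_norm p (?F v) \<xi>)" for \<xi>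
    unfolding E_groupoid_def lp_sum_def by (simp only: cvs.simps un mem_Collect_eq)
  have rmem: "?r u \<xi> \<in> carrier (lp_space p (?F u))" and rnorm: "lp_norm p (?F u) (?r u \<xi>) = lp_norm p (?F u) \<xi>"
    if "\<xi> \<in> carrier ?E" "u \<in> units G" for u \<xi>
  proof -
    have "in_lp p (?F u) (?r u \<xi>) \<longleftrightarrow> in_lp p (?F u) \<xi>" by (rule in_lp_cong) auto
    then show "?r u \<xi> \<in> carrier (lp_space p (?F u))" using that by (simp add: lp_space_def Ecar)
    show "lp_norm p (?F u) (?r u \<xi>) = lp_norm p (?F u) \<xi>" by (rule lp_norm_cong) auto
  qed
  have Lval: "?L \<xi> g = lambda_at p G u f (?r u \<xi>) g"
    if "\<xi> \<in> carrier ?E" "g \<in> ?F u" for \<xi> u g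
    using that by (auto simp: lambda_rep_def src_fibre_def)
  have Lnorm: "lp_norm p (?F u) (?L \<xi>) = lp_norm p (?F u) (lambda_at p G u f (?r u \<xi>))"
    if "\<xi> \<in> carrier ?E" for \<xi> u
    using that by (intro lp_norm_cong) (simp add: Lval)
  have Lmem: "in_lp p (?F u) (?L \<xi>)" if "\<xi> \<in> carrier ?E" "u \<in> units G" for \<xi> u
  proof -
    have "in_lp p (?F u) (lambda_at p G u f (?r u \<xi>))"
      using bl[OF that(2)] rmem[OF that] by (auto simp: bounded_linear_map_def linear_map_def lp_space_def)
    moreover have "in_lp p (?F u) (?L \<xi>) \<longleftrightarrow> in_lp p (?F u) (lambda_at p G u f (?r u \<xi>))"
      using that by (intro in_lp_cong) (simp add: Lval)
    ultimately show ?thesis by simp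
  qed
  have fibre_le: "norm (lp_norm p (?F u) (?L \<xi>)) \<le> M * norm (lp_norm p (?F u) \<xi>)"
    if \<xi>: "\<xi> \<in> carrier ?E" and u: "u \<in> units G" for \<xi> u
  proof -
    have pos: "0 \<le> lp_norm p (?F u) \<xi>" using \<xi> u by (intro lp_norm_nonneg) (simp add: Ecar)
    have "lp_norm p (?F u) (?L \<xi>) \<le> ?N u * lp_norm p (?F u) \<xi>"
      using opnorm_bound(3)[OF p bl[OF u] rmem[OF \<xi> u]] by (simp add: Lnorm[OF \<xi>] rnorm[OF \<xi> u])
    also have "\<dots> \<le> M * lp_norm p (?F u) \<xi>" using NM[OF u] pos by (rule mult_right_mono)
    finally show ?thesis using pos lp_norm_nonneg[OF Lmem[OF \<xi> u]] by simp
  qed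
  have Lin: "in_lp p (units G) (\<lambda>u. lp_norm p (?F u) (?L \<xi>))"
    and Lle: "vnorm ?E (?L \<xi>) \<le> M * vnorm ?E \<xi>" if "\<xi> \<in> carrier ?E" for \<xi>
    unfolding Enorm
    using lp_mono[OF p _ M0 fibre_le[OF that]] that by (auto simp: Ecar)
  let ?S = "{vnorm ?E (?L \<xi>) | \<xi>. \<xi> \<in> carrier ?E \<and> vnorm ?E \<xi> \<le> 1}"
  have le_M: "y \<le> M" if "y \<in> ?S" for y
  proof -
    obtain \<xi> where "y = vnorm ?E (?L \<xi>)" "\<xi> \<in> carrier ?E" "vnorm ?E \<xi> \<le> 1" using \<open>y \<in> ?S\<close> by auto
    then show ?thesis using Lle[of \<xi>] mult_left_mono[of "vnorm ?E \<xi>" 1 M] M0 by simp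
  qed
  then have bddS: "bdd_above ?S" by (rule bdd_aboveI)
  have zE: "(\<lambda>i. 0) \<in> carrier ?E" and zn: "vnorm ?E (\<lambda>i. 0) = 0"
    by (auto simp: Ecar Enorm lp_norm_zero[OF p] in_lp_zero)
  have S0: "?S \<noteq> {}" using zE zn by force
  have opS: "opnorm ?E ?E ?L = Sup ?S" by (simp add: opnorm_def)
  have "opnorm ?E ?E ?L \<le> M" unfolding opS using S0 le_M by (rule cSup_least)
  moreover have "M \<le> opnorm ?E ?E ?L"
    unfolding M_def reduced_norm_def
  proof (rule cSup_least)
    fix y assume "y \<in> insert 0 (?N ` units G)"
    then consider "y = 0" | u where "u \<in> units G" "y = ?N u" by blast
    then show "y \<le> opnorm ?E ?E ?L"
    proof cases
      case 1
      have "0 \<le> vnorm ?E (?L (\<lambda>i. 0))" unfolding Enorm using Lin[OF zE] by (rule lp_norm_nonneg)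
      also have "\<dots> \<le> Sup ?S" using bddS zE zn by (intro cSup_upper) (auto intro!: exI[of _ "\<lambda>i. 0"])
      finally show ?thesis using 1 by (simp add: opS)
    next
      case (2 u)
      let ?l = "lp_space p (?F u)"
      have lnorm: "vnorm ?l = lp_norm p (?F u)" by (simp add: lp_space_def)
      have "?N u \<le> Sup ?S" unfolding opnorm_def[of ?l] lnorm
      proof (rule cSup_least)
        have "(\<lambda>i. 0) \<in> carrier ?l" by (simp add: lp_space_def in_lp_zero)
        then show "{lp_norm p (?F u) (lambda_at p G u f x) |x. x \<in> carrier ?l \<and> lp_norm p (?F u) x \<le> 1} \<noteq> {}"
          using lp_norm_zero[OF p, of "?F u", where 'b = complex]
          by (auto intro!: exI[of _ "\<lambda>i. 0"])
        fix w assume "w \<in> {lp_norm p (?F u) (lambda_at p G u f x) |x. x \<in> carrier ?l \<and> lp_norm p (?F u) x \<le> 1}"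
        then obtain x where x: "x \<in> carrier ?l" "lp_norm p (?F u) x \<le> 1"
          and w: "w = lp_norm p (?F u) (lambda_at p G u f x)" by auto
        have xi: "in_lp p (?F u) x" and x0: "\<And>i. i \<notin> ?F u \<Longrightarrow> x i = 0"
          using x(1) by (auto simp: lp_space_def)
        have a0: "0 \<le> lp_norm p (?F u) x" using xi by (rule lp_norm_nonneg)
        have disj: "x i = 0" if "i \<in> ?F v" "v \<noteq> u" for i v
          using that by (intro x0) (auto simp: src_fibre_def)
        have fib0: "in_lp p (?F v) x" "lp_norm p (?F v) x = 0" if "v \<noteq> u" for v
        proof -
          show "in_lp p (?F v) x"
            using in_lp_zero[of p "?F v", where 'b = complex] disj[OF _ that]
            by (subst in_lp_cong[where g = "\<lambda>i. 0 :: complex"]) auto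
          show "lp_norm p (?F v) x = 0"
            using disj[OF _ that] lp_norm_zero[OF p, of "?F v", where 'b = complex]
            by (subst lp_norm_cong[where g = "\<lambda>i. 0 :: complex"]) auto
        qed
        have norms: "(\<lambda>v. lp_norm p (?F v) x) = (\<lambda>v. if v = u then lp_norm p (?F u) x else 0)"
          using fib0 by auto
        have xE: "x \<in> carrier ?E"
          unfolding Ecar norms
        proof (intro conjI allI ballI impI)
          show "x i = 0" if "i \<notin> arrows G" for i using that fib x0 by blast
          show "in_lp p (?F v) x" for v using xi fib0(1) by (cases "v = u") auto
        qed (rule lp_norm_single(1)[OF p 2(1) a0])
        have xn: "vnorm ?E x \<le> 1"
          unfolding Enorm norms using lp_norm_single(2)[OF p 2(1) a0] x by simp
        have "?r u x = x" using x0 by auto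
        then have "w = lp_norm p (?F u) (?L x)" using w Lnorm[OF xE, of u] by simp
        also have "\<dots> \<le> vnorm ?E (?L x)"
          unfolding Enorm using norm_le_lp_norm[OF p Lin[OF xE] 2(1)] by simp
        also have "\<dots> \<le> Sup ?S" using bddS xE xn by (intro cSup_upper) auto
        finally show "w \<le> Sup ?S" .
      qed
      then show ?thesis using 2 by (simp add: opS)
    qed
  qed simp
  ultimately show ?thesis by (simp add: M_def)
qed

text \<open>The completion of \<^term>\<open>Cspan (gtop G)\<close> in \<^const>\<open>reduced_norm\<close>, realised through its
  isometric representation \<^const>\<open>lambda_rep\<close>, the direct sum of the \<^const>\<open>lambda_at\<close>
  (\<open>opnorm_lambda_rep\<close>). Convolution becomes composition of operators.\<close>

definition Fp_red :: "ennreal \<Rightarrow> 'g groupoid \<Rightarrow> (('g \<Rightarrow> complex) \<Rightarrow> ('g \<Rightarrow> complex)) cna" where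
  "Fp_red p G = (op_algebra (E_groupoid p G))
     \<lparr>carrier := closure_in (op_algebra (E_groupoid p G)) (lambda_rep p G ` Cspan (gtop G))\<rparr>"


section \<open>Groupoid correspondences\<close>

record ('g, 'h, 'z) correspondence =
  ztop :: "'z topology"
  ranchor :: "'z \<Rightarrow> 'g"
  sanchor :: "'z \<Rightarrow> 'h"
  lact :: "'g \<Rightarrow> 'z \<Rightarrow> 'z"
  ract :: "'z \<Rightarrow> 'h \<Rightarrow> 'z"

abbreviation points :: "('g, 'h, 'z) correspondence \<Rightarrow> 'z set" where
  "points Z \<equiv> topspace (ztop Z)"

definition left_action_space ::
  "'g groupoid \<Rightarrow> ('g, 'h, 'z) correspondence \<Rightarrow> ('g \<times> 'z) topology" where
  "left_action_space G Z =
     subtopology (prod_topology (gtop G) (ztop Z)) {(g, z). gsrc G g = ranchor Z z}"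

definition right_action_space ::
  "'h groupoid \<Rightarrow> ('g, 'h, 'z) correspondence \<Rightarrow> ('z \<times> 'h) topology" where
  "right_action_space H Z =
     subtopology (prod_topology (ztop Z) (gtop H)) {(z, h). sanchor Z z = grng H h}"

definition proper_left_action :: "'g groupoid \<Rightarrow> ('g, 'h, 'z) correspondence \<Rightarrow> bool" where
  "proper_left_action G Z \<longleftrightarrow>
     proper_map (left_action_space G Z) (prod_topology (ztop Z) (ztop Z))
       (\<lambda>(g, z). (lact Z g z, z))"

definition proper_right_action :: "'h groupoid \<Rightarrow> ('g, 'h, 'z) correspondence \<Rightarrow> bool" where
  "proper_right_action H Z \<longleftrightarrow>
     proper_map (right_action_space H Z) (prod_topology (ztop Z) (ztop Z))
       (\<lambda>(z, h). (ract Z z h, z))"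

locale groupoid_correspondence =
  G: etale_groupoid G + H: etale_groupoid H
  for G :: "'g groupoid" and H :: "'h groupoid" +
  fixes Z :: "('g, 'h, 'z) correspondence"
  assumes continuous_ranchor: "continuous_map (ztop Z) (unit_space G) (ranchor Z)"
    and lact_closed: "\<lbrakk>g \<in> arrows G; z \<in> points Z; gsrc G g = ranchor Z z\<rbrakk>
      \<Longrightarrow> lact Z g z \<in> points Z"
    and ranchor_lact: "\<lbrakk>g \<in> arrows G; z \<in> points Z; gsrc G g = ranchor Z z\<rbrakk>
      \<Longrightarrow> ranchor Z (lact Z g z) = grng G g"
    and lact_lact: "\<lbrakk>g \<in> arrows G; g' \<in> arrows G; z \<in> points Z;
        gsrc G g = grng G g'; gsrc G g' = ranchor Z z\<rbrakk>
      \<Longrightarrow> lact Z (gmult G g g') z = lact Z g (lact Z g' z)"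
    and lact_unit: "z \<in> points Z \<Longrightarrow> lact Z (ranchor Z z) z = z"
    and continuous_lact: "continuous_map (left_action_space G Z) (ztop Z) (\<lambda>(g, z). lact Z g z)"
    and ract_closed: "\<lbrakk>z \<in> points Z; h \<in> arrows H; sanchor Z z = grng H h\<rbrakk>
      \<Longrightarrow> ract Z z h \<in> points Z"
    and sanchor_ract: "\<lbrakk>z \<in> points Z; h \<in> arrows H; sanchor Z z = grng H h\<rbrakk>
      \<Longrightarrow> sanchor Z (ract Z z h) = gsrc H h"
    and ract_ract: "\<lbrakk>z \<in> points Z; h \<in> arrows H; h' \<in> arrows H;
        sanchor Z z = grng H h; gsrc H h = grng H h'\<rbrakk>
      \<Longrightarrow> ract Z z (gmult H h h') = ract Z (ract Z z h) h'"
    and ract_unit: "z \<in> points Z \<Longrightarrow> ract Z z (sanchor Z z) = z"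
    and continuous_ract: "continuous_map (right_action_space H Z) (ztop Z) (\<lambda>(z, h). ract Z z h)"
    and ranchor_ract: "\<lbrakk>z \<in> points Z; h \<in> arrows H; sanchor Z z = grng H h\<rbrakk>
      \<Longrightarrow> ranchor Z (ract Z z h) = ranchor Z z"
    and sanchor_lact: "\<lbrakk>g \<in> arrows G; z \<in> points Z; gsrc G g = ranchor Z z\<rbrakk>
      \<Longrightarrow> sanchor Z (lact Z g z) = sanchor Z z"
    and actions_commute: "\<lbrakk>g \<in> arrows G; z \<in> points Z; h \<in> arrows H;
        gsrc G g = ranchor Z z; sanchor Z z = grng H h\<rbrakk>
      \<Longrightarrow> ract Z (lact Z g z) h = lact Z g (ract Z z h)"
    and sanchor_local_homeo: "local_homeomorphism_map (ztop Z) (unit_space H) (sanchor Z)"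
    and ract_free: "\<lbrakk>z \<in> points Z; h \<in> arrows H; sanchor Z z = grng H h; ract Z z h = z\<rbrakk>
      \<Longrightarrow> h = sanchor Z z"
    and ract_proper: "proper_right_action H Z"

definition right_orbit :: "'h groupoid \<Rightarrow> ('g, 'h, 'z) correspondence \<Rightarrow> 'z \<Rightarrow> 'z set" where
  "right_orbit H Z z = {ract Z z h | h. h \<in> arrows H \<and> sanchor Z z = grng H h}"

definition orbit_space :: "'h groupoid \<Rightarrow> ('g, 'h, 'z) correspondence \<Rightarrow> 'z set topology" where
  "orbit_space H Z = quotient_topology (ztop Z) (right_orbit H Z)"

text \<open>\<^const>\<open>ranchor\<close> is constant on right orbits.\<close>

definition r_star :: "('g, 'h, 'z) correspondence \<Rightarrow> 'z set \<Rightarrow> 'g" where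
  "r_star Z orb = the_elem (ranchor Z ` orb)"

definition proper_correspondence ::
  "'g groupoid \<Rightarrow> 'h groupoid \<Rightarrow> ('g, 'h, 'z) correspondence \<Rightarrow> bool" where
  "proper_correspondence G H Z \<longleftrightarrow> proper_map (orbit_space H Z) (unit_space G) (r_star Z)"


section \<open>The Banach correspondence of a groupoid correspondence\<close>

definition s_fibre :: "('g, 'h, 'z) correspondence \<Rightarrow> 'h \<Rightarrow> 'z set" where
  "s_fibre Z v = {z \<in> points Z. sanchor Z z = v}"

definition E_corr ::
  "ennreal \<Rightarrow> 'h groupoid \<Rightarrow> ('g, 'h, 'z) correspondence \<Rightarrow> ('z \<Rightarrow> complex) cns" where
  "E_corr p H Z = lp_sum p (units H) (s_fibre Z)"

definition T_op ::
  "ennreal \<Rightarrow> 'h groupoid \<Rightarrow> ('g, 'h, 'z) correspondence \<Rightarrow> ('z \<Rightarrow> complex)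
     \<Rightarrow> (('h \<Rightarrow> complex) \<Rightarrow> ('z \<Rightarrow> complex))" where
  "T_op p H Z \<phi> =
     (\<lambda>\<xi>\<in>carrier (E_groupoid p H). \<lambda>z.
        if z \<in> points Z
        then \<Sum>\<^sub>\<infinity>h\<in>src_fibre H (sanchor Z z). \<phi> (ract Z z (ginv H h)) * \<xi> h
        else 0)"

text \<open>The homeomorphic copy \<open>Z\<^sup>o\<^sup>p\<close> of \<open>Z\<close> is taken to be \<open>Z\<close> itself, with the bar as the identity.\<close>

definition S_op ::
  "ennreal \<Rightarrow> 'h groupoid \<Rightarrow> ('g, 'h, 'z) correspondence \<Rightarrow> ('z \<Rightarrow> complex)
     \<Rightarrow> (('z \<Rightarrow> complex) \<Rightarrow> ('h \<Rightarrow> complex))" where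
  "S_op p H Z \<psi> =
     (\<lambda>\<zeta>\<in>carrier (E_corr p H Z). \<lambda>h.
        if h \<in> arrows H
        then \<Sum>\<^sub>\<infinity>z\<in>s_fibre Z (gsrc H h). \<psi> (ract Z z (ginv H h)) * \<zeta> z
        else 0)"

definition X_space ::
  "ennreal \<Rightarrow> 'h groupoid \<Rightarrow> ('g, 'h, 'z) correspondence
     \<Rightarrow> (('z \<Rightarrow> complex) \<Rightarrow> ('h \<Rightarrow> complex)) cns" where
  "X_space p H Z = (op_space (E_corr p H Z) (E_groupoid p H))
     \<lparr>carrier := closure_in (op_space (E_corr p H Z) (E_groupoid p H))
        (S_op p H Z ` Cspan (ztop Z))\<rparr>"

definition Y_space ::
  "ennreal \<Rightarrow> 'h groupoid \<Rightarrow> ('g, 'h, 'z) correspondence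
     \<Rightarrow> (('h \<Rightarrow> complex) \<Rightarrow> ('z \<Rightarrow> complex)) cns" where
  "Y_space p H Z = (op_space (E_groupoid p H) (E_corr p H Z))
     \<lparr>carrier := closure_in (op_space (E_groupoid p H) (E_corr p H Z))
        (T_op p H Z ` Cspan (ztop Z))\<rparr>"

definition corr_pair ::
  "ennreal \<Rightarrow> 'h groupoid \<Rightarrow> ('g, 'h, 'z) correspondence
     \<Rightarrow> (('h \<Rightarrow> complex) \<Rightarrow> ('h \<Rightarrow> complex),
        ('z \<Rightarrow> complex) \<Rightarrow> ('h \<Rightarrow> complex),
        ('h \<Rightarrow> complex) \<Rightarrow> ('z \<Rightarrow> complex)) pair_data" where
  "corr_pair p H Z =
     \<lparr>lspace = X_space p H Z,
      rspace = Y_space p H Z,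
      left_mul = (\<lambda>b S. compose (carrier (E_corr p H Z)) b S),
      right_mul = (\<lambda>T b. compose (carrier (E_groupoid p H)) T b),
      pairing = (\<lambda>S T. compose (carrier (E_groupoid p H)) S T)\<rparr>"

definition left_mult ::
  "'g groupoid \<Rightarrow> ('g, 'h, 'z) correspondence \<Rightarrow> ('g \<Rightarrow> complex) \<Rightarrow> ('z \<Rightarrow> complex) \<Rightarrow> ('z \<Rightarrow> complex)"
  where
  "left_mult G Z a \<phi> = (\<lambda>z.
     if z \<in> points Z
     then \<Sum>\<^sub>\<infinity>g\<in>{g \<in> arrows G. grng G g = ranchor Z z}. a g * \<phi> (lact Z (ginv G g) z)
     else 0)"

definition right_mult ::
  "'g groupoid \<Rightarrow> ('g, 'h, 'z) correspondence \<Rightarrow> ('z \<Rightarrow> complex) \<Rightarrow> ('g \<Rightarrow> complex) \<Rightarrow> ('z \<Rightarrow> complex)"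
  where
  "right_mult G Z \<psi> a = (\<lambda>z.
     if z \<in> points Z
     then \<Sum>\<^sub>\<infinity>g\<in>{g \<in> arrows G. grng G g = ranchor Z z}. \<psi> (lact Z (ginv G g) z) * a (ginv G g)
     else 0)"

text \<open>The contractive homomorphism extending the two actions; it is unique because the
  \<^term>\<open>lambda_rep p G a\<close>, \<^term>\<open>S_op p H Z \<psi>\<close> and \<^term>\<open>T_op p H Z \<phi>\<close> are dense.\<close>

definition pi_corr ::
  "ennreal \<Rightarrow> 'g groupoid \<Rightarrow> 'h groupoid \<Rightarrow> ('g, 'h, 'z) correspondence
     \<Rightarrow> (('g \<Rightarrow> complex) \<Rightarrow> ('g \<Rightarrow> complex))
     \<Rightarrow> ((('z \<Rightarrow> complex) \<Rightarrow> ('h \<Rightarrow> complex)) \<Rightarrow> (('z \<Rightarrow> complex) \<Rightarrow> ('h \<Rightarrow> complex)))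
      \<times> ((('h \<Rightarrow> complex) \<Rightarrow> ('z \<Rightarrow> complex)) \<Rightarrow> (('h \<Rightarrow> complex) \<Rightarrow> ('z \<Rightarrow> complex)))" where
  "pi_corr p G H Z = (THE \<pi>.
     \<pi> \<in> extensional (carrier (Fp_red p G)) \<and>
     contractive_hom (Fp_red p G) (adjointable_algebra (Fp_red p H) (corr_pair p H Z)) \<pi> \<and>
     (\<forall>a\<in>Cspan (gtop G).
        (\<forall>\<psi>\<in>Cspan (ztop Z).
           fst (\<pi> (lambda_rep p G a)) (S_op p H Z \<psi>) = S_op p H Z (right_mult G Z \<psi> a)) \<and>
        (\<forall>\<phi>\<in>Cspan (ztop Z).
           snd (\<pi> (lambda_rep p G a)) (T_op p H Z \<phi>) = T_op p H Z (left_mult G Z a \<phi>))))"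

end

theory Submission
  imports Defs
begin

text \<open>
  Every object in the theorem is the closure of a space of concrete operators: \<open>F\<^sup>p(G)\<close> of the
  convolution operators \<open>\<lambda>(f)\<close>, the two halves of the pair of the \<open>S\<^sub>\<psi>\<close> and the \<open>T\<^sub>\<phi>\<close>. A
  compactly supported \<open>f\<close> on \<open>G\<close> also acts on all functions on \<open>Z\<close> by the formula for the left
  action; call this operator \<open>L\<^sub>f\<close>. Reindexing finite sums gives
  \<open>L\<^sub>f T\<^sub>\<phi> = T\<^sub>f\<^sub>\<phi>\<close>, \<open>S\<^sub>\<psi> L\<^sub>f = S\<^sub>\<psi>\<^sub>f\<close> and \<open>L\<^sub>f L\<^sub>g = L\<^sub>f\<^sub>g\<close>, so the action on the pair is multiplication by
  \<open>L\<^sub>f\<close>. What makes it extend to the closures is the estimate \<open>\<parallel>L\<^sub>f\<parallel> \<le> \<parallel>\<lambda>(f)\<parallel>\<close>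
  (\<open>left_mult_contractive\<close>). On a \<open>G\<close>-orbit in \<open>Z\<close> with finite stabilisers, functions pull back to a
  fibre of \<open>G\<close> with norms multiplied by a constant, and \<open>L\<^sub>f\<close> becomes a restriction of \<open>\<lambda>(f)\<close>;
  finiteness is what properness of the left action provides. For \<open>p = \<infinity>\<close> the pull back is isometric for
  every stabiliser, and for \<open>p = 1\<close> the bound follows from the column sums of the matrices. The extended
  action is then the unique one allowed by the definition of \<^const>\<open>pi_corr\<close>.

  Functions on the unit spaces are local units for all the modules involved, so nondegeneracy is
  automatic and being a Morita cycle means that the action consists of compact operators
  (\<open>morita_iff_compact\<close>).

  Suppose that \<open>r\<^sub>*\<close> is proper, and let \<open>a\<close> be a cutoff function on the units that is \<open>1\<close> on the sources of the
  support of \<open>f\<close>, so that \<open>L\<^sub>f = L\<^sub>f L\<^sub>a\<close>. The preimage of the support of \<open>a\<close> in \<open>Z/H\<close> is covered by the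
  images of finitely many open sets that meet every \<open>H\<close>-orbit and every fibre of \<open>s\<^sub>Z\<close> at most once. On such a set
  \<open>T\<^sub>\<phi> S\<^sub>\<psi>\<close> is multiplication by the \<open>H\<close>-invariant function that extends \<open>\<phi>\<psi>\<close>. An invariant partition of
  unity therefore writes \<open>L\<^sub>a\<close>, and with it \<open>L\<^sub>f\<close>, as a finite sum of operators \<open>T\<^sub>\<phi> S\<^sub>\<psi>\<close>, that is, of
  rank one operators (\<open>left_mult_decomposition\<close>).

  Conversely, the values of \<open>T\<^sub>\<phi> \<xi>\<close> vanish on the orbits that avoid the compact support of \<open>\<phi>\<close>, and so
  compact operators produce functions that are uniformly small off the saturation of a compact set
  (\<open>compact_vanishing\<close>). If \<open>a = 1\<close> on a compact \<open>K\<close>, then \<open>L\<^sub>a\<close> reproduces the values of \<open>T\<^sub>\<kappa>\<close> at every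
  point over \<open>K\<close>, and these are not small for suitable \<open>\<kappa>\<close>. Hence the orbits over \<open>K\<close> all meet one compact
  set, and \<open>r\<^sub>*\<close> is proper (\<open>proper_if_compact\<close>).
\<close>

section \<open>Functional analysis on carrier sets\<close>

context complex_vspace
begin

lemma zero_add: "x \<in> carrier V \<Longrightarrow> vadd V (vzero V) x = x"
  by (metis add_commute add_zero zero_closed)

lemma add_left_commute:
  "\<lbrakk>x \<in> carrier V; y \<in> carrier V; z \<in> carrier V\<rbrakk> \<Longrightarrow> vadd V x (vadd V y z) = vadd V y (vadd V x z)"
  by (metis add_assoc add_commute)

lemma scale_0: "x \<in> carrier V \<Longrightarrow> vscale V 0 x = vzero V"
  using scale_add_left[of x 1 "- 1"] by (simp add: scale_one add_uminus)

lemma scale_vzero: "vscale V c (vzero V) = vzero V"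
  using scale_scale[OF zero_closed, of c 0] by (simp add: scale_0 zero_closed)

lemma vdiff_closed: "\<lbrakk>x \<in> carrier V; y \<in> carrier V\<rbrakk> \<Longrightarrow> vdiff V x y \<in> carrier V"
  by (simp add: vdiff_def add_closed scale_closed)

lemma vdiff_self: "x \<in> carrier V \<Longrightarrow> vdiff V x x = vzero V"
  by (simp add: vdiff_def add_uminus)

lemma vdiff_vzero: "x \<in> carrier V \<Longrightarrow> vdiff V x (vzero V) = x"
  by (simp add: vdiff_def scale_vzero add_zero)

lemma vdiff_vadd:
  assumes "x \<in> carrier V" "y \<in> carrier V" "x' \<in> carrier V" "y' \<in> carrier V"
  shows "vdiff V (vadd V x y) (vadd V x' y') = vadd V (vdiff V x x') (vdiff V y y')"
  using assms
  by (simp add: vdiff_def scale_add_right add_closed scale_closed add_assoc add_left_commute)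

lemma vdiff_vscale:
  "\<lbrakk>x \<in> carrier V; y \<in> carrier V\<rbrakk>
    \<Longrightarrow> vdiff V (vscale V c x) (vscale V c y) = vscale V c (vdiff V x y)"
  by (simp add: vdiff_def scale_add_right scale_closed scale_scale)

lemma uminus_add_cancel:
  "\<lbrakk>x \<in> carrier V; y \<in> carrier V\<rbrakk> \<Longrightarrow> vadd V (vscale V (- 1) y) (vadd V y x) = x"
  by (metis add_assoc add_commute add_uminus scale_closed zero_add)

lemma vdiff_add_vdiff:
  assumes "x \<in> carrier V" "y \<in> carrier V" "z \<in> carrier V"
  shows "vadd V (vdiff V x y) (vdiff V y z) = vdiff V x z"
  using assms by (simp add: vdiff_def add_assoc add_closed scale_closed uminus_add_cancel)

lemma vdiff_add_cancel: "\<lbrakk>x \<in> carrier V; y \<in> carrier V\<rbrakk> \<Longrightarrow> vadd V (vdiff V x y) y = x"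
  using vdiff_add_vdiff[of x y "vzero V"] by (simp add: vdiff_vzero zero_closed)

lemma vdiff_commute:
  "\<lbrakk>x \<in> carrier V; y \<in> carrier V\<rbrakk> \<Longrightarrow> vdiff V y x = vscale V (- 1) (vdiff V x y)"
  by (simp add: vdiff_def scale_add_right scale_closed scale_scale scale_one add_commute)

end

lemma linear_mapD:
  assumes "linear_map V W T"
  shows "x \<in> carrier V \<Longrightarrow> T x \<in> carrier W"
    and "\<lbrakk>x \<in> carrier V; y \<in> carrier V\<rbrakk> \<Longrightarrow> T (vadd V x y) = vadd W (T x) (T y)"
    and "x \<in> carrier V \<Longrightarrow> T (vscale V c x) = vscale W c (T x)"
  using assms by (auto simp: linear_map_def)

lemma linear_map_vzero:
  assumes "complex_vspace V" "complex_vspace W" "linear_map V W T"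
  shows "T (vzero V) = vzero W"
  using linear_mapD[OF assms(3)] complex_vspace.scale_0[OF assms(1)] complex_vspace.scale_0[OF assms(2)]
  by (metis assms(1) complex_vspace.zero_closed)

lemma linear_map_vdiff:
  assumes "complex_vspace V" "linear_map V W T" "x \<in> carrier V" "y \<in> carrier V"
  shows "T (vdiff V x y) = vdiff W (T x) (T y)"
  using linear_mapD[OF assms(2)] complex_vspace.scale_closed[OF assms(1)] assms(3,4)
  by (simp add: vdiff_def)

context complex_normed_space
begin

lemma norm_vzero: "vnorm V (vzero V) = 0"
  using norm_eq_zero zero_closed by blast

lemma norm_vdiff_commute:
  "\<lbrakk>x \<in> carrier V; y \<in> carrier V\<rbrakk> \<Longrightarrow> vnorm V (vdiff V y x) = vnorm V (vdiff V x y)"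
  by (simp add: vdiff_commute[of x y] norm_scale vdiff_closed)

lemma norm_vdiff_triangle:
  "\<lbrakk>x \<in> carrier V; y \<in> carrier V; z \<in> carrier V\<rbrakk>
    \<Longrightarrow> vnorm V (vdiff V x z) \<le> vnorm V (vdiff V x y) + vnorm V (vdiff V y z)"
  using norm_triangle[of "vdiff V x y" "vdiff V y z"] by (simp add: vdiff_closed vdiff_add_vdiff)

lemma norm_le_vdiff:
  "\<lbrakk>x \<in> carrier V; y \<in> carrier V\<rbrakk> \<Longrightarrow> vnorm V x \<le> vnorm V (vdiff V x y) + vnorm V y"
  using norm_triangle[of "vdiff V x y" y] by (simp add: vdiff_closed vdiff_add_cancel)

lemma vdiff_norm_0: "\<lbrakk>x \<in> carrier V; y \<in> carrier V; vnorm V (vdiff V x y) \<le> 0\<rbrakk> \<Longrightarrow> x = y"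
  using vdiff_add_cancel[of x y] norm_nonneg[of "vdiff V x y"] norm_eq_zero[of "vdiff V x y"]
  by (simp add: vdiff_closed zero_add)

lemma vdiff_norm_eqI:
  assumes "x \<in> carrier V" "y \<in> carrier V" "\<And>e. 0 < e \<Longrightarrow> vnorm V (vdiff V x y) \<le> e"
  shows "x = y"
  by (rule vdiff_norm_0[OF assms(1,2)], rule field_le_epsilon) (simp add: assms(3))

end

subsection \<open>Subspaces and closures\<close>

definition subspace_of :: "('a, 'm) cvs_scheme \<Rightarrow> 'a set \<Rightarrow> bool" where
  "subspace_of V S \<longleftrightarrow> S \<subseteq> carrier V \<and> vzero V \<in> S \<and>
     (\<forall>x\<in>S. \<forall>y\<in>S. vadd V x y \<in> S) \<and> (\<forall>c. \<forall>x\<in>S. vscale V c x \<in> S)"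

lemma subspace_ofD:
  assumes "subspace_of V S"
  shows "x \<in> S \<Longrightarrow> x \<in> carrier V" "vzero V \<in> S" "\<lbrakk>x \<in> S; y \<in> S\<rbrakk> \<Longrightarrow> vadd V x y \<in> S"
    "x \<in> S \<Longrightarrow> vscale V c x \<in> S" "\<lbrakk>x \<in> S; y \<in> S\<rbrakk> \<Longrightarrow> vdiff V x y \<in> S"
  using assms by (auto simp: subspace_of_def vdiff_def)

lemma lin_span_superset:
  assumes "complex_vspace V" "x \<in> S" "S \<subseteq> carrier V"
  shows "x \<in> lin_span V S"
  using lin_span.add[OF lin_span.zero assms(2), of V 1] assms
  by (metis complex_vspace.scale_one complex_vspace.zero_add subsetD)

lemma lin_span_carrier:
  assumes "complex_vspace V" "S \<subseteq> carrier V" "x \<in> lin_span V S"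
  shows "x \<in> carrier V"
proof -
  interpret complex_vspace V by fact
  show ?thesis
    using assms(3) by induction (use assms in \<open>auto intro!: zero_closed add_closed scale_closed\<close>)
qed

lemma lin_span_sum_closed:
  assumes "complex_vspace V" "S \<subseteq> carrier V" "x \<in> lin_span V S" "y \<in> lin_span V S"
  shows "vadd V x y \<in> lin_span V S" and "vscale V c x \<in> lin_span V S"
proof -
  interpret complex_vspace V by fact
  note car = lin_span_carrier[OF assms(1,2)]
  show "vadd V x y \<in> lin_span V S"
    using assms(4)
  proof induction
    case zero
    then show ?case using assms by (simp add: add_zero car)
  next
    case (add z s d)
    have eq: "vadd V x (vadd V z (vscale V d s)) = vadd V (vadd V x z) (vscale V d s)"
      using add.hyps assms(2,3) by (intro add_assoc[symmetric]) (auto intro: car scale_closed)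
    then show ?case using lin_span.add[OF add.IH add.hyps(2), of d] by (simp only: eq)
  qed
  show "vscale V c x \<in> lin_span V S"
    using assms(3)
  proof induction
    case zero
    then show ?case by (simp add: scale_vzero lin_span.zero)
  next
    case (add z s d)
    have "s \<in> carrier V" using add.hyps(2) assms(2) by auto
    then have eq: "vscale V c (vadd V z (vscale V d s)) = vadd V (vscale V c z) (vscale V (c * d) s)"
      using add.hyps(1) by (simp add: scale_add_right scale_scale car scale_closed)
    then show ?case using lin_span.add[OF add.IH add.hyps(2), of "c * d"] by (simp only: eq)
  qed
qed

lemma subspace_of_lin_span:
  "complex_vspace V \<Longrightarrow> S \<subseteq> carrier V \<Longrightarrow> subspace_of V (lin_span V S)"
  unfolding subspace_of_def
  by (intro conjI subsetI ballI allI lin_span.zero lin_span_sum_closed) (auto dest: lin_span_carrier)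

lemma closure_in_superset:
  "complex_normed_space V \<Longrightarrow> S \<subseteq> carrier V \<Longrightarrow> S \<subseteq> closure_in V S"
proof -
  assume V: "complex_normed_space V" and S: "S \<subseteq> carrier V"
  interpret complex_normed_space V by (rule V)
  have "vnorm V (vdiff V x x) = 0" if "x \<in> S" for x
    using that S by (simp add: vdiff_self subset_iff norm_vzero)
  then show "S \<subseteq> closure_in V S" using S unfolding closure_in_def by force
qed

text \<open>The estimate is only required between an arbitrary point and a point of the dense set, which
  suits maps, such as composition, that are controlled in one variable at a time.\<close>

lemma closure_in_map:
  assumes "complex_normed_space V" "complex_normed_space W"
    and "f \<in> carrier V \<rightarrow> carrier W" "S \<subseteq> carrier V" "T \<subseteq> carrier W"
    and lip: "\<And>x y. \<lbrakk>x \<in> carrier V; y \<in> S\<rbrakk>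
      \<Longrightarrow> vnorm W (vdiff W (f x) (f y)) \<le> C * vnorm V (vdiff V x y)"
    and im: "\<And>y. y \<in> S \<Longrightarrow> f y \<in> closure_in W T"
    and x: "x \<in> closure_in V S"
  shows "f x \<in> closure_in W T"
proof -
  interpret V: complex_normed_space V by fact
  interpret W: complex_normed_space W by fact
  have xV: "x \<in> carrier V" using x by (simp add: closure_in_def)
  have "\<exists>t\<in>T. vnorm W (vdiff W (f x) t) < e" if e: "0 < e" for e
  proof -
    define d where "d = e / (2 * (\<bar>C\<bar> + 1))"
    have d: "0 < d" "\<bar>C\<bar> * d \<le> e / 2" using e by (auto simp: d_def field_simps)
    obtain y where y: "y \<in> S" "vnorm V (vdiff V x y) < d"
      using x d(1) unfolding closure_in_def by blast
    obtain t where t: "t \<in> T" "vnorm W (vdiff W (f y) t) < e / 2"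
      using im[OF y(1)] e unfolding closure_in_def by (auto dest: spec[of _ "e / 2"])
    have car: "f x \<in> carrier W" "f y \<in> carrier W" "t \<in> carrier W" using assms(3,4,5) xV y t by auto
    have "0 \<le> vnorm V (vdiff V x y)"
      using xV y(1) assms(4) by (intro V.norm_nonneg V.vdiff_closed) auto
    then have "C * vnorm V (vdiff V x y) \<le> \<bar>C\<bar> * d" using y(2) by (intro mult_mono) auto
    then have "vnorm W (vdiff W (f x) t) < e"
      using W.norm_vdiff_triangle[OF car] lip[OF xV y(1)] d(2) t(2) by linarith
    then show ?thesis using t(1) by blast
  qed
  then show ?thesis using xV assms(3) by (auto simp: closure_in_def)
qed

lemma closure_in_mono: "S \<subseteq> T \<Longrightarrow> closure_in V S \<subseteq> closure_in V T"
  unfolding closure_in_def by blast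

lemma closure_lin_span_eq:
  assumes "complex_vspace V" "closure_in V D = carrier V" "D \<subseteq> S" "S \<subseteq> carrier V"
  shows "closure_in V (lin_span V S) = carrier V"
proof
  show "closure_in V (lin_span V S) \<subseteq> carrier V" by (auto simp: closure_in_def)
  have "D \<subseteq> lin_span V S" using lin_span_superset[OF assms(1) _ assms(4)] assms(3) by blast
  then show "carrier V \<subseteq> closure_in V (lin_span V S)" using closure_in_mono[of D _ V] assms(2) by metis
qed

context complex_normed_space
begin

lemma closure_in_idem:
  assumes "S \<subseteq> carrier V"
  shows "closure_in V (closure_in V S) = closure_in V S"
proof
  show "closure_in V (closure_in V S) \<subseteq> closure_in V S"
    using closure_in_map[where f = "\<lambda>x. x" and C = 1 and V = V and W = V and T = S
        and S = "closure_in V S"] assms complex_normed_space_axioms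
    by (auto simp: closure_in_def)
  show "closure_in V S \<subseteq> closure_in V (closure_in V S)"
    using closure_in_mono[OF closure_in_superset[OF complex_normed_space_axioms assms]] .
qed

lemma subspace_of_closure_in:
  assumes S: "subspace_of V S"
  shows "subspace_of V (closure_in V S)"
  unfolding subspace_of_def
proof (intro conjI ballI allI)
  have Sc: "S \<subseteq> carrier V" using S by (simp add: subspace_of_def)
  note sup = closure_in_superset[OF complex_normed_space_axioms Sc]
  show "closure_in V S \<subseteq> carrier V" by (auto simp: closure_in_def)
  show "vzero V \<in> closure_in V S" using sup S by (auto simp: subspace_of_def)
  fix x assume x: "x \<in> closure_in V S"
  then have xc: "x \<in> carrier V" by (simp add: closure_in_def)
  show "vscale V c x \<in> closure_in V S" for c
  proof (rule closure_in_map[where f = "vscale V c" and C = "cmod c" and V = V and S = S,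
        OF complex_normed_space_axioms complex_normed_space_axioms])
    show "vscale V c y \<in> closure_in V S" if "y \<in> S" for y
      using sup that S by (auto simp: subspace_of_def)
    show "vnorm V (vdiff V (vscale V c x) (vscale V c y)) \<le> cmod c * vnorm V (vdiff V x y)"
      if "x \<in> carrier V" "y \<in> S" for x y
      using that Sc by (auto simp: vdiff_vscale norm_scale vdiff_closed)
  qed (use x Sc scale_closed in auto)
  have trans: "vdiff V (vadd V a y) (vadd V a b) = vdiff V y b"
    if "a \<in> carrier V" "b \<in> carrier V" "y \<in> carrier V" for a b y
    using that by (simp add: vdiff_vadd vdiff_self zero_add vdiff_closed)
  have half: "vadd V a y \<in> closure_in V S"
    if a: "a \<in> carrier V" and y: "y \<in> closure_in V S" and im: "\<And>b. b \<in> S \<Longrightarrow> vadd V a b \<in> closure_in V S"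
    for a y
  proof (rule closure_in_map[where f = "vadd V a" and C = 1 and V = V and S = S,
        OF complex_normed_space_axioms complex_normed_space_axioms])
    show "vnorm V (vdiff V (vadd V a x) (vadd V a b)) \<le> 1 * vnorm V (vdiff V x b)"
      if "x \<in> carrier V" "b \<in> S" for x b
      using that Sc a by (auto simp: trans)
  qed (use a y im Sc add_closed in auto)
  fix y assume y: "y \<in> closure_in V S"
  have yc: "y \<in> carrier V" using y by (simp add: closure_in_def)
  have "vadd V y b \<in> closure_in V S" if b: "b \<in> S" for b
  proof -
    have bc: "b \<in> carrier V" using b Sc by auto
    have "vadd V b y \<in> closure_in V S"
      by (rule half) (use b bc y sup S in \<open>auto simp: subspace_of_def\<close>)
    then show ?thesis by (simp only: add_commute[OF bc yc])
  qed
  then have "vadd V y x \<in> closure_in V S" by (rule half[OF yc x])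
  then show "vadd V x y \<in> closure_in V S" by (simp only: add_commute[OF xc yc])
qed

end

subsection \<open>Spaces of bounded operators\<close>

lemma op_space_simps [simp]:
  "carrier (op_space V W) = {T \<in> extensional (carrier V). bounded_linear_map V W T}"
  "vadd (op_space V W) = (\<lambda>S T. \<lambda>x\<in>carrier V. vadd W (S x) (T x))"
  "vzero (op_space V W) = (\<lambda>x\<in>carrier V. vzero W)"
  "vscale (op_space V W) = (\<lambda>c T. \<lambda>x\<in>carrier V. vscale W c (T x))"
  "vnorm (op_space V W) = opnorm V W"
  by (simp_all add: op_space_def)

lemma bounded_linear_mapD:
  assumes "bounded_linear_map V W T"
  shows "x \<in> carrier V \<Longrightarrow> T x \<in> carrier W"
    and "\<lbrakk>x \<in> carrier V; y \<in> carrier V\<rbrakk> \<Longrightarrow> T (vadd V x y) = vadd W (T x) (T y)"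
    and "x \<in> carrier V \<Longrightarrow> T (vscale V c x) = vscale W c (T x)"
  using assms by (auto simp: bounded_linear_map_def linear_map_def)

lemma op_spaceD:
  assumes "T \<in> carrier (op_space V W)"
  shows "x \<in> carrier V \<Longrightarrow> T x \<in> carrier W" and "T \<in> extensional (carrier V)"
    and "bounded_linear_map V W T" and "linear_map V W T"
  using assms by (auto simp: bounded_linear_map_def linear_map_def)

lemma vdiff_op_space:
  "x \<in> carrier V \<Longrightarrow> vdiff (op_space V W) S T x = vdiff W (S x) (T x)"
  by (simp add: vdiff_def)

lemma op_space_eqI:
  "\<lbrakk>S \<in> carrier (op_space V W); T \<in> carrier (op_space V W); \<And>x. x \<in> carrier V \<Longrightarrow> S x = T x\<rbrakk> \<Longrightarrow> S = T"
  by (auto intro: extensionalityI)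

locale two_normed_spaces =
  V: complex_normed_space V + W: complex_normed_space W
  for V :: "('a, 'm) cns_scheme" and W :: "('b, 'n) cns_scheme"
begin

lemma opnorm_bdd:
  assumes T: "bounded_linear_map V W T"
  shows "bdd_above {vnorm W (T x) | x. x \<in> carrier V \<and> vnorm V x \<le> 1}"
proof -
  obtain C where C: "\<And>x. x \<in> carrier V \<Longrightarrow> vnorm W (T x) \<le> C * vnorm V x"
    using T by (auto simp: bounded_linear_map_def)
  show ?thesis
  proof (rule bdd_aboveI, clarify)
    fix x assume x: "x \<in> carrier V" "vnorm V x \<le> 1"
    have "C * vnorm V x \<le> \<bar>C\<bar> * 1" using x V.norm_nonneg[OF x(1)] by (intro mult_mono) auto
    then show "vnorm W (T x) \<le> \<bar>C\<bar>" using C[OF x(1)] by linarith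
  qed
qed

lemma opnorm_nonneg:
  assumes T: "bounded_linear_map V W T"
  shows "0 \<le> opnorm V W T"
proof -
  have "vnorm W (T (vzero V)) \<in> {vnorm W (T x) | x. x \<in> carrier V \<and> vnorm V x \<le> 1}"
    using V.zero_closed V.norm_vzero by force
  then have "vnorm W (T (vzero V)) \<le> opnorm V W T"
    unfolding opnorm_def by (rule cSup_upper) (rule opnorm_bdd[OF T])
  then show ?thesis
    using W.norm_nonneg[OF bounded_linear_mapD(1)[OF T V.zero_closed]] by linarith
qed

lemma opnorm_apply:
  assumes T: "bounded_linear_map V W T" and x: "x \<in> carrier V"
  shows "vnorm W (T x) \<le> opnorm V W T * vnorm V x"
proof (cases "vnorm V x = 0")
  case True
  obtain C where "vnorm W (T x) \<le> C * vnorm V x"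
    using T x by (auto simp: bounded_linear_map_def)
  then show ?thesis using True by simp
next
  case False
  then have n: "0 < vnorm V x" using V.norm_nonneg[OF x] by simp
  define c where "c = complex_of_real (inverse (vnorm V x))"
  have c: "cmod c = inverse (vnorm V x)" using n by (simp add: c_def norm_inverse)
  have "vnorm W (T (vscale V c x)) \<le> opnorm V W T"
    unfolding opnorm_def
    by (rule cSup_upper[OF _ opnorm_bdd[OF T]])
      (use n x c in \<open>auto intro!: exI[of _ "vscale V c x"] V.scale_closed simp: V.norm_scale\<close>)
  moreover have "vnorm W (T (vscale V c x)) = inverse (vnorm V x) * vnorm W (T x)"
    using bounded_linear_mapD[OF T] x by (simp add: W.norm_scale c)
  ultimately show ?thesis using n by (simp add: field_simps)
qed

lemma opnorm_le:
  assumes "0 \<le> C" "\<And>x. x \<in> carrier V \<Longrightarrow> vnorm W (T x) \<le> C * vnorm V x"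
  shows "opnorm V W T \<le> C"
  unfolding opnorm_def
proof (rule cSup_least)
  show "{vnorm W (T x) |x. x \<in> carrier V \<and> vnorm V x \<le> 1} \<noteq> {}"
    using V.zero_closed V.norm_vzero by fastforce
  fix y assume "y \<in> {vnorm W (T x) |x. x \<in> carrier V \<and> vnorm V x \<le> 1}"
  then obtain x where x: "y = vnorm W (T x)" "x \<in> carrier V" "vnorm V x \<le> 1" by auto
  then show "y \<le> C" using assms(2)[OF x(2)] mult_left_mono[OF x(3) assms(1)] by simp
qed

lemma bounded_linear_mapI:
  assumes "\<And>x. x \<in> carrier V \<Longrightarrow> T x \<in> carrier W"
    and "\<And>x y. \<lbrakk>x \<in> carrier V; y \<in> carrier V\<rbrakk> \<Longrightarrow> T (vadd V x y) = vadd W (T x) (T y)"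
    and "\<And>c x. x \<in> carrier V \<Longrightarrow> T (vscale V c x) = vscale W c (T x)"
    and "\<And>x. x \<in> carrier V \<Longrightarrow> vnorm W (T x) \<le> C * vnorm V x"
  shows "bounded_linear_map V W T"
  unfolding bounded_linear_map_def linear_map_def
  by (intro conjI funcsetI ballI allI exI[of _ C] assms)

lemma op_spaceI:
  assumes "T \<in> extensional (carrier V)" "\<And>x. x \<in> carrier V \<Longrightarrow> T x \<in> carrier W"
    and "\<And>x y. \<lbrakk>x \<in> carrier V; y \<in> carrier V\<rbrakk> \<Longrightarrow> T (vadd V x y) = vadd W (T x) (T y)"
    and "\<And>c x. x \<in> carrier V \<Longrightarrow> T (vscale V c x) = vscale W c (T x)"
    and "\<And>x. x \<in> carrier V \<Longrightarrow> vnorm W (T x) \<le> C * vnorm V x"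
  shows "T \<in> carrier (op_space V W)"
  using assms(1) bounded_linear_mapI[OF assms(2-)] by simp

lemma op_space_add_closed:
  assumes S: "S \<in> carrier (op_space V W)" and T: "T \<in> carrier (op_space V W)"
  shows "vadd (op_space V W) S T \<in> carrier (op_space V W)"
    and "opnorm V W (vadd (op_space V W) S T) \<le> opnorm V W S + opnorm V W T"
proof -
  have Sb: "bounded_linear_map V W S" and Tb: "bounded_linear_map V W T" using S T by auto
  note D = bounded_linear_mapD[OF Sb] bounded_linear_mapD[OF Tb]
  have bd: "vnorm W (vadd W (S x) (T x)) \<le> (opnorm V W S + opnorm V W T) * vnorm V x"
    if x: "x \<in> carrier V" for x
    using W.norm_triangle[OF D(1)[OF x] D(4)[OF x]] opnorm_apply[OF Sb x] opnorm_apply[OF Tb x]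
    by (simp add: algebra_simps)
  show "vadd (op_space V W) S T \<in> carrier (op_space V W)"
  proof (rule op_spaceI)
    show "vadd (op_space V W) S T (vadd V x y)
        = vadd W (vadd (op_space V W) S T x) (vadd (op_space V W) S T y)"
      if "x \<in> carrier V" "y \<in> carrier V" for x y
      using that by (simp add: V.add_closed D W.add_assoc W.add_left_commute W.add_closed)
    show "vnorm W (vadd (op_space V W) S T x) \<le> (opnorm V W S + opnorm V W T) * vnorm V x"
      if "x \<in> carrier V" for x
      using bd[OF that] that by simp
  qed (simp_all add: V.scale_closed D W.scale_add_right W.add_closed)
  show "opnorm V W (vadd (op_space V W) S T) \<le> opnorm V W S + opnorm V W T"
    by (rule opnorm_le) (simp_all add: bd opnorm_nonneg Sb Tb)
qed

lemma op_space_scale_closed: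
  assumes T: "T \<in> carrier (op_space V W)"
  shows "vscale (op_space V W) c T \<in> carrier (op_space V W)"
    and "opnorm V W (vscale (op_space V W) c T) = cmod c * opnorm V W T"
proof -
  let ?s = "vscale (op_space V W)"
  have cl: "?s c T \<in> carrier (op_space V W)" and le: "opnorm V W (?s c T) \<le> cmod c * opnorm V W T"
    if T: "T \<in> carrier (op_space V W)" for c T
  proof -
    have Tb: "bounded_linear_map V W T" using T by auto
    note D = bounded_linear_mapD[OF Tb]
    have bd: "vnorm W (vscale W c (T x)) \<le> cmod c * opnorm V W T * vnorm V x"
      if x: "x \<in> carrier V" for x
      using mult_left_mono[OF opnorm_apply[OF Tb x], of "cmod c"] x
      by (simp add: W.norm_scale D mult.assoc)
    show "?s c T \<in> carrier (op_space V W)"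
    proof (rule op_spaceI)
      show "?s c T (vadd V x y) = vadd W (?s c T x) (?s c T y)"
        if "x \<in> carrier V" "y \<in> carrier V" for x y
        using that by (simp add: V.add_closed D W.scale_add_right)
      show "vnorm W (?s c T x) \<le> cmod c * opnorm V W T * vnorm V x" if "x \<in> carrier V" for x
        using bd[OF that] that by simp
    qed (simp_all add: V.scale_closed D W.scale_closed W.scale_scale mult.commute)
    show "opnorm V W (?s c T) \<le> cmod c * opnorm V W T"
      by (rule opnorm_le) (simp_all add: bd opnorm_nonneg Tb)
  qed
  show "?s c T \<in> carrier (op_space V W)" by (rule cl[OF T])
  show "opnorm V W (?s c T) = cmod c * opnorm V W T"
  proof (cases "c = 0")
    case True
    have "0 \<le> opnorm V W (?s c T)" using cl[OF T, of c] by (intro opnorm_nonneg) simp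
    then show ?thesis using le[OF T, of c] True by simp
  next
    case False
    have "?s (inverse c) (?s c T) = T"
      by (rule op_space_eqI[OF cl[OF cl[OF T]] T])
        (simp add: W.scale_scale op_spaceD(1)[OF T] False W.scale_one)
    then have "opnorm V W T \<le> inverse (cmod c) * opnorm V W (?s c T)"
      using le[OF cl[OF T], of "inverse c" c] by (simp add: norm_inverse)
    then show ?thesis using False le[OF T, of c] by (simp add: field_simps)
  qed
qed

lemma op_space_normed: "complex_normed_space (op_space V W)"
proof -
  let ?O = "op_space V W"
  have zero: "vzero ?O \<in> carrier ?O"
    by (rule op_spaceI[where C = 0])
      (simp_all add: V.add_closed V.scale_closed W.zero_closed W.add_zero W.scale_vzero W.norm_vzero)
  note cl = op_space_add_closed op_space_scale_closed zero
  note D = op_spaceD(1)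
  have eq: "S = T" if "S \<in> carrier ?O" "T \<in> carrier ?O" "\<And>x. x \<in> carrier V \<Longrightarrow> S x = T x" for S T
    using that by (rule op_space_eqI)
  show ?thesis
  proof unfold_locales
    fix S T R c d
    assume S: "S \<in> carrier ?O"
    have Sb: "bounded_linear_map V W S" using S by simp
    show "0 \<le> vnorm ?O S" using opnorm_nonneg[OF Sb] by simp
    show "vnorm ?O (vscale ?O c S) = cmod c * vnorm ?O S" using cl(4)[OF S] by simp
    show "vnorm ?O S = 0 \<longleftrightarrow> S = vzero ?O"
    proof
      assume 0: "vnorm ?O S = 0"
      have "S x = vzero W" if x: "x \<in> carrier V" for x
        using opnorm_apply[OF Sb x] 0 W.norm_nonneg[OF D[OF S x]] W.norm_eq_zero[OF D[OF S x]] by simp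
      then show "S = vzero ?O" by (intro eq[OF S zero]) simp
    next
      assume "S = vzero ?O"
      moreover have "opnorm V W (vzero ?O) \<le> 0" by (rule opnorm_le) (simp_all add: W.norm_vzero)
      ultimately show "vnorm ?O S = 0" using opnorm_nonneg[OF Sb] by simp
    qed
    show "vadd ?O S (vzero ?O) = S"
      by (rule eq[OF cl(1)[OF S zero] S]) (simp add: W.add_zero D[OF S])
    show "vadd ?O S (vscale ?O (- 1) S) = vzero ?O"
      by (rule eq[OF cl(1)[OF S cl(3)[OF S]] zero]) (simp add: W.add_uminus D[OF S])
    show "vscale ?O 1 S = S"
      by (rule eq[OF cl(3)[OF S] S]) (simp add: W.scale_one D[OF S])
    show "vscale ?O c (vscale ?O d S) = vscale ?O (c * d) S"
      by (rule eq[OF cl(3)[OF cl(3)[OF S]] cl(3)[OF S]]) (simp add: W.scale_scale D[OF S])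
    show "vscale ?O (c + d) S = vadd ?O (vscale ?O c S) (vscale ?O d S)"
      by (rule eq[OF cl(3)[OF S] cl(1)[OF cl(3)[OF S] cl(3)[OF S]]])
        (simp add: W.scale_add_left D[OF S])
    show "vscale ?O c S \<in> carrier ?O" by (rule cl(3)[OF S])
    assume T: "T \<in> carrier ?O"
    show "vadd ?O S T \<in> carrier ?O" by (rule cl(1)[OF S T])
    show "vnorm ?O (vadd ?O S T) \<le> vnorm ?O S + vnorm ?O T" using cl(2)[OF S T] by simp
    show "vadd ?O S T = vadd ?O T S"
      by (rule eq[OF cl(1)[OF S T] cl(1)[OF T S]]) (simp add: W.add_commute D[OF S] D[OF T])
    show "vscale ?O c (vadd ?O S T) = vadd ?O (vscale ?O c S) (vscale ?O c T)"
      by (rule eq[OF cl(3)[OF cl(1)[OF S T]] cl(1)[OF cl(3)[OF S] cl(3)[OF T]]])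
        (simp add: W.scale_add_right D[OF S] D[OF T])
    assume R: "R \<in> carrier ?O"
    show "vadd ?O (vadd ?O S T) R = vadd ?O S (vadd ?O T R)"
      by (rule eq[OF cl(1)[OF cl(1)[OF S T] R] cl(1)[OF S cl(1)[OF T R]]])
        (simp add: W.add_assoc D[OF S] D[OF T] D[OF R])
  qed (rule zero)
qed

end

text \<open>A Cauchy sequence of operators converges at every vector. Letting one index tend to infinity in
  the Cauchy condition shows that the convergence is uniform on the unit ball, which gives boundedness
  of the limit and convergence in norm.\<close>

lemma op_space_banach:
  assumes "complex_normed_space V" "complex_banach_space W"
  shows "complex_banach_space (op_space V W)"
proof -
  interpret W: complex_banach_space W by fact
  interpret two_normed_spaces V W
    using assms(1) W.complex_normed_space_axioms by (simp add: two_normed_spaces_def)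
  interpret O: complex_normed_space "op_space V W" by (rule op_space_normed)
  let ?O = "op_space V W"
  show ?thesis
  proof unfold_locales
    fix \<sigma> :: "nat \<Rightarrow> _"
    assume "range \<sigma> \<subseteq> carrier ?O"
    then have \<sigma>: "\<sigma> n \<in> carrier ?O" for n by blast
    assume C: "\<forall>e>0. \<exists>N. \<forall>m\<ge>N. \<forall>n\<ge>N. vnorm ?O (vdiff ?O (\<sigma> m) (\<sigma> n)) < e"
    note D = op_spaceD(1)[OF \<sigma>]
    have bl: "bounded_linear_map V W (vdiff ?O (\<sigma> m) (\<sigma> n))" for m n
      using O.vdiff_closed[OF \<sigma> \<sigma>, of m n] by simp
    have pt: "vnorm W (vdiff W (\<sigma> m x) (\<sigma> n x)) \<le> vnorm ?O (vdiff ?O (\<sigma> m) (\<sigma> n)) * vnorm V x"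
      if "x \<in> carrier V" for m n x
      using opnorm_apply[OF bl that] that by (simp add: vdiff_op_space)
    have "\<exists>y\<in>carrier W. (\<lambda>n. vnorm W (vdiff W (\<sigma> n x) y)) \<longlonglongrightarrow> 0" if x: "x \<in> carrier V" for x
    proof (rule W.complete)
      show "range (\<lambda>n. \<sigma> n x) \<subseteq> carrier W" using D[OF x] by auto
      show "\<forall>e>0. \<exists>N. \<forall>m\<ge>N. \<forall>n\<ge>N. vnorm W (vdiff W (\<sigma> m x) (\<sigma> n x)) < e"
      proof (intro allI impI)
        fix e :: real assume e: "0 < e"
        let ?d = "e / (vnorm V x + 1)"
        have n0: "0 \<le> vnorm V x" by (rule V.norm_nonneg[OF x])
        then have d: "0 < ?d" using e by simp
        obtain N where N: "\<forall>m\<ge>N. \<forall>n\<ge>N. vnorm ?O (vdiff ?O (\<sigma> m) (\<sigma> n)) < ?d"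
          using C d by blast
        have "vnorm W (vdiff W (\<sigma> m x) (\<sigma> n x)) < e" if "m \<ge> N" "n \<ge> N" for m n
        proof -
          have "vnorm ?O (vdiff ?O (\<sigma> m) (\<sigma> n)) * vnorm V x \<le> ?d * vnorm V x"
            using N that n0 by (intro mult_right_mono) (auto intro: less_imp_le)
          also have "\<dots> < e" using n0 e by (simp add: field_simps)
          finally show ?thesis using pt[OF x, of m n] by linarith
        qed
        then show "\<exists>N. \<forall>m\<ge>N. \<forall>n\<ge>N. vnorm W (vdiff W (\<sigma> m x) (\<sigma> n x)) < e" by blast
      qed
    qed
    then obtain L where L: "\<And>x. x \<in> carrier V \<Longrightarrow> L x \<in> carrier W"
      "\<And>x. x \<in> carrier V \<Longrightarrow> (\<lambda>n. vnorm W (vdiff W (\<sigma> n x) (L x))) \<longlonglongrightarrow> 0" by metis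
    define T where "T = restrict L (carrier V)"
    have TV: "T x \<in> carrier W" and lim: "(\<lambda>n. vnorm W (vdiff W (\<sigma> n x) (T x))) \<longlonglongrightarrow> 0"
      if "x \<in> carrier V" for x
      using L that by (simp_all add: T_def)
    have uniq: "y = z" if y: "y \<in> carrier W" "z \<in> carrier W" and u: "\<And>n. u n \<in> carrier W"
      "(\<lambda>n. vnorm W (vdiff W (u n) y)) \<longlonglongrightarrow> 0" "(\<lambda>n. vnorm W (vdiff W (u n) z)) \<longlonglongrightarrow> 0" for u :: "nat \<Rightarrow> _" and y z
    proof (rule W.vdiff_norm_0[OF y])
      have "(\<lambda>n. vnorm W (vdiff W (u n) y) + vnorm W (vdiff W (u n) z)) \<longlonglongrightarrow> 0 + 0"
        by (intro tendsto_add u)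
      moreover have "vnorm W (vdiff W y z) \<le> vnorm W (vdiff W (u n) y) + vnorm W (vdiff W (u n) z)" for n
        using W.norm_vdiff_triangle[OF y(1) u(1) y(2), of n] W.norm_vdiff_commute[OF u(1) y(1), of n] by simp
      ultimately show "vnorm W (vdiff W y z) \<le> 0"
        by (intro LIMSEQ_le_const[where X = "\<lambda>n. vnorm W (vdiff W (u n) y) + vnorm W (vdiff W (u n) z)"]) auto
    qed
    have bd: "\<exists>N. \<forall>n\<ge>N. \<forall>x\<in>carrier V. vnorm W (vdiff W (\<sigma> n x) (T x)) \<le> e * vnorm V x" if e: "0 < e" for e
    proof -
      obtain N where N: "\<forall>m\<ge>N. \<forall>n\<ge>N. vnorm ?O (vdiff ?O (\<sigma> m) (\<sigma> n)) < e"
        using C e by blast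
      have "vnorm W (vdiff W (\<sigma> n x) (T x)) \<le> e * vnorm V x" if n: "n \<ge> N" and x: "x \<in> carrier V" for n x
      proof (rule LIMSEQ_le_const)
        show "(\<lambda>m. e * vnorm V x + vnorm W (vdiff W (\<sigma> m x) (T x))) \<longlonglongrightarrow> e * vnorm V x"
          using tendsto_add[OF tendsto_const lim[OF x]] by simp
        show "\<exists>M. \<forall>m\<ge>M. vnorm W (vdiff W (\<sigma> n x) (T x)) \<le> e * vnorm V x + vnorm W (vdiff W (\<sigma> m x) (T x))"
        proof (intro exI allI impI)
          fix m assume m: "m \<ge> N"
          have "vnorm ?O (vdiff ?O (\<sigma> n) (\<sigma> m)) * vnorm V x \<le> e * vnorm V x"
            using N n m V.norm_nonneg[OF x] by (intro mult_right_mono) (auto intro: less_imp_le)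
          then show "vnorm W (vdiff W (\<sigma> n x) (T x)) \<le> e * vnorm V x + vnorm W (vdiff W (\<sigma> m x) (T x))"
            using pt[OF x, of n m] W.norm_vdiff_triangle[OF D[OF x] D[OF x] TV[OF x], of n m] by linarith
        qed
      qed
      then show ?thesis by blast
    qed
    obtain N where N: "\<forall>x\<in>carrier V. vnorm W (vdiff W (\<sigma> N x) (T x)) \<le> 1 * vnorm V x"
      using bd[of 1] by auto
    have T: "T \<in> carrier ?O"
    proof (rule op_spaceI)
      show "T \<in> extensional (carrier V)" by (simp add: T_def)
      show "vnorm W (T x) \<le> (opnorm V W (\<sigma> N) + 1) * vnorm V x" if x: "x \<in> carrier V" for x
        using N[rule_format, OF x] W.norm_le_vdiff[OF TV[OF x] D[OF x], of N]
          opnorm_apply[OF op_spaceD(3)[OF \<sigma>] x, of N] W.norm_vdiff_commute[OF TV[OF x] D[OF x], of N]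
        by (simp add: algebra_simps)
      show "T (vscale V c x) = vscale W c (T x)" if x: "x \<in> carrier V" for c x
      proof (rule uniq)
        show "(\<lambda>n. vnorm W (vdiff W (\<sigma> n (vscale V c x)) (T (vscale V c x)))) \<longlonglongrightarrow> 0"
          by (rule lim[OF V.scale_closed[OF x]])
        have "(\<lambda>n. cmod c * vnorm W (vdiff W (\<sigma> n x) (T x))) \<longlonglongrightarrow> cmod c * 0"
          by (intro tendsto_mult lim[OF x] tendsto_const)
        then show "(\<lambda>n. vnorm W (vdiff W (\<sigma> n (vscale V c x)) (vscale W c (T x)))) \<longlonglongrightarrow> 0"
          using bounded_linear_mapD(3)[OF op_spaceD(3)[OF \<sigma>] x] D[OF x] TV[OF x]
          by (simp add: W.vdiff_vscale W.norm_scale W.vdiff_closed)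
      qed (use x in \<open>auto intro: D TV V.scale_closed W.scale_closed\<close>)
      show "T (vadd V x y) = vadd W (T x) (T y)" if x: "x \<in> carrier V" and y: "y \<in> carrier V" for x y
      proof (rule uniq)
        show "(\<lambda>n. vnorm W (vdiff W (\<sigma> n (vadd V x y)) (T (vadd V x y)))) \<longlonglongrightarrow> 0"
          by (rule lim[OF V.add_closed[OF x y]])
        show "(\<lambda>n. vnorm W (vdiff W (\<sigma> n (vadd V x y)) (vadd W (T x) (T y)))) \<longlonglongrightarrow> 0"
        proof (rule tendsto_sandwich[OF _ _ tendsto_const])
          show "(\<lambda>n. vnorm W (vdiff W (\<sigma> n x) (T x)) + vnorm W (vdiff W (\<sigma> n y) (T y))) \<longlonglongrightarrow> 0"
            using tendsto_add[OF lim[OF x] lim[OF y]] by simp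
          have eq: "vdiff W (\<sigma> n (vadd V x y)) (vadd W (T x) (T y))
              = vadd W (vdiff W (\<sigma> n x) (T x)) (vdiff W (\<sigma> n y) (T y))" for n
            using bounded_linear_mapD(2)[OF op_spaceD(3)[OF \<sigma>] x y]
              W.vdiff_vadd[OF D[OF x] D[OF y] TV[OF x] TV[OF y]] by simp
          show "\<forall>\<^sub>F n in sequentially. vnorm W (vdiff W (\<sigma> n (vadd V x y)) (vadd W (T x) (T y)))
              \<le> vnorm W (vdiff W (\<sigma> n x) (T x)) + vnorm W (vdiff W (\<sigma> n y) (T y))"
            unfolding eq by (intro always_eventually allI W.norm_triangle W.vdiff_closed D TV x y)
          show "\<forall>\<^sub>F n in sequentially. 0 \<le> vnorm W (vdiff W (\<sigma> n (vadd V x y)) (vadd W (T x) (T y)))"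
            by (intro always_eventually allI W.norm_nonneg W.vdiff_closed W.add_closed D TV x y V.add_closed)
        qed
      qed (use x y in \<open>auto intro: D TV V.add_closed W.add_closed\<close>)
    qed (rule TV)
    show "\<exists>T\<in>carrier ?O. (\<lambda>n. vnorm ?O (vdiff ?O (\<sigma> n) T)) \<longlonglongrightarrow> 0"
    proof (rule bexI[OF _ T], rule LIMSEQ_I)
      fix r :: real assume r: "0 < r"
      obtain N where N: "\<forall>n\<ge>N. \<forall>x\<in>carrier V. vnorm W (vdiff W (\<sigma> n x) (T x)) \<le> r / 2 * vnorm V x"
        using bd[of "r / 2"] r by auto
      have "vnorm ?O (vdiff ?O (\<sigma> n) T) \<le> r / 2" if "n \<ge> N" for n
        using N that r unfolding op_space_simps
        by (intro opnorm_le) (auto simp: vdiff_op_space)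
      moreover have "0 \<le> vnorm ?O (vdiff ?O (\<sigma> n) T)" for n
        by (intro O.norm_nonneg O.vdiff_closed \<sigma> T)
      ultimately show "\<exists>N. \<forall>n\<ge>N. norm (vnorm ?O (vdiff ?O (\<sigma> n) T) - 0) < r"
        using r by (intro exI[of _ N]) (fastforce dest: order.strict_trans1[of _ "r / 2" r])
    qed
  qed
qed

subsection \<open>Closed subspaces\<close>

lemma vdiff_carrier_update [simp]: "vdiff (V\<lparr>carrier := S\<rparr>) = vdiff V"
  by (simp add: vdiff_def fun_eq_iff)

lemma closure_in_carrier_update:
  "C \<subseteq> carrier V \<Longrightarrow> closure_in (V\<lparr>carrier := C\<rparr>) S = C \<inter> closure_in V S"
  by (auto simp: closure_in_def)

lemma complex_normed_subspace:
  assumes "complex_normed_space V" "subspace_of V S"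
  shows "complex_normed_space (V\<lparr>carrier := S\<rparr>)"
proof -
  interpret complex_normed_space V by fact
  note D = subspace_ofD[OF assms(2)]
  show ?thesis
    by unfold_locales
      (simp_all add: D add_assoc add_commute add_left_commute add_zero add_uminus scale_one scale_scale scale_add_left
        scale_add_right norm_nonneg norm_eq_zero norm_triangle norm_scale)
qed

lemma complex_banach_subspace:
  assumes "complex_banach_space V" "subspace_of V S" "closure_in V S \<subseteq> S"
  shows "complex_banach_space (V\<lparr>carrier := S\<rparr>)"
proof -
  interpret complex_banach_space V by fact
  interpret S: complex_normed_space "V\<lparr>carrier := S\<rparr>"
    by (rule complex_normed_subspace[OF complex_normed_space_axioms assms(2)])
  note D = subspace_ofD[OF assms(2)]
  show ?thesis
  proof unfold_locales
    fix \<sigma> :: "nat \<Rightarrow> _"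
    assume "range \<sigma> \<subseteq> carrier (V\<lparr>carrier := S\<rparr>)"
    then have \<sigma>: "\<sigma> n \<in> S" for n by auto
    assume "\<forall>e>0. \<exists>N. \<forall>m\<ge>N. \<forall>n\<ge>N.
      vnorm (V\<lparr>carrier := S\<rparr>) (vdiff (V\<lparr>carrier := S\<rparr>) (\<sigma> m) (\<sigma> n)) < e"
    then obtain x where x: "x \<in> carrier V" "(\<lambda>n. vnorm V (vdiff V (\<sigma> n) x)) \<longlonglongrightarrow> 0"
      using complete[of \<sigma>] D(1)[OF \<sigma>] by (auto simp: image_subset_iff)
    have "\<exists>y\<in>S. vnorm V (vdiff V x y) < e" if e: "0 < e" for e
    proof -
      have "\<forall>\<^sub>F n in sequentially. vnorm V (vdiff V (\<sigma> n) x) < e"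
        using x(2) e by (rule order_tendstoD)
      then obtain n where "vnorm V (vdiff V (\<sigma> n) x) < e"
        by (meson eventually_happens trivial_limit_sequentially)
      then show ?thesis
        using norm_vdiff_commute[OF D(1)[OF \<sigma>] x(1), of n] \<sigma>[of n]
        by (intro bexI[of _ "\<sigma> n"]) auto
    qed
    then have "x \<in> S" using x(1) assms(3) by (auto simp: closure_in_def)
    then show "\<exists>x\<in>carrier (V\<lparr>carrier := S\<rparr>).
        (\<lambda>n. vnorm (V\<lparr>carrier := S\<rparr>) (vdiff (V\<lparr>carrier := S\<rparr>) (\<sigma> n) x)) \<longlonglongrightarrow> 0"
      using x(2) by auto
  qed
qed

lemma complex_banach_closure:
  assumes "complex_banach_space V" "subspace_of V S"
  shows "complex_banach_space (V\<lparr>carrier := closure_in V S\<rparr>)"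
proof -
  interpret complex_banach_space V by fact
  show ?thesis
    using subspace_of_closure_in[OF assms(2)] closure_in_idem assms(2)
    by (intro complex_banach_subspace assms(1)) (auto simp: subspace_of_def)
qed

subsection \<open>Composition of operators\<close>

lemma op_algebra_simps [simp]:
  "carrier (op_algebra V) = carrier (op_space V V)"
  "vadd (op_algebra V) = vadd (op_space V V)"
  "vzero (op_algebra V) = vzero (op_space V V)"
  "vscale (op_algebra V) = vscale (op_space V V)"
  "vnorm (op_algebra V) = opnorm V V"
  "amult (op_algebra V) = compose (carrier V)"
  by (simp_all add: op_algebra_def op_space_def cns.defs cna.defs fun_eq_iff)

lemma vnorm_op_algebra: "vnorm (op_algebra V) = vnorm (op_space V V)"
  by simp

lemma vdiff_op_algebra [simp]: "vdiff (op_algebra V) = vdiff (op_space V V)"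
  by (simp add: vdiff_def fun_eq_iff del: op_space_simps)

lemma closure_in_op_algebra [simp]: "closure_in (op_algebra V) = closure_in (op_space V V)"
  by (simp add: closure_in_def fun_eq_iff)

lemma subspace_of_op_algebra [simp]: "subspace_of (op_algebra V) S = subspace_of (op_space V V) S"
  by (simp add: subspace_of_def)

lemma complex_banach_op_algebra:
  assumes "complex_banach_space V"
  shows "complex_banach_space (op_algebra V)"
proof -
  interpret V: complex_banach_space V by fact
  interpret O: complex_banach_space "op_space V V"
    by (rule op_space_banach[OF V.complex_normed_space_axioms assms])
  show ?thesis
    using O.complex_banach_space_axioms
    unfolding complex_banach_space_def complex_banach_space_axioms_def complex_normed_space_def
      complex_normed_space_axioms_def complex_vspace_def op_algebra_simps(1-4) vnorm_op_algebra
      vdiff_op_algebra .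
qed

lemma compose_op_space:
  assumes "complex_normed_space U" "complex_normed_space V" "complex_normed_space W"
    and T: "T \<in> carrier (op_space U V)" and S: "S \<in> carrier (op_space V W)"
  shows "compose (carrier U) S T \<in> carrier (op_space U W)"
    and "opnorm U W (compose (carrier U) S T) \<le> opnorm V W S * opnorm U V T"
proof -
  interpret UV: two_normed_spaces U V using assms by (simp add: two_normed_spaces_def)
  interpret VW: two_normed_spaces V W using assms by (simp add: two_normed_spaces_def)
  interpret UW: two_normed_spaces U W using assms by (simp add: two_normed_spaces_def)
  have bT: "bounded_linear_map U V T" and bS: "bounded_linear_map V W S" using T S by auto
  note DT = bounded_linear_mapD[OF bT] and DS = bounded_linear_mapD[OF bS]
  have bd: "vnorm W (S (T x)) \<le> opnorm V W S * opnorm U V T * vnorm U x" if x: "x \<in> carrier U" for x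
  proof -
    have "vnorm W (S (T x)) \<le> opnorm V W S * vnorm V (T x)" by (rule VW.opnorm_apply[OF bS DT(1)[OF x]])
    also have "\<dots> \<le> opnorm V W S * (opnorm U V T * vnorm U x)"
      by (intro mult_left_mono UV.opnorm_apply[OF bT x] VW.opnorm_nonneg[OF bS])
    finally show ?thesis by (simp add: mult.assoc)
  qed
  show "compose (carrier U) S T \<in> carrier (op_space U W)"
    by (rule UW.op_spaceI[where C = "opnorm V W S * opnorm U V T"])
      (simp_all add: compose_def DT DS bd UV.V.add_closed UV.V.scale_closed)
  show "opnorm U W (compose (carrier U) S T) \<le> opnorm V W S * opnorm U V T"
    by (rule UW.opnorm_le) (simp_all add: bd compose_def UV.opnorm_nonneg[OF bT] VW.opnorm_nonneg[OF bS])
qed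

lemma compose_linear_left:
  assumes "T \<in> carrier (op_space U V)"
  shows "compose (carrier U) (vadd (op_space V W) S S') T
      = vadd (op_space U W) (compose (carrier U) S T) (compose (carrier U) S' T)"
    and "compose (carrier U) (vscale (op_space V W) c S) T
      = vscale (op_space U W) c (compose (carrier U) S T)"
    and "compose (carrier U) (vdiff (op_space V W) S S') T
      = vdiff (op_space U W) (compose (carrier U) S T) (compose (carrier U) S' T)"
  using op_spaceD(1)[OF assms] by (auto simp: compose_def vdiff_def intro!: restrict_ext)

lemma compose_linear_right:
  assumes "S \<in> carrier (op_space V W)" "T \<in> carrier (op_space U V)" "T' \<in> carrier (op_space U V)"
    and "complex_vspace V"
  shows "compose (carrier U) S (vadd (op_space U V) T T')
      = vadd (op_space U W) (compose (carrier U) S T) (compose (carrier U) S T')"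
    and "compose (carrier U) S (vdiff (op_space U V) T T')
      = vdiff (op_space U W) (compose (carrier U) S T) (compose (carrier U) S T')"
  using op_spaceD(1)[OF assms(2)] op_spaceD(1)[OF assms(3)] bounded_linear_mapD[OF op_spaceD(3)[OF assms(1)]]
    complex_vspace.scale_closed[OF assms(4)]
  by (auto simp: compose_def vdiff_def intro!: restrict_ext)

lemma compose_vscale_right:
  assumes "S \<in> carrier (op_space V W)" "T \<in> carrier (op_space U V)"
  shows "compose (carrier U) S (vscale (op_space U V) c T)
      = vscale (op_space U W) c (compose (carrier U) S T)"
  using op_spaceD(1)[OF assms(2)] bounded_linear_mapD[OF op_spaceD(3)[OF assms(1)]]
  by (auto simp: compose_def intro!: restrict_ext)

lemma compose_op_assoc:
  assumes "T \<in> carrier (op_space U V)"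
  shows "compose (carrier U) (compose (carrier V) R S) T
      = compose (carrier U) R (compose (carrier U) S T)"
  using op_spaceD(1)[OF assms] by (auto simp: compose_def intro!: restrict_ext)

text \<open>Approximate first the right factor with the left one fixed in its generating set, then the left
  factor.\<close>

lemma compose_closure:
  assumes n: "complex_normed_space U" "complex_normed_space V" "complex_normed_space W"
    and sub: "S0 \<subseteq> carrier (op_space V W)" "T0 \<subseteq> carrier (op_space U V)" "R0 \<subseteq> carrier (op_space U W)"
    and prod: "\<And>S T. \<lbrakk>S \<in> S0; T \<in> T0\<rbrakk> \<Longrightarrow> compose (carrier U) S T \<in> closure_in (op_space U W) R0"
    and S: "S \<in> closure_in (op_space V W) S0" and T: "T \<in> closure_in (op_space U V) T0"
  shows "compose (carrier U) S T \<in> closure_in (op_space U W) R0"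
proof -
  interpret UV: two_normed_spaces U V using n by (simp add: two_normed_spaces_def)
  interpret VW: two_normed_spaces V W using n by (simp add: two_normed_spaces_def)
  interpret UW: two_normed_spaces U W using n by (simp add: two_normed_spaces_def)
  have Tc: "T \<in> carrier (op_space U V)" using T by (simp add: closure_in_def)
  have Uv: "complex_vspace V" by (rule UV.W.complex_vspace_axioms)
  have 1: "compose (carrier U) S T \<in> closure_in (op_space U W) R0" if S: "S \<in> S0" for S
  proof (rule closure_in_map[where f = "compose (carrier U) S" and C = "opnorm V W S",
        OF UV.op_space_normed UW.op_space_normed _ sub(2,3) _ prod[OF S] T])
    have Sc: "S \<in> carrier (op_space V W)" using S sub(1) by blast
    show "compose (carrier U) S \<in> carrier (op_space U V) \<rightarrow> carrier (op_space U W)"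
      using compose_op_space(1)[OF n _ Sc] by blast
    fix x y assume x: "x \<in> carrier (op_space U V)" and "y \<in> T0"
    then have y: "y \<in> carrier (op_space U V)" using sub(2) by blast
    have d: "vdiff (op_space U V) x y \<in> carrier (op_space U V)"
      by (rule complex_vspace.vdiff_closed[OF complex_normed_space.axioms(1)[OF UV.op_space_normed] x y])
    show "vnorm (op_space U W) (vdiff (op_space U W) (compose (carrier U) S x) (compose (carrier U) S y))
        \<le> opnorm V W S * vnorm (op_space U V) (vdiff (op_space U V) x y)"
      using compose_op_space(2)[OF n d Sc] unfolding compose_linear_right(2)[OF Sc x y Uv] by simp
  qed
  show ?thesis
  proof (rule closure_in_map[where f = "\<lambda>S. compose (carrier U) S T" and C = "opnorm U V T",
        OF VW.op_space_normed UW.op_space_normed _ sub(1,3) _ 1 S])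
    show "(\<lambda>S. compose (carrier U) S T) \<in> carrier (op_space V W) \<rightarrow> carrier (op_space U W)"
      using compose_op_space(1)[OF n Tc] by blast
    fix x y assume x: "x \<in> carrier (op_space V W)" and "y \<in> S0"
    then have y: "y \<in> carrier (op_space V W)" using sub(1) by blast
    have d: "vdiff (op_space V W) x y \<in> carrier (op_space V W)"
      by (rule complex_vspace.vdiff_closed[OF complex_normed_space.axioms(1)[OF VW.op_space_normed] x y])
    show "vnorm (op_space U W) (vdiff (op_space U W) (compose (carrier U) x T) (compose (carrier U) y T))
        \<le> opnorm U V T * vnorm (op_space V W) (vdiff (op_space V W) x y)"
      using compose_op_space(2)[OF n Tc d] unfolding compose_linear_left(3)[OF Tc]
      by (simp add: mult.commute)
  qed
qed

subsection \<open>Products of normed spaces\<close>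

definition prod_space :: "('a, 'm) cns_scheme \<Rightarrow> ('b, 'n) cns_scheme \<Rightarrow> ('a \<times> 'b) cns" where
  "prod_space V W =
     \<lparr>carrier = carrier V \<times> carrier W,
      vadd = (\<lambda>x y. (vadd V (fst x) (fst y), vadd W (snd x) (snd y))),
      vzero = (vzero V, vzero W),
      vscale = (\<lambda>c x. (vscale V c (fst x), vscale W c (snd x))),
      vnorm = (\<lambda>x. max (vnorm V (fst x)) (vnorm W (snd x)))\<rparr>"

lemma prod_space_simps [simp]:
  "carrier (prod_space V W) = carrier V \<times> carrier W"
  "vadd (prod_space V W) = (\<lambda>x y. (vadd V (fst x) (fst y), vadd W (snd x) (snd y)))"
  "vzero (prod_space V W) = (vzero V, vzero W)"
  "vscale (prod_space V W) = (\<lambda>c x. (vscale V c (fst x), vscale W c (snd x)))"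
  "vnorm (prod_space V W) = (\<lambda>x. max (vnorm V (fst x)) (vnorm W (snd x)))"
  by (simp_all add: prod_space_def)

lemma vdiff_prod_space: "vdiff (prod_space V W) x y = (vdiff V (fst x) (fst y), vdiff W (snd x) (snd y))"
  by (simp add: vdiff_def)

lemma (in two_normed_spaces) prod_space_normed: "complex_normed_space (prod_space V W)"
proof -
  have m: "max (c * a) (c * b) = c * max a b" if "0 \<le> c" for a b c :: real
    using that by (simp add: max_mult_distrib_left)
  show ?thesis
  proof unfold_locales
    fix x y assume x: "x \<in> carrier (prod_space V W)"
    show "(vnorm (prod_space V W) x = 0) = (x = vzero (prod_space V W))"
      using x V.norm_nonneg[of "fst x"] W.norm_nonneg[of "snd x"] V.norm_eq_zero[of "fst x"]
        W.norm_eq_zero[of "snd x"] by (auto simp: max_def V.norm_vzero W.norm_vzero split: if_splits)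
    assume y: "y \<in> carrier (prod_space V W)"
    show "vnorm (prod_space V W) (vadd (prod_space V W) x y)
        \<le> vnorm (prod_space V W) x + vnorm (prod_space V W) y"
      using x y V.norm_triangle[of "fst x" "fst y"] W.norm_triangle[of "snd x" "snd y"] by auto
  qed (auto simp: V.zero_closed W.zero_closed V.add_closed W.add_closed V.scale_closed W.scale_closed
      V.add_assoc W.add_assoc V.add_commute W.add_commute V.add_left_commute W.add_left_commute V.add_zero W.add_zero V.add_uminus W.add_uminus
      V.scale_one W.scale_one V.scale_scale W.scale_scale V.scale_add_left W.scale_add_left
      V.scale_add_right W.scale_add_right V.norm_nonneg W.norm_nonneg V.norm_scale W.norm_scale m
      le_max_iff_disj)
qed

subsection \<open>Banach pairs of operators\<close>

abbreviation closed_op_algebra :: "'v cns \<Rightarrow> ('v \<Rightarrow> 'v) set \<Rightarrow> ('v \<Rightarrow> 'v) cna" where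
  "closed_op_algebra V B0 \<equiv> (op_algebra V)\<lparr>carrier := closure_in (op_algebra V) B0\<rparr>"

definition op_pair ::
  "'v cns \<Rightarrow> 'w cns \<Rightarrow> ('w \<Rightarrow> 'v) set \<Rightarrow> ('v \<Rightarrow> 'w) set
    \<Rightarrow> ('v \<Rightarrow> 'v, 'w \<Rightarrow> 'v, 'v \<Rightarrow> 'w) pair_data" where
  "op_pair V W X0 Y0 =
     \<lparr>lspace = (op_space W V)\<lparr>carrier := closure_in (op_space W V) X0\<rparr>,
      rspace = (op_space V W)\<lparr>carrier := closure_in (op_space V W) Y0\<rparr>,
      left_mul = compose (carrier W), right_mul = compose (carrier V), pairing = compose (carrier V)\<rparr>"

lemma op_pair_simps [simp]:
  "lspace (op_pair V W X0 Y0) = (op_space W V)\<lparr>carrier := closure_in (op_space W V) X0\<rparr>"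
  "rspace (op_pair V W X0 Y0) = (op_space V W)\<lparr>carrier := closure_in (op_space V W) Y0\<rparr>"
  "left_mul (op_pair V W X0 Y0) = compose (carrier W)"
  "right_mul (op_pair V W X0 Y0) = compose (carrier V)"
  "pairing (op_pair V W X0 Y0) = compose (carrier V)"
  by (simp_all add: op_pair_def)

lemma closure_in_subset: "closure_in V S \<subseteq> carrier V"
  by (auto simp: closure_in_def)

lemma closed_op_algebra_banach:
  assumes V: "complex_banach_space V" and sub: "subspace_of (op_space V V) B0"
    and mult: "\<And>a b. \<lbrakk>a \<in> B0; b \<in> B0\<rbrakk> \<Longrightarrow> compose (carrier V) a b \<in> B0"
  shows "complex_banach_algebra (closed_op_algebra V B0)"
proof -
  interpret V: complex_banach_space V by fact
  note n = V.complex_normed_space_axioms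
  interpret VV: two_normed_spaces V V using n by (simp add: two_normed_spaces_def)
  interpret A: complex_banach_space "closed_op_algebra V B0"
    by (rule complex_banach_closure[OF complex_banach_op_algebra[OF V]]) (simp add: sub)
  have B0: "B0 \<subseteq> carrier (op_space V V)" using sub by (simp only: subspace_of_def)
  have B0c: "B0 \<subseteq> closure_in (op_space V V) B0" by (rule closure_in_superset[OF VV.op_space_normed B0])
  have car: "a \<in> carrier (op_space V V)" if "a \<in> carrier (closed_op_algebra V B0)" for a
    using that closure_in_subset[of "op_space V V"] by auto
  have cl: "compose (carrier V) a b \<in> closure_in (op_space V V) B0"
    if "a \<in> carrier (closed_op_algebra V B0)" "b \<in> carrier (closed_op_algebra V B0)" for a b
    by (rule compose_closure[OF n n n B0 B0 B0]) (use mult B0c that in auto)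
  show ?thesis
  proof unfold_locales
    show "bilinear_map (closed_op_algebra V B0) (closed_op_algebra V B0) (closed_op_algebra V B0)
        (amult (closed_op_algebra V B0))"
      unfolding bilinear_map_def linear_map_def
      using cl car
      by (auto simp: compose_linear_left compose_linear_right compose_vscale_right V.complex_vspace_axioms
          simp del: op_space_simps)
  next
    fix a b c assume abc: "a \<in> carrier (closed_op_algebra V B0)" "b \<in> carrier (closed_op_algebra V B0)"
      "c \<in> carrier (closed_op_algebra V B0)"
    show "amult (closed_op_algebra V B0) (amult (closed_op_algebra V B0) a b) c =
        amult (closed_op_algebra V B0) a (amult (closed_op_algebra V B0) b c)"
      using compose_op_assoc[OF car[OF abc(3)]] by simp
    show "vnorm (closed_op_algebra V B0) (amult (closed_op_algebra V B0) a b)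
        \<le> vnorm (closed_op_algebra V B0) a * vnorm (closed_op_algebra V B0) b"
      using compose_op_space(2)[OF n n n car[OF abc(2)] car[OF abc(1)]] by simp
  qed
qed

text \<open>The data of a Banach pair on dense generators: all closure conditions are imposed on generating
  subspaces \<open>B0\<close>, \<open>X0\<close>, \<open>Y0\<close> of operators and pass to the closures by \<open>compose_closure\<close>.\<close>

locale operator_triple =
  V: complex_banach_space V + W: complex_banach_space W
  for V :: "'v cns" and W :: "'w cns" +
  fixes B0 :: "('v \<Rightarrow> 'v) set" and X0 :: "('w \<Rightarrow> 'v) set" and Y0 :: "('v \<Rightarrow> 'w) set"
  assumes B0_sub: "subspace_of (op_space V V) B0" and X0_sub: "subspace_of (op_space W V) X0"
    and Y0_sub: "subspace_of (op_space V W) Y0"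
    and BB: "\<lbrakk>a \<in> B0; b \<in> B0\<rbrakk> \<Longrightarrow> compose (carrier V) a b \<in> B0"
    and BX: "\<lbrakk>b \<in> B0; S \<in> X0\<rbrakk> \<Longrightarrow> compose (carrier W) b S \<in> X0"
    and YB: "\<lbrakk>T \<in> Y0; b \<in> B0\<rbrakk> \<Longrightarrow> compose (carrier V) T b \<in> Y0"
    and XY: "\<lbrakk>S \<in> X0; T \<in> Y0\<rbrakk> \<Longrightarrow> compose (carrier V) S T \<in> B0"
begin

abbreviation "BB \<equiv> closed_op_algebra V B0"
abbreviation "PP \<equiv> op_pair V W X0 Y0"
abbreviation "B1 \<equiv> closure_in (op_space V V) B0"
abbreviation "X1 \<equiv> closure_in (op_space W V) X0"
abbreviation "Y1 \<equiv> closure_in (op_space V W) Y0"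

lemmas nV = V.complex_normed_space_axioms and nW = W.complex_normed_space_axioms
sublocale VV: two_normed_spaces V V using nV by (simp add: two_normed_spaces_def)
sublocale WW: two_normed_spaces W W using nW by (simp add: two_normed_spaces_def)
sublocale VW: two_normed_spaces V W using nV nW by (simp add: two_normed_spaces_def)
sublocale WV: two_normed_spaces W V using nV nW by (simp add: two_normed_spaces_def)

lemma B0c: "B0 \<subseteq> carrier (op_space V V)" "B0 \<subseteq> B1"
  using B0_sub closure_in_superset[OF VV.op_space_normed, of B0] by (auto simp only: subspace_of_def)
lemma X0c: "X0 \<subseteq> carrier (op_space W V)" "X0 \<subseteq> X1"
  using X0_sub closure_in_superset[OF WV.op_space_normed, of X0] by (auto simp only: subspace_of_def)
lemma Y0c: "Y0 \<subseteq> carrier (op_space V W)" "Y0 \<subseteq> Y1"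
  using Y0_sub closure_in_superset[OF VW.op_space_normed, of Y0] by (auto simp only: subspace_of_def)

lemma B1c: "b \<in> B1 \<Longrightarrow> b \<in> carrier (op_space V V)"
  and X1c: "S \<in> X1 \<Longrightarrow> S \<in> carrier (op_space W V)"
  and Y1c: "T \<in> Y1 \<Longrightarrow> T \<in> carrier (op_space V W)"
  by (auto simp only: closure_in_def)

lemma BX1: "\<lbrakk>b \<in> B1; S \<in> X1\<rbrakk> \<Longrightarrow> compose (carrier W) b S \<in> X1"
  using compose_closure[OF nW nV nV B0c(1) X0c(1) X0c(1)] BX X0c(2) by blast
lemma YB1: "\<lbrakk>T \<in> Y1; b \<in> B1\<rbrakk> \<Longrightarrow> compose (carrier V) T b \<in> Y1"
  using compose_closure[OF nV nV nW Y0c(1) B0c(1) Y0c(1)] YB Y0c(2) by blast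
lemma XY1: "\<lbrakk>S \<in> X1; T \<in> Y1\<rbrakk> \<Longrightarrow> compose (carrier V) S T \<in> B1"
  using compose_closure[OF nV nW nV X0c(1) Y0c(1) B0c(1)] XY B0c(2) by blast

lemma banach_pair: "banach_pair BB PP"
proof -
  interpret B: complex_banach_algebra BB
    by (rule closed_op_algebra_banach[OF V.complex_banach_space_axioms B0_sub BB])
  have X: "complex_banach_space (lspace PP)"
    using complex_banach_closure[OF op_space_banach[OF nW V.complex_banach_space_axioms] X0_sub] by simp
  have Y: "complex_banach_space (rspace PP)"
    using complex_banach_closure[OF op_space_banach[OF nV W.complex_banach_space_axioms] Y0_sub] by simp
  note lin = compose_linear_left compose_linear_right compose_vscale_right V.complex_vspace_axioms W.complex_vspace_axioms
  show ?thesis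
  proof (intro banach_pair.intro B.complex_banach_algebra_axioms X Y banach_pair_axioms.intro)
    show "bilinear_map BB (lspace PP) (lspace PP) (left_mul PP)"
      "bilinear_map (rspace PP) BB (rspace PP) (right_mul PP)"
      "bilinear_map (lspace PP) (rspace PP) BB (pairing PP)"
      unfolding bilinear_map_def linear_map_def
      by (auto simp: lin BX1 YB1 XY1 B1c X1c Y1c simp del: op_space_simps)
  next
    fix a b S T
    assume a: "a \<in> carrier BB" and b: "b \<in> carrier BB"
    then have b1: "b \<in> carrier (op_space V V)" by (simp add: B1c del: op_space_simps)
    show "vnorm (lspace PP) (left_mul PP b S) \<le> vnorm BB b * vnorm (lspace PP) S"
      if "S \<in> carrier (lspace PP)" for S
      using compose_op_space(2)[OF nW nV nV X1c b1, of S] that by simp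
    show "vnorm (rspace PP) (right_mul PP T b) \<le> vnorm (rspace PP) T * vnorm BB b"
      if "T \<in> carrier (rspace PP)" for T
      using compose_op_space(2)[OF nV nV nW b1 Y1c, of T] that by simp
    show "left_mul PP (amult BB a b) S = left_mul PP a (left_mul PP b S)" if "S \<in> carrier (lspace PP)" for S
      using compose_op_assoc[OF X1c, of S] that by simp
    show "right_mul PP T (amult BB a b) = right_mul PP (right_mul PP T a) b" for T
      using compose_op_assoc[OF b1, of T a] by simp
    show "pairing PP (left_mul PP b S) T = amult BB b (pairing PP S T)"
      if "T \<in> carrier (rspace PP)" for S T
      using compose_op_assoc[OF Y1c, of T] that by simp
    show "pairing PP S (right_mul PP T b) = amult BB (pairing PP S T) b" for S T
      using compose_op_assoc[OF b1, of S T] by simp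
  next
    fix S T assume "S \<in> carrier (lspace PP)" "T \<in> carrier (rspace PP)"
    then show "vnorm BB (pairing PP S T) \<le> vnorm (lspace PP) S * vnorm (rspace PP) T"
      using compose_op_space(2)[OF nV nW nV Y1c X1c, of T S] by simp
  qed
qed

end

subsection \<open>Extending a contractive assignment of operators\<close>

lemma bounded_linear_eq_on_closure:
  assumes "complex_normed_space V" "complex_normed_space W"
    and S: "bounded_linear_map V W S" and T: "bounded_linear_map V W T"
    and D: "D \<subseteq> carrier V" and eq: "\<And>x. x \<in> D \<Longrightarrow> S x = T x" and x: "x \<in> closure_in V D"
  shows "S x = T x"
proof -
  interpret two_normed_spaces V W using assms(1,2) by (simp add: two_normed_spaces_def)
  have xc: "x \<in> carrier V" using x by (simp add: closure_in_def)
  note cS = bounded_linear_mapD(1)[OF S] and cT = bounded_linear_mapD(1)[OF T]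
  have lS: "linear_map V W S" and lT: "linear_map V W T" using S T by (auto simp: bounded_linear_map_def)
  define M where "M = opnorm V W S + opnorm V W T"
  have M: "0 \<le> M" using opnorm_nonneg[OF S] opnorm_nonneg[OF T] by (simp add: M_def)
  show ?thesis
  proof (rule W.vdiff_norm_eqI[OF cS[OF xc] cT[OF xc]])
    fix e :: real assume e: "0 < e"
    obtain y where y: "y \<in> D" "vnorm V (vdiff V x y) < e / (M + 1)"
      using x e M unfolding closure_in_def by (auto dest: spec[of _ "e / (M + 1)"])
    have yc: "y \<in> carrier V" using y D by auto
    have d: "vdiff V x y \<in> carrier V" by (rule V.vdiff_closed[OF xc yc])
    have "vnorm W (vdiff W (S x) (T x)) \<le> vnorm W (vdiff W (S x) (S y)) + vnorm W (vdiff W (T y) (T x))"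
      using W.norm_vdiff_triangle[OF cS[OF xc] cS[OF yc] cT[OF xc]] eq[OF y(1)] by simp
    also have "\<dots> = vnorm W (S (vdiff V x y)) + vnorm W (T (vdiff V x y))"
      using linear_map_vdiff[OF V.complex_vspace_axioms lS xc yc] linear_map_vdiff[OF V.complex_vspace_axioms lT xc yc]
        W.norm_vdiff_commute[OF cT[OF xc] cT[OF yc]] by simp
    also have "\<dots> \<le> M * vnorm V (vdiff V x y)"
      using opnorm_apply[OF S d] opnorm_apply[OF T d] by (simp add: M_def algebra_simps)
    also have "\<dots> \<le> M * (e / (M + 1))" using y(2) M by (intro mult_left_mono) auto
    also have "\<dots> \<le> e" using M e by (simp add: field_simps)
    finally show "vnorm W (vdiff W (S x) (T x)) \<le> e" .
  qed
qed

text \<open>The left action is prescribed by a relation between the generators of the acting algebra and the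
  operators on \<open>W\<close> by which they should multiply. A relation, rather than a function, is convenient because
  several compactly supported functions could a priori represent the same generator; contractivity
  \<open>R_contr\<close> makes the relation single valued and lets its closure be the graph of the extended action.\<close>

locale operator_correspondence = operator_triple V W B0 X0 Y0 + U: complex_banach_space U
  for V :: "'v cns" and W :: "'w cns" and B0 X0 Y0 and U :: "'u cns" +
  fixes R :: "(('u \<Rightarrow> 'u) \<times> ('w \<Rightarrow> 'w)) set"
  assumes R_sub: "subspace_of (prod_space (op_space U U) (op_space W W)) R"
    and R_mult: "\<lbrakk>(a, l) \<in> R; (b, m) \<in> R\<rbrakk> \<Longrightarrow> (compose (carrier U) a b, compose (carrier W) l m) \<in> R"
    and R_contr: "(a, l) \<in> R \<Longrightarrow> opnorm W W l \<le> opnorm U U a"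
    and R_X: "\<lbrakk>(a, l) \<in> R; S \<in> X0\<rbrakk> \<Longrightarrow> compose (carrier W) S l \<in> X0"
    and R_Y: "\<lbrakk>(a, l) \<in> R; T \<in> Y0\<rbrakk> \<Longrightarrow> compose (carrier V) l T \<in> Y0"
begin

lemmas nU = U.complex_normed_space_axioms
sublocale UU: two_normed_spaces U U using nU by (simp add: two_normed_spaces_def)
sublocale L: complex_normed_space "op_space W W" by (rule WW.op_space_normed)
sublocale A: complex_normed_space "op_space U U" by (rule UU.op_space_normed)
sublocale AL: two_normed_spaces "op_space U U" "op_space W W"
  by (simp add: two_normed_spaces_def A.complex_normed_space_axioms L.complex_normed_space_axioms)
sublocale Q: complex_normed_space "prod_space (op_space U U) (op_space W W)"
  by (rule AL.prod_space_normed)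

abbreviation "QQ \<equiv> prod_space (op_space U U) (op_space W W)"
abbreviation "R1 \<equiv> closure_in QQ R"
abbreviation "AA \<equiv> closed_op_algebra U (fst ` R)"
abbreviation "A1 \<equiv> closure_in (op_space U U) (fst ` R)"

lemma Rc: "R \<subseteq> carrier QQ" "R \<subseteq> R1"
  using R_sub closure_in_superset[OF Q.complex_normed_space_axioms, of R]
  by (auto simp only: subspace_of_def)

lemma RcD: "(a, l) \<in> R \<Longrightarrow> a \<in> carrier (op_space U U)" "(a, l) \<in> R \<Longrightarrow> l \<in> carrier (op_space W W)"
  using Rc(1) by (auto simp del: op_space_simps)

lemma R1_sub: "subspace_of QQ R1"
  by (rule Q.subspace_of_closure_in[OF R_sub])

lemma R1c: "(a, l) \<in> R1 \<Longrightarrow> a \<in> carrier (op_space U U)" "(a, l) \<in> R1 \<Longrightarrow> l \<in> carrier (op_space W W)"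
  by (auto simp: closure_in_def simp del: op_space_simps)

lemma R1_approx:
  assumes "(a, l) \<in> R1" "0 < e"
  obtains b m where "(b, m) \<in> R" "vnorm (op_space U U) (vdiff (op_space U U) a b) < e"
    "vnorm (op_space W W) (vdiff (op_space W W) l m) < e"
proof -
  obtain y where "y \<in> R" "vnorm QQ (vdiff QQ (a, l) y) < e"
    using assms unfolding closure_in_def by blast
  then show ?thesis using that[of "fst y" "snd y"] by (simp add: vdiff_prod_space del: op_space_simps)
qed

lemma R1_contr:
  assumes r: "(a, l) \<in> R1"
  shows "opnorm W W l \<le> opnorm U U a"
proof (rule field_le_epsilon)
  fix e :: real assume e: "0 < e"
  obtain b m where b: "(b, m) \<in> R" "vnorm (op_space U U) (vdiff (op_space U U) a b) < e / 2"
    "vnorm (op_space W W) (vdiff (op_space W W) l m) < e / 2"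
    using R1_approx[OF r, of "e / 2"] e by auto
  note c = R1c[OF r] RcD[OF b(1)]
  show "opnorm W W l \<le> opnorm U U a + e"
    using L.norm_le_vdiff[OF c(2,4)] A.norm_le_vdiff[OF c(3,1)] A.norm_vdiff_commute[OF c(1,3)]
      R_contr[OF b(1)] b(2,3) by simp
qed

text \<open>A difference of two values is related to zero, hence has norm zero.\<close>

lemma R1_fun:
  assumes "(a, l) \<in> R1" "(a, m) \<in> R1"
  shows "l = m"
proof (rule L.vdiff_norm_0[OF R1c(2)[OF assms(1)] R1c(2)[OF assms(2)]])
  have "(vdiff (op_space U U) a a, vdiff (op_space W W) l m) \<in> R1"
    using subspace_ofD(5)[OF R1_sub assms] by (simp add: vdiff_prod_space)
  from R1_contr[OF this] show "vnorm (op_space W W) (vdiff (op_space W W) l m) \<le> 0"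
    using A.norm_vzero unfolding A.vdiff_self[OF R1c(1)[OF assms(1)]] by simp
qed

lemma A0c: "fst ` R \<subseteq> carrier (op_space U U)" "fst ` R \<subseteq> A1"
proof -
  show 1: "fst ` R \<subseteq> carrier (op_space U U)" using RcD(1) by fastforce
  show "fst ` R \<subseteq> A1" by (rule closure_in_superset[OF A.complex_normed_space_axioms 1])
qed

lemma L0c: "snd ` R \<subseteq> carrier (op_space W W)"
  "snd ` R \<subseteq> closure_in (op_space W W) (snd ` R)"
proof -
  show 1: "snd ` R \<subseteq> carrier (op_space W W)" using RcD(2) by fastforce
  show "snd ` R \<subseteq> closure_in (op_space W W) (snd ` R)"
    by (rule closure_in_superset[OF L.complex_normed_space_axioms 1])
qed

lemma R1_snd: "(a, l) \<in> R1 \<Longrightarrow> l \<in> closure_in (op_space W W) (snd ` R)"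
proof -
  assume r: "(a, l) \<in> R1"
  have "snd (a, l) \<in> closure_in (op_space W W) (snd ` R)"
  proof (rule closure_in_map[where f = snd and C = 1, OF Q.complex_normed_space_axioms
        L.complex_normed_space_axioms _ Rc(1) L0c(1) _ _ r])
    show "snd y \<in> closure_in (op_space W W) (snd ` R)" if "y \<in> R" for y
      using L0c(2) that by blast
  qed (auto simp: vdiff_prod_space)
  then show ?thesis by simp
qed

text \<open>Approximants of \<open>a\<close> in the domain form a Cauchy sequence; by contractivity so do their partners, which
  converge because \<open>W\<close> is complete.\<close>

lemma R1_dom:
  assumes a: "a \<in> A1"
  shows "\<exists>l. (a, l) \<in> R1"
proof -
  interpret LB: complex_banach_space "op_space W W"
    by (rule op_space_banach[OF nW W.complex_banach_space_axioms])
  have ac: "a \<in> carrier (op_space U U)" using a by (simp add: closure_in_def del: op_space_simps)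
  have "\<exists>b m. (b, m) \<in> R \<and> vnorm (op_space U U) (vdiff (op_space U U) a b) < 1 / real (Suc n)" for n
    using a unfolding closure_in_def by (auto dest!: spec[of _ "1 / real (Suc n)"])
  then obtain b m where bm: "\<And>n. (b n, m n) \<in> R"
    and b: "\<And>n. vnorm (op_space U U) (vdiff (op_space U U) a (b n)) < 1 / real (Suc n)" by metis
  have d: "vnorm (op_space W W) (vdiff (op_space W W) (m i) (m j)) < 1 / real (Suc i) + 1 / real (Suc j)" for i j
  proof -
    have "(vdiff (op_space U U) (b i) (b j), vdiff (op_space W W) (m i) (m j)) \<in> R"
      using subspace_ofD(5)[OF R_sub bm bm, of i j] by (simp add: vdiff_prod_space)
    then have "vnorm (op_space W W) (vdiff (op_space W W) (m i) (m j)) \<le> vnorm (op_space U U) (vdiff (op_space U U) (b i) (b j))"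
      using R_contr by simp
    then show ?thesis
      using A.norm_vdiff_triangle[OF RcD(1)[OF bm] ac RcD(1)[OF bm], of i j]
        A.norm_vdiff_commute[OF ac RcD(1)[OF bm], of i] b[of i] b[of j] by linarith
  qed
  have small: "\<exists>N. \<forall>n\<ge>N. 1 / real (Suc n) < e" if e: "0 < e" for e :: real
  proof -
    obtain N where N: "1 / real (Suc N) < e" using nat_approx_posE[OF e] by blast
    have "1 / real (Suc n) < e" if "n \<ge> N" for n
    proof -
      have "1 / real (Suc n) \<le> 1 / real (Suc N)" using that by (intro frac_le) auto
      then show ?thesis using N by linarith
    qed
    then show ?thesis by blast
  qed
  have "\<exists>l\<in>carrier (op_space W W). (\<lambda>n. vnorm (op_space W W) (vdiff (op_space W W) (m n) l)) \<longlonglongrightarrow> 0"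
  proof (rule LB.complete)
    show "range m \<subseteq> carrier (op_space W W)" using RcD(2)[OF bm] by auto
    show "\<forall>e>0. \<exists>N. \<forall>i\<ge>N. \<forall>j\<ge>N. vnorm (op_space W W) (vdiff (op_space W W) (m i) (m j)) < e"
    proof (intro allI impI)
      fix e :: real assume "0 < e"
      then obtain N where N: "\<forall>n\<ge>N. 1 / real (Suc n) < e / 2" using small[of "e / 2"] by auto
      have "vnorm (op_space W W) (vdiff (op_space W W) (m i) (m j)) < e" if "i \<ge> N" "j \<ge> N" for i j
        using d[of i j] N[rule_format, OF that(1)] N[rule_format, OF that(2)] by linarith
      then show "\<exists>N. \<forall>i\<ge>N. \<forall>j\<ge>N. vnorm (op_space W W) (vdiff (op_space W W) (m i) (m j)) < e" by blast
    qed
  qed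
  then obtain l where l: "l \<in> carrier (op_space W W)"
    "(\<lambda>n. vnorm (op_space W W) (vdiff (op_space W W) (m n) l)) \<longlonglongrightarrow> 0" by blast
  have "\<exists>y\<in>R. vnorm QQ (vdiff QQ (a, l) y) < e" if e: "0 < e" for e
  proof -
    obtain N where N: "\<forall>n\<ge>N. 1 / real (Suc n) < e" using small e by blast
    have "\<forall>\<^sub>F n in sequentially. vnorm (op_space W W) (vdiff (op_space W W) (m n) l) < e"
      using l(2) e by (rule order_tendstoD)
    then obtain M where M: "\<forall>n\<ge>M. vnorm (op_space W W) (vdiff (op_space W W) (m n) l) < e"
      by (auto simp: eventually_sequentially)
    define n where "n = max N M"
    have "vnorm (op_space U U) (vdiff (op_space U U) a (b n)) < e"
      using b[of n] N[rule_format, of n] by (simp add: n_def)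
    moreover have "vnorm (op_space W W) (vdiff (op_space W W) l (m n)) < e"
      using M[rule_format, of n] L.norm_vdiff_commute[OF l(1) RcD(2)[OF bm], of n] by (simp add: n_def)
    ultimately show ?thesis using bm[of n]
      by (intro bexI[of _ "(b n, m n)"]) (auto simp: vdiff_prod_space)
  qed
  then have "(a, l) \<in> R1" using ac l(1) by (auto simp: closure_in_def)
  then show ?thesis by blast
qed

lemma R1_mult:
  assumes r: "(a, l) \<in> R1" and s: "(b, m) \<in> R1"
  shows "(compose (carrier U) a b, compose (carrier W) l m) \<in> R1"
proof -
  let ?c = "\<lambda>x y. (compose (carrier U) (fst x) (fst y), compose (carrier W) (snd x) (snd y))"
  have cl: "?c x y \<in> carrier QQ" and nm: "vnorm QQ (?c x y) \<le> vnorm QQ x * vnorm QQ y"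
    if x: "x \<in> carrier QQ" and y: "y \<in> carrier QQ" for x y
  proof -
    have x': "fst x \<in> carrier (op_space U U)" "snd x \<in> carrier (op_space W W)"
      and y': "fst y \<in> carrier (op_space U U)" "snd y \<in> carrier (op_space W W)" using x y by auto
    note a = compose_op_space[OF nU nU nU y'(1) x'(1)] and b = compose_op_space[OF nW nW nW y'(2) x'(2)]
    show "?c x y \<in> carrier QQ" using a b by auto
    have "0 \<le> opnorm U U (fst x)" "0 \<le> opnorm W W (snd x)" "0 \<le> opnorm U U (fst y)" "0 \<le> opnorm W W (snd y)"
      using A.norm_nonneg[OF x'(1)] L.norm_nonneg[OF x'(2)] A.norm_nonneg[OF y'(1)] L.norm_nonneg[OF y'(2)] by auto
    then have "opnorm U U (fst x) * opnorm U U (fst y) \<le> vnorm QQ x * vnorm QQ y"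
        "opnorm W W (snd x) * opnorm W W (snd y) \<le> vnorm QQ x * vnorm QQ y"
      by (auto intro!: mult_mono simp: le_max_iff_disj)
    then show "vnorm QQ (?c x y) \<le> vnorm QQ x * vnorm QQ y" using a(2) b(2) by simp
  qed
  have dl: "vdiff QQ (?c x z) (?c y z) = ?c (vdiff QQ x y) z" if "z \<in> carrier QQ" for x y z
    using that by (simp add: vdiff_prod_space mem_Times_iff compose_linear_left del: op_space_simps)
  have dr: "vdiff QQ (?c z x) (?c z y) = ?c z (vdiff QQ x y)"
    if "x \<in> carrier QQ" "y \<in> carrier QQ" "z \<in> carrier QQ" for x y z
    using that
    by (simp add: vdiff_prod_space mem_Times_iff
        compose_linear_right(2)[where V = U and W = U, OF _ _ _ U.complex_vspace_axioms]
        compose_linear_right(2)[where V = W and W = W, OF _ _ _ W.complex_vspace_axioms]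
        del: op_space_simps)
  note nQ = Q.complex_normed_space_axioms
  have 1: "?c (a, l) y \<in> R1" if y: "y \<in> R" for y
  proof (rule closure_in_map[where f = "\<lambda>x. ?c x y" and C = "vnorm QQ y", OF nQ nQ _ Rc(1) Rc(1) _ _ r])
    have yc: "y \<in> carrier QQ" using y Rc(1) by blast
    show "(\<lambda>x. ?c x y) \<in> carrier QQ \<rightarrow> carrier QQ" using cl yc by blast
    show "?c z y \<in> R1" if "z \<in> R" for z
      using R_mult[of "fst z" "snd z" "fst y" "snd y"] y that Rc(2) by auto
    fix x z assume x: "x \<in> carrier QQ" and "z \<in> R"
    then have z: "z \<in> carrier QQ" using Rc(1) by blast
    show "vnorm QQ (vdiff QQ (?c x y) (?c z y)) \<le> vnorm QQ y * vnorm QQ (vdiff QQ x z)"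
      unfolding dl[OF yc] using nm[OF Q.vdiff_closed[OF x z] yc] by (simp only: mult.commute)
  qed
  have rc: "(a, l) \<in> carrier QQ" using R1c[OF r] by simp
  have "?c (a, l) (b, m) \<in> R1"
  proof (rule closure_in_map[where f = "?c (a, l)" and C = "vnorm QQ (a, l)", OF nQ nQ _ Rc(1) Rc(1) _ 1 s])
    show "?c (a, l) \<in> carrier QQ \<rightarrow> carrier QQ" using cl rc by blast
    fix x z assume x: "x \<in> carrier QQ" and "z \<in> R"
    then have z: "z \<in> carrier QQ" using Rc(1) by blast
    show "vnorm QQ (vdiff QQ (?c (a, l) x) (?c (a, l) z)) \<le> vnorm QQ (a, l) * vnorm QQ (vdiff QQ x z)"
      unfolding dr[OF x z rc] by (rule nm[OF rc Q.vdiff_closed[OF x z]])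
  qed
  then show ?thesis by simp
qed

lemma R1_X:
  assumes r: "(a, l) \<in> R1" and S: "S \<in> X1"
  shows "compose (carrier W) S l \<in> X1"
proof (rule compose_closure[OF nW nW nV X0c(1) L0c(1) X0c(1) _ S R1_snd[OF r]])
  fix S m assume "S \<in> X0" "m \<in> snd ` R"
  then show "compose (carrier W) S m \<in> X1" using R_X X0c(2) by (metis imageE prod.collapse subsetD)
qed

lemma R1_Y:
  assumes r: "(a, l) \<in> R1" and T: "T \<in> Y1"
  shows "compose (carrier V) l T \<in> Y1"
proof (rule compose_closure[OF nV nW nW L0c(1) Y0c(1) Y0c(1) _ R1_snd[OF r] T])
  fix T m assume "T \<in> Y0" "m \<in> snd ` R"
  then show "compose (carrier V) m T \<in> Y1" using R_Y Y0c(2) by (metis imageE prod.collapse subsetD)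
qed

definition ext_op :: "('u \<Rightarrow> 'u) \<Rightarrow> ('w \<Rightarrow> 'w)" where
  "ext_op a = (THE l. (a, l) \<in> R1)"

lemma ext_op_eq: "(a, l) \<in> R1 \<Longrightarrow> ext_op a = l"
  unfolding ext_op_def using R1_fun by blast

lemma ext_op_R1: "a \<in> A1 \<Longrightarrow> (a, ext_op a) \<in> R1"
  using R1_dom ext_op_eq by metis

definition mult_pair :: "('w \<Rightarrow> 'w) \<Rightarrow> (('w \<Rightarrow> 'v) \<Rightarrow> ('w \<Rightarrow> 'v)) \<times> (('v \<Rightarrow> 'w) \<Rightarrow> ('v \<Rightarrow> 'w))" where
  "mult_pair l = (\<lambda>S\<in>X1. compose (carrier W) S l, \<lambda>T\<in>Y1. compose (carrier V) l T)"

text \<open>The operators whose multiplication maps the closed spaces into themselves; among them are the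
  members of the range of the closed relation and the products \<open>T S\<close>.\<close>

definition preserves :: "('w \<Rightarrow> 'w) \<Rightarrow> bool" where
  "preserves l \<longleftrightarrow> l \<in> carrier (op_space W W) \<and> (\<forall>S\<in>X1. compose (carrier W) S l \<in> X1) \<and>
     (\<forall>T\<in>Y1. compose (carrier V) l T \<in> Y1)"

lemma preservesD:
  assumes "preserves l"
  shows "l \<in> carrier (op_space W W)" "S \<in> X1 \<Longrightarrow> compose (carrier W) S l \<in> X1" "T \<in> Y1 \<Longrightarrow> compose (carrier V) l T \<in> Y1"
  using assms by (auto simp only: preserves_def)

lemma R1_preserves: "(a, l) \<in> R1 \<Longrightarrow> preserves l"
  using R1c(2) R1_X R1_Y unfolding preserves_def by blast

definition action :: "('u \<Rightarrow> 'u) \<Rightarrow> (('w \<Rightarrow> 'v) \<Rightarrow> ('w \<Rightarrow> 'v)) \<times> (('v \<Rightarrow> 'w) \<Rightarrow> ('v \<Rightarrow> 'w))" where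
  "action = (\<lambda>a\<in>A1. mult_pair (ext_op a))"

lemma action_R: "(a, l) \<in> R \<Longrightarrow> action a = mult_pair l"
  using Rc(2) A0c(2) ext_op_eq[of a l] by (auto simp: action_def image_subset_iff)

lemma mult_pair_apply:
  "S \<in> X1 \<Longrightarrow> fst (mult_pair l) S = compose (carrier W) S l"
  "T \<in> Y1 \<Longrightarrow> snd (mult_pair l) T = compose (carrier V) l T"
  by (simp_all add: mult_pair_def)

end

context operator_correspondence begin

abbreviation "LL \<equiv> adjointable_algebra BB PP"

sublocale X: complex_normed_space "lspace PP"
  using complex_normed_subspace[OF WV.op_space_normed WV.op_space_normed[THEN complex_normed_space.subspace_of_closure_in, OF X0_sub]]
  by simp
sublocale Y: complex_normed_space "rspace PP"
  using complex_normed_subspace[OF VW.op_space_normed VW.op_space_normed[THEN complex_normed_space.subspace_of_closure_in, OF Y0_sub]]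
  by simp
sublocale XX: two_normed_spaces "lspace PP" "lspace PP"
  by (simp only: two_normed_spaces_def X.complex_normed_space_axioms simp_thms)
sublocale YY: two_normed_spaces "rspace PP" "rspace PP"
  by (simp only: two_normed_spaces_def Y.complex_normed_space_axioms simp_thms)

lemma adjointable_simps:
  "carrier LL = {(Tl, Tr). Tl \<in> carrier (op_space (lspace PP) (lspace PP)) \<and> Tr \<in> carrier (op_space (rspace PP) (rspace PP)) \<and>
     (\<forall>b\<in>B1. \<forall>x\<in>X1. Tl (compose (carrier W) b x) = compose (carrier W) b (Tl x)) \<and>
     (\<forall>b\<in>B1. \<forall>y\<in>Y1. Tr (compose (carrier V) y b) = compose (carrier V) (Tr y) b) \<and>
     (\<forall>x\<in>X1. \<forall>y\<in>Y1. compose (carrier V) (Tl x) y = compose (carrier V) x (Tr y))}"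
  "vadd LL = (\<lambda>S T. (\<lambda>x\<in>X1. vadd (op_space W V) (fst S x) (fst T x), \<lambda>y\<in>Y1. vadd (op_space V W) (snd S y) (snd T y)))"
  "vscale LL = (\<lambda>c T. (\<lambda>x\<in>X1. vscale (op_space W V) c (fst T x), \<lambda>y\<in>Y1. vscale (op_space V W) c (snd T y)))"
  "vnorm LL = (\<lambda>T. max (opnorm (lspace PP) (lspace PP) (fst T)) (opnorm (rspace PP) (rspace PP) (snd T)))"
  "amult LL = (\<lambda>T S. (compose X1 (fst S) (fst T), compose Y1 (snd T) (snd S)))"
  by (simp_all add: adjointable_algebra_def Let_def fun_eq_iff)

lemma pair_vnorm: "vnorm (lspace PP) = opnorm W V" "vnorm (rspace PP) = opnorm V W"
  "vadd (lspace PP) = vadd (op_space W V)" "vadd (rspace PP) = vadd (op_space V W)"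
  "vscale (lspace PP) = vscale (op_space W V)" "vscale (rspace PP) = vscale (op_space V W)"
  by simp_all

lemma pair_carrier: "carrier (lspace PP) = X1" "carrier (rspace PP) = Y1"
  by simp_all

lemma X1_add: "\<lbrakk>S \<in> X1; S' \<in> X1\<rbrakk> \<Longrightarrow> vadd (op_space W V) S S' \<in> X1"
  and X1_scale: "S \<in> X1 \<Longrightarrow> vscale (op_space W V) c S \<in> X1"
  using X.add_closed X.scale_closed by simp_all

lemma Y1_add: "\<lbrakk>T \<in> Y1; T' \<in> Y1\<rbrakk> \<Longrightarrow> vadd (op_space V W) T T' \<in> Y1"
  and Y1_scale: "T \<in> Y1 \<Longrightarrow> vscale (op_space V W) c T \<in> Y1"
  using Y.add_closed Y.scale_closed by simp_all

lemma mult_pair_closed: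
  assumes l: "preserves l"
  shows "mult_pair l \<in> carrier LL" and "vnorm LL (mult_pair l) \<le> opnorm W W l"
proof -
  let ?l = l
  note lc = preservesD(1)[OF l]
  have l0: "0 \<le> opnorm W W ?l" using L.norm_nonneg[OF lc] by simp
  note eq = mult_pair_def[of l]
  let ?Tl = "\<lambda>S\<in>X1. compose (carrier W) S ?l" and ?Tr = "\<lambda>T\<in>Y1. compose (carrier V) ?l T"
  have nX: "opnorm W V (compose (carrier W) S ?l) \<le> opnorm W W ?l * opnorm W V S" if "S \<in> X1" for S
    using compose_op_space(2)[OF nW nW nV lc X1c[OF that]] by (simp add: mult.commute)
  have nY: "opnorm V W (compose (carrier V) ?l T) \<le> opnorm W W ?l * opnorm V W T" if "T \<in> Y1" for T
    using compose_op_space(2)[OF nV nW nW Y1c[OF that] lc] by simp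
  have Tl: "?Tl \<in> carrier (op_space (lspace PP) (lspace PP))"
  proof (rule XX.op_spaceI[where C = "opnorm W W ?l"], unfold pair_vnorm pair_carrier)
    show "?Tl \<in> extensional X1" by simp
    show "?Tl S \<in> X1" if "S \<in> X1" for S using that preservesD(2)[OF l] by simp
    show "opnorm W V (?Tl S) \<le> opnorm W W ?l * opnorm W V S" if "S \<in> X1" for S
      using nX[OF that] that by simp
  qed (use compose_linear_left[OF lc, of V] in
      \<open>simp_all add: X1_add X1_scale del: op_space_simps op_pair_simps\<close>)
  have Tr: "?Tr \<in> carrier (op_space (rspace PP) (rspace PP))"
  proof (rule YY.op_spaceI[where C = "opnorm W W ?l"], unfold pair_vnorm pair_carrier)
    show "?Tr \<in> extensional Y1" by simp
    show "?Tr T \<in> Y1" if "T \<in> Y1" for T using that preservesD(3)[OF l] by simp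
    show "opnorm V W (?Tr T) \<le> opnorm W W ?l * opnorm V W T" if "T \<in> Y1" for T
      using nY[OF that] that by simp
  qed (simp_all add: Y1_add Y1_scale compose_linear_right[OF lc Y1c Y1c W.complex_vspace_axioms]
       compose_vscale_right[OF lc Y1c] del: op_space_simps)
  show "mult_pair l \<in> carrier LL"
    unfolding eq adjointable_simps using Tl Tr
    by (simp add: BX1 YB1 preservesD(2)[OF l] preservesD(3)[OF l] compose_op_assoc[OF lc] compose_op_assoc[OF B1c]
        compose_op_assoc[OF Y1c] del: op_space_simps op_pair_simps)
  have "opnorm (lspace PP) (lspace PP) ?Tl \<le> opnorm W W ?l"
    by (rule XX.opnorm_le[OF l0], unfold pair_vnorm pair_carrier) (use nX in simp)
  moreover have "opnorm (rspace PP) (rspace PP) ?Tr \<le> opnorm W W ?l"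
    by (rule YY.opnorm_le[OF l0], unfold pair_vnorm pair_carrier) (use nY in simp)
  ultimately show "vnorm LL (mult_pair l) \<le> opnorm W W l"
    unfolding eq adjointable_simps by simp
qed

lemma action_closed:
  assumes a: "a \<in> A1"
  shows "action a \<in> carrier LL" and "vnorm LL (action a) \<le> opnorm U U a"
proof -
  note r = ext_op_R1[OF a]
  have eq: "action a = mult_pair (ext_op a)" using a by (simp add: action_def)
  show "action a \<in> carrier LL" unfolding eq by (rule mult_pair_closed(1)[OF R1_preserves[OF r]])
  show "vnorm LL (action a) \<le> opnorm U U a"
    unfolding eq using mult_pair_closed(2)[OF R1_preserves[OF r]] R1_contr[OF r] by (rule order_trans)
qed

lemma AA_simps: "carrier AA = A1" "vadd AA = vadd (op_space U U)" "vscale AA = vscale (op_space U U)"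
  "amult AA = compose (carrier U)" "vnorm AA = opnorm U U"
  by simp_all

lemma fst_R_sub: "subspace_of (op_space U U) (fst ` R)"
  unfolding subspace_of_def
proof (intro conjI ballI allI)
  show "fst ` R \<subseteq> carrier (op_space U U)" by (rule A0c)
  show "vzero (op_space U U) \<in> fst ` R" using subspace_ofD(2)[OF R_sub] by force
  show "vadd (op_space U U) a b \<in> fst ` R" if ab: "a \<in> fst ` R" "b \<in> fst ` R" for a b
  proof -
    obtain l m where "(a, l) \<in> R" "(b, m) \<in> R" using ab by auto
    from subspace_ofD(3)[OF R_sub this] show ?thesis by force
  qed
  show "vscale (op_space U U) c a \<in> fst ` R" if ab: "a \<in> fst ` R" for a c
  proof -
    obtain l where "(a, l) \<in> R" using ab by auto
    from subspace_ofD(4)[OF R_sub this, of c] show ?thesis by force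
  qed
qed

lemma fst_R_mult:
  assumes "a \<in> fst ` R" "b \<in> fst ` R"
  shows "compose (carrier U) a b \<in> fst ` R"
proof -
  obtain l m where "(a, l) \<in> R" "(b, m) \<in> R" using assms by auto
  from R_mult[OF this] show ?thesis by (rule image_eqI[rotated]) simp
qed

lemma action_hom: "contractive_hom AA LL action"
  unfolding contractive_hom_def linear_map_def AA_simps
proof (intro conjI ballI allI)
  have ext_add: "ext_op (vadd (op_space U U) a b) = vadd (op_space W W) (ext_op a) (ext_op b)"
    and add_cl: "vadd (op_space U U) a b \<in> A1" if "a \<in> A1" "b \<in> A1" for a b
  proof -
    have "(vadd (op_space U U) a b, vadd (op_space W W) (ext_op a) (ext_op b)) \<in> R1"
      using subspace_ofD(3)[OF R1_sub ext_op_R1[OF that(1)] ext_op_R1[OF that(2)]] by simp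
    then show "ext_op (vadd (op_space U U) a b) = vadd (op_space W W) (ext_op a) (ext_op b)"
      by (rule ext_op_eq)
    show "vadd (op_space U U) a b \<in> A1"
      using subspace_ofD(3)[OF A.subspace_of_closure_in[OF fst_R_sub] that] .
  qed
  have ext_scale: "ext_op (vscale (op_space U U) c a) = vscale (op_space W W) c (ext_op a)"
    and scale_cl: "vscale (op_space U U) c a \<in> A1" if "a \<in> A1" for a c
  proof -
    have "(vscale (op_space U U) c a, vscale (op_space W W) c (ext_op a)) \<in> R1"
      using subspace_ofD(4)[OF R1_sub ext_op_R1[OF that], of c] by simp
    then show "ext_op (vscale (op_space U U) c a) = vscale (op_space W W) c (ext_op a)"
      by (rule ext_op_eq)
    show "vscale (op_space U U) c a \<in> A1"
      using subspace_ofD(4)[OF A.subspace_of_closure_in[OF fst_R_sub] that] .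
  qed
  have mult_cl: "compose (carrier U) a b \<in> A1" if "a \<in> A1" "b \<in> A1" for a b
    using compose_closure[OF nU nU nU A0c(1) A0c(1) A0c(1) _ that] fst_R_mult A0c(2) by blast
  have lc: "ext_op a \<in> carrier (op_space W W)" if "a \<in> A1" for a using R1c(2)[OF ext_op_R1[OF that]] .
  show "action \<in> A1 \<rightarrow> carrier LL" using action_closed(1) by blast
  show "vnorm LL (action a) \<le> opnorm U U a" if "a \<in> A1" for a using action_closed(2)[OF that] .
  show "action (vadd (op_space U U) a b) = vadd LL (action a) (action b)" if "a \<in> A1" "b \<in> A1" for a b
    unfolding adjointable_simps using that by (auto simp: action_def mult_pair_def add_cl ext_add adjointable_simps compose_linear_left
        compose_linear_right[OF X1c lc lc W.complex_vspace_axioms] compose_linear_left[OF Y1c]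
        simp del: op_space_simps intro!: restrict_ext)
  show "action (vscale (op_space U U) c a) = vscale LL c (action a)" if "a \<in> A1" for c a
    unfolding adjointable_simps using that by (auto simp: action_def mult_pair_def scale_cl ext_scale adjointable_simps
        compose_vscale_right[OF X1c lc] compose_linear_left[OF Y1c]
        simp del: op_space_simps intro!: restrict_ext)
  show "action (compose (carrier U) a b) = amult LL (action a) (action b)" if "a \<in> A1" "b \<in> A1" for a b
  proof -
    have e: "ext_op (compose (carrier U) a b) = compose (carrier W) (ext_op a) (ext_op b)"
      by (rule ext_op_eq[OF R1_mult[OF ext_op_R1[OF that(1)] ext_op_R1[OF that(2)]]])
    show ?thesis
      unfolding adjointable_simps using that R1_X[OF ext_op_R1] R1_Y[OF ext_op_R1]
      by (auto simp: action_def mult_pair_def mult_cl e adjointable_simps compose_def[of X1] compose_def[of Y1]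
          compose_op_assoc[OF lc] compose_op_assoc[OF Y1c]
          simp del: op_space_simps intro!: restrict_ext)
  qed
qed

lemma banach_correspondence: "banach_correspondence AA BB PP action"
  using closed_op_algebra_banach[OF U.complex_banach_space_axioms fst_R_sub fst_R_mult] banach_pair action_hom
  by (simp add: banach_correspondence_def banach_correspondence_axioms_def)

text \<open>A contractive homomorphism is determined by its values on dense subsets.\<close>

lemma action_unique:
  assumes ext: "\<rho> \<in> extensional A1" and hom: "contractive_hom AA LL \<rho>"
    and val: "\<And>a l S. \<lbrakk>(a, l) \<in> R; S \<in> X0\<rbrakk> \<Longrightarrow> fst (\<rho> a) S = compose (carrier W) S l"
      "\<And>a l T. \<lbrakk>(a, l) \<in> R; T \<in> Y0\<rbrakk> \<Longrightarrow> snd (\<rho> a) T = compose (carrier V) l T"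
  shows "\<rho> = action"
proof (rule extensionalityI[OF ext])
  show "action \<in> extensional A1" by (simp add: action_def)
  fix a assume a: "a \<in> A1"
  have nAA: "complex_normed_space AA"
    using complex_banach_algebra.axioms(1)[OF closed_op_algebra_banach[OF U.complex_banach_space_axioms fst_R_sub fst_R_mult]]
    by (simp add: complex_banach_space_def)
  have cl: "\<sigma> b \<in> carrier LL" if "contractive_hom AA LL \<sigma>" "b \<in> A1" for \<sigma> b
    using that by (auto simp: contractive_hom_def linear_map_def)
  have blX: "bounded_linear_map (lspace PP) (lspace PP) (fst (\<sigma> b))"
    and blY: "bounded_linear_map (rspace PP) (rspace PP) (snd (\<sigma> b))"
    if "contractive_hom AA LL \<sigma>" "b \<in> A1" for \<sigma> b
    using cl[OF that] unfolding adjointable_simps by (auto simp del: op_pair_simps)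
  have extX: "fst (\<sigma> b) \<in> extensional X1" and extY: "snd (\<sigma> b) \<in> extensional Y1"
    if "contractive_hom AA LL \<sigma>" "b \<in> A1" for \<sigma> b
    using cl[OF that] unfolding adjointable_simps by auto
  have nb: "opnorm (lspace PP) (lspace PP) (fst (\<sigma> b)) \<le> opnorm U U b"
    "opnorm (rspace PP) (rspace PP) (snd (\<sigma> b)) \<le> opnorm U U b"
    if "contractive_hom AA LL \<sigma>" "b \<in> A1" for \<sigma> b
    using that unfolding contractive_hom_def adjointable_simps by auto
  have hom_add: "\<sigma> (vadd (op_space U U) x y) = (\<lambda>z\<in>X1. vadd (op_space W V) (fst (\<sigma> x) z) (fst (\<sigma> y) z),
        \<lambda>z\<in>Y1. vadd (op_space V W) (snd (\<sigma> x) z) (snd (\<sigma> y) z))"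
    if "contractive_hom AA LL \<sigma>" "x \<in> A1" "y \<in> A1" for \<sigma> x y
    using that unfolding contractive_hom_def linear_map_def AA_simps adjointable_simps(2) by blast
  have hom_scale: "\<sigma> (vscale (op_space U U) c x) = (\<lambda>z\<in>X1. vscale (op_space W V) c (fst (\<sigma> x) z),
        \<lambda>z\<in>Y1. vscale (op_space V W) c (snd (\<sigma> x) z))"
    if "contractive_hom AA LL \<sigma>" "x \<in> A1" for \<sigma> c x
    using that unfolding contractive_hom_def linear_map_def AA_simps adjointable_simps(3) by blast
  have appX: "bounded_linear_map AA (lspace PP) (\<lambda>b. fst (\<sigma> b) S)" if \<sigma>: "contractive_hom AA LL \<sigma>" and S: "S \<in> X1" for \<sigma> S
  proof -
    have "linear_map AA (lspace PP) (\<lambda>b. fst (\<sigma> b) S)"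
      using S bounded_linear_mapD(1)[OF blX[OF \<sigma>], unfolded pair_carrier]
      unfolding linear_map_def AA_simps pair_carrier pair_vnorm
      by (auto simp: hom_add[OF \<sigma>] hom_scale[OF \<sigma>] simp del: op_space_simps op_pair_simps)
    moreover have "\<forall>b\<in>A1. opnorm W V (fst (\<sigma> b) S) \<le> opnorm W V S * opnorm U U b"
      using XX.opnorm_apply[OF blX[OF \<sigma>], of _ S] nb(1)[OF \<sigma>] S X.norm_nonneg[of S]
      by (auto simp: mult.commute[of "opnorm W V S"] intro: order_trans[OF _ mult_right_mono])
    ultimately show ?thesis by (auto simp: bounded_linear_map_def)
  qed
  have appY: "bounded_linear_map AA (rspace PP) (\<lambda>b. snd (\<sigma> b) S)" if \<sigma>: "contractive_hom AA LL \<sigma>" and S: "S \<in> Y1" for \<sigma> S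
  proof -
    have "linear_map AA (rspace PP) (\<lambda>b. snd (\<sigma> b) S)"
      using S bounded_linear_mapD(1)[OF blY[OF \<sigma>], unfolded pair_carrier]
      unfolding linear_map_def AA_simps pair_carrier pair_vnorm
      by (auto simp: hom_add[OF \<sigma>] hom_scale[OF \<sigma>] simp del: op_space_simps op_pair_simps)
    moreover have "\<forall>b\<in>A1. opnorm V W (snd (\<sigma> b) S) \<le> opnorm V W S * opnorm U U b"
      using YY.opnorm_apply[OF blY[OF \<sigma>], of _ S] nb(2)[OF \<sigma>] S Y.norm_nonneg[of S]
      by (auto simp: mult.commute[of "opnorm V W S"] intro: order_trans[OF _ mult_right_mono])
    ultimately show ?thesis by (auto simp: bounded_linear_map_def)
  qed
  have A0A: "fst ` R \<subseteq> A1" by (rule A0c)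
  have clX: "closure_in (lspace PP) X0 = X1"
    unfolding op_pair_simps by (simp only: closure_in_carrier_update[OF closure_in_subset] Int_absorb)
  have clY: "closure_in (rspace PP) Y0 = Y1"
    unfolding op_pair_simps by (simp only: closure_in_carrier_update[OF closure_in_subset] Int_absorb)
  have clA: "closure_in AA (fst ` R) = A1"
    by (simp only: closure_in_op_algebra closure_in_carrier_update[OF closure_in_subset] op_algebra_simps
        closure_in_carrier_update[of _ "op_algebra U", unfolded op_algebra_simps, OF closure_in_subset] Int_absorb)
  have "fst (\<rho> a) S = fst (action a) S" if S: "S \<in> X1" for S
  proof (rule bounded_linear_eq_on_closure[OF nAA X.complex_normed_space_axioms appX[OF hom S] appX[OF action_hom S]])
    show "fst (\<rho> b) S = fst (action b) S" if b: "b \<in> fst ` R" for b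
    proof -
      have b1: "b \<in> A1" using b A0A by blast
      show ?thesis
      proof (rule bounded_linear_eq_on_closure[OF X.complex_normed_space_axioms X.complex_normed_space_axioms
            blX[OF hom b1] blX[OF action_hom b1]])
        show "X0 \<subseteq> carrier (lspace PP)" using X0c(2) by simp
        show "fst (\<rho> b) S = fst (action b) S" if "S \<in> X0" for S
          using that b val(1) action_R mult_pair_apply(1) X0c(2) by (auto simp: subset_iff)
        show "S \<in> closure_in (lspace PP) X0" using S clX by simp
      qed
    qed
  qed (use a A0A clA in simp_all)
  moreover have "snd (\<rho> a) S = snd (action a) S" if S: "S \<in> Y1" for S
  proof (rule bounded_linear_eq_on_closure[OF nAA Y.complex_normed_space_axioms appY[OF hom S] appY[OF action_hom S]])
    show "snd (\<rho> b) S = snd (action b) S" if b: "b \<in> fst ` R" for b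
    proof -
      have b1: "b \<in> A1" using b A0A by blast
      show ?thesis
      proof (rule bounded_linear_eq_on_closure[OF Y.complex_normed_space_axioms Y.complex_normed_space_axioms
            blY[OF hom b1] blY[OF action_hom b1]])
        show "Y0 \<subseteq> carrier (rspace PP)" using Y0c(2) by simp
        show "snd (\<rho> b) S = snd (action b) S" if "S \<in> Y0" for S
          using that b val(2) action_R mult_pair_apply(2) Y0c(2) by (auto simp: subset_iff)
        show "S \<in> closure_in (rspace PP) Y0" using S clY by simp
      qed
    qed
  qed (use a A0A clA in simp_all)
  ultimately show "\<rho> a = action a"
    by (intro prod_eqI extensionalityI[OF extX[OF hom a] extX[OF action_hom a]]
        extensionalityI[OF extY[OF hom a] extY[OF action_hom a]])
qed

subsection \<open>Compact operators\<close>

abbreviation "rank_one \<equiv> {theta PP w x | w x. w \<in> carrier (rspace PP) \<and> x \<in> carrier (lspace PP)}"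

text \<open>By associativity of composition the rank one operators are multiplications as well, so that
  identities between operators on \<open>W\<close> can be read as identities in the algebra of adjointable pairs.\<close>

lemma theta_eq:
  assumes w: "w \<in> Y1" and x: "x \<in> X1"
  shows "theta PP w x = mult_pair (compose (carrier W) w x)" "preserves (compose (carrier W) w x)"
proof -
  note wc = Y1c[OF w] and xc = X1c[OF x]
  have 1: "compose (carrier W) (compose (carrier V) v w) x = compose (carrier W) v (compose (carrier W) w x)" for v
    by (rule compose_op_assoc[OF xc])
  have 2: "compose (carrier V) w (compose (carrier V) x y) = compose (carrier V) (compose (carrier W) w x) y" if "y \<in> Y1" for y
    by (rule compose_op_assoc[OF Y1c[OF that], symmetric])
  show "theta PP w x = mult_pair (compose (carrier W) w x)"
    unfolding theta_def mult_pair_def pair_carrier op_pair_simps using 1 2 by (auto intro!: restrict_ext)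
  show "preserves (compose (carrier W) w x)"
    unfolding preserves_def
  proof (intro conjI ballI)
    show "compose (carrier W) w x \<in> carrier (op_space W W)" by (rule compose_op_space(1)[OF nW nV nW xc wc])
    show "compose (carrier W) S (compose (carrier W) w x) \<in> X1" if "S \<in> X1" for S
      unfolding 1[symmetric] by (rule BX1[OF XY1[OF that w] x])
    show "compose (carrier V) (compose (carrier W) w x) T \<in> Y1" if "T \<in> Y1" for T
      unfolding 2[OF that, symmetric] by (rule YB1[OF w XY1[OF x that]])
  qed
qed

lemma mult_pair_add:
  assumes l: "preserves l" and m: "preserves m"
  shows "mult_pair (vadd (op_space W W) l m) = vadd LL (mult_pair l) (vscale LL 1 (mult_pair m))"
    and "preserves (vadd (op_space W W) l m)"
proof -
  note lc = preservesD(1)[OF l] and mc = preservesD(1)[OF m]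
  have r: "compose (carrier W) S (vadd (op_space W W) l m)
      = vadd (op_space W V) (compose (carrier W) S l) (compose (carrier W) S m)" if "S \<in> X1" for S
    by (rule compose_linear_right(1)[OF X1c[OF that] lc mc W.complex_vspace_axioms])
  have s: "compose (carrier V) (vadd (op_space W W) l m) T
      = vadd (op_space V W) (compose (carrier V) l T) (compose (carrier V) m T)" if "T \<in> Y1" for T
    by (rule compose_linear_left(1)[OF Y1c[OF that]])
  have u: "vscale (op_space W V) 1 S = S" if "S \<in> X1" for S
    using X.scale_one[unfolded pair_carrier pair_vnorm, OF that] .
  have v: "vscale (op_space V W) 1 T = T" if "T \<in> Y1" for T
    using Y.scale_one[unfolded pair_carrier pair_vnorm, OF that] .
  show "mult_pair (vadd (op_space W W) l m) = vadd LL (mult_pair l) (vscale LL 1 (mult_pair m))"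
    unfolding adjointable_simps mult_pair_def
    using preservesD(2,3)[OF m]
    by (auto simp: r s u v simp del: op_space_simps intro!: restrict_ext)
  show "preserves (vadd (op_space W W) l m)"
    unfolding preserves_def
    using preservesD(2,3)[OF m] preservesD(2,3)[OF l] L.add_closed[OF lc mc]
    by (simp add: r s X1_add Y1_add del: op_space_simps)
qed

lemma mult_pair_zero: "mult_pair (vzero (op_space W W)) = vzero LL" "preserves (vzero (op_space W W))"
proof -
  have r: "compose (carrier W) S (vzero (op_space W W)) = vzero (op_space W V)" if "S \<in> X1" for S
    using linear_map_vzero[OF W.complex_vspace_axioms V.complex_vspace_axioms op_spaceD(4)[OF X1c[OF that]]]
    by (auto simp: compose_def intro!: restrict_ext)
  have s: "compose (carrier V) (vzero (op_space W W)) T = vzero (op_space V W)" if "T \<in> Y1" for T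
    using op_spaceD(1)[OF Y1c[OF that]] by (auto simp: compose_def intro!: restrict_ext)
  have z: "vzero LL = (\<lambda>S\<in>X1. vzero (op_space W V), \<lambda>T\<in>Y1. vzero (op_space V W))"
    by (simp add: adjointable_algebra_def Let_def)
  show "mult_pair (vzero (op_space W W)) = vzero LL"
    unfolding z mult_pair_def using r s by (auto simp del: op_space_simps intro!: restrict_ext)
  have "vzero (op_space W V) \<in> X1" "vzero (op_space V W) \<in> Y1"
    using X.zero_closed Y.zero_closed by simp_all
  then show "preserves (vzero (op_space W W))"
    unfolding preserves_def using L.zero_closed by (simp add: r s del: op_space_simps)
qed

lemma span_rank_one_add:
  assumes "mult_pair l \<in> lin_span LL rank_one" "preserves l" "w \<in> Y1" "x \<in> X1"
  shows "mult_pair (vadd (op_space W W) l (compose (carrier W) w x)) \<in> lin_span LL rank_one"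
    "preserves (vadd (op_space W W) l (compose (carrier W) w x))"
proof -
  have "theta PP w x \<in> rank_one" using assms(3,4) by (auto simp only: pair_carrier)
  from lin_span.add[OF assms(1) this, of 1]
  show "mult_pair (vadd (op_space W W) l (compose (carrier W) w x)) \<in> lin_span LL rank_one"
    unfolding theta_eq(1)[OF assms(3,4)] mult_pair_add(1)[OF assms(2) theta_eq(2)[OF assms(3,4)]] .
  show "preserves (vadd (op_space W W) l (compose (carrier W) w x))"
    by (rule mult_pair_add(2)[OF assms(2) theta_eq(2)[OF assms(3,4)]])
qed

text \<open>The compact operators are closed and the action is contractive, so a dense set of elements suffices.\<close>

lemma action_compactI:
  assumes "\<And>a. a \<in> fst ` R \<Longrightarrow> action a \<in> lin_span LL rank_one"
  shows "action ` A1 \<subseteq> compact_operators BB PP"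
proof
  fix P assume "P \<in> action ` A1"
  then obtain a where a: "a \<in> A1" "P = action a" by blast
  have nAA: "complex_vspace AA"
    using complex_banach_algebra.axioms(1)[OF closed_op_algebra_banach[OF U.complex_banach_space_axioms fst_R_sub fst_R_mult]]
    by (simp add: complex_banach_space_def complex_normed_space_def)
  have "\<exists>y\<in>lin_span LL rank_one. vnorm LL (vdiff LL P y) < e" if e: "0 < e" for e
  proof -
    obtain b where b: "b \<in> fst ` R" "vnorm (op_space U U) (vdiff (op_space U U) a b) < e"
      using a(1) e unfolding closure_in_def by blast
    have b1: "b \<in> A1" using b(1) A0c(2) by blast
    have d: "vdiff (op_space U U) a b \<in> A1"
      by (rule subspace_ofD(5)[OF A.subspace_of_closure_in[OF fst_R_sub] a(1) b1])
    have "linear_map AA LL action" using action_hom by (simp add: contractive_hom_def)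
    then have "vdiff LL P (action b) = action (vdiff (op_space U U) a b)"
      using linear_map_vdiff[OF nAA, of LL action a b] a b1 by simp
    then have "vnorm LL (vdiff LL P (action b)) \<le> opnorm U U (vdiff (op_space U U) a b)"
      using action_closed(2)[OF d] by simp
    then show ?thesis using assms[OF b(1)] b(2) by (intro bexI[of _ "action b"]) auto
  qed
  then show "P \<in> compact_operators BB PP"
    using action_closed(1)[OF a(1)] a(2) unfolding compact_operators_def closure_in_def by blast
qed

text \<open>Nondegeneracy holds as soon as the generators themselves are products.\<close>

lemma nondegenerateI:
  "\<lbrakk>X0 \<subseteq> S; S \<subseteq> X1\<rbrakk> \<Longrightarrow> closure_in (lspace PP) (lin_span (lspace PP) S) = carrier (lspace PP)"
  "\<lbrakk>Y0 \<subseteq> T; T \<subseteq> Y1\<rbrakk> \<Longrightarrow> closure_in (rspace PP) (lin_span (rspace PP) T) = carrier (rspace PP)"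
proof -
  have "closure_in (lspace PP) X0 = carrier (lspace PP)" "closure_in (rspace PP) Y0 = carrier (rspace PP)"
    unfolding pair_carrier unfolding op_pair_simps
    by (simp_all only: closure_in_carrier_update[OF closure_in_subset] Int_absorb)
  then show "\<lbrakk>X0 \<subseteq> S; S \<subseteq> X1\<rbrakk> \<Longrightarrow> closure_in (lspace PP) (lin_span (lspace PP) S) = carrier (lspace PP)"
    "\<lbrakk>Y0 \<subseteq> T; T \<subseteq> Y1\<rbrakk> \<Longrightarrow> closure_in (rspace PP) (lin_span (rspace PP) T) = carrier (rspace PP)"
    using closure_lin_span_eq[OF X.complex_vspace_axioms, of X0 S] closure_lin_span_eq[OF Y.complex_vspace_axioms, of Y0 T]
    by (simp_all only: pair_carrier)
qed

end

section \<open>Spaces of p-summable families\<close>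

lemma lp_norm_finite:
  assumes "finite F" "p \<noteq> \<infinity>"
  shows "lp_norm p F f = (\<Sum>i\<in>F. norm (f i) powr enn2real p) powr (1 / enn2real p)"
  using assms by (simp add: lp_norm_def)

lemma in_lp_finite: "finite F \<Longrightarrow> in_lp p F f"
  by (simp add: in_lp_def finite_imp_bounded)

lemma lp_norm_le_powr:
  assumes p: "1 \<le> p" "p \<noteq> \<infinity>" and F: "finite F" and C: "0 \<le> C"
  shows "lp_norm p F f \<le> C \<longleftrightarrow> (\<Sum>i\<in>F. norm (f i) powr enn2real p) \<le> C powr enn2real p"
proof -
  have q: "0 < enn2real p" by (rule enn2real_exponent_pos[OF p])
  let ?s = "\<Sum>i\<in>F. norm (f i) powr enn2real p"
  have s: "0 \<le> ?s" by (intro sum_nonneg) simp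
  have 1: "?s = (?s powr (1 / enn2real p)) powr enn2real p" using q s by (simp add: powr_powr)
  have 2: "(C powr enn2real p) powr (1 / enn2real p) = C" using q C by (simp add: powr_powr)
  show ?thesis
    unfolding lp_norm_finite[OF F p(2)]
  proof
    assume "?s powr (1 / enn2real p) \<le> C"
    then show "?s \<le> C powr enn2real p" using q by (subst 1) (auto intro: powr_mono2)
  next
    assume "?s \<le> C powr enn2real p"
    then have "?s powr (1 / enn2real p) \<le> (C powr enn2real p) powr (1 / enn2real p)"
      using q s by (intro powr_mono2) auto
    then show "?s powr (1 / enn2real p) \<le> C" by (simp only: 2)
  qed
qed

lemma lp_norm_inf_le:
  assumes "0 \<le> C"
  shows "(in_lp \<infinity> I f \<and> lp_norm \<infinity> I f \<le> C) \<longleftrightarrow> (\<forall>i\<in>I. norm (f i) \<le> C)"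
proof
  assume *: "in_lp \<infinity> I f \<and> lp_norm \<infinity> I f \<le> C"
  have "(1::ennreal) \<le> \<infinity>" by simp
  from norm_le_lp_norm[OF this] * show "\<forall>i\<in>I. norm (f i) \<le> C" by (meson order_trans)
next
  assume *: "\<forall>i\<in>I. norm (f i) \<le> C"
  have "bounded (f ` I)" unfolding bounded_iff using * by blast
  moreover have "Sup (insert 0 ((\<lambda>i. norm (f i)) ` I)) \<le> C"
    using * assms by (intro cSup_least) auto
  ultimately show "in_lp \<infinity> I f \<and> lp_norm \<infinity> I f \<le> C" by (simp add: in_lp_def lp_norm_def)
qed

text \<open>Norm bounds can be tested on finite subsets, for every exponent. Most estimates below are
  reduced to finite sums in this way.\<close>

lemma lp_le_iff_finite:
  assumes p: "1 \<le> p" and C: "0 \<le> C"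
  shows "(in_lp p I f \<and> lp_norm p I f \<le> C) \<longleftrightarrow> (\<forall>F. finite F \<longrightarrow> F \<subseteq> I \<longrightarrow> lp_norm p F f \<le> C)"
proof (cases "p = \<infinity>")
  case True
  have "(\<forall>F. finite F \<longrightarrow> F \<subseteq> I \<longrightarrow> lp_norm p F f \<le> C) \<longleftrightarrow> (\<forall>F. finite F \<longrightarrow> F \<subseteq> I \<longrightarrow> (\<forall>i\<in>F. norm (f i) \<le> C))"
  proof -
    have "lp_norm p F f \<le> C \<longleftrightarrow> (\<forall>i\<in>F. norm (f i) \<le> C)" if "finite F" for F
      using lp_norm_inf_le[OF C, of F f] in_lp_finite[OF that, of p f] True by simp
    then show ?thesis by simp
  qed
  also have "\<dots> \<longleftrightarrow> (\<forall>i\<in>I. norm (f i) \<le> C)"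
  proof
    assume *: "\<forall>F. finite F \<longrightarrow> F \<subseteq> I \<longrightarrow> (\<forall>i\<in>F. norm (f i) \<le> C)"
    show "\<forall>i\<in>I. norm (f i) \<le> C"
    proof
      fix i assume "i \<in> I"
      then show "norm (f i) \<le> C" using *[rule_format, of "{i}" i] by simp
    qed
  qed auto
  finally show ?thesis using lp_norm_inf_le[OF C, of I f] True by simp
next
  case False
  have q: "0 < enn2real p" by (rule enn2real_exponent_pos[OF p False])
  let ?g = "\<lambda>i. norm (f i) powr enn2real p"
  have eq: "(\<forall>F. finite F \<longrightarrow> F \<subseteq> I \<longrightarrow> lp_norm p F f \<le> C) \<longleftrightarrow>
      (\<forall>F. finite F \<longrightarrow> F \<subseteq> I \<longrightarrow> sum ?g F \<le> C powr enn2real p)"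
    using lp_norm_le_powr[OF p False _ C] by blast
  show ?thesis unfolding eq
  proof
    assume *: "in_lp p I f \<and> lp_norm p I f \<le> C"
    then have sm: "?g summable_on I" using False by (simp add: in_lp_def)
    have le: "infsum ?g I powr (1 / enn2real p) \<le> C" using * False by (simp add: lp_norm_def)
    have n: "0 \<le> infsum ?g I" by (intro infsum_nonneg) simp
    have "infsum ?g I = (infsum ?g I powr (1 / enn2real p)) powr enn2real p" using q n by (simp add: powr_powr)
    also have "\<dots> \<le> C powr enn2real p" using le q by (intro powr_mono2) auto
    finally have "infsum ?g I \<le> C powr enn2real p" .
    then show "\<forall>F. finite F \<longrightarrow> F \<subseteq> I \<longrightarrow> sum ?g F \<le> C powr enn2real p"
      using finite_sum_le_infsum[OF sm] by (meson order_trans powr_ge_zero)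
  next
    assume *: "\<forall>F. finite F \<longrightarrow> F \<subseteq> I \<longrightarrow> sum ?g F \<le> C powr enn2real p"
    have sm: "?g summable_on I"
      using * by (intro nonneg_bdd_above_summable_on) (auto intro!: bdd_aboveI[of _ "C powr enn2real p"])
    have "infsum ?g I \<le> C powr enn2real p" using sm * by (intro infsum_le_finite_sums) auto
    then have "infsum ?g I powr (1 / enn2real p) \<le> (C powr enn2real p) powr (1 / enn2real p)"
      using q by (intro powr_mono2) (auto intro!: infsum_nonneg)
    then show "in_lp p I f \<and> lp_norm p I f \<le> C"
      using sm False q C by (simp add: in_lp_def lp_norm_def powr_powr)
  qed
qed

lemma lp_leI:
  assumes "1 \<le> p" "0 \<le> C" "\<And>F. \<lbrakk>finite F; F \<subseteq> I\<rbrakk> \<Longrightarrow> lp_norm p F f \<le> C"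
  shows "in_lp p I f" "lp_norm p I f \<le> C"
  using lp_le_iff_finite[OF assms(1,2), of I f] assms(3) by auto

lemma lp_norm_finite_le:
  assumes "1 \<le> p" "in_lp p I f" "finite F" "F \<subseteq> I"
  shows "lp_norm p F f \<le> lp_norm p I f"
  using lp_le_iff_finite[OF assms(1) lp_norm_nonneg[OF assms(2)], of I f] assms by auto

lemma lp_subset:
  assumes "1 \<le> p" "in_lp p I f" "J \<subseteq> I"
  shows "in_lp p J f" "lp_norm p J f \<le> lp_norm p I f"
proof -
  have "lp_norm p F f \<le> lp_norm p I f" if "finite F" "F \<subseteq> J" for F
    by (rule lp_norm_finite_le[OF assms(1,2) that(1)]) (use that assms in blast)
  from lp_leI[OF assms(1) lp_norm_nonneg[OF assms(2)] this]
  show "in_lp p J f" "lp_norm p J f \<le> lp_norm p I f" by blast+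
qed

lemma lp_point_mass:
  assumes "1 \<le> p" "i \<in> I"
  shows "in_lp p I (\<lambda>j. if j = i then 1 else 0 :: complex)" "lp_norm p I (\<lambda>j. if j = i then 1 else 0 :: complex) = 1"
proof -
  let ?d = "\<lambda>j. if j = i then 1 else 0 :: complex" and ?r = "\<lambda>j. if j = i then 1 else 0 :: real"
  have n: "norm (?d j) = norm (?r j)" for j by simp
  show "in_lp p I ?d" using in_lp_cong[of I ?d ?r p] n lp_norm_single(1)[OF assms, of 1] by auto
  show "lp_norm p I ?d = 1" using lp_norm_cong[of I ?d ?r p] n lp_norm_single(2)[OF assms, of 1] by auto
qed

subsection \<open>The triangle inequality\<close>

lemma powr_convex_combination:
  fixes x y t :: real
  assumes q: "1 \<le> q" and "0 \<le> x" "0 \<le> y" "0 \<le> t" "t \<le> 1"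
  shows "((1 - t) * x + t * y) powr q \<le> (1 - t) * x powr q + t * y powr q"
proof -
  have le: "s powr q \<le> s" if "0 \<le> s" "s \<le> 1" for s :: real
    using powr_mono'[of 1 q s] that q by (cases "s = 0") auto
  consider "x = 0" | "y = 0" | "0 < x" "0 < y" using assms by linarith
  then show ?thesis
  proof cases
    case 1
    then show ?thesis using assms le[of t] by (simp add: powr_mult mult_right_mono)
  next
    case 2
    then show ?thesis using assms le[of "1 - t"] by (simp add: powr_mult mult_right_mono)
  next
    case 3
    then show ?thesis
      using convex_onD[OF powr_convex[OF q], of t x y] q assms by simp
  qed
qed

text \<open>Minkowski's inequality by convexity of \<open>x\<^sup>q\<close>: the sum is \<open>a + b\<close> times a convex combination of
  \<open>f / a\<close> and \<open>g / b\<close>, both of norm at most one. The bounds \<open>a\<close>, \<open>b\<close> are kept positive to allow the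
  division and are decreased to the norms later.\<close>

lemma lp_norm_triangle_finite:
  fixes f g :: "'i \<Rightarrow> complex"
  assumes p: "1 \<le> p" and F: "finite F" and ab: "0 < a" "0 < b"
    and f: "lp_norm p F f \<le> a" and g: "lp_norm p F g \<le> b"
  shows "lp_norm p F (\<lambda>i. f i + g i) \<le> a + b"
proof (cases "p = \<infinity>")
  case True
  have "norm (f i) \<le> a" "norm (g i) \<le> b" if "i \<in> F" for i
    using norm_le_lp_norm[OF p in_lp_finite[OF F] that] f g by (meson order_trans)+
  then have "\<forall>i\<in>F. norm (f i + g i) \<le> a + b" by (meson add_mono norm_triangle_ineq order_trans)
  then show ?thesis using lp_norm_inf_le[of "a + b" F "\<lambda>i. f i + g i"] ab True by auto
next
  case False
  define q where "q = enn2real p"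
  have q: "1 \<le> q" unfolding q_def using p False
    by (metis enn2real_1 enn2real_mono infinity_ennreal_def less_top)
  have fs: "(\<Sum>i\<in>F. norm (f i) powr q) \<le> a powr q" and gs: "(\<Sum>i\<in>F. norm (g i) powr q) \<le> b powr q"
    using lp_norm_le_powr[OF p False F, THEN iffD1, OF _ f] lp_norm_le_powr[OF p False F, THEN iffD1, OF _ g] ab
    by (simp_all add: q_def)
  define t where "t = b / (a + b)"
  have t: "0 \<le> t" "t \<le> 1" "1 - t = a / (a + b)" using ab by (auto simp: t_def field_simps)
  have "norm (f i + g i) powr q
      \<le> (a + b) powr q * ((1 - t) * (norm (f i) powr q / a powr q) + t * (norm (g i) powr q / b powr q))" for i
  proof -
    have "norm (f i + g i) \<le> norm (f i) + norm (g i)" by (rule norm_triangle_ineq)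
    also have "\<dots> = (a + b) * ((1 - t) * (norm (f i) / a) + t * (norm (g i) / b))"
    proof -
      have "(a / (a + b)) * (norm (f i) / a) = norm (f i) / (a + b)"
        "(b / (a + b)) * (norm (g i) / b) = norm (g i) / (a + b)" using ab by simp_all
      then have "(1 - t) * (norm (f i) / a) + t * (norm (g i) / b) = (norm (f i) + norm (g i)) / (a + b)"
        unfolding t(3) unfolding t_def by (simp only: add_divide_distrib)
      then show ?thesis using ab by simp
    qed
    finally have "norm (f i + g i) powr q \<le> ((a + b) * ((1 - t) * (norm (f i) / a) + t * (norm (g i) / b))) powr q"
      using q by (intro powr_mono2) auto
    also have "\<dots> = (a + b) powr q * ((1 - t) * (norm (f i) / a) + t * (norm (g i) / b)) powr q"
      using ab t by (intro powr_mult)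
    also have "\<dots> \<le> (a + b) powr q * ((1 - t) * (norm (f i) / a) powr q + t * (norm (g i) / b) powr q)"
      using ab t q by (intro mult_left_mono powr_convex_combination) auto
    finally show ?thesis using ab by (simp add: powr_divide)
  qed
  then have "(\<Sum>i\<in>F. norm (f i + g i) powr q) \<le>
      (\<Sum>i\<in>F. (a + b) powr q * ((1 - t) * (norm (f i) powr q / a powr q) + t * (norm (g i) powr q / b powr q)))"
    by (rule sum_mono)
  also have "\<dots> = (a + b) powr q * ((1 - t) * ((\<Sum>i\<in>F. norm (f i) powr q) / a powr q)
      + t * ((\<Sum>i\<in>F. norm (g i) powr q) / b powr q))"
    by (simp only: sum_distrib_left[symmetric] sum.distrib sum_divide_distrib[symmetric])
  also have "\<dots> \<le> (a + b) powr q * ((1 - t) * 1 + t * 1)"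
    using fs gs ab t by (intro mult_left_mono add_mono) auto
  finally show ?thesis
    using lp_norm_le_powr[OF p False F, of "a + b" "\<lambda>i. f i + g i"] ab by (simp add: q_def)
qed

lemma lp_add:
  fixes f g :: "'i \<Rightarrow> complex"
  assumes p: "1 \<le> p" and f: "in_lp p I f" and g: "in_lp p I g"
  shows "in_lp p I (\<lambda>i. f i + g i)" "lp_norm p I (\<lambda>i. f i + g i) \<le> lp_norm p I f + lp_norm p I g"
proof -
  have n: "0 \<le> lp_norm p I f + lp_norm p I g" by (intro add_nonneg_nonneg lp_norm_nonneg f g)
  have "lp_norm p F (\<lambda>i. f i + g i) \<le> lp_norm p I f + lp_norm p I g" if F: "finite F" "F \<subseteq> I" for F
  proof (rule field_le_epsilon)
    fix e :: real assume e: "0 < e"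
    have "lp_norm p F (\<lambda>i. f i + g i) \<le> (lp_norm p I f + e / 2) + (lp_norm p I g + e / 2)"
      using lp_norm_finite_le[OF p f F] lp_norm_finite_le[OF p g F] e lp_norm_nonneg[OF f] lp_norm_nonneg[OF g]
      by (intro lp_norm_triangle_finite[OF p F(1)]) linarith+
    then show "lp_norm p F (\<lambda>i. f i + g i) \<le> lp_norm p I f + lp_norm p I g + e" by simp
  qed
  from lp_leI[OF p n this] show "in_lp p I (\<lambda>i. f i + g i)"
    "lp_norm p I (\<lambda>i. f i + g i) \<le> lp_norm p I f + lp_norm p I g" by blast+
qed

lemma lp_scale:
  fixes f :: "'i \<Rightarrow> complex"
  assumes p: "1 \<le> p" and f: "in_lp p I f"
  shows "in_lp p I (\<lambda>i. c * f i)" "lp_norm p I (\<lambda>i. c * f i) = cmod c * lp_norm p I f"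
proof -
  have 1: "in_lp p I (\<lambda>i. c * f i)" "lp_norm p I (\<lambda>i. c * f i) \<le> cmod c * lp_norm p I f"
    if "in_lp p I f" for c and f :: "'i \<Rightarrow> complex"
    using lp_mono[OF p that, of "cmod c" "\<lambda>i. c * f i"] by (auto simp: norm_mult)
  show in1: "in_lp p I (\<lambda>i. c * f i)" by (rule 1[OF f])
  show "lp_norm p I (\<lambda>i. c * f i) = cmod c * lp_norm p I f"
  proof (cases "c = 0")
    case True
    then show ?thesis using lp_norm_zero[OF p, of I, where 'b = complex] by simp
  next
    case False
    then have "lp_norm p I f \<le> inverse (cmod c) * lp_norm p I (\<lambda>i. c * f i)"
      using 1(2)[OF in1, of "inverse c"] by (simp add: norm_inverse mult.assoc[symmetric])
    then show ?thesis using 1(2)[OF f, of c] False by (simp add: field_simps)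
  qed
qed

subsection \<open>Completeness\<close>

lemma lp_space_simps [simp]:
  "carrier (lp_space p I) = {f. (\<forall>i. i \<notin> I \<longrightarrow> f i = 0) \<and> in_lp p I f}"
  "vadd (lp_space p I) = (\<lambda>f g i. f i + g i)"
  "vzero (lp_space p I) = (\<lambda>i. 0)"
  "vscale (lp_space p I) = (\<lambda>c f i. c * f i)"
  "vnorm (lp_space p I) = lp_norm p I"
  by (simp_all add: lp_space_def)

lemma vdiff_lp_space [simp]: "vdiff (lp_space p I) f g = (\<lambda>i. f i - g i)"
  by (simp add: vdiff_def)

lemma lp_space_normed:
  assumes p: "1 \<le> p"
  shows "complex_normed_space (lp_space p I)"
proof unfold_locales
  fix f assume f: "f \<in> carrier (lp_space p I)"
  show "vnorm (lp_space p I) f = 0 \<longleftrightarrow> f = vzero (lp_space p I)"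
  proof
    assume 0: "vnorm (lp_space p I) f = 0"
    have "f i = 0" for i
      using f norm_le_lp_norm[OF p, of I f i] 0 by (cases "i \<in> I") auto
    then show "f = vzero (lp_space p I)" by (simp add: fun_eq_iff)
  qed (simp add: lp_norm_zero[OF p, of I, where 'b = complex])
qed (use lp_add[OF p] lp_scale[OF p] in
    \<open>auto simp: in_lp_zero lp_norm_nonneg algebra_simps fun_eq_iff\<close>)

text \<open>The limit is taken coordinatewise; norm estimates survive because they are tested on finite sets of
  coordinates.\<close>

lemma lp_space_banach:
  assumes p: "1 \<le> p"
  shows "complex_banach_space (lp_space p I)"
proof -
  let ?L = "lp_space p I"
  interpret complex_normed_space ?L by (rule lp_space_normed[OF p])
  show ?thesis
  proof unfold_locales
    fix \<sigma> :: "nat \<Rightarrow> 'a \<Rightarrow> complex"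
    assume "range \<sigma> \<subseteq> carrier ?L"
    then have \<sigma>: "\<sigma> n \<in> carrier ?L" for n by blast
    assume "\<forall>e>0. \<exists>N. \<forall>m\<ge>N. \<forall>n\<ge>N. vnorm ?L (vdiff ?L (\<sigma> m) (\<sigma> n)) < e"
    then have C: "\<exists>N. \<forall>m\<ge>N. \<forall>n\<ge>N. lp_norm p I (\<lambda>i. \<sigma> m i - \<sigma> n i) < e" if "0 < e" for e
      using that by simp
    have din: "in_lp p I (\<lambda>i. \<sigma> m i - \<sigma> n i)" for m n
      using vdiff_closed[OF \<sigma> \<sigma>, of m n] by simp
    have "Cauchy (\<lambda>n. \<sigma> n i)" if "i \<in> I" for i
      unfolding Cauchy_def dist_norm
      using C norm_le_lp_norm[OF p din that] by (meson order.strict_trans1)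
    then have "\<exists>l. (\<lambda>n. \<sigma> n i) \<longlonglongrightarrow> l" if "i \<in> I" for i
      using that Cauchy_convergent convergent_def by blast
    then obtain l where l: "\<And>i. i \<in> I \<Longrightarrow> (\<lambda>n. \<sigma> n i) \<longlonglongrightarrow> l i" by metis
    define f where "f = (\<lambda>i. if i \<in> I then l i else 0)"
    have lim: "(\<lambda>n. \<sigma> n i) \<longlonglongrightarrow> f i" if "i \<in> I" for i using l that by (simp add: f_def)
    have close: "\<exists>N. \<forall>m\<ge>N. in_lp p I (\<lambda>i. \<sigma> m i - f i) \<and> lp_norm p I (\<lambda>i. \<sigma> m i - f i) \<le> e"
      if e: "0 < e" for e
    proof -
      obtain N where N: "\<forall>m\<ge>N. \<forall>n\<ge>N. lp_norm p I (\<lambda>i. \<sigma> m i - \<sigma> n i) < e" using C[OF e] by blast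
      have "lp_norm p F (\<lambda>i. \<sigma> m i - f i) \<le> e" if m: "m \<ge> N" and F: "finite F" "F \<subseteq> I" for m F
      proof -
        have bd: "lp_norm p F (\<lambda>i. \<sigma> m i - \<sigma> n i) \<le> e" if "n \<ge> N" for n
          using lp_norm_finite_le[OF p din F, of m n] N m that by (meson less_imp_le order_trans)
        have lm: "(\<lambda>n. norm (\<sigma> m i - \<sigma> n i)) \<longlonglongrightarrow> norm (\<sigma> m i - f i)" if "i \<in> F" for i
          using F that by (intro tendsto_intros lim) auto
        show ?thesis
        proof (cases "p = \<infinity>")
          case True
          have "norm (\<sigma> m i - f i) \<le> e" if i: "i \<in> F" for i
          proof (rule LIMSEQ_le_const2[OF lm[OF i]])
            show "\<exists>N. \<forall>n\<ge>N. norm (\<sigma> m i - \<sigma> n i) \<le> e"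
              using bd norm_le_lp_norm[OF p in_lp_finite[OF F(1)] i] by (meson order_trans)
          qed
          then show ?thesis using lp_norm_inf_le[of e F] True e by force
        next
          case False
          have q: "0 < enn2real p" by (rule enn2real_exponent_pos[OF p False])
          have "(\<lambda>n. \<Sum>i\<in>F. norm (\<sigma> m i - \<sigma> n i) powr enn2real p)
              \<longlonglongrightarrow> (\<Sum>i\<in>F. norm (\<sigma> m i - f i) powr enn2real p)"
            using q by (intro tendsto_sum tendsto_powr' lm tendsto_const) auto
          then have "(\<Sum>i\<in>F. norm (\<sigma> m i - f i) powr enn2real p) \<le> e powr enn2real p"
            by (rule LIMSEQ_le_const2)
              (use lp_norm_le_powr[OF p False F(1) less_imp_le[OF e], THEN iffD1, OF bd] in \<open>auto intro!: exI[of _ N]\<close>)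
          then show ?thesis by (rule iffD2[OF lp_norm_le_powr[OF p False F(1) less_imp_le[OF e]]])
        qed
      qed
      then have "in_lp p I (\<lambda>i. \<sigma> m i - f i) \<and> lp_norm p I (\<lambda>i. \<sigma> m i - f i) \<le> e" if "m \<ge> N" for m
        using lp_le_iff_finite[OF p less_imp_le[OF e], of I] that by blast
      then show ?thesis by blast
    qed
    obtain N where N: "in_lp p I (\<lambda>i. \<sigma> N i - f i)" using close[of 1] by auto
    have "in_lp p I (\<lambda>i. \<sigma> N i + (- 1) * (\<sigma> N i - f i))"
      using \<sigma>[of N] by (intro lp_add(1) lp_scale(1) p N) auto
    then have fc: "f \<in> carrier ?L" by (simp add: f_def)
    have "(\<lambda>n. vnorm ?L (vdiff ?L (\<sigma> n) f)) \<longlonglongrightarrow> 0"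
    proof (rule LIMSEQ_I)
      fix r :: real assume r: "0 < r"
      then obtain N where N: "\<forall>m\<ge>N. in_lp p I (\<lambda>i. \<sigma> m i - f i) \<and> lp_norm p I (\<lambda>i. \<sigma> m i - f i) \<le> r / 2"
        using close[of "r / 2"] by auto
      have "norm (vnorm ?L (vdiff ?L (\<sigma> n) f) - 0) < r" if "n \<ge> N" for n
        using N that lp_norm_nonneg[of p I "\<lambda>i. \<sigma> n i - f i"] r by force
      then show "\<exists>no. \<forall>n\<ge>no. norm (vnorm ?L (vdiff ?L (\<sigma> n) f) - 0) < r" by blast
    qed
    then show "\<exists>x\<in>carrier ?L. (\<lambda>n. vnorm ?L (vdiff ?L (\<sigma> n) x)) \<longlonglongrightarrow> 0" using fc by blast
  qed
qed


subsection \<open>Direct sums over disjoint families\<close>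

lemma infsum_disjoint_Union:
  fixes f :: "'i \<Rightarrow> real"
  assumes "f summable_on (\<Union>v\<in>V. F v)" and disj: "disjoint_family_on F V"
  shows "infsum f (\<Union>v\<in>V. F v) = (\<Sum>\<^sub>\<infinity>v\<in>V. infsum f (F v))"
proof -
  have inj: "inj_on snd (Sigma V F)"
    using disj by (force simp: disjoint_family_on_def inj_on_def)
  have im: "snd ` Sigma V F = (\<Union>v\<in>V. F v)" by force
  have "infsum f (\<Union>v\<in>V. F v) = infsum (f \<circ> snd) (Sigma V F)"
    using infsum_reindex[OF inj, of f] by (simp add: im)
  moreover have "(f \<circ> snd) summable_on Sigma V F"
    using assms(1) summable_on_reindex[OF inj, of f] by (simp add: im)
  ultimately show ?thesis using infsum_Sigma_banach[of "f \<circ> snd" V F] by simp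
qed

text \<open>A sum over a disjoint union is an iterated sum. It identifies the \<open>\<ell>\<^sup>p\<close>-sums over fibres with one space
  of functions on all points.\<close>

lemma lp_disjoint_Union:
  fixes f :: "'i \<Rightarrow> complex"
  assumes p: "1 \<le> p" and disj: "disjoint_family_on F V"
  shows "in_lp p (\<Union>v\<in>V. F v) f \<longleftrightarrow> (\<forall>v\<in>V. in_lp p (F v) f) \<and> in_lp p V (\<lambda>v. lp_norm p (F v) f)"
    and "in_lp p (\<Union>v\<in>V. F v) f \<Longrightarrow> lp_norm p V (\<lambda>v. lp_norm p (F v) f) = lp_norm p (\<Union>v\<in>V. F v) f"
proof -
  let ?U = "\<Union>v\<in>V. F v" and ?N = "\<lambda>v. lp_norm p (F v) f"
  have sub: "in_lp p (F v) f" "?N v \<le> lp_norm p ?U f" if "in_lp p ?U f" "v \<in> V" for v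
    using lp_subset[OF p that(1), of "F v"] that(2) by auto
  have "(in_lp p ?U f \<longleftrightarrow> (\<forall>v\<in>V. in_lp p (F v) f) \<and> in_lp p V ?N) \<and> (in_lp p ?U f \<longrightarrow> lp_norm p V ?N = lp_norm p ?U f)"
  proof (cases "p = \<infinity>")
    case True
    have 1: "in_lp p V ?N \<and> lp_norm p V ?N \<le> lp_norm p ?U f" if U: "in_lp p ?U f"
    proof -
      have "\<forall>v\<in>V. norm (?N v) \<le> lp_norm p ?U f"
        using sub[OF U] lp_norm_nonneg[OF sub(1)[OF U]] by auto
      then show ?thesis using lp_norm_inf_le[OF lp_norm_nonneg[OF U], of V ?N] True by simp
    qed
    have 2: "in_lp p ?U f \<and> lp_norm p ?U f \<le> lp_norm p V ?N"
      if F: "\<forall>v\<in>V. in_lp p (F v) f" and V: "in_lp p V ?N"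
    proof -
      have "norm (f i) \<le> lp_norm p V ?N" if "v \<in> V" "i \<in> F v" for v i
        using norm_le_lp_norm[OF p F[rule_format, OF that(1)] that(2)] norm_le_lp_norm[OF p V that(1)] by simp
      then show ?thesis using lp_norm_inf_le[OF lp_norm_nonneg[OF V], of ?U f] True by auto
    qed
    show ?thesis using 1 2 sub(1) by (meson order_antisym)
  next
    case False
    have q: "0 < enn2real p" by (rule enn2real_exponent_pos[OF p False])
    let ?g = "\<lambda>i. norm (f i) powr enn2real p"
    have Npow: "norm (?N v) powr enn2real p = infsum ?g (F v)" for v
    proof -
      have "0 \<le> infsum ?g (F v)" by (intro infsum_nonneg) simp
      then show ?thesis using False q by (simp add: lp_norm_def powr_powr)
    qed
    have iff: "?g summable_on ?U \<longleftrightarrow> (\<lambda>v. infsum ?g (F v)) summable_on V" if "\<forall>v\<in>V. in_lp p (F v) f"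
      using that False by (intro summable_on_Union_iff disj) (auto simp: in_lp_def)
    have eq: "lp_norm p V ?N = lp_norm p ?U f" if "in_lp p ?U f"
    proof -
      have "infsum ?g ?U = (\<Sum>\<^sub>\<infinity>v\<in>V. infsum ?g (F v))"
        using that False by (intro infsum_disjoint_Union disj) (simp add: in_lp_def)
      then show ?thesis using False unfolding lp_norm_def[of p V] Npow by (simp add: lp_norm_def)
    qed
    have "in_lp p ?U f \<longleftrightarrow> in_lp p V ?N" if "\<forall>v\<in>V. in_lp p (F v) f"
      using iff[OF that] False unfolding in_lp_def[of p V] Npow by (simp add: in_lp_def)
    then show ?thesis using eq sub(1) by blast
  qed
  then show "in_lp p ?U f \<longleftrightarrow> (\<forall>v\<in>V. in_lp p (F v) f) \<and> in_lp p V ?N"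
    "in_lp p ?U f \<Longrightarrow> lp_norm p V ?N = lp_norm p ?U f" by blast+
qed

lemma lp_sum_alt:
  assumes "1 \<le> p" "disjoint_family_on F V"
  shows "carrier (lp_sum p V F) = carrier (lp_space p (\<Union>v\<in>V. F v))"
    "vadd (lp_sum p V F) = (\<lambda>f g i. f i + g i)" "vzero (lp_sum p V F) = (\<lambda>i. 0)"
    "vscale (lp_sum p V F) = (\<lambda>c f i. c * f i)"
    "f \<in> carrier (lp_space p (\<Union>v\<in>V. F v)) \<Longrightarrow> vnorm (lp_sum p V F) f = lp_norm p (\<Union>v\<in>V. F v) f"
  using lp_disjoint_Union[OF assms] by (auto simp: lp_sum_def)

lemma lp_reindex:
  assumes "bij_betw m J I"
  shows "in_lp p J (\<lambda>j. f (m j)) \<longleftrightarrow> in_lp p I f" "lp_norm p J (\<lambda>j. f (m j)) = lp_norm p I f"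
proof -
  have im: "m ` J = I" using assms by (simp add: bij_betw_def)
  have "(\<lambda>j. f (m j)) ` J = f ` I" "(\<lambda>j. norm (f (m j))) ` J = (\<lambda>i. norm (f i)) ` I"
    unfolding im[symmetric] by (simp_all add: image_image)
  then show "in_lp p J (\<lambda>j. f (m j)) \<longleftrightarrow> in_lp p I f" "lp_norm p J (\<lambda>j. f (m j)) = lp_norm p I f"
    using summable_on_reindex_bij_betw[OF assms, of "\<lambda>i. norm (f i) powr enn2real p"]
      infsum_reindex_bij_betw[OF assms, of "\<lambda>i. norm (f i) powr enn2real p"]
    by (simp_all add: in_lp_def lp_norm_def)
qed

text \<open>A matrix with at most one nonzero entry in each row and in each column.\<close>

lemma lp_partial_injection:
  fixes f g :: "_ \<Rightarrow> complex"
  assumes p: "1 \<le> p" and g: "in_lp p I g" and M: "0 \<le> M"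
    and m: "inj_on m D" "m ` D \<subseteq> I"
    and le: "\<And>j. \<lbrakk>j \<in> J; j \<in> D\<rbrakk> \<Longrightarrow> norm (f j) \<le> M * norm (g (m j))"
    and z: "\<And>j. \<lbrakk>j \<in> J; j \<notin> D\<rbrakk> \<Longrightarrow> f j = 0"
  shows "in_lp p J f" "lp_norm p J f \<le> M * lp_norm p I g"
proof -
  have n: "0 \<le> M * lp_norm p I g" using M lp_norm_nonneg[OF g] by simp
  have "lp_norm p F f \<le> M * lp_norm p I g" if F: "finite F" "F \<subseteq> J" for F
  proof -
    let ?h = "\<lambda>j. if j \<in> D then g (m j) else 0"
    have 1: "lp_norm p F f \<le> M * lp_norm p F ?h"
      by (rule lp_mono(2)[OF p in_lp_finite[OF F(1)] M]) (use le z F in \<open>auto simp: subset_iff\<close>)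
    have "lp_norm p F ?h \<le> lp_norm p I g"
    proof -
      have b: "bij_betw m (F \<inter> D) (m ` (F \<inter> D))"
        using m(1) by (auto simp: bij_betw_def inj_on_def)
      have "lp_norm p F ?h \<le> lp_norm p (F \<inter> D) ?h"
      proof (cases "p = \<infinity>")
        case False
        have "(\<Sum>j\<in>F. norm (?h j) powr enn2real p) = (\<Sum>j\<in>F \<inter> D. norm (?h j) powr enn2real p)"
          using F(1) by (intro sum.mono_neutral_right) auto
        then show ?thesis using lp_norm_finite[OF F(1) False, of ?h] lp_norm_finite[OF _ False, of "F \<inter> D" ?h] F(1)
          by simp
      next
        case True
        have c: "0 \<le> lp_norm p (F \<inter> D) ?h" using F(1) by (intro lp_norm_nonneg in_lp_finite) auto
        have "\<forall>i\<in>F. norm (?h i) \<le> lp_norm p (F \<inter> D) ?h"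
          using norm_le_lp_norm[OF p in_lp_finite, of "F \<inter> D" _ ?h] F(1) c by auto
        then show ?thesis using lp_norm_inf_le[OF c, of F ?h] True by simp
      qed
      also have "\<dots> = lp_norm p (F \<inter> D) (\<lambda>j. g (m j))" by (rule lp_norm_cong) auto
      also have "\<dots> = lp_norm p (m ` (F \<inter> D)) g" by (rule lp_reindex(2)[OF b])
      also have "\<dots> \<le> lp_norm p I g" using m(2) by (intro lp_subset(2)[OF p g]) auto
      finally show ?thesis .
    qed
    then show ?thesis using 1 M by (meson mult_left_mono order_trans)
  qed
  from lp_leI[OF p n this] show "in_lp p J f" "lp_norm p J f \<le> M * lp_norm p I g" by blast+
qed

section \<open>Compactly supported functions\<close>

lemma continuous_map_apply:
  assumes "continuous_map X euclidean f" "continuous_on UNIV h"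
  shows "continuous_map X euclidean (\<lambda>x. h (f x))"
  using continuous_map_compose[OF assms(1), of euclidean h] assms(2) by (simp add: o_def)

lemma continuous_map_apply2:
  fixes f :: "'a \<Rightarrow> 'b::topological_space" and g :: "'a \<Rightarrow> 'c::topological_space"
  assumes "continuous_map X euclidean f" "continuous_map X euclidean g"
    and "continuous_on UNIV (\<lambda>p. h (fst p) (snd p))"
  shows "continuous_map X euclidean (\<lambda>x. h (f x) (g x))"
proof -
  have "continuous_map X euclidean (\<lambda>x. (f x, g x))"
    using continuous_map_pairedI[OF assms(1,2)] by (simp add: euclidean_product_topology)
  from continuous_map_apply[OF this assms(3)] show ?thesis by simp
qed

lemma Cc_onI:
  assumes U: "openin X U" "Hausdorff_space (subtopology X U)"
    and f: "continuous_map (subtopology X U) euclidean f"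
    and K: "compactin X K" "K \<subseteq> U" "\<And>x. x \<notin> K \<Longrightarrow> f x = 0"
  shows "f \<in> Cc_on X U"
proof -
  have KU: "compactin (subtopology X U) K" using K(1,2) by (simp add: compactin_subtopology)
  have cl: "closedin (subtopology X U) K" by (rule compactin_imp_closedin[OF U(2) KU])
  have "subtopology X U closure_of {x \<in> U. f x \<noteq> 0} \<subseteq> K"
    using K(3) by (intro closure_of_minimal cl) auto
  then have "compactin (subtopology X U) (subtopology X U closure_of {x \<in> U. f x \<noteq> 0})"
    by (intro closed_compactin[OF KU]) auto
  then show ?thesis using f K by (auto simp: Cc_on_def)
qed

lemma Cc_onD:
  assumes "f \<in> Cc_on X U" "openin X U"
  obtains K where "compactin X K" "K \<subseteq> U" "\<And>x. x \<notin> K \<Longrightarrow> f x = 0"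
proof -
  define K where "K = subtopology X U closure_of {x \<in> U. f x \<noteq> 0}"
  have U: "U \<subseteq> topspace X" using assms(2) by (rule openin_subset)
  have K: "compactin X K" "K \<subseteq> U"
    using assms(1) by (auto simp: Cc_on_def K_def compactin_subtopology)
  have "{x \<in> U. f x \<noteq> 0} \<subseteq> K"
    unfolding K_def using U by (intro closure_of_subset) auto
  then have "f x = 0" if "x \<notin> K" for x using that assms(1) by (auto simp: Cc_on_def)
  with K show ?thesis using that by blast
qed

lemma Cc_on_continuous: "f \<in> Cc_on X U \<Longrightarrow> continuous_map (subtopology X U) euclidean f"
  by (simp add: Cc_on_def)

lemma Cc_on_outside: "f \<in> Cc_on X U \<Longrightarrow> x \<notin> U \<Longrightarrow> f x = 0"
  by (simp add: Cc_on_def)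

lemma Cc_on_mono:
  assumes f: "f \<in> Cc_on X U" and U: "openin X U" and UV: "U \<subseteq> V"
    and V: "openin X V" "Hausdorff_space (subtopology X V)"
  shows "f \<in> Cc_on X V"
proof -
  obtain K where K: "compactin X K" "K \<subseteq> U" "\<And>x. x \<notin> K \<Longrightarrow> f x = 0" using Cc_onD[OF f U] by metis
  have "closedin (subtopology X V) K"
    using K(1,2) UV by (intro compactin_imp_closedin V) (auto simp: compactin_subtopology)
  then have o: "openin X (V - K)" using V(1) by (metis openin_diff openin_trans_full openin_topspace topspace_subtopology_subset openin_subset)
  have "continuous_map (subtopology X V) euclidean f"
    unfolding continuous_map_def
  proof (intro conjI allI impI)
    fix S :: "complex set" assume S: "openin euclidean S"
    have "openin (subtopology X U) {x \<in> topspace (subtopology X U). f x \<in> S}"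
      by (rule openin_continuous_map_preimage[OF Cc_on_continuous[OF f] S])
    then have oU: "openin X {x \<in> U. f x \<in> S}"
      using U openin_subset[OF U] by (simp add: openin_open_subtopology Int_absorb1)
    have "{x \<in> V. f x \<in> S} = {x \<in> U. f x \<in> S} \<union> (if 0 \<in> S then V - K else {})"
    proof -
      have nz: "x \<in> U" if "f x \<noteq> 0" for x using K(2,3) that by blast
      show ?thesis by (rule set_eqI, cases "0 \<in> S") (use nz K(2,3) UV in \<open>simp, metis subsetD\<close>)+
    qed
    then have "openin X {x \<in> V. f x \<in> S}" using oU o by auto
    then show "openin (subtopology X V) {x \<in> topspace (subtopology X V). f x \<in> S}"
      using V(1) openin_subset[OF V(1)] by (simp add: openin_open_subtopology Int_absorb1)
  qed auto
  then show ?thesis using Cc_onI[OF V _ K(1)] K UV by auto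
qed

lemma Cc_on_times:
  assumes U: "openin X U" "Hausdorff_space (subtopology X U)" and f: "f \<in> Cc_on X U"
    and g: "continuous_map (subtopology X U) euclidean g"
  shows "(\<lambda>x. f x * g x) \<in> Cc_on X U"
proof -
  obtain K where K: "compactin X K" "K \<subseteq> U" "\<And>x. x \<notin> K \<Longrightarrow> f x = 0" using Cc_onD[OF f U(1)] by metis
  have "continuous_map (subtopology X U) euclidean (\<lambda>x. f x * g x)"
    by (rule continuous_map_apply2[where h = times, OF Cc_on_continuous[OF f] g]) (intro continuous_intros)
  then show ?thesis using K by (intro Cc_onI[OF U _ K(1,2)]) auto
qed

subsection \<open>Locally compact, locally Hausdorff spaces\<close>

definition locally_LCH :: "'a topology \<Rightarrow> bool" where
  "locally_LCH X \<longleftrightarrow> (\<forall>x\<in>topspace X. \<exists>W. openin X W \<and> x \<in> W \<and>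
     Hausdorff_space (subtopology X W) \<and> locally_compact_space (subtopology X W))"

lemma Hausdorff_subset:
  "Hausdorff_space (subtopology X U) \<Longrightarrow> V \<subseteq> U \<Longrightarrow> Hausdorff_space (subtopology X V)"
  by (metis Hausdorff_space_subtopology inf.absorb_iff2 subtopology_subtopology)

lemma locally_LCH_open_Hausdorff:
  assumes X: "locally_LCH X" and U: "openin X U" "Hausdorff_space (subtopology X U)"
  shows "locally_compact_space (subtopology X U)"
  unfolding locally_compact_space_def
proof
  fix x assume "x \<in> topspace (subtopology X U)"
  then have x: "x \<in> topspace X" "x \<in> U" by auto
  obtain W where W: "openin X W" "x \<in> W" "Hausdorff_space (subtopology X W)"
    "locally_compact_space (subtopology X W)"
    using X x(1) unfolding locally_LCH_def by blast
  have o: "openin (subtopology X W) (W \<inter> U)" using U(1) by (simp add: openin_subtopology_Int2)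
  have "locally_compact_space (subtopology (subtopology X W) (W \<inter> U))"
    by (intro locally_compact_space_open_subset o W(4)) (simp add: W(3))
  then have "locally_compact_space (subtopology X (W \<inter> U))" by (simp add: subtopology_subtopology)
  then obtain V K where V: "openin (subtopology X (W \<inter> U)) V" "compactin (subtopology X (W \<inter> U)) K" "x \<in> V" "V \<subseteq> K"
    using x W(2) unfolding locally_compact_space_def by (auto dest!: bspec[of _ _ x])
  have "openin X V" "V \<subseteq> U"
    using V(1) W(1) U(1) by (auto simp: openin_open_subtopology openin_Int)
  then have "openin (subtopology X U) V" using U(1) by (simp add: openin_open_subtopology)
  moreover have "compactin (subtopology X U) K" using V(2) by (simp add: compactin_subtopology)
  ultimately show "\<exists>V K. openin (subtopology X U) V \<and> compactin (subtopology X U) K \<and> x \<in> V \<and> V \<subseteq> K"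
    using V(3,4) by blast
qed

definition bump :: "'a topology \<Rightarrow> 'a set \<Rightarrow> ('a \<Rightarrow> real) \<Rightarrow> bool" where
  "bump X U \<kappa> \<longleftrightarrow> (\<lambda>x. complex_of_real (\<kappa> x)) \<in> Cc_on X U \<and> (\<forall>x. 0 \<le> \<kappa> x \<and> \<kappa> x \<le> 1)"

lemma bump_continuous:
  assumes "bump X U \<kappa>" shows "continuous_map (subtopology X U) euclideanreal \<kappa>"
proof -
  have "continuous_map (subtopology X U) euclideanreal (\<lambda>x. Re (complex_of_real (\<kappa> x)))"
    using assms by (intro continuous_map_apply[where h = Re] Cc_on_continuous)
      (auto simp: bump_def intro: continuous_intros)
  then show ?thesis by simp
qed

lemma bump_mono:
  "\<lbrakk>bump X U \<kappa>; openin X U; U \<subseteq> V; openin X V; Hausdorff_space (subtopology X V)\<rbrakk> \<Longrightarrow> bump X V \<kappa>"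
  unfolding bump_def using Cc_on_mono by blast

lemma bump_outside: "bump X U \<kappa> \<Longrightarrow> x \<notin> U \<Longrightarrow> \<kappa> x = 0"
  unfolding bump_def using Cc_on_outside[of _ X U x] by fastforce

text \<open>Open Hausdorff sets are locally compact, hence completely regular.\<close>

lemma bump_at_point:
  assumes X: "locally_LCH X" and U: "openin X U" "Hausdorff_space (subtopology X U)" and x: "x \<in> U"
  shows "\<exists>\<kappa>. bump X U \<kappa> \<and> \<kappa> x = 1"
proof -
  let ?Y = "subtopology X U"
  have UX: "U \<subseteq> topspace X" by (rule openin_subset[OF U(1)])
  have tY: "topspace ?Y = U" using UX by auto
  have lc: "locally_compact_space ?Y" by (rule locally_LCH_open_Hausdorff[OF X U])
  have cr: "completely_regular_space ?Y"
    using locally_compact_regular_imp_completely_regular_space[OF lc] U(2) by blast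
  obtain V K where V: "openin ?Y V" "compactin ?Y K" "x \<in> V" "V \<subseteq> K"
    using lc x tY unfolding locally_compact_space_def by auto
  have "closedin ?Y (U - V)" using V(1) tY by (metis closedin_def openin_closedin_eq)
  then obtain f :: "'a \<Rightarrow> real" where f: "continuous_map ?Y (top_of_set {0..1}) f" "f x = 0" "f ` (U - V) \<subseteq> {1}"
    using cr x V(3) tY unfolding completely_regular_space_def by (metis DiffD2 DiffI)
  \<comment> \<open>Outside the relatively compact \<open>V\<close> the separating function is \<open>1\<close>.\<close>
  define \<kappa> where "\<kappa> = (\<lambda>y. if y \<in> U then 1 - f y else 0)"
  have fc: "continuous_map ?Y euclideanreal f" and f01: "\<And>y. y \<in> U \<Longrightarrow> 0 \<le> f y \<and> f y \<le> 1"
    using f(1) tY by (auto simp: continuous_map_in_subtopology)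
  have "continuous_map ?Y euclidean (\<lambda>y. complex_of_real (1 - f y))"
    using fc by (intro continuous_map_apply[where h = "\<lambda>t. complex_of_real (1 - t)"]) (auto intro!: continuous_intros)
  then have c: "continuous_map ?Y euclidean (\<lambda>y. complex_of_real (\<kappa> y))"
    by (rule continuous_map_eq) (use tY in \<open>auto simp: \<kappa>_def\<close>)
  have "(\<lambda>y. complex_of_real (\<kappa> y)) \<in> Cc_on X U"
    using V f(3) by (intro Cc_onI[OF U c, of K]) (auto simp: compactin_subtopology \<kappa>_def)
  then show ?thesis using f(2) f01 x by (auto simp: bump_def \<kappa>_def intro!: exI[of _ \<kappa>])
qed

text \<open>Only a lower bound for the sum is recorded: dividing by the maximum of the sum and \<open>1/2\<close> turns such a
  family into a partition of unity on \<open>K\<close> without leaving the continuous functions.\<close>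

lemma compact_bump_cover:
  assumes X: "locally_LCH X" and U: "openin X U" "Hausdorff_space (subtopology X U)"
    and K: "compactin X K" "K \<subseteq> U"
    and B: "\<And>x. x \<in> U \<Longrightarrow> openin X (B x) \<and> x \<in> B x \<and> B x \<subseteq> U"
  shows "\<exists>T \<kappa>. finite T \<and> T \<subseteq> U \<and> (\<forall>t\<in>T. bump X (B t) (\<kappa> t)) \<and>
    (\<forall>x\<in>K. 1 / 2 < (\<Sum>t\<in>T. \<kappa> t x))"
proof -
  have "\<exists>\<kappa>. bump X (B x) \<kappa> \<and> \<kappa> x = 1" if "x \<in> U" for x
    using B[OF that] by (intro bump_at_point X Hausdorff_subset[OF U(2)]) auto
  then obtain \<kappa> where \<kappa>: "\<And>x. x \<in> U \<Longrightarrow> bump X (B x) (\<kappa> x)" "\<And>x. x \<in> U \<Longrightarrow> \<kappa> x x = 1" by metis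
  define Op where "Op = (\<lambda>x. {y \<in> B x. 1 / 2 < \<kappa> x y})"
  have oOp: "openin X (Op x)" if "x \<in> U" for x
  proof -
    have "openin (subtopology X (B x)) {y \<in> topspace (subtopology X (B x)). \<kappa> x y \<in> {1/2<..}}"
      by (rule openin_continuous_map_preimage[OF bump_continuous[OF \<kappa>(1)[OF that]]]) simp
    moreover have "topspace (subtopology X (B x)) = B x" using B[OF that] openin_subset by fastforce
    ultimately have "openin (subtopology X (B x)) (Op x)" by (simp only: Op_def greaterThan_iff)
    then show ?thesis using B[OF that] by (simp add: openin_open_subtopology)
  qed
  have "\<exists>\<F>. finite \<F> \<and> \<F> \<subseteq> Op ` U \<and> K \<subseteq> \<Union>\<F>"
  proof (rule compactinD[OF K(1)])
    show "K \<subseteq> \<Union> (Op ` U)" using K(2) B \<kappa>(2) by (force simp: Op_def)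
  qed (use oOp in auto)
  then obtain T where T: "finite T" "T \<subseteq> U" "K \<subseteq> (\<Union>t\<in>T. Op t)"
    by (metis finite_subset_image)
  show ?thesis
  proof (intro exI[of _ T] exI[of _ \<kappa>] conjI ballI T(1,2))
    show "bump X (B t) (\<kappa> t)" if "t \<in> T" for t using that T(2) \<kappa>(1) by auto
    show "1 / 2 < (\<Sum>t\<in>T. \<kappa> t x)" if xK: "x \<in> K" for x
    proof -
      obtain t where t: "t \<in> T" "x \<in> Op t" using T(3) xK by blast
      have "\<kappa> t x \<le> (\<Sum>t\<in>T. \<kappa> t x)"
        using T \<kappa>(1) t(1) by (intro member_le_sum) (auto simp: bump_def)
      then show ?thesis using t(2) by (simp add: Op_def)
    qed
  qed
qed

lemma bump_on_compact:
  assumes X: "locally_LCH X" and U: "openin X U" "Hausdorff_space (subtopology X U)"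
    and K: "compactin X K" "K \<subseteq> U"
  shows "\<exists>\<kappa>. bump X U \<kappa> \<and> (\<forall>x\<in>K. \<kappa> x = 1)"
proof -
  have "\<exists>T \<kappa>. finite T \<and> T \<subseteq> U \<and> (\<forall>t\<in>T. bump X U (\<kappa> t)) \<and> (\<forall>x\<in>K. 1 / 2 < (\<Sum>t\<in>T. \<kappa> t x))"
    by (rule compact_bump_cover[OF X U K, of "\<lambda>_. U"]) (use U(1) in auto)
  then obtain T and \<kappa> :: "'a \<Rightarrow> 'a \<Rightarrow> real" where "finite T \<and> T \<subseteq> U \<and> (\<forall>t\<in>T. bump X U (\<kappa> t)) \<and>
      (\<forall>x\<in>K. 1 / 2 < (\<Sum>t\<in>T. \<kappa> t x))" by (elim exE)
  then have T: "finite T" "\<And>t. t \<in> T \<Longrightarrow> bump X U (\<kappa> t)" "\<And>x. x \<in> K \<Longrightarrow> 1 / 2 < (\<Sum>t\<in>T. \<kappa> t x)"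
    by auto
  define \<sigma> where "\<sigma> = (\<lambda>x. \<Sum>t\<in>T. \<kappa> t x)"
  have c: "continuous_map (subtopology X U) euclideanreal \<sigma>"
    unfolding \<sigma>_def using T by (intro continuous_map_sum bump_continuous) auto
  have "\<exists>C. compactin X C \<and> C \<subseteq> U \<and> (\<forall>x. x \<notin> C \<longrightarrow> \<kappa> t x = 0)" if "t \<in> T" for t
    using Cc_onD[of "\<lambda>x. complex_of_real (\<kappa> t x)" X U] T(2)[OF that] U(1) unfolding bump_def by (metis of_real_eq_0_iff)
  then obtain C where C: "\<And>t. t \<in> T \<Longrightarrow> compactin X (C t) \<and> C t \<subseteq> U \<and> (\<forall>x. x \<notin> C t \<longrightarrow> \<kappa> t x = 0)" by metis
  have s0: "\<sigma> x = 0" if "x \<notin> (\<Union>t\<in>T. C t)" for x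
    unfolding \<sigma>_def using C that by (intro sum.neutral) auto
  have sn: "0 \<le> \<sigma> x" for x unfolding \<sigma>_def using T(2) by (intro sum_nonneg) (auto simp: bump_def)
  have "continuous_map (subtopology X U) euclidean (\<lambda>x. complex_of_real (min 1 (2 * \<sigma> x)))"
    by (rule continuous_map_apply[OF c]) (intro continuous_intros)
  then have "(\<lambda>x. complex_of_real (min 1 (2 * \<sigma> x))) \<in> Cc_on X U"
    using C T(1) s0 by (intro Cc_onI[OF U, of _ "\<Union>t\<in>T. C t"]) (auto intro!: compactin_Union)
  then have "bump X U (\<lambda>x. min 1 (2 * \<sigma> x))" using sn by (simp add: bump_def)
  moreover have "min 1 (2 * \<sigma> x) = 1" if "x \<in> K" for x using T(3)[OF that] by (simp add: \<sigma>_def)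
  ultimately show ?thesis by blast
qed

subsection \<open>Localising the supports\<close>

lemma fun_space_simps [simp]:
  "carrier (fun_space S) = {f. \<forall>x. x \<notin> S \<longrightarrow> f x = 0}"
  "vadd (fun_space S) = (\<lambda>f g x. f x + g x)"
  "vzero (fun_space S) = (\<lambda>x. 0)"
  "vscale (fun_space S) = (\<lambda>c f x. c * f x)"
  by (simp_all add: fun_space_def)

lemma complex_vspace_fun_space: "complex_vspace (fun_space S)"
  by unfold_locales (auto simp: algebra_simps)

lemma Cc_on_fun_space: "openin X U \<Longrightarrow> Cc_on X U \<subseteq> carrier (fun_space (topspace X))"
  using openin_subset by (fastforce simp: Cc_on_def)

lemma Cspan_subspace: "subspace_of (fun_space (topspace X)) (Cspan X)"
  unfolding Cspan_def
  by (intro subspace_of_lin_span complex_vspace_fun_space) (use Cc_on_fun_space in blast)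

lemma Cspan_add: "\<lbrakk>f \<in> Cspan X; g \<in> Cspan X\<rbrakk> \<Longrightarrow> (\<lambda>x. f x + g x) \<in> Cspan X"
  and Cspan_scale: "f \<in> Cspan X \<Longrightarrow> (\<lambda>x. c * f x) \<in> Cspan X"
  and Cspan_zero: "(\<lambda>x. 0) \<in> Cspan X"
  and Cspan_outside: "f \<in> Cspan X \<Longrightarrow> x \<notin> topspace X \<Longrightarrow> f x = 0"
  using subspace_ofD[OF Cspan_subspace[of X]] by auto

lemma Cspan_Cc_on:
  assumes "openin X U" "Hausdorff_space (subtopology X U)" "f \<in> Cc_on X U"
  shows "f \<in> Cspan X"
  unfolding Cspan_def
proof (rule lin_span_superset[OF complex_vspace_fun_space])
  show "f \<in> \<Union> {Cc_on X U |U. openin X U \<and> Hausdorff_space (subtopology X U)}" using assms by blast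
  show "\<Union> {Cc_on X U |U. openin X U \<and> Hausdorff_space (subtopology X U)} \<subseteq> carrier (fun_space (topspace X))"
    using Cc_on_fun_space by blast
qed

text \<open>A partition of unity subordinate to arbitrarily small open sets cuts a function into pieces
  with small supports.\<close>

lemma Cc_on_split:
  assumes X: "locally_LCH X" and U: "openin X U" "Hausdorff_space (subtopology X U)"
    and f: "f \<in> Cc_on X U" and B: "\<And>x. x \<in> U \<Longrightarrow> openin X (B x) \<and> x \<in> B x \<and> B x \<subseteq> U"
  shows "\<exists>T g. finite T \<and> T \<subseteq> U \<and> (\<forall>t\<in>T. g t \<in> Cc_on X (B t)) \<and> f = (\<lambda>x. \<Sum>t\<in>T. g t x)"
proof -
  obtain K where K: "compactin X K" "K \<subseteq> U" "\<And>x. x \<notin> K \<Longrightarrow> f x = 0" using Cc_onD[OF f U(1)] by metis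
  have "\<exists>T \<kappa>. finite T \<and> T \<subseteq> U \<and> (\<forall>t\<in>T. bump X (B t) (\<kappa> t)) \<and> (\<forall>x\<in>K. 1 / 2 < (\<Sum>t\<in>T. \<kappa> t x))"
    by (rule compact_bump_cover[OF X U K(1,2)]) (rule B)
  then obtain T and \<kappa> :: "'a \<Rightarrow> 'a \<Rightarrow> real" where "finite T \<and> T \<subseteq> U \<and> (\<forall>t\<in>T. bump X (B t) (\<kappa> t)) \<and>
      (\<forall>x\<in>K. 1 / 2 < (\<Sum>t\<in>T. \<kappa> t x))" by (elim exE)
  then have T: "finite T" "T \<subseteq> U" "\<And>t. t \<in> T \<Longrightarrow> bump X (B t) (\<kappa> t)"
    "\<And>x. x \<in> K \<Longrightarrow> 1 / 2 < (\<Sum>t\<in>T. \<kappa> t x)" by auto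
  have BU: "bump X U (\<kappa> t)" if "t \<in> T" for t
    using T(2) that B U by (intro bump_mono[OF T(3)[OF that]]) auto
  define \<sigma> where "\<sigma> = (\<lambda>x. \<Sum>t\<in>T. \<kappa> t x)"
  define g where "g = (\<lambda>t x. complex_of_real (\<kappa> t x) * (f x / complex_of_real (max (\<sigma> x) (1 / 2))))"
  have c: "continuous_map (subtopology X U) euclideanreal \<sigma>"
    unfolding \<sigma>_def using T(1) BU by (intro continuous_map_sum bump_continuous) auto
  have c': "continuous_map (subtopology X U) euclidean (\<lambda>x. complex_of_real (inverse (max (\<sigma> x) (1 / 2))))"
    by (rule continuous_map_apply[OF c]) (intro continuous_intros, auto simp: max_def)
  have q: "continuous_map (subtopology X U) euclidean (\<lambda>x. f x / complex_of_real (max (\<sigma> x) (1 / 2)))"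
  proof -
    have "continuous_map (subtopology X U) euclidean (\<lambda>x. f x * complex_of_real (inverse (max (\<sigma> x) (1 / 2))))"
      by (rule continuous_map_apply2[where h = times, OF Cc_on_continuous[OF f] c']) (intro continuous_intros)
    then show ?thesis by (simp only: divide_inverse of_real_inverse)
  qed
  show ?thesis
  proof (intro exI[of _ T] exI[of _ g] conjI ballI T(1,2))
    show "g t \<in> Cc_on X (B t)" if t: "t \<in> T" for t
      unfolding g_def
    proof (rule Cc_on_times)
      have b: "openin X (B t) \<and> t \<in> B t \<and> B t \<subseteq> U" using B t T(2) by blast
      then show "openin X (B t)" "Hausdorff_space (subtopology X (B t))"
        using Hausdorff_subset[OF U(2)] by auto
      show "(\<lambda>x. complex_of_real (\<kappa> t x)) \<in> Cc_on X (B t)" using T(3)[OF t] by (simp add: bump_def)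
      show "continuous_map (subtopology X (B t)) euclidean (\<lambda>x. f x / complex_of_real (max (\<sigma> x) (1 / 2)))"
        using continuous_map_from_subtopology[OF q, of "B t"] b
        by (simp add: subtopology_subtopology Int_absorb1)
    qed
    show "f = (\<lambda>x. \<Sum>t\<in>T. g t x)"
    proof
      fix x
      have "(\<Sum>t\<in>T. g t x) = complex_of_real (\<sigma> x) * (f x / complex_of_real (max (\<sigma> x) (1 / 2)))"
        unfolding g_def \<sigma>_def of_real_sum sum_distrib_right ..
      also have "\<dots> = f x"
      proof (cases "x \<in> K")
        case True
        then have "1 / 2 < \<sigma> x" using T(4) by (simp only: \<sigma>_def)
        then have "max (\<sigma> x) (1 / 2) = \<sigma> x" "complex_of_real (\<sigma> x) \<noteq> 0" by auto
        then show ?thesis by simp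
      qed (simp add: K(3))
      finally show "f x = (\<Sum>t\<in>T. g t x)" by simp
    qed
  qed
qed

lemma Cspan_induct [consumes 1, case_names zero add]:
  assumes "f \<in> Cspan X" "P (\<lambda>x. 0)"
    and "\<And>f c g U. \<lbrakk>f \<in> Cspan X; P f; openin X U; Hausdorff_space (subtopology X U); g \<in> Cc_on X U\<rbrakk>
      \<Longrightarrow> P (\<lambda>x. f x + c * g x)"
  shows "P f"
  using assms(1)[unfolded Cspan_def]
proof induction
  case zero
  show ?case using assms(2) by simp
next
  case (add x y c)
  then show ?case using assms(3)[of x _ y c] by (auto simp: Cspan_def)
qed

text \<open>Induction over sums of functions supported in arbitrarily small open sets.\<close>

lemma Cspan_induct_small [consumes 2, case_names cover zero add]:
  assumes X: "locally_LCH X" and f: "f \<in> Cspan X"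
    and cover: "\<And>x. x \<in> topspace X \<Longrightarrow> \<exists>B. openin X B \<and> x \<in> B \<and> (\<forall>B'. openin X B' \<longrightarrow> B' \<subseteq> B \<longrightarrow> Q B')"
    and zero: "P (\<lambda>x. 0)"
    and add: "\<And>f c g U. \<lbrakk>f \<in> Cspan X; P f; openin X U; Hausdorff_space (subtopology X U); Q U; g \<in> Cc_on X U\<rbrakk>
      \<Longrightarrow> P (\<lambda>x. f x + c * g x)"
  shows "P f"
  using f
proof (induction rule: Cspan_induct)
  case (add f c g U)
  obtain B0 where B0: "\<And>x. x \<in> topspace X \<Longrightarrow> openin X (B0 x) \<and> x \<in> B0 x \<and> (\<forall>B'. openin X B' \<longrightarrow> B' \<subseteq> B0 x \<longrightarrow> Q B')"
    using cover by metis
  have UX: "U \<subseteq> topspace X" by (rule openin_subset[OF add.hyps(2)])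
  have B: "openin X (B0 x \<inter> U) \<and> x \<in> B0 x \<inter> U \<and> B0 x \<inter> U \<subseteq> U" if "x \<in> U" for x
    using B0[of x] UX that add.hyps(2) by auto
  have "\<exists>T h. finite T \<and> T \<subseteq> U \<and> (\<forall>t\<in>T. h t \<in> Cc_on X (B0 t \<inter> U)) \<and> g = (\<lambda>x. \<Sum>t\<in>T. h t x)"
    by (rule Cc_on_split[OF X add.hyps(2,3,4)]) (rule B)
  then obtain T and h :: "'a \<Rightarrow> 'a \<Rightarrow> complex" where
    "finite T \<and> T \<subseteq> U \<and> (\<forall>t\<in>T. h t \<in> Cc_on X (B0 t \<inter> U)) \<and> g = (\<lambda>x. \<Sum>t\<in>T. h t x)" by (elim exE)
  then have T: "finite T" "T \<subseteq> U" "\<And>t. t \<in> T \<Longrightarrow> h t \<in> Cc_on X (B0 t \<inter> U)" "g = (\<lambda>x. \<Sum>t\<in>T. h t x)"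
    by auto
  have "(\<lambda>x. f x + c * (\<Sum>t\<in>T'. h t x)) \<in> Cspan X \<and> P (\<lambda>x. f x + c * (\<Sum>t\<in>T'. h t x))" if "T' \<subseteq> T" for T'
    using finite_subset[OF that T(1)] that
  proof (induction T' rule: finite_induct)
    case empty
    then show ?case using add.hyps(1) add.IH by simp
  next
    case (insert t T')
    have t: "t \<in> T" "t \<in> U" using insert T(2) by auto
    have o: "openin X (B0 t \<inter> U)" and H: "Hausdorff_space (subtopology X (B0 t \<inter> U))" and q: "Q (B0 t \<inter> U)"
      using B[OF t(2)] Hausdorff_subset[OF add.hyps(3), of "B0 t \<inter> U"] B0[of t] t UX by auto
    have eq: "(\<lambda>x. f x + c * (\<Sum>t\<in>insert t T'. h t x)) = (\<lambda>x. (f x + c * (\<Sum>t\<in>T'. h t x)) + c * h t x)"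
      using insert by (simp add: algebra_simps)
    have IH: "(\<lambda>x. f x + c * (\<Sum>t\<in>T'. h t x)) \<in> Cspan X" "P (\<lambda>x. f x + c * (\<Sum>t\<in>T'. h t x))"
      using insert by auto
    show ?case
      unfolding eq
      using Cspan_add[OF IH(1) Cspan_scale[OF Cspan_Cc_on[OF o H T(3)[OF t(1)]]], of c]
        assms(5)[OF IH o H q T(3)[OF t(1)], of c] by simp
  qed
  then show ?case using T(4) by auto
qed (rule zero)

lemma Cspan_compact_support:
  assumes "f \<in> Cspan X"
  obtains K where "compactin X K" "\<And>x. x \<notin> K \<Longrightarrow> f x = 0"
proof -
  have "\<exists>K. compactin X K \<and> (\<forall>x. x \<notin> K \<longrightarrow> f x = 0)"
    using assms
  proof (induction rule: Cspan_induct)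
    case zero
    show ?case by (intro exI[of _ "{}"]) auto
  next
    case (add f c g U)
    obtain K where "compactin X K" "\<forall>x. x \<notin> K \<longrightarrow> f x = 0" using add.IH by blast
    moreover obtain L where "compactin X L" "L \<subseteq> U" "\<And>x. x \<notin> L \<Longrightarrow> g x = 0"
      using Cc_onD[OF add.hyps(4,2)] by metis
    ultimately show ?case by (intro exI[of _ "K \<union> L"]) (auto intro: compactin_Un)
  qed
  then show ?thesis using that by blast
qed

subsection \<open>Local homeomorphisms\<close>

context
  fixes X :: "'x topology" and Y :: "'y topology" and f :: "'x \<Rightarrow> 'y"
  assumes lh: "local_homeomorphism_map X Y f"
begin

lemma local_homeo_chart:
  assumes "x \<in> topspace X"
  obtains U V where "openin X U" "x \<in> U" "openin Y V" "homeomorphic_map (subtopology X U) (subtopology Y V) f"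
  using lh assms unfolding local_homeomorphism_map_def by blast

lemma local_homeo_continuous: "continuous_map X Y f"
  unfolding continuous_map_def
proof (intro conjI allI impI)
  show "f \<in> topspace X \<rightarrow> topspace Y" using lh by (simp add: local_homeomorphism_map_def)
  fix V assume V: "openin Y V"
  show "openin X {x \<in> topspace X. f x \<in> V}"
  proof (subst openin_subopen, intro ballI)
    fix x assume x: "x \<in> {x \<in> topspace X. f x \<in> V}"
    obtain U V' where U: "openin X U" "x \<in> U" "openin Y V'" "homeomorphic_map (subtopology X U) (subtopology Y V') f"
      using local_homeo_chart x by blast
    have "continuous_map (subtopology X U) Y f"
      using homeomorphic_imp_continuous_map[OF U(4)] by (simp add: continuous_map_in_subtopology)
    from openin_continuous_map_preimage[OF this V]
    have "openin X {x \<in> topspace (subtopology X U). f x \<in> V}" using U(1) by (rule openin_trans_full)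
    then show "\<exists>T. openin X T \<and> x \<in> T \<and> T \<subseteq> {x \<in> topspace X. f x \<in> V}"
      using x U(2) by (intro exI[of _ "{x \<in> topspace (subtopology X U). f x \<in> V}"]) auto
  qed
qed

lemma local_homeo_open_map: "open_map X Y f"
  unfolding open_map_def
proof (intro allI impI)
  fix W assume W: "openin X W"
  show "openin Y (f ` W)"
  proof (subst openin_subopen, intro ballI)
    fix y assume "y \<in> f ` W"
    then obtain x where x: "x \<in> W" "y = f x" by blast
    then have xX: "x \<in> topspace X" using openin_subset[OF W] by blast
    obtain U V' where U: "openin X U" "x \<in> U" "openin Y V'" "homeomorphic_map (subtopology X U) (subtopology Y V') f"
      using local_homeo_chart[OF xX] by blast
    have "openin (subtopology X U) (U \<inter> W)" using W by (simp add: openin_subtopology_Int2)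
    then have "openin (subtopology Y V') (f ` (U \<inter> W))"
      using homeomorphic_imp_open_map[OF U(4)] unfolding open_map_def by blast
    then have "openin Y (f ` (U \<inter> W))" using U(3) by (rule openin_trans_full)
    then show "\<exists>T. openin Y T \<and> y \<in> T \<and> T \<subseteq> f ` W"
      using x U(2) by (intro exI[of _ "f ` (U \<inter> W)"]) auto
  qed
qed

lemma local_homeo_cover:
  assumes "x \<in> topspace X"
  shows "\<exists>U. openin X U \<and> x \<in> U \<and> inj_on f U"
proof -
  obtain U V where U: "openin X U" "x \<in> U" "homeomorphic_map (subtopology X U) (subtopology Y V) f"
    using local_homeo_chart[OF assms] by blast
  have "inj_on f (topspace (subtopology X U))" by (rule homeomorphic_imp_injective_map[OF U(3)])
  moreover have "topspace (subtopology X U) = U" using openin_subset[OF U(1)] by auto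
  ultimately show ?thesis using U by auto
qed

lemma local_homeo_section:
  assumes U: "openin X U" and inj: "inj_on f U"
  shows "openin Y (f ` U)" "continuous_map (subtopology Y (f ` U)) (subtopology X U) (inv_into U f)"
proof -
  show o: "openin Y (f ` U)" using local_homeo_open_map U by (auto simp: open_map_def)
  have UX: "U \<subseteq> topspace X" by (rule openin_subset[OF U])
  have fU: "f ` U \<subseteq> topspace Y" by (rule openin_subset[OF o])
  show "continuous_map (subtopology Y (f ` U)) (subtopology X U) (inv_into U f)"
    unfolding continuous_map_def
  proof (intro conjI allI impI)
    show "inv_into U f \<in> topspace (subtopology Y (f ` U)) \<rightarrow> topspace (subtopology X U)"
      using UX inv_into_into[of _ f U] by auto
    fix W assume "openin (subtopology X U) W"
    then have W: "openin X W" "W \<subseteq> U" using U by (auto simp: openin_open_subtopology)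
    have "{y \<in> topspace (subtopology Y (f ` U)). inv_into U f y \<in> W} = f ` W"
    proof (intro equalityI subsetI)
      fix y assume "y \<in> {y \<in> topspace (subtopology Y (f ` U)). inv_into U f y \<in> W}"
      then have "y \<in> f ` U" "inv_into U f y \<in> W" by auto
      then show "y \<in> f ` W" by (metis f_inv_into_f imageI)
    next
      fix y assume "y \<in> f ` W"
      then obtain w where w: "w \<in> W" "y = f w" by blast
      then have "inv_into U f y = w" using W(2) inj by (auto simp: inv_into_f_f)
      then show "y \<in> {y \<in> topspace (subtopology Y (f ` U)). inv_into U f y \<in> W}"
        using w W(2) fU by auto
    qed
    moreover have "openin Y (f ` W)" using local_homeo_open_map W by (auto simp: open_map_def)
    ultimately show "openin (subtopology Y (f ` U)) {y \<in> topspace (subtopology Y (f ` U)). inv_into U f y \<in> W}"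
      using o W(2) by (auto simp: openin_open_subtopology)
  qed
qed

lemma local_homeo_LCH:
  assumes "locally_compact_space Y" "Hausdorff_space Y"
  shows "locally_LCH X"
  unfolding locally_LCH_def
proof
  fix x assume "x \<in> topspace X"
  then obtain U V where U: "openin X U" "x \<in> U" "openin Y V" "homeomorphic_map (subtopology X U) (subtopology Y V) f"
    using local_homeo_chart by blast
  then have h: "subtopology X U homeomorphic_space subtopology Y V"
    using homeomorphic_map_imp_homeomorphic_space by blast
  have "Hausdorff_space (subtopology Y V)" using assms(2) by (rule Hausdorff_space_subtopology)
  moreover have "locally_compact_space (subtopology Y V)"
    using assms U(3) locally_compact_space_open_subset by blast
  ultimately show "\<exists>W. openin X W \<and> x \<in> W \<and> Hausdorff_space (subtopology X W) \<and> locally_compact_space (subtopology X W)"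
    using U(1,2) homeomorphic_Hausdorff_space[OF h] homeomorphic_locally_compact_space[OF h] by blast
qed

lemma Cspan_induct_injective [consumes 2, case_names zero add]:
  assumes X: "locally_LCH X" and g: "g \<in> Cspan X" and zero: "P (\<lambda>x. 0)"
    and add: "\<And>h c k U. \<lbrakk>h \<in> Cspan X; P h; openin X U; Hausdorff_space (subtopology X U); inj_on f U; k \<in> Cc_on X U\<rbrakk>
      \<Longrightarrow> P (\<lambda>x. h x + c * k x)"
  shows "P g"
proof (rule Cspan_induct_small[OF X g, where Q = "inj_on f"])
  show "\<exists>B. openin X B \<and> x \<in> B \<and> (\<forall>B'. openin X B' \<longrightarrow> B' \<subseteq> B \<longrightarrow> inj_on f B')" if "x \<in> topspace X" for x
    using local_homeo_cover[OF that] inj_on_subset by blast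
qed (fact zero, fact add)

text \<open>Fibres of a local homeomorphism may be infinite, but a function supported where the map is injective
  sees one point of each. This makes all sums below finite.\<close>

lemma Cspan_finite_fibre:
  assumes X: "locally_LCH X" and g: "g \<in> Cspan X"
  shows "finite {x \<in> topspace X. f x = y \<and> g x \<noteq> 0}"
  using X g
proof (induction rule: Cspan_induct_injective)
  case zero
  show ?case by simp
next
  case (add h c k U)
  have "finite {x \<in> U. f x = y}"
  proof (rule finite_subset)
    show "{x \<in> U. f x = y} \<subseteq> {inv_into U f y}" using add.hyps(4) by (auto simp: inv_into_f_f)
  qed simp
  then show ?case
    using add.IH
  proof (rule finite_subset[OF _ finite_UnI, rotated])
    show "{x \<in> topspace X. f x = y \<and> h x + c * k x \<noteq> 0} \<subseteq>
        {x \<in> U. f x = y} \<union> {x \<in> topspace X. f x = y \<and> h x \<noteq> 0}"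
      using Cc_on_outside[OF add.hyps(5)] by auto
  qed
qed

end

subsection \<open>Convolution products\<close>

lemma infsum_finite_support_add:
  fixes f g :: "'i \<Rightarrow> complex"
  assumes "finite {i \<in> I. f i \<noteq> 0}" "finite {i \<in> I. g i \<noteq> 0}"
  shows "(\<Sum>\<^sub>\<infinity>i\<in>I. f i + c * g i) = (\<Sum>\<^sub>\<infinity>i\<in>I. f i) + c * (\<Sum>\<^sub>\<infinity>i\<in>I. g i)"
proof -
  have f: "f summable_on I" and g: "g summable_on I"
    using assms by (auto intro: finite_nonzero_values_imp_summable_on)
  show ?thesis by (simp add: infsum_add[OF f summable_on_cmult_right[OF g]] infsum_cmult_right')
qed

lemma infsum_one_term:
  fixes f :: "'i \<Rightarrow> complex"
  assumes "\<And>j. \<lbrakk>j \<in> I; j \<noteq> i\<rbrakk> \<Longrightarrow> f j = 0" "i \<in> I"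
  shows "infsum f I = f i"
proof -
  have "infsum f I = infsum f {i}" by (rule infsum_cong_neutral) (use assms in auto)
  then show ?thesis by simp
qed

text \<open>Convolution in a groupoid, the left and right module actions and the pairing of two functions on a
  correspondence have one common shape: \<open>f\<close> lives on \<open>Y\<close>, \<open>g\<close> on \<open>Z\<close>, and the product at \<open>x\<close> sums
  \<open>f(y) g(y x)\<close> over the fibre of the local homeomorphism \<open>a\<close>. Treating them together, the proof that the
  product is again compactly supported is needed once.\<close>

locale fibred_action =
  fixes Y :: "'y topology" and B :: "'b topology" and X :: "'x topology" and Z :: "'z topology"
    and a :: "'y \<Rightarrow> 'b" and \<rho> :: "'x \<Rightarrow> 'b" and act :: "'y \<Rightarrow> 'x \<Rightarrow> 'z"
  assumes locY: "locally_LCH Y" and a_homeo: "local_homeomorphism_map Y B a"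
    and rho_cont: "continuous_map X B \<rho>"
    and act_cont: "continuous_map (subtopology (prod_topology Y X) {(y, x). a y = \<rho> x}) Z (\<lambda>(y, x). act y x)"
    and act_proper: "proper_map (subtopology (prod_topology Y X) {(y, x). a y = \<rho> x}) (prod_topology Z Y)
        (\<lambda>(y, x). (act y x, y))"
    and act_cancel: "\<lbrakk>y \<in> topspace Y; x \<in> topspace X; x' \<in> topspace X; a y = \<rho> x; a y = \<rho> x'; act y x = act y x'\<rbrakk>
        \<Longrightarrow> x = x'"
begin

definition conv :: "('y \<Rightarrow> complex) \<Rightarrow> ('z \<Rightarrow> complex) \<Rightarrow> ('x \<Rightarrow> complex)" where
  "conv f g = (\<lambda>x. if x \<in> topspace X then \<Sum>\<^sub>\<infinity>y\<in>{y \<in> topspace Y. a y = \<rho> x}. f y * g (act y x) else 0)"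

lemma finite_terms:
  assumes "f \<in> Cspan Y"
  shows "finite {y \<in> {y \<in> topspace Y. a y = b}. f y * h y \<noteq> 0}"
  by (rule finite_subset[OF _ Cspan_finite_fibre[OF a_homeo locY assms, of b]]) auto

lemma conv_add_left:
  assumes "f \<in> Cspan Y" "f' \<in> Cspan Y"
  shows "conv (\<lambda>y. f y + c * f' y) g = (\<lambda>x. conv f g x + c * conv f' g x)"
proof
  fix x
  show "conv (\<lambda>y. f y + c * f' y) g x = conv f g x + c * conv f' g x"
    using infsum_finite_support_add[OF finite_terms[OF assms(1), of "\<rho> x" "\<lambda>y. g (act y x)"]
        finite_terms[OF assms(2), of "\<rho> x" "\<lambda>y. g (act y x)"], of c]
    by (simp add: conv_def algebra_simps)
qed

lemma conv_add_right:
  assumes "f \<in> Cspan Y"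
  shows "conv f (\<lambda>z. g z + c * g' z) = (\<lambda>x. conv f g x + c * conv f g' x)"
proof
  fix x
  show "conv f (\<lambda>z. g z + c * g' z) x = conv f g x + c * conv f g' x"
    using infsum_finite_support_add[OF finite_terms[OF assms, of "\<rho> x" "\<lambda>y. g (act y x)"]
        finite_terms[OF assms, of "\<rho> x" "\<lambda>y. g' (act y x)"], of c]
    by (simp add: conv_def algebra_simps)
qed

lemma conv_zero_left: "conv (\<lambda>y. 0) g = (\<lambda>x. 0)"
  and conv_zero_right: "conv f (\<lambda>z. 0) = (\<lambda>x. 0)"
  by (simp_all add: conv_def fun_eq_iff)

lemma conv_one_term:
  assumes "x \<in> topspace X" "y \<in> topspace Y" "a y = \<rho> x"
    and "\<And>y'. \<lbrakk>y' \<in> topspace Y; a y' = \<rho> x; y' \<noteq> y\<rbrakk> \<Longrightarrow> f y' = 0"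
  shows "conv f g x = f y * g (act y x)"
proof -
  have "conv f g x = (\<Sum>\<^sub>\<infinity>y\<in>{y \<in> topspace Y. a y = \<rho> x}. f y * g (act y x))" using assms(1) by (simp add: conv_def)
  also have "\<dots> = f y * g (act y x)" by (rule infsum_one_term) (use assms in auto)
  finally show ?thesis .
qed

text \<open>When \<open>a\<close> is injective on the support of \<open>f\<close>, one term survives, at the point \<open>e1 x\<close> given by the local
  section, and the product is continuous where \<open>e1\<close> is defined. The support is compact by properness of
  the action map. The domain is Hausdorff because cancellation makes \<open>x \<mapsto> (e1 x \<cdot> x, e1 x)\<close> injective.\<close>

lemma conv_Cc_on:
  assumes U: "openin Y U" "Hausdorff_space (subtopology Y U)" "inj_on a U" and f: "f \<in> Cc_on Y U"
    and V: "openin Z V" "Hausdorff_space (subtopology Z V)" and g: "g \<in> Cc_on Z V"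
  shows "conv f g \<in> Cspan X"
proof -
  let ?P = "subtopology (prod_topology Y X) {(y, x). a y = \<rho> x}"
  define e1 where "e1 = (\<lambda>x. inv_into U a (\<rho> x))"
  define e2 where "e2 = (\<lambda>x. act (e1 x) x)"
  define D where "D = {x \<in> topspace X. \<rho> x \<in> a ` U}"
  define W where "W = {x \<in> D. e2 x \<in> V}"
  note sec = local_homeo_section[OF a_homeo U(1,3)]
  have UY: "U \<subseteq> topspace Y" by (rule openin_subset[OF U(1)])
  have oD: "openin X D" unfolding D_def by (rule openin_continuous_map_preimage[OF rho_cont sec(1)])
  have tD: "topspace (subtopology X D) = D" using openin_subset[OF oD] by auto
  have e1U: "e1 x \<in> U" and ae1: "a (e1 x) = \<rho> x" if "x \<in> D" for x
    using that by (auto simp: e1_def D_def inv_into_into f_inv_into_f)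
  have e1_eq: "y = e1 x" if "y \<in> U" "a y = \<rho> x" for x y
    using that U(3) unfolding e1_def by (metis inv_into_f_f)
  have c1: "continuous_map (subtopology X D) (subtopology Y U) e1"
  proof -
    have "continuous_map (subtopology X D) (subtopology B (a ` U)) \<rho>"
      using continuous_map_from_subtopology[OF rho_cont, of D] by (auto simp: continuous_map_in_subtopology D_def)
    from continuous_map_compose[OF this sec(2)] show ?thesis by (simp add: e1_def o_def)
  qed
  then have c1': "continuous_map (subtopology X D) Y e1" by (simp add: continuous_map_in_subtopology)
  have c2: "continuous_map (subtopology X D) Z e2"
  proof -
    have "continuous_map (subtopology X D) ?P (\<lambda>x. (e1 x, x))"
      using c1' ae1 tD
      by (auto simp: continuous_map_in_subtopology intro!: continuous_map_pairedI continuous_map_id_subt[unfolded id_def])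
    from continuous_map_compose[OF this act_cont] show ?thesis by (simp add: e2_def o_def)
  qed
  have oW: "openin X W"
  proof -
    have "openin (subtopology X D) {x \<in> topspace (subtopology X D). e2 x \<in> V}"
      by (rule openin_continuous_map_preimage[OF c2 V(1)])
    then show ?thesis using oD by (simp only: tD W_def openin_trans_full)
  qed
  have WD: "W \<subseteq> D" by (auto simp: W_def)
  have tW: "topspace (subtopology X W) = W" using openin_subset[OF oW] by auto
  have cW: "continuous_map (subtopology X W) T h" if "continuous_map (subtopology X D) T h" for T :: "'t topology" and h
    using continuous_map_from_subtopology[OF that, of W] WD by (simp add: subtopology_subtopology Int_absorb1)
  have cW1: "continuous_map (subtopology X W) (subtopology Y U) e1"
    using continuous_map_from_subtopology[OF c1, of W] WD by (simp add: subtopology_subtopology Int_absorb1)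
  have cW2: "continuous_map (subtopology X W) (subtopology Z V) e2"
    using continuous_map_from_subtopology[OF c2, of W] WD tW
    by (auto simp: subtopology_subtopology Int_absorb1 continuous_map_in_subtopology W_def)
  have HW: "Hausdorff_space (subtopology X W)"
  proof (rule Hausdorff_space_injective_preimage)
    show "Hausdorff_space (prod_topology (subtopology Z V) (subtopology Y U))"
      using U(2) V(2) by (simp add: Hausdorff_space_prod_topology)
    show "continuous_map (subtopology X W) (prod_topology (subtopology Z V) (subtopology Y U)) (\<lambda>x. (e2 x, e1 x))"
      by (intro continuous_map_pairedI cW1 cW2)
    show "inj_on (\<lambda>x. (e2 x, e1 x)) (topspace (subtopology X W))"
    proof (rule inj_onI)
      fix x x' assume x: "x \<in> topspace (subtopology X W)" "x' \<in> topspace (subtopology X W)"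
        and eq: "(e2 x, e1 x) = (e2 x', e1 x')"
      then have D: "x \<in> D" "x' \<in> D" using WD by auto
      show "x = x'"
        using act_cancel[of "e1 x" x x'] ae1[OF D(1)] ae1[OF D(2)] e1U[OF D(1)] eq D UY
        by (auto simp: e2_def D_def)
    qed
  qed
  have val: "conv f g x = (if x \<in> W then f (e1 x) * g (e2 x) else 0)" for x
  proof (cases "x \<in> D")
    case True
    have "conv f g x = f (e1 x) * g (act (e1 x) x)"
    proof (rule conv_one_term)
      show "x \<in> topspace X" using True by (simp add: D_def)
      show "e1 x \<in> topspace Y" "a (e1 x) = \<rho> x" using e1U[OF True] ae1[OF True] UY by auto
      fix y assume "a y = \<rho> x" "y \<noteq> e1 x"
      then have "y \<notin> U" using e1_eq[of y x] by auto
      then show "f y = 0" by (rule Cc_on_outside[OF f])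
    qed
    then show ?thesis using True Cc_on_outside[OF g, of "e2 x"] by (auto simp: W_def e2_def)
  next
    case False
    have "f y = 0" if "x \<in> topspace X" "a y = \<rho> x" for y
    proof -
      have "y \<notin> U" using False that by (force simp: D_def image_iff)
      then show ?thesis by (rule Cc_on_outside[OF f])
    qed
    then have "conv f g x = 0" unfolding conv_def by (auto intro!: infsum_0)
    then show ?thesis using False WD by auto
  qed
  obtain K where K: "compactin Y K" "K \<subseteq> U" "\<And>y. y \<notin> K \<Longrightarrow> f y = 0" using Cc_onD[OF f U(1)] by metis
  obtain L where L: "compactin Z L" "L \<subseteq> V" "\<And>z. z \<notin> L \<Longrightarrow> g z = 0" using Cc_onD[OF g V(1)] by metis
  let ?C = "{p \<in> topspace ?P. (\<lambda>(y, x). (act y x, y)) p \<in> L \<times> K}"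
  have "compactin ?P ?C"
    by (rule compactin_proper_map_preimage[OF act_proper]) (simp add: compactin_Times K(1) L(1))
  then have C: "compactin X (snd ` ?C)"
    by (rule image_compactin[OF _ continuous_map_subtopology_snd])
  have CW: "snd ` ?C \<subseteq> W"
  proof
    fix x assume "x \<in> snd ` ?C"
    then obtain y where y: "y \<in> topspace Y" "x \<in> topspace X" "a y = \<rho> x" "y \<in> K" "act y x \<in> L" by auto
    then have yU: "y \<in> U" using K(2) by blast
    then have "\<rho> x \<in> a ` U" using y(3) by (metis imageI)
    then show "x \<in> W" using y L(2) e1_eq[OF yU y(3)] by (auto simp: W_def D_def e2_def)
  qed
  have "conv f g \<in> Cc_on X W"
  proof (rule Cc_onI[OF oW HW _ C CW])
    have "continuous_map (subtopology X W) euclidean (\<lambda>x. f (e1 x) * g (e2 x))"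
    proof (rule continuous_map_apply2[where h = times])
      show "continuous_map (subtopology X W) euclidean (\<lambda>x. f (e1 x))"
        using continuous_map_compose[OF cW1 Cc_on_continuous[OF f]] by (simp add: o_def)
      show "continuous_map (subtopology X W) euclidean (\<lambda>x. g (e2 x))"
        using continuous_map_compose[OF cW2 Cc_on_continuous[OF g]] by (simp add: o_def)
    qed (intro continuous_intros)
    then show "continuous_map (subtopology X W) euclidean (conv f g)"
      by (rule continuous_map_eq) (simp add: val)
    fix x assume x: "x \<notin> snd ` ?C"
    show "conv f g x = 0"
    proof (rule ccontr)
      assume "conv f g x \<noteq> 0"
      then have xW: "x \<in> W" and nz: "f (e1 x) \<noteq> 0" "g (e2 x) \<noteq> 0" by (auto simp: val split: if_splits)
      have xD: "x \<in> D" using xW WD by blast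
      have "e1 x \<in> K" "act (e1 x) x \<in> L" using nz K(3) L(3) unfolding e2_def by blast+
      moreover have "e1 x \<in> topspace Y" "x \<in> topspace X" using e1U[OF xD] UY xD by (auto simp: D_def)
      ultimately have "(e1 x, x) \<in> ?C" using ae1[OF xD] by simp
      then have "x \<in> snd ` ?C" by (rule image_eqI[rotated]) simp
      then show False using x by blast
    qed
  qed
  then show ?thesis by (rule Cspan_Cc_on[OF oW HW])
qed

theorem conv_Cspan:
  assumes f: "f \<in> Cspan Y" and g: "g \<in> Cspan Z"
  shows "conv f g \<in> Cspan X"
  using f
proof (induction rule: Cspan_induct_injective[OF a_homeo locY, consumes 1, case_names zero add])
  case zero
  show ?case by (simp add: conv_zero_left Cspan_zero)
next
  case (add h c k U)
  have "conv k g \<in> Cspan X"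
    using g
  proof (induction rule: Cspan_induct)
    case zero
    show ?case by (simp add: conv_zero_right Cspan_zero)
  next
    case (add g c g' V)
    show ?case
      unfolding conv_add_right[OF Cspan_Cc_on[OF \<open>openin Y U\<close> \<open>Hausdorff_space (subtopology Y U)\<close> \<open>k \<in> Cc_on Y U\<close>]]
      by (intro Cspan_add Cspan_scale add.IH conv_Cc_on[OF \<open>openin Y U\<close> \<open>Hausdorff_space (subtopology Y U)\<close>
            \<open>inj_on a U\<close> \<open>k \<in> Cc_on Y U\<close> add.hyps(2,3,4)])
  qed
  then show ?case
    unfolding conv_add_left[OF add.hyps(1) Cspan_Cc_on[OF add.hyps(2,3,5)]]
    by (intro Cspan_add Cspan_scale add.IH)
qed

end

text \<open>A continuous injection with a continuous inverse on a closed image is proper.\<close>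

lemma proper_map_closed_embedding:
  assumes Q: "closedin Y Q" and f: "f \<in> topspace X \<rightarrow> Q" and g: "continuous_map (subtopology Y Q) X g"
    and gf: "\<And>x. x \<in> topspace X \<Longrightarrow> g (f x) = x" and fg: "\<And>y. y \<in> Q \<Longrightarrow> f (g y) = y"
  shows "proper_map X Y f"
proof (rule closed_injective_imp_proper_map)
  have QY: "Q \<subseteq> topspace Y" by (rule closedin_subset[OF Q])
  show "inj_on f (topspace X)" using gf by (metis inj_onI)
  show "closed_map X Y f"
    unfolding closed_map_def
  proof (intro allI impI)
    fix C assume C: "closedin X C"
    have gQ: "g y \<in> topspace X" if "y \<in> Q" for y using g that QY by (auto simp: continuous_map_def)
    have "f ` C = {y \<in> topspace (subtopology Y Q). g y \<in> C}"
    proof (intro equalityI subsetI)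
      fix y assume "y \<in> f ` C"
      then obtain c where c: "c \<in> C" "y = f c" by blast
      then have "c \<in> topspace X" using closedin_subset[OF C] by blast
      then have "y \<in> Q" "g y = c" using f gf c(2) by auto
      then show "y \<in> {y \<in> topspace (subtopology Y Q). g y \<in> C}" using c(1) QY by auto
    next
      fix y assume "y \<in> {y \<in> topspace (subtopology Y Q). g y \<in> C}"
      then have "y = f (g y)" "g y \<in> C" using fg by auto
      then show "y \<in> f ` C" by (rule image_eqI)
    qed
    then have "closedin (subtopology Y Q) (f ` C)"
      using closedin_continuous_map_preimage[OF g C] by simp
    then show "closedin Y (f ` C)" using Q by (rule closedin_trans_full)
  qed
qed

section \<open>Etale groupoids\<close>

context etale_groupoid
begin

lemma unit_arrow: "u \<in> units G \<Longrightarrow> u \<in> arrows G"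
  and src_unit: "u \<in> units G \<Longrightarrow> gsrc G u = u"
  and rng_unit: "u \<in> units G \<Longrightarrow> grng G u = u"
  by (auto simp: units_def src_closed src_src rng_src)

lemma src_units: "g \<in> arrows G \<Longrightarrow> gsrc G g \<in> units G"
  by (simp add: units_def)

lemma topspace_unit_space: "topspace (unit_space G) = units G"
  using unit_arrow by (auto simp: unit_space_def)

lemma inv_unique:
  assumes "g \<in> arrows G" "h \<in> arrows G" "gsrc G g = grng G h" "gmult G g h = grng G g"
  shows "h = ginv G g"
proof -
  have "h = gmult G (gmult G (ginv G g) g) h"
    using assms by (simp add: inv_mult rng_mult_self)
  also have "\<dots> = gmult G (ginv G g) (grng G g)"
    using assms by (simp add: mult_assoc inv_closed src_inv)
  also have "\<dots> = ginv G g"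
    using assms mult_src[of "ginv G g"] by (simp add: inv_closed src_inv)
  finally show ?thesis .
qed

lemma inv_inv: "g \<in> arrows G \<Longrightarrow> ginv G (ginv G g) = g"
  using inv_unique[of "ginv G g" g] by (simp add: inv_closed src_inv rng_inv inv_mult)

lemma inv_mult_cancel:
  "\<lbrakk>g \<in> arrows G; h \<in> arrows G; gsrc G g = grng G h\<rbrakk> \<Longrightarrow> gmult G (ginv G g) (gmult G g h) = h"
  using mult_assoc[of "ginv G g" g h] by (simp add: inv_closed src_inv inv_mult rng_mult_self)

lemma mult_inv_cancel:
  "\<lbrakk>g \<in> arrows G; h \<in> arrows G; grng G g = grng G h\<rbrakk> \<Longrightarrow> gmult G g (gmult G (ginv G g) h) = h"
  using mult_assoc[of g "ginv G g" h] by (simp add: inv_closed rng_inv src_inv mult_inv rng_mult_self)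

lemma mult_inv_cancel_right:
  "\<lbrakk>g \<in> arrows G; h \<in> arrows G; gsrc G g = gsrc G h\<rbrakk> \<Longrightarrow> gmult G (gmult G g (ginv G h)) h = g"
  using mult_assoc[of g "ginv G h" h] mult_src[of g] by (simp add: inv_closed rng_inv src_inv inv_mult)

lemma mult_cancel_right:
  "\<lbrakk>g \<in> arrows G; h \<in> arrows G; gsrc G g = grng G h\<rbrakk> \<Longrightarrow> gmult G (gmult G g h) (ginv G h) = g"
  using mult_assoc[of g h "ginv G h"] mult_src[of g] by (simp add: inv_closed rng_inv mult_inv)

lemma inv_of_mult:
  assumes "g \<in> arrows G" "h \<in> arrows G" "gsrc G g = grng G h"
  shows "ginv G (gmult G g h) = gmult G (ginv G h) (ginv G g)"
proof (rule inv_unique[symmetric])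
  have "gmult G (gmult G g h) (gmult G (ginv G h) (ginv G g)) = gmult G (gmult G (gmult G g h) (ginv G h)) (ginv G g)"
    using assms by (subst mult_assoc) (simp_all add: mult_closed inv_closed src_mult rng_mult src_inv rng_inv)
  then show "gmult G (gmult G g h) (gmult G (ginv G h) (ginv G g)) = grng G (gmult G g h)"
    using assms by (simp add: mult_cancel_right mult_inv rng_mult)
qed (use assms in \<open>simp_all add: mult_closed inv_closed src_mult rng_mult src_inv rng_inv\<close>)

lemma inv_unit: "u \<in> units G \<Longrightarrow> ginv G u = u"
  using inv_unique[of u u] mult_src[of u] by (simp add: unit_arrow src_unit rng_unit)

lemma src_cont: "continuous_map (gtop G) (unit_space G) (gsrc G)"
  and rng_cont: "continuous_map (gtop G) (unit_space G) (grng G)"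
  by (rule local_homeo_continuous[OF src_local_homeo], rule local_homeo_continuous[OF rng_local_homeo])

text \<open>Near a unit, \<open>x\<close> and \<open>s(x)\<close> lie in a common set on which the source map is injective, and they have
  the same source.\<close>

lemma units_open: "openin (gtop G) (units G)"
proof (subst openin_subopen, intro ballI)
  fix u assume u: "u \<in> units G"
  obtain U where U: "openin (gtop G) U" "u \<in> U" "inj_on (gsrc G) U"
    using local_homeo_cover[OF src_local_homeo unit_arrow[OF u]] by blast
  have UA: "U \<subseteq> arrows G" by (rule openin_subset[OF U(1)])
  have c: "continuous_map (gtop G) (gtop G) (gsrc G)"
    using src_cont by (simp add: unit_space_def continuous_map_in_subtopology)
  let ?V = "U \<inter> {x \<in> arrows G. gsrc G x \<in> U}"
  have "openin (gtop G) ?V"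
    by (rule openin_Int[OF U(1) openin_continuous_map_preimage[OF c U(1)]])
  moreover have "u \<in> ?V" using u U(2) by (simp add: unit_arrow src_unit)
  moreover have "?V \<subseteq> units G"
  proof
    fix x assume x: "x \<in> ?V"
    then have "x \<in> arrows G" by simp
    moreover have "gsrc G x = x" using x U(3) src_src[of x] by (auto dest: inj_onD)
    ultimately show "x \<in> units G" using src_units[of x] by simp
  qed
  ultimately show "\<exists>T. openin (gtop G) T \<and> u \<in> T \<and> T \<subseteq> units G" by blast
qed

lemma cont_mult:
  assumes "continuous_map X (gtop G) a" "continuous_map X (gtop G) b"
    and "\<And>x. x \<in> topspace X \<Longrightarrow> gsrc G (a x) = grng G (b x)"
  shows "continuous_map X (gtop G) (\<lambda>x. gmult G (a x) (b x))"
proof -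
  have "continuous_map X (subtopology (prod_topology (gtop G) (gtop G)) {(g, h). gsrc G g = grng G h}) (\<lambda>x. (a x, b x))"
    using assms by (auto simp: continuous_map_in_subtopology intro!: continuous_map_pairedI)
  from continuous_map_compose[OF this continuous_mult] show ?thesis by (simp add: o_def)
qed

lemma cont_inv:
  assumes "continuous_map X (gtop G) a"
  shows "continuous_map X (gtop G) (\<lambda>x. ginv G (a x))"
  using continuous_map_compose[OF assms continuous_inv] by (simp add: o_def)

lemma cont_src:
  assumes "continuous_map X (gtop G) a"
  shows "continuous_map X (unit_space G) (\<lambda>x. gsrc G (a x))" "continuous_map X (unit_space G) (\<lambda>x. grng G (a x))"
  using continuous_map_compose[OF assms src_cont] continuous_map_compose[OF assms rng_cont] by (simp_all add: o_def)

end

locale lc_groupoid = etale_groupoid +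
  assumes lc_units: "locally_compact_space (unit_space G)"
    and Hausdorff_units: "Hausdorff_space (unit_space G)"
begin

lemma locally_LCH_arrows: "locally_LCH (gtop G)"
  by (rule local_homeo_LCH[OF src_local_homeo lc_units Hausdorff_units])

lemma Cspan_inv:
  assumes "f \<in> Cspan (gtop G)"
  shows "(\<lambda>g. if g \<in> arrows G then f (ginv G g) else 0) \<in> Cspan (gtop G)"
  using assms
proof (induction rule: Cspan_induct)
  case zero
  show ?case by (simp add: Cspan_zero)
next
  case (add f c k U)
  let ?k = "\<lambda>g. if g \<in> arrows G then k (ginv G g) else 0"
  define V where "V = {g \<in> arrows G. ginv G g \<in> U}"
  have oV: "openin (gtop G) V" unfolding V_def by (rule openin_continuous_map_preimage[OF continuous_inv add.hyps(2)])
  have c: "continuous_map (subtopology (gtop G) V) (subtopology (gtop G) U) (ginv G)"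
    using continuous_map_from_subtopology[OF continuous_inv, of V] by (auto simp: continuous_map_in_subtopology V_def)
  have "inj_on (ginv G) (topspace (subtopology (gtop G) V))"
    by (intro inj_onI) (metis Int_iff inv_inv topspace_subtopology)
  then have HV: "Hausdorff_space (subtopology (gtop G) V)"
    by (rule Hausdorff_space_injective_preimage[OF add.hyps(3) c])
  obtain K where K: "compactin (gtop G) K" "K \<subseteq> U" "\<And>g. g \<notin> K \<Longrightarrow> k g = 0"
    using Cc_onD[OF add.hyps(4,2)] by metis
  have KA: "K \<subseteq> arrows G" using K(1) by (simp add: compactin_def)
  have "?k \<in> Cc_on (gtop G) V"
  proof (rule Cc_onI[OF oV HV])
    have "continuous_map (subtopology (gtop G) V) euclidean (\<lambda>g. k (ginv G g))"
      using continuous_map_compose[OF c Cc_on_continuous[OF add.hyps(4)]] by (simp add: o_def)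
    then show "continuous_map (subtopology (gtop G) V) euclidean ?k"
      by (rule continuous_map_eq) simp
    show "compactin (gtop G) (ginv G ` K)" by (rule image_compactin[OF K(1) continuous_inv])
    show "ginv G ` K \<subseteq> V" using KA K(2) by (auto simp: V_def inv_closed inv_inv subset_iff)
    show "?k g = 0" if g: "g \<notin> ginv G ` K" for g
    proof (cases "g \<in> arrows G")
      case True
      then have "ginv G g \<notin> K" using g inv_inv[OF True] by (metis imageI)
      then show ?thesis using K(3) by simp
    qed simp
  qed
  then have "?k \<in> Cspan (gtop G)" by (rule Cspan_Cc_on[OF oV HV])
  from Cspan_add[OF add.IH Cspan_scale[OF this, of c]] show ?case
    by (rule back_subst[of "\<lambda>f. f \<in> Cspan (gtop G)"]) auto
qed

end

section \<open>Correspondences\<close>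

locale lc_correspondence = groupoid_correspondence G H Z + G: lc_groupoid G + H: lc_groupoid H
  for G :: "'g groupoid" and H :: "'h groupoid" and Z :: "('g, 'h, 'z) correspondence"
begin

lemma ranchor_units: "z \<in> points Z \<Longrightarrow> ranchor Z z \<in> units G"
  using continuous_ranchor by (auto simp: continuous_map_def G.topspace_unit_space)

lemma sanchor_cont: "continuous_map (ztop Z) (unit_space H) (sanchor Z)"
  by (rule local_homeo_continuous[OF sanchor_local_homeo])

lemma sanchor_units: "z \<in> points Z \<Longrightarrow> sanchor Z z \<in> units H"
  using sanchor_cont by (auto simp: continuous_map_def H.topspace_unit_space)

lemma locally_LCH_points: "locally_LCH (ztop Z)"
  by (rule local_homeo_LCH[OF sanchor_local_homeo H.lc_units H.Hausdorff_units])

lemma lact_inv_cancel: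
  assumes "g \<in> arrows G" "z \<in> points Z" "gsrc G g = ranchor Z z"
  shows "lact Z (ginv G g) (lact Z g z) = z"
  using assms lact_lact[of "ginv G g" g z]
  by (simp add: G.inv_closed G.src_inv G.inv_mult lact_unit)

lemma lact_cancel_inv:
  assumes "g \<in> arrows G" "z \<in> points Z" "grng G g = ranchor Z z"
  shows "lact Z g (lact Z (ginv G g) z) = z"
  using assms lact_lact[of g "ginv G g" z]
  by (simp add: G.inv_closed G.src_inv G.rng_inv G.mult_inv lact_unit)

lemma ract_inv_cancel:
  assumes "z \<in> points Z" "h \<in> arrows H" "sanchor Z z = grng H h"
  shows "ract Z (ract Z z h) (ginv H h) = z"
  using assms ract_ract[of z h "ginv H h"] ract_unit[of z]
  by (simp add: H.inv_closed H.rng_inv H.mult_inv)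

lemma ract_cancel_inv:
  assumes "z \<in> points Z" "h \<in> arrows H" "sanchor Z z = gsrc H h"
  shows "ract Z (ract Z z (ginv H h)) h = z"
  using assms ract_ract[of z "ginv H h" h] ract_unit[of z]
  by (simp add: H.inv_closed H.rng_inv H.src_inv H.inv_mult)

lemma cont_lact:
  assumes "continuous_map X (gtop G) a" "continuous_map X (ztop Z) b"
    and "\<And>x. x \<in> topspace X \<Longrightarrow> gsrc G (a x) = ranchor Z (b x)"
  shows "continuous_map X (ztop Z) (\<lambda>x. lact Z (a x) (b x))"
proof -
  have "continuous_map X (left_action_space G Z) (\<lambda>x. (a x, b x))"
    using assms by (auto simp: left_action_space_def continuous_map_in_subtopology intro!: continuous_map_pairedI)
  from continuous_map_compose[OF this continuous_lact] show ?thesis by (simp add: o_def)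
qed

lemma cont_ract:
  assumes "continuous_map X (ztop Z) a" "continuous_map X (gtop H) b"
    and "\<And>x. x \<in> topspace X \<Longrightarrow> sanchor Z (a x) = grng H (b x)"
  shows "continuous_map X (ztop Z) (\<lambda>x. ract Z (a x) (b x))"
proof -
  have "continuous_map X (right_action_space H Z) (\<lambda>x. (a x, b x))"
    using assms by (auto simp: right_action_space_def continuous_map_in_subtopology intro!: continuous_map_pairedI)
  from continuous_map_compose[OF this continuous_ract] show ?thesis by (simp add: o_def)
qed

lemma ract_free_eq:
  assumes "z \<in> points Z" "h \<in> arrows H" "h' \<in> arrows H" "sanchor Z z = grng H h" "sanchor Z z = grng H h'"
    and "ract Z z h = ract Z z h'"
  shows "h = h'"
proof -
  have s: "gsrc H h = gsrc H h'" using assms sanchor_ract by metis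
  have "ract Z z (gmult H h' (ginv H h)) = z"
    using assms s ract_ract[of z h' "ginv H h"] ract_inv_cancel[of z h] by (simp add: H.inv_closed H.rng_inv)
  then have "gmult H h' (ginv H h) = sanchor Z z"
    using assms s by (intro ract_free) (simp_all add: H.mult_closed H.inv_closed H.rng_inv H.rng_mult)
  then have "gmult H h' (ginv H h) = grng H h'" using assms by simp
  then have "ginv H h = ginv H h'"
    using assms s by (intro H.inv_unique) (simp_all add: H.inv_closed H.rng_inv)
  then show ?thesis using assms H.inv_inv by metis
qed

end

lemma closedin_equaliser:
  assumes "Hausdorff_space Y" "continuous_map X Y f" "continuous_map X Y g"
  shows "closedin X {x \<in> topspace X. f x = g x}"
  using closedin_continuous_maps_eq[OF assms] .

text \<open>The three products: functions on \<open>G\<close> and on \<open>H\<close> act on functions on \<open>Z\<close>, and two functions on \<open>Z\<close>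
  pair to a function on \<open>H\<close>. For the first two the action map is proper because it is an embedding onto a
  closed set, with inverse given by the inverse arrows; for the third this is properness of the
  right action.\<close>

sublocale lc_correspondence \<subseteq> left: fibred_action "gtop G" "unit_space G" "ztop Z" "ztop Z" "gsrc G" "ranchor Z" "lact Z"
proof unfold_locales
  show "locally_LCH (gtop G)" by (rule G.locally_LCH_arrows)
  show "local_homeomorphism_map (gtop G) (unit_space G) (gsrc G)" by (rule G.src_local_homeo)
  show "continuous_map (ztop Z) (unit_space G) (ranchor Z)" by (rule continuous_ranchor)
  show "continuous_map (subtopology (prod_topology (gtop G) (ztop Z)) {(y, x). gsrc G y = ranchor Z x}) (ztop Z) (\<lambda>(y, x). lact Z y x)"
    using continuous_lact by (simp add: left_action_space_def)
  let ?P = "subtopology (prod_topology (gtop G) (ztop Z)) {(y, x). gsrc G y = ranchor Z x}"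
  let ?R = "prod_topology (ztop Z) (gtop G)"
  let ?Q = "{q \<in> topspace ?R. ranchor Z (fst q) = grng G (snd q)}"
  show "proper_map ?P ?R (\<lambda>(y, x). (lact Z y x, y))"
  proof (rule proper_map_closed_embedding[where Q = ?Q and g = "\<lambda>(z, y). (y, lact Z (ginv G y) z)"])
    show "closedin ?R ?Q"
    proof (rule closedin_equaliser[OF G.Hausdorff_units])
      show "continuous_map ?R (unit_space G) (\<lambda>q. ranchor Z (fst q))"
        using continuous_map_compose[OF continuous_map_fst continuous_ranchor] by (simp add: o_def)
      show "continuous_map ?R (unit_space G) (\<lambda>q. grng G (snd q))"
        by (rule G.cont_src(2)[OF continuous_map_snd])
    qed
    show "(\<lambda>(y, x). (lact Z y x, y)) \<in> topspace ?P \<rightarrow> ?Q"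
      by (auto simp: lact_closed ranchor_lact)
    have "continuous_map (subtopology ?R ?Q) (ztop Z) (\<lambda>q. lact Z (ginv G (snd q)) (fst q))"
      by (intro cont_lact G.cont_inv continuous_map_subtopology_snd continuous_map_subtopology_fst)
        (auto simp: G.src_inv)
    then show "continuous_map (subtopology ?R ?Q) ?P (\<lambda>(z, y). (y, lact Z (ginv G y) z))"
      by (auto simp: continuous_map_in_subtopology case_prod_unfold ranchor_lact G.inv_closed G.src_inv G.rng_inv
          intro!: continuous_map_pairedI continuous_map_subtopology_snd)
    show "(\<lambda>(z, y). (y, lact Z (ginv G y) z)) ((\<lambda>(y, x). (lact Z y x, y)) x) = x" if "x \<in> topspace ?P" for x
      using that by (auto simp: lact_inv_cancel)
    show "(\<lambda>(y, x). (lact Z y x, y)) ((\<lambda>(z, y). (y, lact Z (ginv G y) z)) q) = q" if "q \<in> ?Q" for q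
      using that by (auto simp: lact_cancel_inv)
  qed
  show "x = x'" if "y \<in> arrows G" "x \<in> points Z" "x' \<in> points Z" "gsrc G y = ranchor Z x"
    "gsrc G y = ranchor Z x'" "lact Z y x = lact Z y x'" for y x x'
    using that lact_inv_cancel by metis
qed

sublocale lc_correspondence \<subseteq> right: fibred_action "gtop H" "unit_space H" "ztop Z" "ztop Z" "grng H" "sanchor Z" "\<lambda>h z. ract Z z h"
proof unfold_locales
  show "locally_LCH (gtop H)" by (rule H.locally_LCH_arrows)
  show "local_homeomorphism_map (gtop H) (unit_space H) (grng H)" by (rule H.rng_local_homeo)
  show "continuous_map (ztop Z) (unit_space H) (sanchor Z)" by (rule sanchor_cont)
  let ?P = "subtopology (prod_topology (gtop H) (ztop Z)) {(y, x). grng H y = sanchor Z x}"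
  have "continuous_map ?P (ztop Z) (\<lambda>q. ract Z (snd q) (fst q))"
    by (intro cont_ract continuous_map_subtopology_snd continuous_map_subtopology_fst) auto
  then show "continuous_map ?P (ztop Z) (\<lambda>(y, x). ract Z x y)" by (simp add: case_prod_unfold)
  let ?R = "prod_topology (ztop Z) (gtop H)"
  let ?Q = "{q \<in> topspace ?R. sanchor Z (fst q) = gsrc H (snd q)}"
  show "proper_map ?P ?R (\<lambda>(y, x). (ract Z x y, y))"
  proof (rule proper_map_closed_embedding[where Q = ?Q and g = "\<lambda>(z, y). (y, ract Z z (ginv H y))"])
    show "closedin ?R ?Q"
    proof (rule closedin_equaliser[OF H.Hausdorff_units])
      show "continuous_map ?R (unit_space H) (\<lambda>q. sanchor Z (fst q))"
        using continuous_map_compose[OF continuous_map_fst sanchor_cont] by (simp add: o_def)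
      show "continuous_map ?R (unit_space H) (\<lambda>q. gsrc H (snd q))"
        by (rule H.cont_src(1)[OF continuous_map_snd])
    qed
    show "(\<lambda>(y, x). (ract Z x y, y)) \<in> topspace ?P \<rightarrow> ?Q"
      by (auto simp: ract_closed sanchor_ract)
    have "continuous_map (subtopology ?R ?Q) (ztop Z) (\<lambda>q. ract Z (fst q) (ginv H (snd q)))"
      by (intro cont_ract H.cont_inv continuous_map_subtopology_snd continuous_map_subtopology_fst)
        (auto simp: H.rng_inv)
    then show "continuous_map (subtopology ?R ?Q) ?P (\<lambda>(z, y). (y, ract Z z (ginv H y)))"
      by (auto simp: continuous_map_in_subtopology case_prod_unfold sanchor_ract H.inv_closed H.src_inv H.rng_inv
          intro!: continuous_map_pairedI continuous_map_subtopology_snd)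
    show "(\<lambda>(z, y). (y, ract Z z (ginv H y))) ((\<lambda>(y, x). (ract Z x y, y)) x) = x" if "x \<in> topspace ?P" for x
      using that by (auto simp: ract_inv_cancel)
    show "(\<lambda>(y, x). (ract Z x y, y)) ((\<lambda>(z, y). (y, ract Z z (ginv H y))) q) = q" if "q \<in> ?Q" for q
      using that by (auto simp: ract_cancel_inv)
  qed
  show "x = x'" if "y \<in> arrows H" "x \<in> points Z" "x' \<in> points Z" "grng H y = sanchor Z x"
    "grng H y = sanchor Z x'" "ract Z x y = ract Z x' y" for y x x'
    using that ract_inv_cancel by metis
qed

sublocale lc_correspondence \<subseteq> pair: fibred_action "ztop Z" "unit_space H" "gtop H" "ztop Z" "sanchor Z" "grng H" "ract Z"
proof unfold_locales
  show "locally_LCH (ztop Z)" by (rule locally_LCH_points)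
  show "local_homeomorphism_map (ztop Z) (unit_space H) (sanchor Z)" by (rule sanchor_local_homeo)
  show "continuous_map (gtop H) (unit_space H) (grng H)" by (rule H.rng_cont)
  show "continuous_map (subtopology (prod_topology (ztop Z) (gtop H)) {(y, x). sanchor Z y = grng H x}) (ztop Z) (\<lambda>(y, x). ract Z y x)"
    using continuous_ract by (simp add: right_action_space_def)
  show "proper_map (subtopology (prod_topology (ztop Z) (gtop H)) {(y, x). sanchor Z y = grng H x})
      (prod_topology (ztop Z) (ztop Z)) (\<lambda>(y, x). (ract Z y x, y))"
    using ract_proper by (simp add: proper_right_action_def right_action_space_def)
qed (rule ract_free_eq)

subsection \<open>A groupoid as a correspondence over itself\<close>

text \<open>A groupoid acting on itself by multiplication is a correspondence, whose operators \<open>T\<close> are the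
  regular representation. General results on correspondences thereby cover the representation too.\<close>

definition self_corr :: "'g groupoid \<Rightarrow> ('g, 'g, 'g) correspondence" where
  "self_corr G = \<lparr>ztop = gtop G, ranchor = grng G, sanchor = gsrc G, lact = gmult G, ract = gmult G\<rparr>"

lemma self_corr_simps [simp]:
  "ztop (self_corr G) = gtop G" "ranchor (self_corr G) = grng G" "sanchor (self_corr G) = gsrc G"
  "lact (self_corr G) = gmult G" "ract (self_corr G) = gmult G"
  by (simp_all add: self_corr_def)

lemma (in lc_groupoid) self_correspondence: "lc_correspondence G G (self_corr G)"
proof -
  interpret G: lc_groupoid G by (rule lc_groupoid_axioms)
  have "proper_right_action G (self_corr G)"
    unfolding proper_right_action_def right_action_space_def self_corr_simps
  proof -
    let ?P = "subtopology (prod_topology (gtop G) (gtop G)) {(z, h). gsrc G z = grng G h}"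
    let ?R = "prod_topology (gtop G) (gtop G)"
    let ?Q = "{q \<in> topspace ?R. grng G (fst q) = grng G (snd q)}"
    show "proper_map ?P ?R (\<lambda>(z, h). (gmult G z h, z))"
    proof (rule proper_map_closed_embedding[where Q = ?Q and g = "\<lambda>(y, z). (z, gmult G (ginv G z) y)"])
      show "closedin ?R ?Q"
        by (rule closedin_equaliser[OF Hausdorff_units cont_src(2)[OF continuous_map_fst] cont_src(2)[OF continuous_map_snd]])
      show "(\<lambda>(z, h). (gmult G z h, z)) \<in> topspace ?P \<rightarrow> ?Q" by (auto simp: mult_closed rng_mult)
      have "continuous_map (subtopology ?R ?Q) (gtop G) (\<lambda>q. gmult G (ginv G (snd q)) (fst q))"
        by (intro cont_mult cont_inv continuous_map_subtopology_snd continuous_map_subtopology_fst)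
          (auto simp: src_inv)
      then show "continuous_map (subtopology ?R ?Q) ?P (\<lambda>(y, z). (z, gmult G (ginv G z) y))"
        by (auto simp: continuous_map_in_subtopology case_prod_unfold rng_mult inv_closed src_inv rng_inv
            intro!: continuous_map_pairedI continuous_map_subtopology_snd)
      show "(\<lambda>(y, z). (z, gmult G (ginv G z) y)) ((\<lambda>(z, h). (gmult G z h, z)) q) = q" if "q \<in> topspace ?P" for q
        using that by (auto simp: inv_mult_cancel)
      show "(\<lambda>(z, h). (gmult G z h, z)) ((\<lambda>(y, z). (z, gmult G (ginv G z) y)) q) = q" if "q \<in> ?Q" for q
        using that by (auto simp: mult_inv_cancel)
    qed
  qed
  moreover have "h = gsrc G z" if "z \<in> arrows G" "h \<in> arrows G" "gsrc G z = grng G h" "gmult G z h = z" for z h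
    using inv_mult_cancel[OF that(1,2,3)] that(4) inv_mult[OF that(1)] by simp
  ultimately show ?thesis
    by unfold_locales
      (simp_all add: rng_cont mult_closed rng_mult src_mult mult_assoc rng_mult_self mult_src
        left_action_space_def right_action_space_def continuous_mult src_local_homeo)
qed

subsection \<open>Small open sets\<close>

context lc_correspondence
begin

text \<open>Small sets meet each fibre of \<open>s\<^sub>Z\<close> and, as \<open>small_orbit\<close> shows, each \<open>H\<close>-orbit in at most one point.
  A function supported in one gives \<open>T\<close> and \<open>S\<close> a matrix with at most one nonzero entry in each row and
  column.\<close>

definition small :: "'z set \<Rightarrow> bool" where
  "small U \<longleftrightarrow> inj_on (sanchor Z) U \<and>
     (\<forall>z\<in>U. \<forall>h\<in>arrows H. sanchor Z z = grng H h \<longrightarrow> ract Z z h \<in> U \<longrightarrow> h \<in> units H)"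

text \<open>The arrows that are not units form a closed set, which the proper right action maps to a closed set
  of pairs of points. By freeness the diagonal avoids it, and a product neighbourhood of \<open>(z, z)\<close> does too.\<close>

lemma small_cover:
  assumes z: "z \<in> points Z"
  shows "\<exists>B. openin (ztop Z) B \<and> z \<in> B \<and> (\<forall>B'. openin (ztop Z) B' \<longrightarrow> B' \<subseteq> B \<longrightarrow> small B')"
proof -
  let ?R = "right_action_space H Z" and ?m = "\<lambda>(z, h). (ract Z z h, z)"
  have tR: "topspace ?R = {(z, h). z \<in> points Z \<and> h \<in> arrows H \<and> sanchor Z z = grng H h}"
    by (auto simp: right_action_space_def)
  have "openin ?R {q \<in> topspace ?R. snd q \<in> units H}"
    unfolding right_action_space_def
    by (rule openin_continuous_map_preimage[OF continuous_map_subtopology_snd H.units_open])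
  then have "closedin ?R (topspace ?R - {q \<in> topspace ?R. snd q \<in> units H})" by (rule closedin_diff[OF closedin_topspace])
  moreover have "closed_map ?R (prod_topology (ztop Z) (ztop Z)) ?m"
    using ract_proper proper_imp_closed_map unfolding proper_right_action_def by blast
  ultimately have cl: "closedin (prod_topology (ztop Z) (ztop Z)) (?m ` (topspace ?R - {q \<in> topspace ?R. snd q \<in> units H}))"
    unfolding closed_map_def by blast
  define C where "C = ?m ` (topspace ?R - {q \<in> topspace ?R. snd q \<in> units H})"
  have "openin (prod_topology (ztop Z) (ztop Z)) (points Z \<times> points Z - C)"
    using openin_diff[OF openin_topspace cl] by (simp add: C_def)
  moreover have "(z, z) \<in> points Z \<times> points Z - C"
  proof -
    have "(z, z) \<notin> C"
    proof
      assume "(z, z) \<in> C"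
      then obtain q where q: "(z, z) = ?m q" "q \<in> topspace ?R - {q \<in> topspace ?R. snd q \<in> units H}"
        unfolding C_def by (elim imageE)
      obtain y h where yh: "q = (y, h)" by (cases q)
      have yz: "y = z" using q(1) unfolding yh prod.case by (elim Pair_inject) (rule sym)
      have h: "h \<in> arrows H" "sanchor Z z = grng H h" "h \<notin> units H" "ract Z z h = z"
        using q unfolding yh yz tR by simp_all
      have "h = sanchor Z z" by (rule ract_free[OF z h(1,2,4)])
      then show False using h(3) sanchor_units[OF z] by metis
    qed
    then show ?thesis using z by simp
  qed
  ultimately have "\<exists>A A'. openin (ztop Z) A \<and> openin (ztop Z) A' \<and> z \<in> A \<and> z \<in> A' \<and> A \<times> A' \<subseteq> points Z \<times> points Z - C"
    by (rule openin_prod_topology_alt[THEN iffD1, rule_format])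
  then obtain A A' where A: "openin (ztop Z) A" "openin (ztop Z) A'" "z \<in> A" "z \<in> A'"
    "A \<times> A' \<subseteq> points Z \<times> points Z - C"
    by (elim exE conjE)
  obtain U where U: "openin (ztop Z) U" "z \<in> U" "inj_on (sanchor Z) U"
    using local_homeo_cover[OF sanchor_local_homeo z] by blast
  have "small B'" if "B' \<subseteq> A \<inter> A' \<inter> U" for B'
    unfolding small_def
  proof (intro conjI ballI impI)
    show "inj_on (sanchor Z) B'" using inj_on_subset[OF U(3)] that by blast
    fix y h assume y: "y \<in> B'" and h: "h \<in> arrows H" "sanchor Z y = grng H h" "ract Z y h \<in> B'"
    have "(ract Z y h, y) \<notin> C" using A(5) that y h(3) by blast
    have yp: "y \<in> points Z" using y that openin_subset[OF A(1)] by blast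
    show "h \<in> units H"
    proof (rule ccontr)
      assume "h \<notin> units H"
      then have "(y, h) \<in> topspace ?R - {q \<in> topspace ?R. snd q \<in> units H}" using h yp by (simp add: tR)
      then have "?m (y, h) \<in> C" unfolding C_def by (rule imageI)
      then show False using \<open>(ract Z y h, y) \<notin> C\<close> by simp
    qed
  qed
  then show ?thesis
    using A U by (intro exI[of _ "A \<inter> A' \<inter> U"]) auto
qed

lemma Cspan_induct_small_sets [consumes 1, case_names zero add]:
  assumes "f \<in> Cspan (ztop Z)" "P (\<lambda>x. 0)"
    and "\<And>f c g U. \<lbrakk>f \<in> Cspan (ztop Z); P f; openin (ztop Z) U; Hausdorff_space (subtopology (ztop Z) U); small U;
      g \<in> Cc_on (ztop Z) U\<rbrakk> \<Longrightarrow> P (\<lambda>x. f x + c * g x)"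
  shows "P f"
  by (rule Cspan_induct_small[OF locally_LCH_points assms(1), where Q = small])
    (fact small_cover, fact assms(2), fact assms(3))

lemma ract_inv_closed:
  assumes "z \<in> points Z" "h \<in> arrows H" "gsrc H h = sanchor Z z"
  shows "ract Z z (ginv H h) \<in> points Z" "sanchor Z (ract Z z (ginv H h)) = grng H h"
    "ranchor Z (ract Z z (ginv H h)) = ranchor Z z"
  using assms by (simp_all add: ract_closed sanchor_ract ranchor_ract H.inv_closed H.rng_inv H.src_inv)

lemma small_row:
  assumes U: "small U" and z: "z \<in> points Z" and h: "h \<in> arrows H" "gsrc H h = sanchor Z z"
    and h': "h' \<in> arrows H" "gsrc H h' = sanchor Z z"
    and i: "ract Z z (ginv H h) \<in> U" "ract Z z (ginv H h') \<in> U"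
  shows "h = h'"
proof -
  let ?k = "gmult H h (ginv H h')"
  have k: "?k \<in> arrows H" "grng H ?k = grng H h" "gsrc H ?k = grng H h'"
    using h h' by (simp_all add: H.mult_closed H.inv_closed H.rng_mult H.src_mult H.rng_inv H.src_inv)
  have "ract Z (ract Z z (ginv H h)) ?k = ract Z (ract Z (ract Z z (ginv H h)) h) (ginv H h')"
    using h h' z ract_inv_closed[OF z h] by (intro ract_ract) (simp_all add: H.inv_closed H.rng_inv)
  also have "\<dots> = ract Z z (ginv H h')" using h z by (simp add: ract_cancel_inv)
  finally have "ract Z (ract Z z (ginv H h)) ?k \<in> U" using i by simp
  then have "?k \<in> units H" using U i(1) k ract_inv_closed[OF z h] by (auto simp: small_def)
  then have "?k = grng H h" using k H.rng_unit by metis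
  then have "gmult H h (ginv H h') = grng H h" .
  then have "ginv H h' = ginv H h" using h h' by (intro H.inv_unique) (simp_all add: H.inv_closed H.rng_inv)
  then show ?thesis using h h' H.inv_inv by metis
qed

lemma small_column:
  assumes U: "small U" and z: "z \<in> points Z" "z' \<in> points Z" and h: "h \<in> arrows H" "gsrc H h = sanchor Z z"
    "gsrc H h = sanchor Z z'" and i: "ract Z z (ginv H h) \<in> U" "ract Z z' (ginv H h) \<in> U"
  shows "z = z'"
proof -
  have "ract Z z (ginv H h) = ract Z z' (ginv H h)"
    using U i ract_inv_closed[OF z(1) h(1,2)] ract_inv_closed[OF z(2) h(1,3)] by (auto simp: small_def inj_on_def)
  then show ?thesis using ract_cancel_inv[of z h] ract_cancel_inv[of z' h] z h by simp
qed

lemma finite_s_fibre: "\<phi> \<in> Cspan (ztop Z) \<Longrightarrow> finite {z \<in> points Z. sanchor Z z = v \<and> \<phi> z \<noteq> 0}"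
  by (rule Cspan_finite_fibre[OF sanchor_local_homeo locally_LCH_points])

lemma finite_row:
  assumes "\<phi> \<in> Cspan (ztop Z)" and z: "z \<in> points Z"
  shows "finite {h \<in> src_fibre H (sanchor Z z). \<phi> (ract Z z (ginv H h)) \<noteq> 0}"
  using assms(1)
proof (induction rule: Cspan_induct_small_sets)
  case zero
  show ?case by simp
next
  case (add \<phi> c g U)
  let ?A = "{h \<in> src_fibre H (sanchor Z z). ract Z z (ginv H h) \<in> U}"
  have "finite ?A"
  proof (cases "?A = {}")
    case False
    then obtain h0 where h0: "h0 \<in> ?A" by (metis ex_in_conv)
    have "?A \<subseteq> {h0}"
    proof
      fix h assume "h \<in> ?A"
      then have "h = h0" using h0 by - (rule small_row[OF add.hyps(4) z], simp_all add: src_fibre_def)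
      then show "h \<in> {h0}" by simp
    qed
    then show ?thesis by (rule finite_subset) simp
  qed (metis finite.emptyI)
  then show ?case
    using add.IH
  proof (rule finite_subset[OF _ finite_UnI, rotated])
    show "{h \<in> src_fibre H (sanchor Z z). \<phi> (ract Z z (ginv H h)) + c * g (ract Z z (ginv H h)) \<noteq> 0}
      \<subseteq> ?A \<union> {h \<in> src_fibre H (sanchor Z z). \<phi> (ract Z z (ginv H h)) \<noteq> 0}"
    proof -
      have gU: "x \<in> U" if "g x \<noteq> 0" for x using Cc_on_outside[OF add.hyps(5)] that by blast
      show ?thesis by (auto intro: gU)
    qed
  qed
qed

lemma finite_column:
  assumes \<psi>: "\<psi> \<in> Cspan (ztop Z)" and h: "h \<in> arrows H"
  shows "finite {z \<in> s_fibre Z (gsrc H h). \<psi> (ract Z z (ginv H h)) \<noteq> 0}"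
proof (rule finite_imageD)
  let ?m = "\<lambda>z. ract Z z (ginv H h)"
  show "finite (?m ` {z \<in> s_fibre Z (gsrc H h). \<psi> (ract Z z (ginv H h)) \<noteq> 0})"
    by (rule finite_subset[OF _ finite_s_fibre[OF \<psi>, of "grng H h"]]) (auto simp: s_fibre_def ract_inv_closed h)
  show "inj_on ?m {z \<in> s_fibre Z (gsrc H h). \<psi> (ract Z z (ginv H h)) \<noteq> 0}"
    by (rule inj_on_inverseI[where g = "\<lambda>z. ract Z z h"]) (auto simp: s_fibre_def ract_cancel_inv h)
qed

end

lemma (in lc_groupoid) finite_fibre:
  assumes "f \<in> Cspan (gtop G)"
  shows "finite {g \<in> arrows G. gsrc G g = u \<and> f g \<noteq> 0}" "finite {g \<in> arrows G. grng G g = u \<and> f g \<noteq> 0}"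
  by (rule Cspan_finite_fibre[OF src_local_homeo locally_LCH_arrows assms],
      rule Cspan_finite_fibre[OF rng_local_homeo locally_LCH_arrows assms])

subsection \<open>The operators on arbitrary functions\<close>

text \<open>The formulas for the operators without a restriction of the domain to a space of summable functions.
  The sums are finite for compactly supported \<open>\<phi>\<close> and \<open>\<psi>\<close>, so that identities between them hold for
  arbitrary functions and all exponents at once.\<close>

definition T_raw :: "'h groupoid \<Rightarrow> ('g, 'h, 'z) correspondence \<Rightarrow> ('z \<Rightarrow> complex) \<Rightarrow> ('h \<Rightarrow> complex) \<Rightarrow> ('z \<Rightarrow> complex)" where
  "T_raw H Z \<phi> \<xi> = (\<lambda>z. if z \<in> points Z then \<Sum>\<^sub>\<infinity>h\<in>src_fibre H (sanchor Z z). \<phi> (ract Z z (ginv H h)) * \<xi> h else 0)"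

definition S_raw :: "'h groupoid \<Rightarrow> ('g, 'h, 'z) correspondence \<Rightarrow> ('z \<Rightarrow> complex) \<Rightarrow> ('z \<Rightarrow> complex) \<Rightarrow> ('h \<Rightarrow> complex)" where
  "S_raw H Z \<psi> \<zeta> = (\<lambda>h. if h \<in> arrows H then \<Sum>\<^sub>\<infinity>z\<in>s_fibre Z (gsrc H h). \<psi> (ract Z z (ginv H h)) * \<zeta> z else 0)"

lemma infsum_swap_finite:
  fixes a :: "'i \<Rightarrow> complex" and b :: "'i \<Rightarrow> 'j \<Rightarrow> complex"
  assumes fin: "finite {i \<in> I. a i \<noteq> 0}" and b: "\<And>i. i \<in> I \<Longrightarrow> finite {j \<in> J. b i j \<noteq> 0}"
  shows "(\<Sum>\<^sub>\<infinity>i\<in>I. a i * (\<Sum>\<^sub>\<infinity>j\<in>J. b i j * x j)) = (\<Sum>\<^sub>\<infinity>j\<in>J. (\<Sum>\<^sub>\<infinity>i\<in>I. a i * b i j) * x j)"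
proof -
  have "finite (Sigma {i \<in> I. a i \<noteq> 0} (\<lambda>i. {j \<in> J. b i j \<noteq> 0}))" using fin b by (intro finite_SigmaI) auto
  then have "(\<lambda>(i, j). a i * b i j * x j) summable_on I \<times> J"
    by (rule finite_nonzero_values_imp_summable_on[OF finite_subset, rotated]) auto
  from infsum_swap_banach[OF this]
  have "(\<Sum>\<^sub>\<infinity>i\<in>I. \<Sum>\<^sub>\<infinity>j\<in>J. a i * b i j * x j) = (\<Sum>\<^sub>\<infinity>j\<in>J. \<Sum>\<^sub>\<infinity>i\<in>I. a i * b i j * x j)" .
  moreover have "(\<Sum>\<^sub>\<infinity>i\<in>I. \<Sum>\<^sub>\<infinity>j\<in>J. a i * b i j * x j) = (\<Sum>\<^sub>\<infinity>i\<in>I. a i * (\<Sum>\<^sub>\<infinity>j\<in>J. b i j * x j))"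
    by (simp only: infsum_cmult_right' mult.assoc)
  moreover have "(\<Sum>\<^sub>\<infinity>j\<in>J. \<Sum>\<^sub>\<infinity>i\<in>I. a i * b i j * x j) = (\<Sum>\<^sub>\<infinity>j\<in>J. (\<Sum>\<^sub>\<infinity>i\<in>I. a i * b i j) * x j)"
    by (simp only: infsum_cmult_left')
  ultimately show ?thesis by simp
qed

context lc_correspondence
begin

text \<open>Composition with the inverse, which converts left into right convolutions.\<close>

definition tilde :: "('k \<Rightarrow> complex) \<Rightarrow> 'k groupoid \<Rightarrow> ('k \<Rightarrow> complex)" where
  "tilde f K = (\<lambda>g. if g \<in> arrows K then f (ginv K g) else 0)"

lemma left_mult_conv: "left_mult G Z f \<phi> = left.conv (tilde f G) \<phi>"
proof
  fix z
  have "(\<Sum>\<^sub>\<infinity>g\<in>{g \<in> arrows G. grng G g = ranchor Z z}. f g * \<phi> (lact Z (ginv G g) z))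
    = (\<Sum>\<^sub>\<infinity>g\<in>{g \<in> arrows G. gsrc G g = ranchor Z z}. tilde f G g * \<phi> (lact Z g z))"
    by (rule infsum_reindex_bij_witness[of _ "ginv G" "ginv G"])
      (auto simp: G.inv_inv G.inv_closed G.src_inv G.rng_inv tilde_def)
  then show "left_mult G Z f \<phi> z = left.conv (tilde f G) \<phi> z"
    by (simp add: left_mult_def left.conv_def)
qed

lemma right_mult_conv: "right_mult G Z \<psi> f = left.conv f \<psi>"
proof
  fix z
  have "(\<Sum>\<^sub>\<infinity>g\<in>{g \<in> arrows G. grng G g = ranchor Z z}. \<psi> (lact Z (ginv G g) z) * f (ginv G g))
    = (\<Sum>\<^sub>\<infinity>g\<in>{g \<in> arrows G. gsrc G g = ranchor Z z}. f g * \<psi> (lact Z g z))"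
    by (rule infsum_reindex_bij_witness[of _ "ginv G" "ginv G"])
      (auto simp: G.inv_inv G.inv_closed G.src_inv G.rng_inv)
  then show "right_mult G Z \<psi> f z = left.conv f \<psi> z"
    by (simp add: right_mult_def left.conv_def)
qed

lemma left_mult_Cspan: "\<lbrakk>f \<in> Cspan (gtop G); \<phi> \<in> Cspan (ztop Z)\<rbrakk> \<Longrightarrow> left_mult G Z f \<phi> \<in> Cspan (ztop Z)"
  unfolding left_mult_conv tilde_def by (intro left.conv_Cspan G.Cspan_inv)

lemma right_mult_Cspan: "\<lbrakk>f \<in> Cspan (gtop G); \<psi> \<in> Cspan (ztop Z)\<rbrakk> \<Longrightarrow> right_mult G Z \<psi> f \<in> Cspan (ztop Z)"
  unfolding right_mult_conv by (intro left.conv_Cspan)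

lemma finite_rng_terms:
  assumes "f \<in> Cspan (gtop G)"
  shows "finite {g \<in> {g \<in> arrows G. grng G g = u}. f g \<noteq> 0}"
  using G.finite_fibre(2)[OF assms, of u] by (simp add: conj_assoc)

lemma lact_inv_closed:
  assumes "z \<in> points Z" "g \<in> arrows G" "grng G g = ranchor Z z"
  shows "lact Z (ginv G g) z \<in> points Z" "sanchor Z (lact Z (ginv G g) z) = sanchor Z z"
    "ranchor Z (lact Z (ginv G g) z) = gsrc G g"
  using assms by (simp_all add: lact_closed sanchor_lact ranchor_lact G.inv_closed G.src_inv G.rng_inv)

text \<open>Each of the following identities is an interchange of two finite sums, after a bijective change of
  the summation variable when the products are regrouped.\<close>

lemma left_mult_T_raw:
  assumes f: "f \<in> Cspan (gtop G)" and \<phi>: "\<phi> \<in> Cspan (ztop Z)"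
  shows "left_mult G Z f (T_raw H Z \<phi> \<xi>) = T_raw H Z (left_mult G Z f \<phi>) \<xi>"
proof
  fix z
  show "left_mult G Z f (T_raw H Z \<phi> \<xi>) z = T_raw H Z (left_mult G Z f \<phi>) \<xi> z"
  proof (cases "z \<in> points Z")
    case z: True
    let ?I = "{g \<in> arrows G. grng G g = ranchor Z z}" and ?J = "src_fibre H (sanchor Z z)"
    have "left_mult G Z f (T_raw H Z \<phi> \<xi>) z =
        (\<Sum>\<^sub>\<infinity>g\<in>?I. f g * (\<Sum>\<^sub>\<infinity>h\<in>?J. \<phi> (ract Z (lact Z (ginv G g) z) (ginv H h)) * \<xi> h))"
      using z by (auto simp: left_mult_def T_raw_def lact_inv_closed intro!: infsum_cong)
    also have "\<dots> = (\<Sum>\<^sub>\<infinity>h\<in>?J. (\<Sum>\<^sub>\<infinity>g\<in>?I. f g * \<phi> (ract Z (lact Z (ginv G g) z) (ginv H h))) * \<xi> h)"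
    proof (rule infsum_swap_finite[OF finite_rng_terms[OF f]])
      fix g assume g: "g \<in> ?I"
      then show "finite {h \<in> ?J. \<phi> (ract Z (lact Z (ginv G g) z) (ginv H h)) \<noteq> 0}"
        using finite_row[OF \<phi>, of "lact Z (ginv G g) z"] z by (simp add: lact_inv_closed)
    qed
    also have "\<dots> = (\<Sum>\<^sub>\<infinity>h\<in>?J. left_mult G Z f \<phi> (ract Z z (ginv H h)) * \<xi> h)"
    proof (rule infsum_cong)
      fix h assume "h \<in> ?J"
      then have h: "h \<in> arrows H" "gsrc H h = sanchor Z z" by (auto simp: src_fibre_def)
      have "(\<Sum>\<^sub>\<infinity>g\<in>?I. f g * \<phi> (ract Z (lact Z (ginv G g) z) (ginv H h)))
          = (\<Sum>\<^sub>\<infinity>g\<in>?I. f g * \<phi> (lact Z (ginv G g) (ract Z z (ginv H h))))"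
        using z h by (intro infsum_cong) (simp add: actions_commute G.inv_closed H.inv_closed G.src_inv H.rng_inv)
      then show "(\<Sum>\<^sub>\<infinity>g\<in>?I. f g * \<phi> (ract Z (lact Z (ginv G g) z) (ginv H h))) * \<xi> h = left_mult G Z f \<phi> (ract Z z (ginv H h)) * \<xi> h"
        using z h by (simp add: left_mult_def ract_inv_closed)
    qed
    finally show ?thesis using z by (simp add: T_raw_def)
  qed (simp add: left_mult_def T_raw_def)
qed

lemma left_mult_mult:
  assumes f: "f \<in> Cspan (gtop G)" and g: "g \<in> Cspan (gtop G)"
  shows "left_mult G Z f (left_mult G Z g \<zeta>) = left_mult G Z (left_mult G (self_corr G) f g) \<zeta>"
proof
  fix z
  show "left_mult G Z f (left_mult G Z g \<zeta>) z = left_mult G Z (left_mult G (self_corr G) f g) \<zeta> z"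
  proof (cases "z \<in> points Z")
    case z: True
    let ?I = "{k \<in> arrows G. grng G k = ranchor Z z}"
    have "left_mult G Z f (left_mult G Z g \<zeta>) z
        = (\<Sum>\<^sub>\<infinity>k\<in>?I. f k * (\<Sum>\<^sub>\<infinity>l\<in>?I. g (gmult G (ginv G k) l) * \<zeta> (lact Z (ginv G l) z)))"
      unfolding left_mult_def
    proof (simp only: z if_True, rule infsum_cong)
      fix k assume "k \<in> ?I"
      then have k: "k \<in> arrows G" "grng G k = ranchor Z z" by auto
      have "(\<Sum>\<^sub>\<infinity>l\<in>{l \<in> arrows G. grng G l = gsrc G k}. g l * \<zeta> (lact Z (ginv G l) (lact Z (ginv G k) z)))
          = (\<Sum>\<^sub>\<infinity>l\<in>?I. g (gmult G (ginv G k) l) * \<zeta> (lact Z (ginv G l) z))"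
      proof (rule infsum_reindex_bij_witness[of _ "\<lambda>l. gmult G (ginv G k) l" "\<lambda>l. gmult G k l"])
        fix l assume l: "l \<in> {l \<in> arrows G. grng G l = gsrc G k}"
        then show "gmult G (ginv G k) (gmult G k l) = l" "gmult G k l \<in> ?I"
          using k by (auto simp: G.inv_mult_cancel G.mult_closed G.rng_mult)
        show "g (gmult G (ginv G k) (gmult G k l)) * \<zeta> (lact Z (ginv G (gmult G k l)) z)
            = g l * \<zeta> (lact Z (ginv G l) (lact Z (ginv G k) z))"
          using k l z by (simp add: G.inv_mult_cancel G.inv_of_mult lact_lact G.inv_closed G.src_inv G.rng_inv)
      next
        fix l assume l: "l \<in> ?I"
        then show "gmult G k (gmult G (ginv G k) l) = l" "gmult G (ginv G k) l \<in> {l \<in> arrows G. grng G l = gsrc G k}"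
          using k by (auto simp: G.mult_inv_cancel G.mult_closed G.rng_mult G.inv_closed G.src_inv G.rng_inv)
      qed
      then show "f k * (if lact Z (ginv G k) z \<in> points Z
           then \<Sum>\<^sub>\<infinity>l\<in>{l \<in> arrows G. grng G l = ranchor Z (lact Z (ginv G k) z)}. g l * \<zeta> (lact Z (ginv G l) (lact Z (ginv G k) z))
           else 0) = f k * (\<Sum>\<^sub>\<infinity>l\<in>?I. g (gmult G (ginv G k) l) * \<zeta> (lact Z (ginv G l) z))"
        using z k by (simp add: lact_inv_closed)
    qed
    also have "\<dots> = (\<Sum>\<^sub>\<infinity>l\<in>?I. (\<Sum>\<^sub>\<infinity>k\<in>?I. f k * g (gmult G (ginv G k) l)) * \<zeta> (lact Z (ginv G l) z))"
    proof (rule infsum_swap_finite[OF finite_rng_terms[OF f]])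
      fix k assume "k \<in> ?I"
      then have k: "k \<in> arrows G" "grng G k = ranchor Z z" by auto
      show "finite {l \<in> ?I. g (gmult G (ginv G k) l) \<noteq> 0}"
      proof (rule finite_imageD)
        show "finite (gmult G (ginv G k) ` {l \<in> ?I. g (gmult G (ginv G k) l) \<noteq> 0})"
          by (rule finite_subset[OF _ G.finite_fibre(2)[OF g, of "gsrc G k"]])
            (use k in \<open>auto simp: G.mult_closed G.rng_mult G.inv_closed G.src_inv G.rng_inv\<close>)
        show "inj_on (gmult G (ginv G k)) {l \<in> ?I. g (gmult G (ginv G k) l) \<noteq> 0}"
          by (rule inj_on_inverseI[where g = "gmult G k"]) (use k in \<open>auto simp: G.mult_inv_cancel\<close>)
      qed
    qed
    also have "\<dots> = left_mult G Z (left_mult G (self_corr G) f g) \<zeta> z"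
      using z by (auto simp: left_mult_def intro!: infsum_cong)
    finally show ?thesis .
  qed (simp add: left_mult_def)
qed


lemma S_raw_left_mult:
  assumes f: "f \<in> Cspan (gtop G)" and \<psi>: "\<psi> \<in> Cspan (ztop Z)"
  shows "S_raw H Z \<psi> (left_mult G Z f \<zeta>) = S_raw H Z (right_mult G Z \<psi> f) \<zeta>"
proof
  fix h
  show "S_raw H Z \<psi> (left_mult G Z f \<zeta>) h = S_raw H Z (right_mult G Z \<psi> f) \<zeta> h"
  proof (cases "h \<in> arrows H")
    case h: True
    let ?F = "s_fibre Z (gsrc H h)" and ?\<Gamma> = "\<lambda>z. {g \<in> arrows G. grng G g = ranchor Z z}"
    let ?u = "\<lambda>(z, g). \<psi> (ract Z z (ginv H h)) * (f g * \<zeta> (lact Z (ginv G g) z))"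
    let ?v = "\<lambda>(z, g). (\<psi> (lact Z (ginv G g) (ract Z z (ginv H h))) * f (ginv G g)) * \<zeta> z"
    let ?j = "\<lambda>(z, g). (lact Z (ginv G g) z, ginv G g)"
    have F: "z \<in> ?F \<longleftrightarrow> z \<in> points Z \<and> sanchor Z z = gsrc H h" for z by (simp add: s_fibre_def)
    have jj: "?j (?j a) = a" and jm: "?j a \<in> Sigma ?F ?\<Gamma>" if "a \<in> Sigma ?F ?\<Gamma>" for a
    proof -
      obtain z g where a: "a = (z, g)" by (cases a)
      show "?j (?j a) = a" "?j a \<in> Sigma ?F ?\<Gamma>"
        using that by (auto simp: a F lact_inv_closed G.inv_inv G.inv_closed G.rng_inv lact_cancel_inv)
    qed
    have vu: "?v (?j a) = ?u a" if "a \<in> Sigma ?F ?\<Gamma>" for a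
    proof -
      obtain z g where a: "a = (z, g)" by (cases a)
      have z: "z \<in> points Z" "sanchor Z z = gsrc H h" "g \<in> arrows G" "grng G g = ranchor Z z"
        using that by (auto simp: a F)
      have "lact Z g (ract Z (lact Z (ginv G g) z) (ginv H h)) = ract Z z (ginv H h)"
        using z h actions_commute[of g "lact Z (ginv G g) z" "ginv H h"]
        by (simp add: lact_inv_closed H.inv_closed H.rng_inv lact_cancel_inv)
      then show ?thesis using z by (simp add: a G.inv_inv)
    qed
    have "finite (Sigma {z \<in> ?F. \<psi> (ract Z z (ginv H h)) \<noteq> 0} (\<lambda>z. {g \<in> ?\<Gamma> z. f g \<noteq> 0}))"
      by (intro finite_SigmaI finite_column[OF \<psi> h] finite_rng_terms[OF f])
    then have su: "?u summable_on Sigma ?F ?\<Gamma>"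
      by (rule finite_nonzero_values_imp_summable_on[OF finite_subset, rotated]) auto
    have sv: "?v summable_on Sigma ?F ?\<Gamma>"
      using su summable_on_reindex_bij_witness[of "Sigma ?F ?\<Gamma>" ?j ?j "Sigma ?F ?\<Gamma>" ?v ?u] jj jm vu by blast
    have "S_raw H Z \<psi> (left_mult G Z f \<zeta>) h = (\<Sum>\<^sub>\<infinity>z\<in>?F. \<Sum>\<^sub>\<infinity>g\<in>?\<Gamma> z. ?u (z, g))"
      unfolding S_raw_def left_mult_def using h by (auto simp: F infsum_cmult_right' intro!: infsum_cong)
    also have "\<dots> = infsum ?u (Sigma ?F ?\<Gamma>)" by (rule infsum_Sigma_banach[OF su])
    also have "\<dots> = infsum ?v (Sigma ?F ?\<Gamma>)"
      by (rule infsum_reindex_bij_witness[of _ ?j ?j]) (fact jj, fact jm, fact jj, fact jm, fact vu)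
    also have "\<dots> = (\<Sum>\<^sub>\<infinity>z\<in>?F. \<Sum>\<^sub>\<infinity>g\<in>?\<Gamma> z. ?v (z, g))" by (rule infsum_Sigma_banach[OF sv, symmetric])
    also have "\<dots> = S_raw H Z (right_mult G Z \<psi> f) \<zeta> h"
      unfolding S_raw_def right_mult_def using h
      by (auto simp: F infsum_cmult_left' ract_inv_closed intro!: infsum_cong)
    finally show ?thesis .
  qed (simp add: S_raw_def)
qed

lemma src_fibre_iff: "h \<in> src_fibre H v \<longleftrightarrow> h \<in> arrows H \<and> gsrc H h = v"
  and s_fibre_iff: "z \<in> s_fibre Z v \<longleftrightarrow> z \<in> points Z \<and> sanchor Z z = v"
  by (auto simp: src_fibre_def s_fibre_def)

lemma ract_inv_mult:
  assumes "z \<in> points Z" "h \<in> arrows H" "k \<in> arrows H" "gsrc H h = sanchor Z z" "gsrc H k = sanchor Z z"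
  shows "ract Z (ract Z z (ginv H h)) (gmult H h (ginv H k)) = ract Z z (ginv H k)"
  using assms ract_ract[of "ract Z z (ginv H h)" h "ginv H k"]
  by (simp add: ract_inv_closed ract_cancel_inv H.inv_closed H.rng_inv)

lemma S_raw_T_raw:
  assumes \<psi>: "\<psi> \<in> Cspan (ztop Z)" and \<phi>: "\<phi> \<in> Cspan (ztop Z)"
  shows "S_raw H Z \<psi> (T_raw H Z \<phi> \<xi>) = T_raw H (self_corr H) (pair.conv \<psi> \<phi>) \<xi>"
proof
  fix h
  show "S_raw H Z \<psi> (T_raw H Z \<phi> \<xi>) h = T_raw H (self_corr H) (pair.conv \<psi> \<phi>) \<xi> h"
  proof (cases "h \<in> arrows H")
    case h: True
    let ?I = "s_fibre Z (gsrc H h)" and ?J = "src_fibre H (gsrc H h)"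
    have "S_raw H Z \<psi> (T_raw H Z \<phi> \<xi>) h = (\<Sum>\<^sub>\<infinity>z\<in>?I. \<psi> (ract Z z (ginv H h)) * (\<Sum>\<^sub>\<infinity>k\<in>?J. \<phi> (ract Z z (ginv H k)) * \<xi> k))"
      using h by (auto simp: S_raw_def T_raw_def s_fibre_iff intro!: infsum_cong)
    also have "\<dots> = (\<Sum>\<^sub>\<infinity>k\<in>?J. (\<Sum>\<^sub>\<infinity>z\<in>?I. \<psi> (ract Z z (ginv H h)) * \<phi> (ract Z z (ginv H k))) * \<xi> k)"
    proof (rule infsum_swap_finite[OF finite_column[OF \<psi> h]])
      show "finite {k \<in> ?J. \<phi> (ract Z z (ginv H k)) \<noteq> 0}" if "z \<in> ?I" for z
        using finite_row[OF \<phi>, of z] that by (simp add: s_fibre_iff)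
    qed
    also have "\<dots> = (\<Sum>\<^sub>\<infinity>k\<in>?J. pair.conv \<psi> \<phi> (gmult H h (ginv H k)) * \<xi> k)"
    proof (rule infsum_cong)
      fix k assume "k \<in> ?J"
      then have k: "k \<in> arrows H" "gsrc H k = gsrc H h" by (auto simp: src_fibre_iff)
      have hk: "gmult H h (ginv H k) \<in> arrows H" "grng H (gmult H h (ginv H k)) = grng H h"
        using h k by (simp_all add: H.mult_closed H.rng_mult H.inv_closed H.rng_inv)
      have "(\<Sum>\<^sub>\<infinity>z\<in>?I. \<psi> (ract Z z (ginv H h)) * \<phi> (ract Z z (ginv H k)))
          = (\<Sum>\<^sub>\<infinity>w\<in>{w \<in> points Z. sanchor Z w = grng H h}. \<psi> w * \<phi> (ract Z w (gmult H h (ginv H k))))"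
        by (rule infsum_reindex_bij_witness[of _ "\<lambda>w. ract Z w h" "\<lambda>z. ract Z z (ginv H h)"])
          (use h k in \<open>auto simp: s_fibre_iff ract_cancel_inv ract_inv_cancel ract_inv_closed ract_closed sanchor_ract ract_inv_mult\<close>)
      then show "(\<Sum>\<^sub>\<infinity>z\<in>?I. \<psi> (ract Z z (ginv H h)) * \<phi> (ract Z z (ginv H k))) * \<xi> k
          = pair.conv \<psi> \<phi> (gmult H h (ginv H k)) * \<xi> k"
        using hk by (simp add: pair.conv_def)
    qed
    finally show ?thesis using h by (simp add: T_raw_def)
  qed (simp add: S_raw_def T_raw_def)
qed

lemma T_raw_T_raw:
  assumes \<phi>: "\<phi> \<in> Cspan (ztop Z)" and f: "f \<in> Cspan (gtop H)"
  shows "T_raw H Z \<phi> (T_raw H (self_corr H) f \<xi>) = T_raw H Z (right.conv (tilde f H) \<phi>) \<xi>"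
proof
  interpret HH: lc_correspondence H H "self_corr H" by (rule H.self_correspondence)
  fix z
  show "T_raw H Z \<phi> (T_raw H (self_corr H) f \<xi>) z = T_raw H Z (right.conv (tilde f H) \<phi>) \<xi> z"
  proof (cases "z \<in> points Z")
    case z: True
    let ?J = "src_fibre H (sanchor Z z)"
    have "T_raw H Z \<phi> (T_raw H (self_corr H) f \<xi>) z
        = (\<Sum>\<^sub>\<infinity>h\<in>?J. \<phi> (ract Z z (ginv H h)) * (\<Sum>\<^sub>\<infinity>k\<in>?J. f (gmult H h (ginv H k)) * \<xi> k))"
      using z by (auto simp: T_raw_def src_fibre_iff intro!: infsum_cong)
    also have "\<dots> = (\<Sum>\<^sub>\<infinity>k\<in>?J. (\<Sum>\<^sub>\<infinity>h\<in>?J. \<phi> (ract Z z (ginv H h)) * f (gmult H h (ginv H k))) * \<xi> k)"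
    proof (rule infsum_swap_finite[OF finite_row[OF \<phi> z]])
      show "finite {k \<in> ?J. f (gmult H h (ginv H k)) \<noteq> 0}" if "h \<in> ?J" for h
        using HH.finite_row[of f h] f that by (simp add: src_fibre_iff)
    qed
    also have "\<dots> = (\<Sum>\<^sub>\<infinity>k\<in>?J. right.conv (tilde f H) \<phi> (ract Z z (ginv H k)) * \<xi> k)"
    proof (rule infsum_cong)
      fix k assume "k \<in> ?J"
      then have k: "k \<in> arrows H" "gsrc H k = sanchor Z z" by (auto simp: src_fibre_iff)
      have "(\<Sum>\<^sub>\<infinity>h\<in>?J. \<phi> (ract Z z (ginv H h)) * f (gmult H h (ginv H k)))
          = (\<Sum>\<^sub>\<infinity>l\<in>{l \<in> arrows H. grng H l = grng H k}. tilde f H l * \<phi> (ract Z (ract Z z (ginv H k)) l))"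
      proof (rule infsum_reindex_bij_witness[of _ "\<lambda>l. gmult H (ginv H l) k" "\<lambda>h. gmult H k (ginv H h)"])
        fix h assume "h \<in> ?J"
        then have h: "h \<in> arrows H" "gsrc H h = sanchor Z z" by (auto simp: src_fibre_iff)
        have i: "ginv H (gmult H k (ginv H h)) = gmult H h (ginv H k)"
          using h k by (simp add: H.inv_of_mult H.inv_closed H.rng_inv H.inv_inv)
        have m: "gmult H k (ginv H h) \<in> arrows H" "grng H (gmult H k (ginv H h)) = grng H k"
          using h k by (simp_all add: H.mult_closed H.rng_mult H.inv_closed H.rng_inv)
        show "gmult H (ginv H (gmult H k (ginv H h))) k = h"
          unfolding i using h k by (simp add: H.mult_inv_cancel_right)
        show "gmult H k (ginv H h) \<in> {l \<in> arrows H. grng H l = grng H k}" using m by simp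
        show "tilde f H (gmult H k (ginv H h)) * \<phi> (ract Z (ract Z z (ginv H k)) (gmult H k (ginv H h)))
            = \<phi> (ract Z z (ginv H h)) * f (gmult H h (ginv H k))"
          using ract_inv_mult[OF z k(1) h(1) k(2) h(2)] m by (simp add: tilde_def i)
      next
        fix l assume "l \<in> {l \<in> arrows H. grng H l = grng H k}"
        then have l: "l \<in> arrows H" "grng H l = grng H k" by auto
        show "gmult H (ginv H l) k \<in> ?J"
          using l k by (simp add: src_fibre_iff H.mult_closed H.src_mult H.inv_closed H.src_inv)
        have "ginv H (gmult H (ginv H l) k) = gmult H (ginv H k) l"
          using l k by (simp add: H.inv_of_mult H.inv_closed H.src_inv H.inv_inv)
        then show "gmult H k (ginv H (gmult H (ginv H l) k)) = l"
          using l k by (simp add: H.mult_inv_cancel)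
      qed
      then show "(\<Sum>\<^sub>\<infinity>h\<in>?J. \<phi> (ract Z z (ginv H h)) * f (gmult H h (ginv H k))) * \<xi> k
          = right.conv (tilde f H) \<phi> (ract Z z (ginv H k)) * \<xi> k"
        using z k by (simp add: right.conv_def ract_inv_closed)
    qed
    finally show ?thesis using z by (simp add: T_raw_def)
  qed (simp add: T_raw_def)
qed

lemma T_raw_S_raw:
  assumes f: "f \<in> Cspan (gtop H)" and \<psi>: "\<psi> \<in> Cspan (ztop Z)"
  shows "T_raw H (self_corr H) f (S_raw H Z \<psi> \<zeta>) = S_raw H Z (right.conv f \<psi>) \<zeta>"
proof
  interpret HH: lc_correspondence H H "self_corr H" by (rule H.self_correspondence)
  fix h
  show "T_raw H (self_corr H) f (S_raw H Z \<psi> \<zeta>) h = S_raw H Z (right.conv f \<psi>) \<zeta> h"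
  proof (cases "h \<in> arrows H")
    case h: True
    let ?I = "src_fibre H (gsrc H h)" and ?J = "s_fibre Z (gsrc H h)"
    have "T_raw H (self_corr H) f (S_raw H Z \<psi> \<zeta>) h
        = (\<Sum>\<^sub>\<infinity>k\<in>?I. f (gmult H h (ginv H k)) * (\<Sum>\<^sub>\<infinity>z\<in>?J. \<psi> (ract Z z (ginv H k)) * \<zeta> z))"
      using h by (auto simp: T_raw_def S_raw_def src_fibre_iff intro!: infsum_cong)
    also have "\<dots> = (\<Sum>\<^sub>\<infinity>z\<in>?J. (\<Sum>\<^sub>\<infinity>k\<in>?I. f (gmult H h (ginv H k)) * \<psi> (ract Z z (ginv H k))) * \<zeta> z)"
    proof (rule infsum_swap_finite)
      show "finite {k \<in> ?I. f (gmult H h (ginv H k)) \<noteq> 0}" using HH.finite_row[of f h] f h by simp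
      show "finite {z \<in> ?J. \<psi> (ract Z z (ginv H k)) \<noteq> 0}" if "k \<in> ?I" for k
        using finite_column[OF \<psi>, of k] that by (simp add: src_fibre_iff)
    qed
    also have "\<dots> = (\<Sum>\<^sub>\<infinity>z\<in>?J. right.conv f \<psi> (ract Z z (ginv H h)) * \<zeta> z)"
    proof (rule infsum_cong)
      fix z assume "z \<in> ?J"
      then have z: "z \<in> points Z" "sanchor Z z = gsrc H h" by (auto simp: s_fibre_iff)
      have "(\<Sum>\<^sub>\<infinity>k\<in>?I. f (gmult H h (ginv H k)) * \<psi> (ract Z z (ginv H k)))
          = (\<Sum>\<^sub>\<infinity>l\<in>{l \<in> arrows H. grng H l = grng H h}. f l * \<psi> (ract Z (ract Z z (ginv H h)) l))"
      proof (rule infsum_reindex_bij_witness[of _ "\<lambda>l. gmult H (ginv H l) h" "\<lambda>k. gmult H h (ginv H k)"])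
        fix k assume "k \<in> ?I"
        then have k: "k \<in> arrows H" "gsrc H k = gsrc H h" by (auto simp: src_fibre_iff)
        have i: "ginv H (gmult H h (ginv H k)) = gmult H k (ginv H h)"
          using h k by (simp add: H.inv_of_mult H.inv_closed H.rng_inv H.inv_inv)
        show "gmult H (ginv H (gmult H h (ginv H k))) h = k"
          unfolding i using h k by (simp add: H.mult_inv_cancel_right)
        show "gmult H h (ginv H k) \<in> {l \<in> arrows H. grng H l = grng H h}"
          using h k by (simp add: H.mult_closed H.rng_mult H.inv_closed H.rng_inv)
        show "f (gmult H h (ginv H k)) * \<psi> (ract Z (ract Z z (ginv H h)) (gmult H h (ginv H k)))
            = f (gmult H h (ginv H k)) * \<psi> (ract Z z (ginv H k))"
          using ract_inv_mult[of z h k] z h k by simp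
      next
        fix l assume "l \<in> {l \<in> arrows H. grng H l = grng H h}"
        then have l: "l \<in> arrows H" "grng H l = grng H h" by auto
        show "gmult H (ginv H l) h \<in> ?I"
          using l h by (simp add: src_fibre_iff H.mult_closed H.src_mult H.inv_closed H.src_inv)
        have "ginv H (gmult H (ginv H l) h) = gmult H (ginv H h) l"
          using l h by (simp add: H.inv_of_mult H.inv_closed H.src_inv H.inv_inv)
        then show "gmult H h (ginv H (gmult H (ginv H l) h)) = l"
          using l h by (simp add: H.mult_inv_cancel)
      qed
      then show "(\<Sum>\<^sub>\<infinity>k\<in>?I. f (gmult H h (ginv H k)) * \<psi> (ract Z z (ginv H k))) * \<zeta> z
          = right.conv f \<psi> (ract Z z (ginv H h)) * \<zeta> z"
        using z h by (simp add: right.conv_def ract_inv_closed)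
    qed
    finally show ?thesis using h by (simp add: S_raw_def)
  qed (simp add: T_raw_def S_raw_def)
qed

end

section \<open>Bounded operators between the spaces of p-summable functions\<close>

lemma complex_banach_cong_norm:
  assumes "complex_banach_space V" and eq: "carrier V' = carrier V" "vadd V' = vadd V" "vzero V' = vzero V"
    "vscale V' = vscale V" and n: "\<And>x. x \<in> carrier V \<Longrightarrow> vnorm V' x = vnorm V x"
  shows "complex_banach_space V'"
proof -
  interpret complex_banach_space V by fact
  have d: "vdiff V' = vdiff V" by (simp add: vdiff_def fun_eq_iff eq)
  show ?thesis
  proof unfold_locales
    fix \<sigma> :: "nat \<Rightarrow> _"
    assume \<sigma>: "range \<sigma> \<subseteq> carrier V'" and C: "\<forall>e>0. \<exists>N. \<forall>m\<ge>N. \<forall>n\<ge>N. vnorm V' (vdiff V' (\<sigma> m) (\<sigma> n)) < e"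
    have c: "\<sigma> k \<in> carrier V" for k using \<sigma> eq by auto
    have nd: "vnorm V' (vdiff V' (\<sigma> k) x) = vnorm V (vdiff V (\<sigma> k) x)" if "x \<in> carrier V" for k x
      using n[OF vdiff_closed[OF c that]] by (simp add: d)
    have "\<exists>x\<in>carrier V. (\<lambda>n. vnorm V (vdiff V (\<sigma> n) x)) \<longlonglongrightarrow> 0"
      using C c by (intro complete) (auto simp: nd)
    then show "\<exists>x\<in>carrier V'. (\<lambda>n. vnorm V' (vdiff V' (\<sigma> n) x)) \<longlonglongrightarrow> 0"
      by (auto simp: nd eq)
  qed (simp_all add: eq n zero_closed add_closed scale_closed add_assoc add_commute add_left_commute add_zero add_uminus
      scale_one scale_scale scale_add_left scale_add_right norm_nonneg norm_eq_zero norm_triangle norm_scale)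
qed

lemma Cc_on_bounded:
  assumes f: "f \<in> Cc_on X U" and U: "openin X U"
  obtains M where "0 \<le> M" "\<And>x. cmod (f x) \<le> M"
proof -
  obtain K where K: "compactin X K" "K \<subseteq> U" "\<And>x. x \<notin> K \<Longrightarrow> f x = 0" using Cc_onD[OF f U] by metis
  have "compactin euclidean (f ` K)"
    by (rule image_compactin[OF _ Cc_on_continuous[OF f]]) (simp add: compactin_subtopology K)
  then have "bounded (f ` K)" by (simp add: compact_imp_bounded)
  then obtain M where M: "\<And>x. x \<in> K \<Longrightarrow> cmod (f x) \<le> M" by (auto simp: bounded_iff)
  show ?thesis
  proof (rule that[of "max M 0"])
    show "cmod (f x) \<le> max M 0" for x using M[of x] K(3)[of x] by (cases "x \<in> K") auto
  qed simp
qed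

lemma lp_extend_zero:
  fixes f :: "_ \<Rightarrow> complex"
  assumes p: "1 \<le> p" and J: "J \<subseteq> I" and f: "in_lp p J f" and z: "\<And>i. i \<in> I \<Longrightarrow> i \<notin> J \<Longrightarrow> f i = 0"
  shows "in_lp p I f" "lp_norm p I f = lp_norm p J f"
proof -
  have *: "in_lp p I f" "lp_norm p I f \<le> 1 * lp_norm p J f"
    using lp_partial_injection[OF p f, where m = "\<lambda>i. i" and D = J and J = I and f = f and M = 1] z by auto
  then show "in_lp p I f" "lp_norm p I f = lp_norm p J f"
    using lp_subset(2)[OF p *(1) J] by auto
qed

lemma (in etale_groupoid) E_self: "E_corr p G (self_corr G) = E_groupoid p G"
  by (simp add: E_corr_def E_groupoid_def s_fibre_def[abs_def] src_fibre_def[abs_def])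

context lc_correspondence
begin

lemma E_corr_simps:
  assumes p: "1 \<le> p"
  shows "carrier (E_corr p H Z) = carrier (lp_space p (points Z))"
    "vadd (E_corr p H Z) = (\<lambda>f g i. f i + g i)" "vzero (E_corr p H Z) = (\<lambda>i. 0)"
    "vscale (E_corr p H Z) = (\<lambda>c f i. c * f i)"
    "\<zeta> \<in> carrier (lp_space p (points Z)) \<Longrightarrow> vnorm (E_corr p H Z) \<zeta> = lp_norm p (points Z) \<zeta>"
proof -
  have "disjoint_family_on (s_fibre Z) (units H)" by (auto simp: disjoint_family_on_def s_fibre_def)
  moreover have "(\<Union>v\<in>units H. s_fibre Z v) = points Z" using sanchor_units by (auto simp: s_fibre_def)
  ultimately show "carrier (E_corr p H Z) = carrier (lp_space p (points Z))"
    "vadd (E_corr p H Z) = (\<lambda>f g i. f i + g i)" "vzero (E_corr p H Z) = (\<lambda>i. 0)"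
    "vscale (E_corr p H Z) = (\<lambda>c f i. c * f i)"
    "\<zeta> \<in> carrier (lp_space p (points Z)) \<Longrightarrow> vnorm (E_corr p H Z) \<zeta> = lp_norm p (points Z) \<zeta>"
    unfolding E_corr_def using lp_sum_alt[OF p, of "s_fibre Z" "units H"] by simp_all
qed

lemma E_corr_banach: "1 \<le> p \<Longrightarrow> complex_banach_space (E_corr p H Z)"
  by (rule complex_banach_cong_norm[OF lp_space_banach[of p "points Z"]]) (simp_all add: E_corr_simps)

lemma E_corr_mem: "1 \<le> p \<Longrightarrow> \<zeta> \<in> carrier (E_corr p H Z) \<longleftrightarrow> (\<forall>z. z \<notin> points Z \<longrightarrow> \<zeta> z = 0) \<and> in_lp p (points Z) \<zeta>"
  by (simp add: E_corr_simps)

lemma T_op_raw: "T_op p H Z \<phi> = restrict (T_raw H Z \<phi>) (carrier (E_groupoid p H))"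
  by (simp add: T_op_def T_raw_def[abs_def])

lemma S_op_raw: "S_op p H Z \<psi> = restrict (S_raw H Z \<psi>) (carrier (E_corr p H Z))"
  by (simp add: S_op_def S_raw_def[abs_def])

lemma finite_row': "\<lbrakk>\<phi> \<in> Cspan (ztop Z); z \<in> points Z\<rbrakk>
    \<Longrightarrow> finite {h \<in> src_fibre H (sanchor Z z). \<phi> (ract Z z (ginv H h)) * \<xi> h \<noteq> 0}"
  by (rule finite_subset[OF _ finite_row]) auto

lemma finite_column': "\<lbrakk>\<psi> \<in> Cspan (ztop Z); h \<in> arrows H\<rbrakk>
    \<Longrightarrow> finite {z \<in> s_fibre Z (gsrc H h). \<psi> (ract Z z (ginv H h)) * \<zeta> z \<noteq> 0}"
  by (rule finite_subset[OF _ finite_column]) auto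

lemma T_raw_add_left:
  assumes "\<phi> \<in> Cspan (ztop Z)" "\<phi>' \<in> Cspan (ztop Z)"
  shows "T_raw H Z (\<lambda>z. \<phi> z + c * \<phi>' z) \<xi> = (\<lambda>z. T_raw H Z \<phi> \<xi> z + c * T_raw H Z \<phi>' \<xi> z)"
proof
  fix z
  show "T_raw H Z (\<lambda>z. \<phi> z + c * \<phi>' z) \<xi> z = T_raw H Z \<phi> \<xi> z + c * T_raw H Z \<phi>' \<xi> z"
  proof (cases "z \<in> points Z")
    case True
    show ?thesis using infsum_finite_support_add[OF finite_row'[OF assms(1) True, of \<xi>] finite_row'[OF assms(2) True, of \<xi>], of c] True
      by (simp add: T_raw_def algebra_simps)
  qed (simp add: T_raw_def)
qed

lemma T_raw_add_right:
  assumes "\<phi> \<in> Cspan (ztop Z)"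
  shows "T_raw H Z \<phi> (\<lambda>h. \<xi> h + c * \<xi>' h) = (\<lambda>z. T_raw H Z \<phi> \<xi> z + c * T_raw H Z \<phi> \<xi>' z)"
proof
  fix z
  show "T_raw H Z \<phi> (\<lambda>h. \<xi> h + c * \<xi>' h) z = T_raw H Z \<phi> \<xi> z + c * T_raw H Z \<phi> \<xi>' z"
  proof (cases "z \<in> points Z")
    case True
    show ?thesis using infsum_finite_support_add[OF finite_row'[OF assms True, of \<xi>] finite_row'[OF assms True, of \<xi>'], of c] True
      by (simp add: T_raw_def algebra_simps)
  qed (simp add: T_raw_def)
qed

lemma S_raw_add_left:
  assumes "\<psi> \<in> Cspan (ztop Z)" "\<psi>' \<in> Cspan (ztop Z)"
  shows "S_raw H Z (\<lambda>z. \<psi> z + c * \<psi>' z) \<zeta> = (\<lambda>h. S_raw H Z \<psi> \<zeta> h + c * S_raw H Z \<psi>' \<zeta> h)"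
proof
  fix h
  show "S_raw H Z (\<lambda>z. \<psi> z + c * \<psi>' z) \<zeta> h = S_raw H Z \<psi> \<zeta> h + c * S_raw H Z \<psi>' \<zeta> h"
  proof (cases "h \<in> arrows H")
    case True
    show ?thesis using infsum_finite_support_add[OF finite_column'[OF assms(1) True, of \<zeta>] finite_column'[OF assms(2) True, of \<zeta>], of c] True
      by (simp add: S_raw_def algebra_simps)
  qed (simp add: S_raw_def)
qed

lemma S_raw_add_right:
  assumes "\<psi> \<in> Cspan (ztop Z)"
  shows "S_raw H Z \<psi> (\<lambda>z. \<zeta> z + c * \<zeta>' z) = (\<lambda>h. S_raw H Z \<psi> \<zeta> h + c * S_raw H Z \<psi> \<zeta>' h)"
proof
  fix h
  show "S_raw H Z \<psi> (\<lambda>z. \<zeta> z + c * \<zeta>' z) h = S_raw H Z \<psi> \<zeta> h + c * S_raw H Z \<psi> \<zeta>' h"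
  proof (cases "h \<in> arrows H")
    case True
    show ?thesis using infsum_finite_support_add[OF finite_column'[OF assms True, of \<zeta>] finite_column'[OF assms True, of \<zeta>'], of c] True
      by (simp add: S_raw_def algebra_simps)
  qed (simp add: S_raw_def)
qed

lemma T_raw_small:
  assumes U: "small U" and \<phi>: "\<And>z. z \<notin> U \<Longrightarrow> \<phi> z = 0" and z: "z \<in> points Z" and h: "h \<in> src_fibre H (sanchor Z z)"
    "ract Z z (ginv H h) \<in> U"
  shows "T_raw H Z \<phi> \<xi> z = \<phi> (ract Z z (ginv H h)) * \<xi> h"
proof -
  have "\<phi> (ract Z z (ginv H k)) = 0" if "k \<in> src_fibre H (sanchor Z z)" "k \<noteq> h" for k
    using small_row[OF U z, of k h] that h by (intro \<phi>) (auto simp: src_fibre_iff)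
  then show ?thesis using z h(1) unfolding T_raw_def by (simp only: if_True) (rule infsum_one_term, auto)
qed

lemma T_raw_small_zero:
  assumes \<phi>: "\<And>z. z \<notin> U \<Longrightarrow> \<phi> z = 0" and "\<not> (\<exists>h\<in>src_fibre H (sanchor Z z). ract Z z (ginv H h) \<in> U)"
  shows "T_raw H Z \<phi> \<xi> z = 0"
  using assms unfolding T_raw_def by (auto intro!: infsum_0)

lemma S_raw_small:
  assumes U: "small U" and \<psi>: "\<And>z. z \<notin> U \<Longrightarrow> \<psi> z = 0" and h: "h \<in> arrows H" and z: "z \<in> s_fibre Z (gsrc H h)"
    "ract Z z (ginv H h) \<in> U"
  shows "S_raw H Z \<psi> \<zeta> h = \<psi> (ract Z z (ginv H h)) * \<zeta> z"
proof -
  have "\<psi> (ract Z y (ginv H h)) = 0" if "y \<in> s_fibre Z (gsrc H h)" "y \<noteq> z" for y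
  proof (rule \<psi>, rule notI)
    assume yU: "ract Z y (ginv H h) \<in> U"
    have "y = z"
      by (rule small_column[OF U _ _ h _ _ yU z(2)]) (use that z(1) in \<open>simp_all add: s_fibre_iff\<close>)
    then show False using that by simp
  qed
  then show ?thesis using z(1) h unfolding S_raw_def by (simp only: if_True) (rule infsum_one_term, auto)
qed

lemma S_raw_small_zero:
  assumes \<psi>: "\<And>z. z \<notin> U \<Longrightarrow> \<psi> z = 0" and "\<not> (\<exists>z\<in>s_fibre Z (gsrc H h). ract Z z (ginv H h) \<in> U)"
  shows "S_raw H Z \<psi> \<zeta> h = 0"
  using assms unfolding S_raw_def by (auto intro!: infsum_0)

text \<open>The matrix of \<open>T\<^sub>\<phi>\<close> has at most one nonzero entry in each row and column, so its norm is at most the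
  largest entry for every exponent.\<close>

lemma T_small_bound:
  assumes p: "1 \<le> p" and U: "small U" and \<phi>: "\<And>z. z \<notin> U \<Longrightarrow> \<phi> z = 0" "\<And>z. cmod (\<phi> z) \<le> M"
    and \<xi>: "in_lp p (arrows H) \<xi>"
  shows "in_lp p (points Z) (T_raw H Z \<phi> \<xi>)" "lp_norm p (points Z) (T_raw H Z \<phi> \<xi>) \<le> M * lp_norm p (arrows H) \<xi>"
proof -
  have M: "0 \<le> M" using \<phi>(2)[of undefined] norm_ge_zero order_trans by blast
  define D where "D = {z \<in> points Z. \<exists>h\<in>src_fibre H (sanchor Z z). ract Z z (ginv H h) \<in> U}"
  define m where "m = (\<lambda>z. SOME h. h \<in> src_fibre H (sanchor Z z) \<and> ract Z z (ginv H h) \<in> U)"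
  have m: "m z \<in> src_fibre H (sanchor Z z)" "ract Z z (ginv H (m z)) \<in> U" if "z \<in> D" for z
    using someI_ex[of "\<lambda>h. h \<in> src_fibre H (sanchor Z z) \<and> ract Z z (ginv H h) \<in> U"] that
    unfolding D_def m_def by auto
  have inj: "inj_on m D"
  proof (rule inj_onI)
    fix z y assume zy: "z \<in> D" "y \<in> D" "m z = m y"
    show "z = y"
    proof (rule small_column[OF U _ _ _ _ _ m(2)[OF zy(1)] m(2)[OF zy(2), folded zy(3)]])
      show "z \<in> points Z" "y \<in> points Z" using zy by (auto simp: D_def)
      show "m z \<in> arrows H" "gsrc H (m z) = sanchor Z z" using m(1)[OF zy(1)] by (simp_all add: src_fibre_iff)
      show "gsrc H (m z) = sanchor Z y" using m(1)[OF zy(2)] unfolding zy(3) by (simp add: src_fibre_iff)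
    qed
  qed
  have im: "m ` D \<subseteq> arrows H" using m(1) by (auto simp: src_fibre_iff)
  have le: "cmod (T_raw H Z \<phi> \<xi> z) \<le> M * cmod (\<xi> (m z))" if "z \<in> points Z" "z \<in> D" for z
    using T_raw_small[OF U \<phi>(1) that(1) m[OF that(2)]] mult_right_mono[OF \<phi>(2), of "cmod (\<xi> (m z))"]
    by (simp add: norm_mult)
  have z: "T_raw H Z \<phi> \<xi> z = 0" if "z \<in> points Z" "z \<notin> D" for z
    using that by (intro T_raw_small_zero[OF \<phi>(1)]) (auto simp: D_def)
  show "in_lp p (points Z) (T_raw H Z \<phi> \<xi>)" "lp_norm p (points Z) (T_raw H Z \<phi> \<xi>) \<le> M * lp_norm p (arrows H) \<xi>"
    using lp_partial_injection[OF p \<xi> M inj im le z] by blast+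
qed

lemma S_small_bound:
  assumes p: "1 \<le> p" and U: "small U" and \<psi>: "\<And>z. z \<notin> U \<Longrightarrow> \<psi> z = 0" "\<And>z. cmod (\<psi> z) \<le> M"
    and \<zeta>: "in_lp p (points Z) \<zeta>"
  shows "in_lp p (arrows H) (S_raw H Z \<psi> \<zeta>)" "lp_norm p (arrows H) (S_raw H Z \<psi> \<zeta>) \<le> M * lp_norm p (points Z) \<zeta>"
proof -
  have M: "0 \<le> M" using \<psi>(2)[of undefined] norm_ge_zero order_trans by blast
  define D where "D = {h \<in> arrows H. \<exists>z\<in>s_fibre Z (gsrc H h). ract Z z (ginv H h) \<in> U}"
  define m where "m = (\<lambda>h. SOME z. z \<in> s_fibre Z (gsrc H h) \<and> ract Z z (ginv H h) \<in> U)"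
  have m: "m h \<in> s_fibre Z (gsrc H h)" "ract Z (m h) (ginv H h) \<in> U" if "h \<in> D" for h
    using someI_ex[of "\<lambda>z. z \<in> s_fibre Z (gsrc H h) \<and> ract Z z (ginv H h) \<in> U"] that
    unfolding D_def m_def by auto
  have inj: "inj_on m D"
  proof (rule inj_onI)
    fix h k assume hk: "h \<in> D" "k \<in> D" "m h = m k"
    show "h = k"
    proof (rule small_row[OF U _ _ _ _ _ m(2)[OF hk(1)] m(2)[OF hk(2), folded hk(3)]])
      show "h \<in> arrows H" "k \<in> arrows H" using hk by (auto simp: D_def)
      show "m h \<in> points Z" "gsrc H h = sanchor Z (m h)" using m(1)[OF hk(1)] by (simp_all add: s_fibre_iff)
      show "gsrc H k = sanchor Z (m h)" using m(1)[OF hk(2)] unfolding hk(3) by (simp add: s_fibre_iff)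
    qed
  qed
  have im: "m ` D \<subseteq> points Z" using m(1) by (auto simp: s_fibre_iff)
  have le: "cmod (S_raw H Z \<psi> \<zeta> h) \<le> M * cmod (\<zeta> (m h))" if "h \<in> arrows H" "h \<in> D" for h
    using S_raw_small[OF U \<psi>(1) that(1) m[OF that(2)]] mult_right_mono[OF \<psi>(2), of "cmod (\<zeta> (m h))"]
    by (simp add: norm_mult)
  have z: "S_raw H Z \<psi> \<zeta> h = 0" if "h \<in> arrows H" "h \<notin> D" for h
    using that by (intro S_raw_small_zero[OF \<psi>(1)]) (auto simp: D_def)
  show "in_lp p (arrows H) (S_raw H Z \<psi> \<zeta>)" "lp_norm p (arrows H) (S_raw H Z \<psi> \<zeta>) \<le> M * lp_norm p (points Z) \<zeta>"
    using lp_partial_injection[OF p \<zeta> M inj im le z] by blast+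
qed

lemma lp_combination_bound:
  fixes a b :: "'i \<Rightarrow> complex"
  assumes p: "1 \<le> p" and "in_lp p I a" "lp_norm p I a \<le> A * n" "in_lp p I b" "lp_norm p I b \<le> B * n"
  shows "in_lp p I (\<lambda>i. a i + c * b i) \<and> lp_norm p I (\<lambda>i. a i + c * b i) \<le> (A + cmod c * B) * n"
proof -
  have "cmod c * lp_norm p I b \<le> cmod c * (B * n)" by (intro mult_left_mono assms) simp
  then show ?thesis
    using lp_add[OF p assms(2) lp_scale(1)[OF p assms(4), of c]] lp_scale(2)[OF p assms(4), of c] assms(3)
    by (simp add: algebra_simps)
qed

text \<open>General functions are sums of functions with small supports.\<close>

lemma T_bounded:
  assumes p: "1 \<le> p" and "\<phi> \<in> Cspan (ztop Z)"
  shows "\<exists>C. \<forall>\<xi>. in_lp p (arrows H) \<xi> \<longrightarrow>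
    in_lp p (points Z) (T_raw H Z \<phi> \<xi>) \<and> lp_norm p (points Z) (T_raw H Z \<phi> \<xi>) \<le> C * lp_norm p (arrows H) \<xi>"
  using assms(2)
proof (induction rule: Cspan_induct_small_sets)
  case zero
  have "T_raw H Z (\<lambda>z. 0) \<xi> = (\<lambda>z. 0)" for \<xi> by (simp add: T_raw_def fun_eq_iff)
  then show ?case by (intro exI[of _ 0]) (simp add: in_lp_zero lp_norm_zero[OF p])
next
  case (add \<phi> c g U)
  obtain C where C: "\<And>\<xi>. in_lp p (arrows H) \<xi> \<Longrightarrow> in_lp p (points Z) (T_raw H Z \<phi> \<xi>) \<and>
      lp_norm p (points Z) (T_raw H Z \<phi> \<xi>) \<le> C * lp_norm p (arrows H) \<xi>" using add.IH by blast
  obtain M where M: "\<And>x. cmod (g x) \<le> M" using Cc_on_bounded[OF add.hyps(5,2)] by metis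
  show ?case
    unfolding T_raw_add_left[OF add.hyps(1) Cspan_Cc_on[OF add.hyps(2,3,5)]]
    using C T_small_bound[OF p add.hyps(4) Cc_on_outside[OF add.hyps(5)] M]
    by (intro exI[of _ "C + cmod c * M"] allI impI lp_combination_bound[OF p]) auto
qed

lemma S_bounded:
  assumes p: "1 \<le> p" and "\<psi> \<in> Cspan (ztop Z)"
  shows "\<exists>C. \<forall>\<zeta>. in_lp p (points Z) \<zeta> \<longrightarrow>
    in_lp p (arrows H) (S_raw H Z \<psi> \<zeta>) \<and> lp_norm p (arrows H) (S_raw H Z \<psi> \<zeta>) \<le> C * lp_norm p (points Z) \<zeta>"
  using assms(2)
proof (induction rule: Cspan_induct_small_sets)
  case zero
  have "S_raw H Z (\<lambda>z. 0) \<zeta> = (\<lambda>z. 0)" for \<zeta> by (simp add: S_raw_def fun_eq_iff)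
  then show ?case by (intro exI[of _ 0]) (simp add: in_lp_zero lp_norm_zero[OF p])
next
  case (add \<psi> c g U)
  obtain C where C: "\<And>\<zeta>. in_lp p (points Z) \<zeta> \<Longrightarrow> in_lp p (arrows H) (S_raw H Z \<psi> \<zeta>) \<and>
      lp_norm p (arrows H) (S_raw H Z \<psi> \<zeta>) \<le> C * lp_norm p (points Z) \<zeta>" using add.IH by blast
  obtain M where M: "\<And>x. cmod (g x) \<le> M" using Cc_on_bounded[OF add.hyps(5,2)] by metis
  show ?case
    unfolding S_raw_add_left[OF add.hyps(1) Cspan_Cc_on[OF add.hyps(2,3,5)]]
    using C S_small_bound[OF p add.hyps(4) Cc_on_outside[OF add.hyps(5)] M]
    by (intro exI[of _ "C + cmod c * M"] allI impI lp_combination_bound[OF p]) auto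
qed

end

subsection \<open>The operators as elements of the operator spaces\<close>

lemma linear_image_subspace:
  assumes V: "complex_vspace V" and F: "\<And>f. f \<in> Cspan X \<Longrightarrow> F f \<in> carrier V"
    and lin: "\<And>f g c. \<lbrakk>f \<in> Cspan X; g \<in> Cspan X\<rbrakk> \<Longrightarrow> F (\<lambda>x. f x + c * g x) = vadd V (F f) (vscale V c (F g))"
  shows "subspace_of V (F ` Cspan X)"
proof -
  interpret complex_vspace V by fact
  have F0: "F (\<lambda>x. 0) = vzero V"
    using lin[OF Cspan_zero Cspan_zero, of "- 1"] F[OF Cspan_zero] by (simp add: add_uminus)
  show ?thesis
    unfolding subspace_of_def
  proof (intro conjI ballI allI)
    show "F ` Cspan X \<subseteq> carrier V" using F by blast
    show "vzero V \<in> F ` Cspan X" using F0 Cspan_zero by (metis imageI)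
    fix x assume "x \<in> F ` Cspan X"
    then obtain f where f: "f \<in> Cspan X" "x = F f" by blast
    show "vscale V c x \<in> F ` Cspan X" for c
    proof
      show "vscale V c x = F (\<lambda>x. c * f x)"
        using lin[OF Cspan_zero f(1), of c] f F0 F[OF f(1)] by (simp add: zero_add scale_closed)
    qed (rule Cspan_scale[OF f(1)])
    fix y assume "y \<in> F ` Cspan X"
    then obtain g where g: "g \<in> Cspan X" "y = F g" by blast
    show "vadd V x y \<in> F ` Cspan X"
    proof
      show "vadd V x y = F (\<lambda>x. f x + g x)"
        using lin[OF f(1) g(1), of 1] f g F[OF g(1)] by (simp add: scale_one)
    qed (rule Cspan_add[OF f(1) g(1)])
  qed
qed

context lc_groupoid
begin

lemma E_groupoid_simps:
  assumes p: "1 \<le> p"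
  shows "carrier (E_groupoid p G) = carrier (lp_space p (arrows G))"
    "vadd (E_groupoid p G) = (\<lambda>f g i. f i + g i)" "vzero (E_groupoid p G) = (\<lambda>i. 0)"
    "vscale (E_groupoid p G) = (\<lambda>c f i. c * f i)"
    "\<xi> \<in> carrier (lp_space p (arrows G)) \<Longrightarrow> vnorm (E_groupoid p G) \<xi> = lp_norm p (arrows G) \<xi>"
  using lc_correspondence.E_corr_simps[OF self_correspondence p] by (simp_all add: E_self)

lemma E_groupoid_mem: "1 \<le> p \<Longrightarrow> \<xi> \<in> carrier (E_groupoid p G) \<longleftrightarrow> (\<forall>g. g \<notin> arrows G \<longrightarrow> \<xi> g = 0) \<and> in_lp p (arrows G) \<xi>"
  by (simp add: E_groupoid_simps)

lemma E_groupoid_norm: "1 \<le> p \<Longrightarrow> \<xi> \<in> carrier (E_groupoid p G) \<Longrightarrow> vnorm (E_groupoid p G) \<xi> = lp_norm p (arrows G) \<xi>"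
  by (simp add: E_groupoid_simps)

lemma E_groupoid_banach: "1 \<le> p \<Longrightarrow> complex_banach_space (E_groupoid p G)"
  using lc_correspondence.E_corr_banach[OF self_correspondence] by (simp add: E_self)

text \<open>The substitution \<open>k = g h\<^sup>-\<^sup>1\<close>.\<close>

lemma T_raw_self: "T_raw G (self_corr G) f \<xi> = left_mult G (self_corr G) f \<xi>"
proof
  fix g
  show "T_raw G (self_corr G) f \<xi> g = left_mult G (self_corr G) f \<xi> g"
  proof (cases "g \<in> arrows G")
    case g: True
    have "(\<Sum>\<^sub>\<infinity>h\<in>src_fibre G (gsrc G g). f (gmult G g (ginv G h)) * \<xi> h)
        = (\<Sum>\<^sub>\<infinity>k\<in>{k \<in> arrows G. grng G k = grng G g}. f k * \<xi> (gmult G (ginv G k) g))"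
    proof (rule infsum_reindex_bij_witness[of _ "\<lambda>k. gmult G (ginv G k) g" "\<lambda>h. gmult G g (ginv G h)"])
      fix h assume "h \<in> src_fibre G (gsrc G g)"
      then have h: "h \<in> arrows G" "gsrc G h = gsrc G g" by (auto simp: src_fibre_def)
      have "ginv G (gmult G g (ginv G h)) = gmult G h (ginv G g)"
        using g h by (simp add: inv_of_mult inv_closed rng_inv inv_inv)
      then show e: "gmult G (ginv G (gmult G g (ginv G h))) g = h"
        using g h by (simp add: mult_inv_cancel_right)
      then show "f (gmult G g (ginv G h)) * \<xi> (gmult G (ginv G (gmult G g (ginv G h))) g) = f (gmult G g (ginv G h)) * \<xi> h"
        by simp
      show "gmult G g (ginv G h) \<in> {k \<in> arrows G. grng G k = grng G g}"
        using g h by (simp add: mult_closed rng_mult inv_closed rng_inv)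
    next
      fix k assume "k \<in> {k \<in> arrows G. grng G k = grng G g}"
      then have k: "k \<in> arrows G" "grng G k = grng G g" by auto
      have "ginv G (gmult G (ginv G k) g) = gmult G (ginv G g) k"
        using g k by (simp add: inv_of_mult inv_closed src_inv inv_inv)
      then show "gmult G g (ginv G (gmult G (ginv G k) g)) = k"
        using g k by (simp add: mult_inv_cancel)
      show "gmult G (ginv G k) g \<in> src_fibre G (gsrc G g)"
        using g k by (simp add: src_fibre_def mult_closed src_mult inv_closed src_inv)
    qed
    then show ?thesis using g by (simp add: T_raw_def left_mult_def)
  qed (simp add: T_raw_def left_mult_def)
qed

text \<open>The restriction to the source fibre of \<open>g\<close> in the definition of \<^const>\<open>lambda_rep\<close> has no effect, since
  \<open>k\<^sup>-\<^sup>1 g\<close> has the same source as \<open>g\<close>.\<close>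

lemma lambda_rep_raw:
  assumes p: "1 \<le> p"
  shows "lambda_rep p G f = restrict (left_mult G (self_corr G) f) (carrier (E_groupoid p G))"
proof (rule extensionalityI)
  fix \<xi> assume \<xi>: "\<xi> \<in> carrier (E_groupoid p G)"
  then have \<xi>in: "in_lp p (arrows G) \<xi>" using p by (simp add: E_groupoid_mem)
  show "lambda_rep p G f \<xi> = restrict (left_mult G (self_corr G) f) (carrier (E_groupoid p G)) \<xi>"
  proof
    fix g
    show "lambda_rep p G f \<xi> g = restrict (left_mult G (self_corr G) f) (carrier (E_groupoid p G)) \<xi> g"
    proof (cases "g \<in> arrows G")
      case g: True
      let ?F = "src_fibre G (gsrc G g)"
      let ?r = "\<lambda>k. if k \<in> ?F then \<xi> k else 0"
      have "in_lp p ?F \<xi>" by (rule lp_subset(1)[OF p \<xi>in]) (auto simp: src_fibre_def)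
      then have "in_lp p ?F ?r" using in_lp_cong[of ?F \<xi> ?r p] by simp
      then have r: "?r \<in> carrier (lp_space p ?F)" by simp
      have "lambda_rep p G f \<xi> g = lambda_at p G (gsrc G g) f ?r g"
        using g \<xi> by (simp add: lambda_rep_def)
      also have "\<dots> = (\<Sum>\<^sub>\<infinity>k\<in>{k \<in> arrows G. grng G k = grng G g}. f k * ?r (gmult G (ginv G k) g))"
        using g r by (simp add: lambda_at_def src_fibre_def)
      also have "\<dots> = (\<Sum>\<^sub>\<infinity>k\<in>{k \<in> arrows G. grng G k = grng G g}. f k * \<xi> (gmult G (ginv G k) g))"
        using g by (intro infsum_cong) (auto simp: src_fibre_def mult_closed src_mult inv_closed src_inv)
      finally show ?thesis using g \<xi> by (simp add: left_mult_def)
    qed (use \<xi> in \<open>simp add: lambda_rep_def left_mult_def\<close>)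
  qed
qed (simp_all add: lambda_rep_def)

lemma lambda_rep_T: "1 \<le> p \<Longrightarrow> lambda_rep p G f = T_op p G (self_corr G) f"
  using lc_correspondence.T_op_raw[OF self_correspondence, of p f]
  by (simp add: lambda_rep_raw T_raw_self[abs_def])

end

context lc_correspondence
begin

lemma E_corr_norm: "1 \<le> p \<Longrightarrow> \<zeta> \<in> carrier (E_corr p H Z) \<Longrightarrow> vnorm (E_corr p H Z) \<zeta> = lp_norm p (points Z) \<zeta>"
  by (simp add: E_corr_simps)

lemma normed_spaces:
  assumes "1 \<le> p"
  shows "two_normed_spaces (E_groupoid p H) (E_corr p H Z)" "two_normed_spaces (E_corr p H Z) (E_groupoid p H)"
    "two_normed_spaces (E_corr p H Z) (E_corr p H Z)"
  using E_corr_banach[OF assms] H.E_groupoid_banach[OF assms]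
  by (simp_all add: two_normed_spaces_def complex_banach_space_def)

lemma T_raw_mem:
  assumes p: "1 \<le> p" and \<phi>: "\<phi> \<in> Cspan (ztop Z)" and \<xi>: "\<xi> \<in> carrier (E_groupoid p H)"
  shows "T_raw H Z \<phi> \<xi> \<in> carrier (E_corr p H Z)"
proof -
  have "in_lp p (points Z) (T_raw H Z \<phi> \<xi>)"
    using T_bounded[OF p \<phi>] \<xi> by (auto simp: H.E_groupoid_mem[OF p])
  then show ?thesis by (simp add: E_corr_mem[OF p] T_raw_def)
qed

lemma S_raw_mem:
  assumes p: "1 \<le> p" and \<psi>: "\<psi> \<in> Cspan (ztop Z)" and \<zeta>: "\<zeta> \<in> carrier (E_corr p H Z)"
  shows "S_raw H Z \<psi> \<zeta> \<in> carrier (E_groupoid p H)"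
proof -
  have "in_lp p (arrows H) (S_raw H Z \<psi> \<zeta>)"
    using S_bounded[OF p \<psi>] \<zeta> by (auto simp: E_corr_mem[OF p])
  then show ?thesis by (simp add: H.E_groupoid_mem[OF p] S_raw_def)
qed

lemma raw_zero: "T_raw H Z \<phi> (\<lambda>_. 0) = (\<lambda>_. 0)" "S_raw H Z \<phi> (\<lambda>_. 0) = (\<lambda>_. 0)"
  "left_mult G Z f (\<lambda>_. 0) = (\<lambda>_. 0)"
  by (simp_all add: T_raw_def S_raw_def left_mult_def fun_eq_iff)

lemma T_op_mem:
  assumes p: "1 \<le> p" and \<phi>: "\<phi> \<in> Cspan (ztop Z)"
  shows "T_op p H Z \<phi> \<in> carrier (op_space (E_groupoid p H) (E_corr p H Z))"
proof -
  let ?R = "restrict (T_raw H Z \<phi>) (carrier (E_groupoid p H))"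
  interpret N: two_normed_spaces "E_groupoid p H" "E_corr p H Z" by (rule normed_spaces[OF p])
  obtain C where C: "\<And>\<xi>. in_lp p (arrows H) \<xi> \<Longrightarrow> lp_norm p (points Z) (T_raw H Z \<phi> \<xi>) \<le> C * lp_norm p (arrows H) \<xi>"
    using T_bounded[OF p \<phi>] by blast
  show ?thesis
    unfolding T_op_raw
  proof (rule N.op_spaceI[where C = C])
    show "?R \<xi> \<in> carrier (E_corr p H Z)"
      if "\<xi> \<in> carrier (E_groupoid p H)" for \<xi> using T_raw_mem[OF p \<phi> that] that by simp
    show "vnorm (E_corr p H Z) (?R \<xi>) \<le> C * vnorm (E_groupoid p H) \<xi>"
      if \<xi>: "\<xi> \<in> carrier (E_groupoid p H)" for \<xi>
      using C[of \<xi>] \<xi> T_raw_mem[OF p \<phi> \<xi>]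
      by (simp add: E_corr_norm[OF p] H.E_groupoid_norm[OF p]) (simp add: H.E_groupoid_mem[OF p])
    show "?R (vadd (E_groupoid p H) \<xi> \<eta>) =
        vadd (E_corr p H Z) (?R \<xi>)
          (?R \<eta>)"
      if "\<xi> \<in> carrier (E_groupoid p H)" "\<eta> \<in> carrier (E_groupoid p H)" for \<xi> \<eta>
      using N.V.add_closed[OF that] that T_raw_add_right[OF \<phi>, of \<xi> 1 \<eta>]
      by (simp add: E_corr_simps(2)[OF p] H.E_groupoid_simps(2)[OF p])
    show "?R (vscale (E_groupoid p H) c \<xi>) =
        vscale (E_corr p H Z) c (?R \<xi>)"
      if "\<xi> \<in> carrier (E_groupoid p H)" for c \<xi>
      using N.V.scale_closed[OF that] that T_raw_add_right[OF \<phi>, of "\<lambda>_. 0" c \<xi>]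
      by (simp add: E_corr_simps(4)[OF p] H.E_groupoid_simps(4)[OF p] raw_zero)
  qed simp
qed

lemma S_op_mem:
  assumes p: "1 \<le> p" and \<psi>: "\<psi> \<in> Cspan (ztop Z)"
  shows "S_op p H Z \<psi> \<in> carrier (op_space (E_corr p H Z) (E_groupoid p H))"
proof -
  let ?R = "restrict (S_raw H Z \<psi>) (carrier (E_corr p H Z))"
  interpret N: two_normed_spaces "E_corr p H Z" "E_groupoid p H" by (rule normed_spaces[OF p])
  obtain C where C: "\<And>\<zeta>. in_lp p (points Z) \<zeta> \<Longrightarrow> lp_norm p (arrows H) (S_raw H Z \<psi> \<zeta>) \<le> C * lp_norm p (points Z) \<zeta>"
    using S_bounded[OF p \<psi>] by blast
  show ?thesis
    unfolding S_op_raw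
  proof (rule N.op_spaceI[where C = C])
    show "?R \<xi> \<in> carrier (E_groupoid p H)"
      if "\<xi> \<in> carrier (E_corr p H Z)" for \<xi> using S_raw_mem[OF p \<psi> that] that by simp
    show "vnorm (E_groupoid p H) (?R \<xi>) \<le> C * vnorm (E_corr p H Z) \<xi>"
      if \<xi>: "\<xi> \<in> carrier (E_corr p H Z)" for \<xi>
      using C[of \<xi>] \<xi> S_raw_mem[OF p \<psi> \<xi>]
      by (simp add: E_corr_norm[OF p] H.E_groupoid_norm[OF p]) (simp add: E_corr_mem[OF p])
    show "?R (vadd (E_corr p H Z) \<xi> \<eta>) =
        vadd (E_groupoid p H) (?R \<xi>)
          (?R \<eta>)"
      if "\<xi> \<in> carrier (E_corr p H Z)" "\<eta> \<in> carrier (E_corr p H Z)" for \<xi> \<eta>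
      using N.V.add_closed[OF that] that S_raw_add_right[OF \<psi>, of \<xi> 1 \<eta>]
      by (simp add: E_corr_simps(2)[OF p] H.E_groupoid_simps(2)[OF p])
    show "?R (vscale (E_corr p H Z) c \<xi>) =
        vscale (E_groupoid p H) c (?R \<xi>)"
      if "\<xi> \<in> carrier (E_corr p H Z)" for c \<xi>
      using N.V.scale_closed[OF that] that S_raw_add_right[OF \<psi>, of "\<lambda>_. 0" c \<xi>]
      by (simp add: E_corr_simps(4)[OF p] H.E_groupoid_simps(4)[OF p] raw_zero)
  qed simp
qed

lemma T_op_linear:
  assumes p: "1 \<le> p" and "\<phi> \<in> Cspan (ztop Z)" "\<phi>' \<in> Cspan (ztop Z)"
  shows "T_op p H Z (\<lambda>z. \<phi> z + c * \<phi>' z) = vadd (op_space (E_groupoid p H) (E_corr p H Z)) (T_op p H Z \<phi>)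
      (vscale (op_space (E_groupoid p H) (E_corr p H Z)) c (T_op p H Z \<phi>'))"
  unfolding T_op_raw op_space_simps
  by (rule restrict_ext) (simp add: E_corr_simps(2,4)[OF p] T_raw_add_left[OF assms(2,3)])

lemma S_op_linear:
  assumes p: "1 \<le> p" and "\<psi> \<in> Cspan (ztop Z)" "\<psi>' \<in> Cspan (ztop Z)"
  shows "S_op p H Z (\<lambda>z. \<psi> z + c * \<psi>' z) = vadd (op_space (E_corr p H Z) (E_groupoid p H)) (S_op p H Z \<psi>)
      (vscale (op_space (E_corr p H Z) (E_groupoid p H)) c (S_op p H Z \<psi>'))"
  unfolding S_op_raw op_space_simps
  by (rule restrict_ext) (simp add: H.E_groupoid_simps(2,4)[OF p] S_raw_add_left[OF assms(2,3)])

lemma T_op_subspace: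
  assumes p: "1 \<le> p"
  shows "subspace_of (op_space (E_groupoid p H) (E_corr p H Z)) (T_op p H Z ` Cspan (ztop Z))"
  using two_normed_spaces.op_space_normed[OF normed_spaces(1)[OF p]]
  by (intro linear_image_subspace T_op_mem T_op_linear p) (simp add: complex_normed_space_def)

lemma S_op_subspace:
  assumes p: "1 \<le> p"
  shows "subspace_of (op_space (E_corr p H Z) (E_groupoid p H)) (S_op p H Z ` Cspan (ztop Z))"
  using two_normed_spaces.op_space_normed[OF normed_spaces(2)[OF p]]
  by (intro linear_image_subspace S_op_mem S_op_linear p) (simp add: complex_normed_space_def)

definition L_op :: "ennreal \<Rightarrow> ('g \<Rightarrow> complex) \<Rightarrow> ('z \<Rightarrow> complex) \<Rightarrow> ('z \<Rightarrow> complex)" where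
  "L_op p f = restrict (left_mult G Z f) (carrier (E_corr p H Z))"

lemma left_mult_add_left:
  assumes "f \<in> Cspan (gtop G)" "f' \<in> Cspan (gtop G)"
  shows "left_mult G Z (\<lambda>g. f g + c * f' g) \<zeta> = (\<lambda>z. left_mult G Z f \<zeta> z + c * left_mult G Z f' \<zeta> z)"
proof -
  have "tilde (\<lambda>g. f g + c * f' g) G = (\<lambda>g. tilde f G g + c * tilde f' G g)" by (auto simp: tilde_def fun_eq_iff)
  moreover have "tilde f G \<in> Cspan (gtop G)" "tilde f' G \<in> Cspan (gtop G)"
    unfolding tilde_def by (intro G.Cspan_inv assms)+
  ultimately show ?thesis by (simp add: left_mult_conv left.conv_add_left)
qed

lemma left_mult_add_right:
  assumes "f \<in> Cspan (gtop G)"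
  shows "left_mult G Z f (\<lambda>z. \<zeta> z + c * \<zeta>' z) = (\<lambda>z. left_mult G Z f \<zeta> z + c * left_mult G Z f \<zeta>' z)"
  using left.conv_add_right[OF G.Cspan_inv[OF assms]] by (simp add: left_mult_conv tilde_def)

lemma compose_T_lambda:
  assumes p: "1 \<le> p" and \<phi>: "\<phi> \<in> Cspan (ztop Z)" and f: "f \<in> Cspan (gtop H)"
  shows "compose (carrier (E_groupoid p H)) (T_op p H Z \<phi>) (lambda_rep p H f) = T_op p H Z (right.conv (tilde f H) \<phi>)"
    and "right.conv (tilde f H) \<phi> \<in> Cspan (ztop Z)"
proof -
  interpret HH: lc_correspondence H H "self_corr H" by (rule H.self_correspondence)
  show "compose (carrier (E_groupoid p H)) (T_op p H Z \<phi>) (lambda_rep p H f) = T_op p H Z (right.conv (tilde f H) \<phi>)"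
    unfolding H.lambda_rep_T[OF p] T_op_raw HH.T_op_raw compose_def
    using HH.T_raw_mem[OF p, of f] f T_raw_T_raw[OF \<phi> f]
    by (intro restrict_ext) (simp add: H.E_self)
  show "right.conv (tilde f H) \<phi> \<in> Cspan (ztop Z)"
    unfolding tilde_def by (intro right.conv_Cspan H.Cspan_inv f \<phi>)
qed

lemma compose_lambda_S:
  assumes p: "1 \<le> p" and \<psi>: "\<psi> \<in> Cspan (ztop Z)" and f: "f \<in> Cspan (gtop H)"
  shows "compose (carrier (E_corr p H Z)) (lambda_rep p H f) (S_op p H Z \<psi>) = S_op p H Z (right.conv f \<psi>)"
    and "right.conv f \<psi> \<in> Cspan (ztop Z)"
proof -
  interpret HH: lc_correspondence H H "self_corr H" by (rule H.self_correspondence)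
  show "compose (carrier (E_corr p H Z)) (lambda_rep p H f) (S_op p H Z \<psi>) = S_op p H Z (right.conv f \<psi>)"
    unfolding H.lambda_rep_T[OF p] S_op_raw HH.T_op_raw compose_def
    using S_raw_mem[OF p \<psi>] T_raw_S_raw[OF f \<psi>]
    by (intro restrict_ext) simp
  show "right.conv f \<psi> \<in> Cspan (ztop Z)" by (intro right.conv_Cspan f \<psi>)
qed

lemma compose_S_T:
  assumes p: "1 \<le> p" and \<psi>: "\<psi> \<in> Cspan (ztop Z)" and \<phi>: "\<phi> \<in> Cspan (ztop Z)"
  shows "compose (carrier (E_groupoid p H)) (S_op p H Z \<psi>) (T_op p H Z \<phi>) \<in> lambda_rep p H ` Cspan (gtop H)"
proof
  interpret HH: lc_correspondence H H "self_corr H" by (rule H.self_correspondence)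
  show "compose (carrier (E_groupoid p H)) (S_op p H Z \<psi>) (T_op p H Z \<phi>) = lambda_rep p H (pair.conv \<psi> \<phi>)"
    unfolding H.lambda_rep_T[OF p] S_op_raw HH.T_op_raw T_op_raw compose_def
    using T_raw_mem[OF p \<phi>] S_raw_T_raw[OF \<psi> \<phi>]
    by (intro restrict_ext) simp
  show "pair.conv \<psi> \<phi> \<in> Cspan (gtop H)" by (intro pair.conv_Cspan \<phi> \<psi>)
qed

lemma compose_L_T:
  assumes p: "1 \<le> p" and f: "f \<in> Cspan (gtop G)" and \<phi>: "\<phi> \<in> Cspan (ztop Z)"
  shows "compose (carrier (E_groupoid p H)) (L_op p f) (T_op p H Z \<phi>) = T_op p H Z (left_mult G Z f \<phi>)"
  unfolding L_op_def T_op_raw compose_def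
  using T_raw_mem[OF p \<phi>] left_mult_T_raw[OF f \<phi>] by (intro restrict_ext) simp

lemma L_mem_if_bounded:
  assumes p: "1 \<le> p" and f: "f \<in> Cspan (gtop G)"
    and b: "\<And>\<zeta>. \<lbrakk>in_lp p (points Z) \<zeta>; \<And>z. z \<notin> points Z \<Longrightarrow> \<zeta> z = 0\<rbrakk> \<Longrightarrow>
      in_lp p (points Z) (left_mult G Z f \<zeta>) \<and> lp_norm p (points Z) (left_mult G Z f \<zeta>) \<le> C * lp_norm p (points Z) \<zeta>"
    and C: "0 \<le> C"
  shows "L_op p f \<in> carrier (op_space (E_corr p H Z) (E_corr p H Z))"
    and "opnorm (E_corr p H Z) (E_corr p H Z) (L_op p f) \<le> C"
proof -
  interpret N: two_normed_spaces "E_corr p H Z" "E_corr p H Z" by (rule normed_spaces[OF p])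
  have m: "left_mult G Z f \<zeta> \<in> carrier (E_corr p H Z)" if "\<zeta> \<in> carrier (E_corr p H Z)" for \<zeta>
    using b[of \<zeta>] that by (simp add: E_corr_mem[OF p] left_mult_def)
  have n: "vnorm (E_corr p H Z) (L_op p f \<zeta>) \<le> C * vnorm (E_corr p H Z) \<zeta>" if "\<zeta> \<in> carrier (E_corr p H Z)" for \<zeta>
    using b[of \<zeta>] that m[OF that] by (simp add: L_op_def E_corr_norm[OF p]) (simp add: E_corr_mem[OF p])
  show "opnorm (E_corr p H Z) (E_corr p H Z) (L_op p f) \<le> C" by (rule N.opnorm_le[OF C n])
  show "L_op p f \<in> carrier (op_space (E_corr p H Z) (E_corr p H Z))"
  proof (rule N.op_spaceI[OF _ _ _ _ n])
    show "L_op p f \<in> extensional (carrier (E_corr p H Z))" by (simp add: L_op_def)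
    show "L_op p f \<zeta> \<in> carrier (E_corr p H Z)" if "\<zeta> \<in> carrier (E_corr p H Z)" for \<zeta>
      using m that by (simp add: L_op_def)
    show "L_op p f (vadd (E_corr p H Z) x y) = vadd (E_corr p H Z) (L_op p f x) (L_op p f y)"
      if "x \<in> carrier (E_corr p H Z)" "y \<in> carrier (E_corr p H Z)" for x y
      using N.V.add_closed[OF that] that left_mult_add_right[OF f, of x 1 y]
      by (simp add: L_op_def E_corr_simps(2)[OF p])
    show "L_op p f (vscale (E_corr p H Z) c x) = vscale (E_corr p H Z) c (L_op p f x)"
      if "x \<in> carrier (E_corr p H Z)" for c x
      using N.V.scale_closed[OF that] that left_mult_add_right[OF f, of "\<lambda>_. 0" c x]
      by (simp add: L_op_def E_corr_simps(4)[OF p] raw_zero)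
  qed
qed

lemma compose_S_L:
  assumes p: "1 \<le> p" and f: "f \<in> Cspan (gtop G)" and \<psi>: "\<psi> \<in> Cspan (ztop Z)"
    and L: "L_op p f \<in> carrier (op_space (E_corr p H Z) (E_corr p H Z))"
  shows "compose (carrier (E_corr p H Z)) (S_op p H Z \<psi>) (L_op p f) = S_op p H Z (right_mult G Z \<psi> f)"
  using op_spaceD(1)[OF L] S_raw_left_mult[OF f \<psi>]
  unfolding S_op_raw compose_def L_op_def by (intro restrict_ext) simp

end

section \<open>Contractivity of the left action\<close>

context lc_groupoid
begin

lemma lambda_rep_mem:
  assumes "1 \<le> p" "f \<in> Cspan (gtop G)"
  shows "lambda_rep p G f \<in> carrier (op_space (E_groupoid p G) (E_groupoid p G))"
  using lc_correspondence.T_op_mem[OF self_correspondence assms(1)] assms by (simp only: lambda_rep_T E_self self_corr_simps)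

lemma lambda_rep_bound:
  assumes p: "1 \<le> p" and f: "f \<in> Cspan (gtop G)" and \<xi>: "in_lp p (arrows G) \<xi>" "\<And>g. g \<notin> arrows G \<Longrightarrow> \<xi> g = 0"
  defines "N \<equiv> opnorm (E_groupoid p G) (E_groupoid p G) (lambda_rep p G f)"
  shows "in_lp p (arrows G) (left_mult G (self_corr G) f \<xi>)"
    "lp_norm p (arrows G) (left_mult G (self_corr G) f \<xi>) \<le> N * lp_norm p (arrows G) \<xi>"
proof -
  interpret N: two_normed_spaces "E_groupoid p G" "E_groupoid p G"
    using E_groupoid_banach[OF p] by (simp add: two_normed_spaces_def complex_banach_space_def)
  note mem = lambda_rep_mem[OF p f]
  have x: "\<xi> \<in> carrier (E_groupoid p G)" using \<xi> by (simp add: E_groupoid_mem[OF p])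
  have e: "lambda_rep p G f \<xi> = left_mult G (self_corr G) f \<xi>" using x by (simp add: lambda_rep_raw[OF p])
  have y: "left_mult G (self_corr G) f \<xi> \<in> carrier (E_groupoid p G)" using op_spaceD(1)[OF mem x] by (simp add: e)
  show "in_lp p (arrows G) (left_mult G (self_corr G) f \<xi>)" using y by (simp add: E_groupoid_mem[OF p])
  show "lp_norm p (arrows G) (left_mult G (self_corr G) f \<xi>) \<le> N * lp_norm p (arrows G) \<xi>"
    using N.opnorm_apply[OF op_spaceD(3)[OF mem] x] x y by (simp add: e N_def E_groupoid_norm[OF p])
qed

lemma lambda_rep_norm_nonneg:
  assumes "1 \<le> p" "f \<in> Cspan (gtop G)"
  shows "0 \<le> opnorm (E_groupoid p G) (E_groupoid p G) (lambda_rep p G f)"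
proof -
  interpret N: two_normed_spaces "E_groupoid p G" "E_groupoid p G"
    using E_groupoid_banach[OF assms(1)] by (simp add: two_normed_spaces_def complex_banach_space_def)
  show ?thesis by (rule N.opnorm_nonneg[OF op_spaceD(3)[OF lambda_rep_mem[OF assms]]])
qed

text \<open>The column of \<open>\<lambda>(f)\<close> at a unit is \<open>f\<close> itself: apply the operator to the point mass there.\<close>

lemma column_sum_bound:
  assumes f: "f \<in> Cspan (gtop G)" and C: "finite C" "C \<subseteq> src_fibre G u"
  shows "(\<Sum>g\<in>C. cmod (f g)) \<le> opnorm (E_groupoid 1 G) (E_groupoid 1 G) (lambda_rep 1 G f)"
proof (cases "C = {}")
  case True
  then show ?thesis using lambda_rep_norm_nonneg[of 1 f] f by simp
next
  case False
  then obtain g0 where "g0 \<in> C" by blast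
  then have u: "u \<in> units G" using C(2) src_units by (auto simp: src_fibre_def)
  let ?d = "\<lambda>g. if g = u then 1 else 0 :: complex"
  note d = lp_point_mass[OF order_refl unit_arrow[OF u]]
  have d0: "?d g = 0" if "g \<notin> arrows G" for g using that unit_arrow[OF u] by auto
  note b = lambda_rep_bound[OF _ f d(1) d0]
  have val: "left_mult G (self_corr G) f ?d g = f g" if "g \<in> C" for g
  proof -
    have g: "g \<in> arrows G" "gsrc G g = u" using that C(2) by (auto simp: src_fibre_def)
    have "(\<Sum>\<^sub>\<infinity>k\<in>{k \<in> arrows G. grng G k = grng G g}. f k * ?d (gmult G (ginv G k) g)) = f g * ?d (gmult G (ginv G g) g)"
    proof (rule infsum_one_term)
      fix k assume k: "k \<in> {k \<in> arrows G. grng G k = grng G g}" "k \<noteq> g"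
      have "gmult G (ginv G k) g \<noteq> u"
      proof
        assume "gmult G (ginv G k) g = u"
        then have "gmult G k u = g" using mult_inv_cancel[of k g] k g by simp
        moreover have "gsrc G k = u"
        proof -
          have "gsrc G k = grng G (gmult G (ginv G k) g)" using k g by (simp add: rng_mult inv_closed src_inv rng_inv)
          then show ?thesis using \<open>gmult G (ginv G k) g = u\<close> rng_unit[OF u] by simp
        qed
        ultimately show False using k mult_src[of k] by simp
      qed
      then show "f k * ?d (gmult G (ginv G k) g) = 0" by simp
    qed (use g in simp)
    then show ?thesis using g by (simp add: left_mult_def inv_mult)
  qed
  have "(\<Sum>g\<in>C. cmod (f g)) = lp_norm 1 C (left_mult G (self_corr G) f ?d)"
    using C(1) val by (simp add: lp_norm_finite sum_nonneg)
  also have "\<dots> \<le> lp_norm 1 (arrows G) (left_mult G (self_corr G) f ?d)"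
    using C by (intro lp_subset(2) b(1)) (auto simp: src_fibre_def)
  also have "\<dots> \<le> opnorm (E_groupoid 1 G) (E_groupoid 1 G) (lambda_rep 1 G f)" using b(2) d(2) by simp
  finally show ?thesis .
qed

end

context lc_correspondence
begin

definition stabiliser :: "'z \<Rightarrow> 'g set" where
  "stabiliser z = {g \<in> src_fibre G (ranchor Z z). lact Z g z = z}"

definition orbit :: "'z \<Rightarrow> 'z set" where
  "orbit z = (\<lambda>g. lact Z g z) ` src_fibre G (ranchor Z z)"

text \<open>The orbit map is a bijection from cosets of the stabiliser, so a function on the orbit is repeated
  on sets of equal size. Pulling back therefore multiplies norms by \<open>c\<close>, the norm of the constant function
  on the stabiliser. This is meaningful for a finite stabiliser and, with \<open>c = 1\<close>, always for the supremum
  norm, which is why the hypothesis is summability of the constant.\<close>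

lemma orbit_pullback:
  fixes \<eta> :: "'z \<Rightarrow> complex"
  assumes p: "1 \<le> p" and z0: "z0 \<in> points Z" and fin: "in_lp p (stabiliser z0) (\<lambda>_. 1 :: complex)"
  defines "c \<equiv> lp_norm p (stabiliser z0) (\<lambda>_. 1 :: complex)"
  shows "0 < c"
    and "in_lp p (src_fibre G (ranchor Z z0)) (\<lambda>g. \<eta> (lact Z g z0)) \<longleftrightarrow> in_lp p (orbit z0) \<eta>"
    and "in_lp p (orbit z0) \<eta> \<Longrightarrow> lp_norm p (src_fibre G (ranchor Z z0)) (\<lambda>g. \<eta> (lact Z g z0)) = c * lp_norm p (orbit z0) \<eta>"
proof -
  let ?u = "ranchor Z z0"
  let ?S = "src_fibre G ?u"
  let ?F = "\<lambda>z. {g \<in> ?S. lact Z g z0 = z}"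
  have u: "?u \<in> units G" by (rule ranchor_units[OF z0])
  have "?u \<in> stabiliser z0"
    using u z0 by (simp add: stabiliser_def src_fibre_def G.unit_arrow G.src_unit lact_unit)
  from norm_le_lp_norm[OF p fin this] show c: "0 < c" by (simp add: c_def)
  have fib: "in_lp p (?F z) (\<lambda>_. 1 :: complex) \<and> lp_norm p (?F z) (\<lambda>_. 1 :: complex) = c" if z: "z \<in> orbit z0" for z
  proof -
    obtain g where g: "g \<in> arrows G" "gsrc G g = ?u" "z = lact Z g z0" using z by (auto simp: orbit_def src_fibre_def)
    have "bij_betw (\<lambda>k. gmult G g k) (stabiliser z0) (?F z)"
    proof (rule bij_betw_byWitness[where f' = "\<lambda>k. gmult G (ginv G g) k"])
      have rk: "grng G k = ?u" if "k \<in> stabiliser z0" for k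
        using that ranchor_lact[of k z0] z0 by (simp add: stabiliser_def src_fibre_def)
      have rF: "grng G k = grng G g" if "k \<in> ?F z" for k
        using that ranchor_lact[of k z0] ranchor_lact[of g z0] z0 g by (simp add: src_fibre_def)
      show "\<forall>k\<in>stabiliser z0. gmult G (ginv G g) (gmult G g k) = k"
        using rk g by (auto simp: stabiliser_def src_fibre_def G.inv_mult_cancel)
      show "\<forall>k\<in>?F z. gmult G g (gmult G (ginv G g) k) = k"
      proof
        fix k assume k: "k \<in> ?F z"
        then have "k \<in> arrows G" by (simp add: src_fibre_def)
        then show "gmult G g (gmult G (ginv G g) k) = k" by (rule G.mult_inv_cancel[OF g(1) _ rF[OF k, symmetric]])
      qed
      show "gmult G g ` stabiliser z0 \<subseteq> ?F z"
      proof (rule image_subsetI)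
        fix k assume k: "k \<in> stabiliser z0"
        then have k': "k \<in> arrows G" "gsrc G k = ?u" "lact Z k z0 = z0" by (auto simp: stabiliser_def src_fibre_def)
        have gk: "gsrc G g = grng G k" using rk[OF k] g(2) by simp
        have "lact Z (gmult G g k) z0 = z" using lact_lact[OF g(1) k'(1) z0 gk k'(2)] k'(3) g(3) by simp
        then show "gmult G g k \<in> ?F z" using k' gk g by (simp add: src_fibre_def G.mult_closed G.src_mult)
      qed
      show "gmult G (ginv G g) ` ?F z \<subseteq> stabiliser z0"
      proof
        fix k assume "k \<in> gmult G (ginv G g) ` ?F z"
        then obtain l where l: "l \<in> ?F z" "k = gmult G (ginv G g) l" by blast
        then have l': "l \<in> arrows G" "gsrc G l = ?u" "lact Z l z0 = z" "grng G l = grng G g"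
          using rF by (auto simp: src_fibre_def)
        have "lact Z k z0 = lact Z (ginv G g) (lact Z l z0)"
          unfolding l(2) by (rule lact_lact) (use l' g z0 in \<open>simp_all add: G.inv_closed G.src_inv\<close>)
        also have "\<dots> = z0" unfolding l'(3) g(3) by (rule lact_inv_cancel[OF g(1) z0 g(2)])
        finally show "k \<in> stabiliser z0"
          using l' l(2) g by (simp add: stabiliser_def src_fibre_def G.mult_closed G.src_mult G.inv_closed G.src_inv)
      qed
    qed
    from lp_reindex[OF this, of p "\<lambda>_. 1 :: complex"] fin show ?thesis by (simp add: c_def)
  qed
  have Fn: "in_lp p (?F z) (\<lambda>g. \<eta> (lact Z g z0))" "lp_norm p (?F z) (\<lambda>g. \<eta> (lact Z g z0)) = cmod (\<eta> z) * c"
    if z: "z \<in> orbit z0" for z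
  proof -
    have cong: "in_lp p (?F z) (\<lambda>g. \<eta> (lact Z g z0)) \<longleftrightarrow> in_lp p (?F z) (\<lambda>g. \<eta> z * 1)"
      "lp_norm p (?F z) (\<lambda>g. \<eta> (lact Z g z0)) = lp_norm p (?F z) (\<lambda>g. \<eta> z * 1)"
      by (rule in_lp_cong, simp, rule lp_norm_cong, simp)
    show "in_lp p (?F z) (\<lambda>g. \<eta> (lact Z g z0))" "lp_norm p (?F z) (\<lambda>g. \<eta> (lact Z g z0)) = cmod (\<eta> z) * c"
      using cong lp_scale[OF p, of "?F z" "\<lambda>_. 1" "\<eta> z"] fib[OF z] by simp_all
  qed
  have U: "(\<Union>z\<in>orbit z0. ?F z) = ?S" by (auto simp: orbit_def)
  have disj: "disjoint_family_on ?F (orbit z0)" by (auto simp: disjoint_family_on_def)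
  have nn: "in_lp p (orbit z0) (\<lambda>z. lp_norm p (?F z) (\<lambda>g. \<eta> (lact Z g z0))) \<longleftrightarrow> in_lp p (orbit z0) (\<lambda>z. complex_of_real c * \<eta> z)"
    "lp_norm p (orbit z0) (\<lambda>z. lp_norm p (?F z) (\<lambda>g. \<eta> (lact Z g z0))) = lp_norm p (orbit z0) (\<lambda>z. complex_of_real c * \<eta> z)"
  proof -
    have n: "norm (lp_norm p (?F z) (\<lambda>g. \<eta> (lact Z g z0))) = norm (complex_of_real c * \<eta> z)" if "z \<in> orbit z0" for z
      using Fn(2)[OF that] c by (simp add: norm_mult)
    show "in_lp p (orbit z0) (\<lambda>z. lp_norm p (?F z) (\<lambda>g. \<eta> (lact Z g z0))) \<longleftrightarrow> in_lp p (orbit z0) (\<lambda>z. complex_of_real c * \<eta> z)"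
      by (rule in_lp_cong) (rule n)
    show "lp_norm p (orbit z0) (\<lambda>z. lp_norm p (?F z) (\<lambda>g. \<eta> (lact Z g z0))) = lp_norm p (orbit z0) (\<lambda>z. complex_of_real c * \<eta> z)"
      by (rule lp_norm_cong) (rule n)
  qed
  have sc: "in_lp p (orbit z0) (\<lambda>z. complex_of_real c * \<eta> z) \<longleftrightarrow> in_lp p (orbit z0) \<eta>"
  proof
    assume "in_lp p (orbit z0) (\<lambda>z. complex_of_real c * \<eta> z)"
    from lp_scale(1)[OF p this, of "inverse (complex_of_real c)"]
    have "in_lp p (orbit z0) (\<lambda>z. inverse (complex_of_real c) * (complex_of_real c * \<eta> z))" .
    moreover have "(\<lambda>z. inverse (complex_of_real c) * (complex_of_real c * \<eta> z)) = \<eta>"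
      using c by (simp add: fun_eq_iff mult.assoc[symmetric])
    ultimately show "in_lp p (orbit z0) \<eta>" by simp
  qed (rule lp_scale(1)[OF p])
  note UN = lp_disjoint_Union[OF p disj, of "\<lambda>g. \<eta> (lact Z g z0)", unfolded U]
  show iff: "in_lp p ?S (\<lambda>g. \<eta> (lact Z g z0)) \<longleftrightarrow> in_lp p (orbit z0) \<eta>"
    unfolding UN(1) using Fn(1) nn(1) sc by simp
  show "lp_norm p ?S (\<lambda>g. \<eta> (lact Z g z0)) = c * lp_norm p (orbit z0) \<eta>" if "in_lp p (orbit z0) \<eta>"
    using UN(2) iff that nn(2) lp_scale(2)[OF p that, of "complex_of_real c"] c by simp
qed

text \<open>The orbit map intertwines \<open>L\<^sub>f\<close> with convolution by \<open>f\<close> on a source fibre of \<open>G\<close>; the constant of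
  \<open>orbit_pullback\<close> appears on both sides and cancels.\<close>

lemma left_mult_orbit_bound:
  assumes p: "1 \<le> p" and f: "f \<in> Cspan (gtop G)" and z0: "z0 \<in> points Z"
    and fin: "in_lp p (stabiliser z0) (\<lambda>_. 1 :: complex)" and \<zeta>: "in_lp p (points Z) \<zeta>"
  shows "in_lp p (orbit z0) (left_mult G Z f \<zeta>)"
    "lp_norm p (orbit z0) (left_mult G Z f \<zeta>)
      \<le> opnorm (E_groupoid p G) (E_groupoid p G) (lambda_rep p G f) * lp_norm p (orbit z0) \<zeta>"
proof -
  let ?S = "src_fibre G (ranchor Z z0)" and ?N = "opnorm (E_groupoid p G) (E_groupoid p G) (lambda_rep p G f)"
  let ?\<xi> = "\<lambda>g. if g \<in> ?S then \<zeta> (lact Z g z0) else 0"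
  define c where "c = lp_norm p (stabiliser z0) (\<lambda>_. 1 :: complex)"
  note pull = orbit_pullback[OF p z0 fin, folded c_def]
  have O: "orbit z0 \<subseteq> points Z" using z0 by (auto simp: orbit_def src_fibre_def lact_closed)
  have \<zeta>O: "in_lp p (orbit z0) \<zeta>" by (rule lp_subset(1)[OF p \<zeta> O])
  have SA: "?S \<subseteq> arrows G" by (auto simp: src_fibre_def)
  have cg: "in_lp p ?S ?\<xi> \<longleftrightarrow> in_lp p ?S (\<lambda>g. \<zeta> (lact Z g z0))" "lp_norm p ?S ?\<xi> = lp_norm p ?S (\<lambda>g. \<zeta> (lact Z g z0))"
    by (rule in_lp_cong, simp, rule lp_norm_cong, simp)
  have \<xi>S: "in_lp p ?S ?\<xi>" "lp_norm p ?S ?\<xi> = c * lp_norm p (orbit z0) \<zeta>"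
    using cg pull(2)[of \<zeta>] pull(3)[OF \<zeta>O] \<zeta>O by simp_all
  have \<xi>A: "in_lp p (arrows G) ?\<xi>" "lp_norm p (arrows G) ?\<xi> = c * lp_norm p (orbit z0) \<zeta>"
    using lp_extend_zero[OF p SA \<xi>S(1)] \<xi>S(2) by simp_all
  have \<xi>0: "?\<xi> g = 0" if "g \<notin> arrows G" for g using that SA by auto
  note b = G.lambda_rep_bound[OF p f \<xi>A(1) \<xi>0]
  have val: "left_mult G (self_corr G) f ?\<xi> g = left_mult G Z f \<zeta> (lact Z g z0)" if "g \<in> ?S" for g
  proof -
    have g: "g \<in> arrows G" "gsrc G g = ranchor Z z0" using that by (auto simp: src_fibre_def)
    have "(\<Sum>\<^sub>\<infinity>k\<in>{k \<in> arrows G. grng G k = grng G g}. f k * ?\<xi> (gmult G (ginv G k) g))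
        = (\<Sum>\<^sub>\<infinity>k\<in>{k \<in> arrows G. grng G k = grng G g}. f k * \<zeta> (lact Z (ginv G k) (lact Z g z0)))"
      using g z0 by (intro infsum_cong) (simp add: src_fibre_def G.mult_closed G.src_mult G.inv_closed G.src_inv lact_lact)
    then show ?thesis unfolding left_mult_def self_corr_simps using g z0 by (simp add: lact_closed ranchor_lact)
  qed
  have cg2: "in_lp p ?S (left_mult G (self_corr G) f ?\<xi>) \<longleftrightarrow> in_lp p ?S (\<lambda>g. left_mult G Z f \<zeta> (lact Z g z0))"
    "lp_norm p ?S (left_mult G (self_corr G) f ?\<xi>) = lp_norm p ?S (\<lambda>g. left_mult G Z f \<zeta> (lact Z g z0))"
    by (rule in_lp_cong, simp only: val, rule lp_norm_cong, simp only: val)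
  have "in_lp p ?S (left_mult G (self_corr G) f ?\<xi>)" by (rule lp_subset(1)[OF p b(1) SA])
  then have "in_lp p ?S (\<lambda>g. left_mult G Z f \<zeta> (lact Z g z0))" using cg2 by simp
  then show L: "in_lp p (orbit z0) (left_mult G Z f \<zeta>)" using pull(2) by simp
  have "c * lp_norm p (orbit z0) (left_mult G Z f \<zeta>) = lp_norm p ?S (left_mult G (self_corr G) f ?\<xi>)"
    using pull(3)[OF L] cg2 by simp
  also have "\<dots> \<le> lp_norm p (arrows G) (left_mult G (self_corr G) f ?\<xi>)" by (rule lp_subset(2)[OF p b(1) SA])
  also have "\<dots> \<le> ?N * (c * lp_norm p (orbit z0) \<zeta>)" using b(2) \<xi>A(2) by simp
  finally have "c * lp_norm p (orbit z0) (left_mult G Z f \<zeta>) \<le> c * (?N * lp_norm p (orbit z0) \<zeta>)" by (simp add: mult.left_commute)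
  then show "lp_norm p (orbit z0) (left_mult G Z f \<zeta>) \<le> ?N * lp_norm p (orbit z0) \<zeta>" using pull(1) by simp
qed

lemma orbit_self: "z \<in> points Z \<Longrightarrow> z \<in> orbit z"
  unfolding orbit_def
  by (rule image_eqI[of _ _ "ranchor Z z"])
    (simp_all add: lact_unit src_fibre_def G.unit_arrow G.src_unit ranchor_units)

lemma orbit_eq:
  assumes z: "z \<in> points Z" and y: "y \<in> orbit z"
  shows "orbit y = orbit z"
proof -
  have sub: "orbit b \<subseteq> orbit a" if a: "a \<in> points Z" and b: "b \<in> orbit a" for a b
  proof
    fix x assume "x \<in> orbit b"
    obtain g where g: "g \<in> arrows G" "gsrc G g = ranchor Z a" "b = lact Z g a" using b by (auto simp: orbit_def src_fibre_def)
    obtain k where k: "k \<in> arrows G" "gsrc G k = grng G g" "x = lact Z k b"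
      using \<open>x \<in> orbit b\<close> g a by (auto simp: orbit_def src_fibre_def ranchor_lact)
    have "x = lact Z (gmult G k g) a" using g k a by (simp add: lact_lact)
    moreover have "gmult G k g \<in> src_fibre G (ranchor Z a)" using g k by (simp add: src_fibre_def G.mult_closed G.src_mult)
    ultimately show "x \<in> orbit a" unfolding orbit_def by blast
  qed
  obtain g where g: "g \<in> arrows G" "gsrc G g = ranchor Z z" "y = lact Z g z" using y by (auto simp: orbit_def src_fibre_def)
  then have yp: "y \<in> points Z" using z by (simp add: lact_closed)
  have "z = lact Z (ginv G g) y" using g z by (simp add: lact_inv_cancel)
  moreover have "ginv G g \<in> src_fibre G (ranchor Z y)" using g z by (simp add: src_fibre_def G.inv_closed G.src_inv ranchor_lact)
  ultimately have "z \<in> orbit y" unfolding orbit_def by blast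
  then show ?thesis using sub[OF z y] sub[OF yp] by blast
qed

lemma left_mult_bound_orbits:
  assumes p: "1 \<le> p" and f: "f \<in> Cspan (gtop G)" and \<zeta>: "in_lp p (points Z) \<zeta>"
    and fin: "\<And>z. z \<in> points Z \<Longrightarrow> in_lp p (stabiliser z) (\<lambda>_. 1 :: complex)"
  shows "in_lp p (points Z) (left_mult G Z f \<zeta>) \<and> lp_norm p (points Z) (left_mult G Z f \<zeta>)
      \<le> opnorm (E_groupoid p G) (E_groupoid p G) (lambda_rep p G f) * lp_norm p (points Z) \<zeta>"
proof -
  let ?N = "opnorm (E_groupoid p G) (E_groupoid p G) (lambda_rep p G f)" and ?V = "orbit ` points Z"
  let ?id = "\<lambda>Q. Q :: 'z set"
  have N: "0 \<le> ?N" by (rule G.lambda_rep_norm_nonneg[OF p f])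
  have U: "(\<Union>Q\<in>?V. ?id Q) = points Z"
    using orbit_self by (auto simp: orbit_def src_fibre_def lact_closed)
  have disj: "disjoint_family_on ?id ?V"
  proof (unfold disjoint_family_on_def, intro ballI impI)
    fix A B assume "A \<in> ?V" "B \<in> ?V" "A \<noteq> B"
    then obtain a b where ab: "a \<in> points Z" "A = orbit a" "b \<in> points Z" "B = orbit b" by blast
    show "A \<inter> B = {}"
    proof (rule ccontr)
      assume "A \<inter> B \<noteq> {}"
      then obtain x where "x \<in> orbit a" "x \<in> orbit b" using ab by blast
      then have "orbit a = orbit b" using orbit_eq ab by metis
      then show False using ab \<open>A \<noteq> B\<close> by simp
    qed
  qed
  note UN = lp_disjoint_Union[OF p disj, unfolded U]
  have bd: "in_lp p Q (left_mult G Z f \<zeta>)" "lp_norm p Q (left_mult G Z f \<zeta>) \<le> ?N * lp_norm p Q \<zeta>" if "Q \<in> ?V" for Q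
    using left_mult_orbit_bound[OF p f _ fin \<zeta>] that by auto
  have \<zeta>V: "\<forall>Q\<in>?V. in_lp p Q \<zeta>" "in_lp p ?V (\<lambda>Q. lp_norm p Q \<zeta>)" using UN(1)[of \<zeta>] \<zeta> by auto
  have le: "norm (lp_norm p Q (left_mult G Z f \<zeta>)) \<le> ?N * norm (lp_norm p Q \<zeta>)" if "Q \<in> ?V" for Q
    using bd[OF that] lp_norm_nonneg[OF bd(1)[OF that]] lp_norm_nonneg[of p Q \<zeta>] \<zeta>V(1) that by simp
  note m = lp_mono[OF p \<zeta>V(2) N le]
  have L: "in_lp p (points Z) (left_mult G Z f \<zeta>)" using UN(1)[of "left_mult G Z f \<zeta>"] bd(1) m(1) by simp
  then show ?thesis using UN(2)[OF L] UN(2)[OF \<zeta>] m(2) by simp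
qed

text \<open>For exponent one the norm of a matrix is its largest column sum, and both operators have the
  same columns up to identifications.\<close>

lemma left_mult_bound_one:
  assumes f: "f \<in> Cspan (gtop G)" and \<zeta>: "in_lp 1 (points Z) \<zeta>"
  shows "in_lp 1 (points Z) (left_mult G Z f \<zeta>) \<and> lp_norm 1 (points Z) (left_mult G Z f \<zeta>)
      \<le> opnorm (E_groupoid 1 G) (E_groupoid 1 G) (lambda_rep 1 G f) * lp_norm 1 (points Z) \<zeta>"
proof -
  let ?N = "opnorm (E_groupoid 1 G) (E_groupoid 1 G) (lambda_rep 1 G f)"
  have one: "(1::ennreal) \<le> 1" by simp
  have N: "0 \<le> ?N" by (rule G.lambda_rep_norm_nonneg[OF one f])
  have n1: "lp_norm 1 A \<eta> = (\<Sum>z\<in>A. cmod (\<eta> z))" if "finite A" for A and \<eta> :: "'z \<Rightarrow> complex"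
    using that by (simp add: lp_norm_finite sum_nonneg)
  have "lp_norm 1 A (left_mult G Z f \<zeta>) \<le> ?N * lp_norm 1 (points Z) \<zeta>" if A: "finite A" "A \<subseteq> points Z" for A
  proof -
    let ?\<Gamma> = "\<lambda>z. {g \<in> {g \<in> arrows G. grng G g = ranchor Z z}. f g \<noteq> 0}"
    have fin: "finite (?\<Gamma> z)" for z by (rule finite_rng_terms[OF f])
    have 1: "cmod (left_mult G Z f \<zeta> z) \<le> (\<Sum>g\<in>?\<Gamma> z. cmod (f g) * cmod (\<zeta> (lact Z (ginv G g) z)))" if "z \<in> A" for z
    proof -
      have "left_mult G Z f \<zeta> z = (\<Sum>\<^sub>\<infinity>g\<in>?\<Gamma> z. f g * \<zeta> (lact Z (ginv G g) z))"
        using that A(2) unfolding left_mult_def by (auto intro!: infsum_cong_neutral)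
      also have "\<dots> = (\<Sum>g\<in>?\<Gamma> z. f g * \<zeta> (lact Z (ginv G g) z))" by (rule infsum_finite[OF fin])
      finally show ?thesis using norm_sum[of "\<lambda>g. f g * \<zeta> (lact Z (ginv G g) z)" "?\<Gamma> z"] by (simp add: norm_mult)
    qed
    define T where "T = (\<lambda>(z, g). (lact Z (ginv G g) z, g)) ` Sigma A ?\<Gamma>"
    have inj: "inj_on (\<lambda>(z, g). (lact Z (ginv G g) z, g)) (Sigma A ?\<Gamma>)"
    proof (rule inj_onI)
      fix x y assume x: "x \<in> Sigma A ?\<Gamma>" and y: "y \<in> Sigma A ?\<Gamma>"
        and eq: "(\<lambda>(z, g). (lact Z (ginv G g) z, g)) x = (\<lambda>(z, g). (lact Z (ginv G g) z, g)) y"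
      obtain z g z' g' where xy: "x = (z, g)" "y = (z', g')" by (cases x, cases y)
      have e: "g = g'" "lact Z (ginv G g) z = lact Z (ginv G g) z'" using eq by (auto simp: xy)
      have d: "z \<in> points Z" "z' \<in> points Z" "g \<in> arrows G" "grng G g = ranchor Z z" "grng G g = ranchor Z z'"
        using x y A(2) e(1) by (auto simp: xy)
      have "z = z'" using lact_cancel_inv[OF d(3,1,4)] lact_cancel_inv[OF d(3,2,5)] e(2) by metis
      then show "x = y" using e(1) by (simp add: xy)
    qed
    have finT: "finite T" unfolding T_def using A(1) fin by (intro finite_imageI finite_SigmaI)
    have TD: "z \<in> points Z \<and> g \<in> src_fibre G (ranchor Z z)" if "(z, g) \<in> T" for z g
      using that A(2) by (auto simp: T_def src_fibre_def lact_inv_closed subset_iff)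
    have TS: "T = Sigma (fst ` T) (\<lambda>z. {g. (z, g) \<in> T})" by force
    have fT: "finite {g. (z, g) \<in> T}" for z
      by (rule finite_subset[OF _ finite_imageI[OF finT, of snd]]) force
    have "lp_norm 1 A (left_mult G Z f \<zeta>) \<le> (\<Sum>z\<in>A. \<Sum>g\<in>?\<Gamma> z. cmod (f g) * cmod (\<zeta> (lact Z (ginv G g) z)))"
      unfolding n1[OF A(1)] by (rule sum_mono[OF 1])
    also have "\<dots> = (\<Sum>(z, g)\<in>Sigma A ?\<Gamma>. cmod (f g) * cmod (\<zeta> (lact Z (ginv G g) z)))"
      by (rule sum.Sigma) (use A fin in auto)
    also have "\<dots> = (\<Sum>(z, g)\<in>T. cmod (f g) * cmod (\<zeta> z))"
      unfolding T_def by (subst sum.reindex[OF inj]) (simp add: o_def case_prod_unfold)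
    also have "\<dots> = (\<Sum>z\<in>fst ` T. \<Sum>g\<in>{g. (z, g) \<in> T}. cmod (f g) * cmod (\<zeta> z))"
      using finT fT by (subst TS, subst sum.Sigma) auto
    also have "\<dots> \<le> (\<Sum>z\<in>fst ` T. ?N * cmod (\<zeta> z))"
    proof (rule sum_mono)
      fix z
      have "(\<Sum>g\<in>{g. (z, g) \<in> T}. cmod (f g)) \<le> ?N"
        by (rule G.column_sum_bound[OF f fT]) (use TD in auto)
      then show "(\<Sum>g\<in>{g. (z, g) \<in> T}. cmod (f g) * cmod (\<zeta> z)) \<le> ?N * cmod (\<zeta> z)"
        by (simp add: sum_distrib_right[symmetric] mult_right_mono)
    qed
    also have "\<dots> = ?N * lp_norm 1 (fst ` T) \<zeta>" using finT by (simp add: n1 sum_distrib_left)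
    also have "\<dots> \<le> ?N * lp_norm 1 (points Z) \<zeta>"
      using TD by (intro mult_left_mono lp_subset(2)[OF one \<zeta>] N) force
    finally show ?thesis .
  qed
  from lp_leI[OF one _ this] show ?thesis using N lp_norm_nonneg[OF \<zeta>] by simp
qed

text \<open>Properness makes the stabiliser compact, and it is contained in a fibre of a local homeomorphism.\<close>

lemma stabiliser_finite:
  assumes "proper_left_action G Z" and z: "z \<in> points Z"
  shows "finite (stabiliser z)"
proof -
  let ?P = "left_action_space G Z"
  let ?C = "{q \<in> topspace ?P. (\<lambda>(g, z). (lact Z g z, z)) q \<in> {(z, z)}}"
  have "compactin ?P ?C"
    by (rule compactin_proper_map_preimage[OF assms(1)[unfolded proper_left_action_def]])
      (simp add: finite_imp_compactin z)
  then have "compactin (gtop G) (fst ` ?C)"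
    unfolding left_action_space_def by (rule image_compactin[OF _ continuous_map_subtopology_fst])
  moreover have "fst ` ?C = stabiliser z"
    using z by (force simp: left_action_space_def stabiliser_def src_fibre_def)
  ultimately have K: "compactin (gtop G) (stabiliser z)" by simp
  have "\<exists>U. openin (gtop G) U \<and> g \<in> U \<and> inj_on (gsrc G) U" if "g \<in> arrows G" for g
    by (rule local_homeo_cover[OF G.src_local_homeo that])
  then obtain U where U: "\<And>g. g \<in> arrows G \<Longrightarrow> openin (gtop G) (U g) \<and> g \<in> U g \<and> inj_on (gsrc G) (U g)" by metis
  have SA: "stabiliser z \<subseteq> arrows G" by (auto simp: stabiliser_def src_fibre_def)
  have "\<exists>\<F>. finite \<F> \<and> \<F> \<subseteq> U ` arrows G \<and> stabiliser z \<subseteq> \<Union>\<F>"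
    by (rule compactinD[OF K]) (use U SA in auto)
  then obtain \<F> where F: "finite \<F>" "\<F> \<subseteq> U ` arrows G" "stabiliser z \<subseteq> \<Union>\<F>" by blast
  have "finite (stabiliser z \<inter> V)" if "V \<in> \<F>" for V
  proof -
    have "inj_on (gsrc G) V" using that F(2) U by auto
    then have "inj_on (gsrc G) (stabiliser z \<inter> V)" by (rule inj_on_subset) auto
    moreover have "finite (gsrc G ` (stabiliser z \<inter> V))"
      by (rule finite_subset[of _ "{ranchor Z z}"]) (auto simp: stabiliser_def src_fibre_def)
    ultimately show ?thesis by (rule finite_imageD[rotated])
  qed
  then have "finite (\<Union>V\<in>\<F>. stabiliser z \<inter> V)" using F(1) by blast
  then show ?thesis by (rule finite_subset[rotated]) (use F(3) in blast)
qed

theorem left_mult_contractive: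
  assumes p: "1 \<le> p" and cases: "p \<in> {1, \<infinity>} \<or> (1 < p \<and> p < \<infinity> \<and> proper_left_action G Z)"
    and f: "f \<in> Cspan (gtop G)" and \<zeta>: "in_lp p (points Z) \<zeta>"
  shows "in_lp p (points Z) (left_mult G Z f \<zeta>) \<and> lp_norm p (points Z) (left_mult G Z f \<zeta>)
      \<le> opnorm (E_groupoid p G) (E_groupoid p G) (lambda_rep p G f) * lp_norm p (points Z) \<zeta>"
proof (cases "p = 1")
  case True
  then show ?thesis using left_mult_bound_one[OF f] \<zeta> by simp
next
  case False
  show ?thesis
  proof (rule left_mult_bound_orbits[OF p f \<zeta>])
    fix z assume "z \<in> points Z"
    then show "in_lp p (stabiliser z) (\<lambda>_. 1 :: complex)"
      using cases False stabiliser_finite[of z] in_lp_finite[of "stabiliser z" p "\<lambda>_. 1 :: complex"]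
      by (auto simp: in_lp_def bounded_iff)
  qed
qed

end

section \<open>The associated Banach correspondence\<close>

context lc_groupoid
begin

lemma lambda_rep_linear:
  assumes "1 \<le> p" "f \<in> Cspan (gtop G)" "g \<in> Cspan (gtop G)"
  shows "lambda_rep p G (\<lambda>x. f x + c * g x) = vadd (op_space (E_groupoid p G) (E_groupoid p G)) (lambda_rep p G f)
      (vscale (op_space (E_groupoid p G) (E_groupoid p G)) c (lambda_rep p G g))"
  using lc_correspondence.T_op_linear[OF self_correspondence, of p f g c] assms
  by (simp add: lambda_rep_T E_self del: op_space_simps)

lemma lambda_rep_subspace:
  assumes "1 \<le> p"
  shows "subspace_of (op_space (E_groupoid p G) (E_groupoid p G)) (lambda_rep p G ` Cspan (gtop G))"
  using lc_correspondence.T_op_subspace[OF self_correspondence assms]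
  by (simp add: lambda_rep_T[OF assms] E_self del: op_space_simps)

lemma lambda_rep_mult:
  assumes p: "1 \<le> p" and f: "f \<in> Cspan (gtop G)" and g: "g \<in> Cspan (gtop G)"
  shows "compose (carrier (E_groupoid p G)) (lambda_rep p G f) (lambda_rep p G g)
      = lambda_rep p G (left_mult G (self_corr G) f g)" "left_mult G (self_corr G) f g \<in> Cspan (gtop G)"
proof -
  interpret S: lc_correspondence G G "self_corr G" by (rule self_correspondence)
  have m: "left_mult G (self_corr G) g \<xi> \<in> carrier (E_groupoid p G)" if "\<xi> \<in> carrier (E_groupoid p G)" for \<xi>
    using op_spaceD(1)[OF lambda_rep_mem[OF p g] that] that by (simp add: lambda_rep_raw[OF p])
  show "compose (carrier (E_groupoid p G)) (lambda_rep p G f) (lambda_rep p G g)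
      = lambda_rep p G (left_mult G (self_corr G) f g)"
    unfolding lambda_rep_raw[OF p] compose_def
    using m S.left_mult_mult[OF f g] by (intro restrict_ext) simp
  show "left_mult G (self_corr G) f g \<in> Cspan (gtop G)"
    using S.left_mult_Cspan[OF f] g by simp
qed

end

locale admissible_correspondence = lc_correspondence G H Z
  for G :: "'g groupoid" and H :: "'h groupoid" and Z :: "('g, 'h, 'z) correspondence" +
  fixes p :: ennreal
  assumes p: "1 \<le> p" and admissible: "p \<in> {1, \<infinity>} \<or> (1 < p \<and> p < \<infinity> \<and> proper_left_action G Z)"
begin

abbreviation "EG \<equiv> E_groupoid p G"
abbreviation "EH \<equiv> E_groupoid p H"
abbreviation "EZ \<equiv> E_corr p H Z"

lemma L_op_mem:
  assumes f: "f \<in> Cspan (gtop G)"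
  shows "L_op p f \<in> carrier (op_space EZ EZ)"
    and "opnorm EZ EZ (L_op p f) \<le> opnorm EG EG (lambda_rep p G f)"
  by (rule L_mem_if_bounded[OF p f], rule left_mult_contractive[OF p admissible f], assumption,
      rule G.lambda_rep_norm_nonneg[OF p f])+

lemma L_op_linear:
  assumes "f \<in> Cspan (gtop G)" "g \<in> Cspan (gtop G)"
  shows "L_op p (\<lambda>x. f x + c * g x) = vadd (op_space EZ EZ) (L_op p f)
      (vscale (op_space EZ EZ) c (L_op p g))"
  unfolding L_op_def op_space_simps
  by (rule restrict_ext) (simp add: E_corr_simps(2,4)[OF p] left_mult_add_left[OF assms])

abbreviation "rep \<equiv> \<lambda>f. (lambda_rep p G f, L_op p f)"

text \<open>The relation pairs \<open>\<lambda>(f)\<close> with \<open>L\<^sub>f\<close>.\<close>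

sublocale ops: operator_correspondence EH EZ "lambda_rep p H ` Cspan (gtop H)"
  "S_op p H Z ` Cspan (ztop Z)" "T_op p H Z ` Cspan (ztop Z)" EG "rep ` Cspan (gtop G)"
proof (intro operator_correspondence.intro operator_triple.intro operator_triple_axioms.intro
    operator_correspondence_axioms.intro)
  let ?LH = "lambda_rep p H ` Cspan (gtop H)" and ?SS = "S_op p H Z ` Cspan (ztop Z)" and ?TT = "T_op p H Z ` Cspan (ztop Z)"
  show "complex_banach_space EH" "complex_banach_space EG"
    by (rule H.E_groupoid_banach[OF p], rule G.E_groupoid_banach[OF p])
  show bZ: "complex_banach_space EZ" by (rule E_corr_banach[OF p])
  show "subspace_of (op_space EH EH) ?LH" by (rule H.lambda_rep_subspace[OF p])
  show "subspace_of (op_space EZ EH) ?SS" by (rule S_op_subspace[OF p])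
  show "subspace_of (op_space EH EZ) ?TT" by (rule T_op_subspace[OF p])
  show "compose (carrier EH) a b \<in> ?LH" if "a \<in> ?LH" "b \<in> ?LH" for a b
    using that H.lambda_rep_mult[OF p] by (auto simp del: op_space_simps)
  show "compose (carrier EZ) b S \<in> ?SS" if "b \<in> ?LH" "S \<in> ?SS" for b S
    using that compose_lambda_S[OF p] by auto
  show "compose (carrier EH) T b \<in> ?TT" if "T \<in> ?TT" "b \<in> ?LH" for T b
    using that compose_T_lambda[OF p] by auto
  show "compose (carrier EH) S T \<in> ?LH" if "S \<in> ?SS" "T \<in> ?TT" for S T
    using that compose_S_T[OF p] by blast
  let ?A = "op_space EG EG" and ?L = "op_space EZ EZ"
  have n: "complex_normed_space ?A" "complex_normed_space ?L"
    using two_normed_spaces.op_space_normed[OF lc_correspondence.normed_spaces(1)[OF G.self_correspondence p]]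
      two_normed_spaces.op_space_normed[OF normed_spaces(3)[OF p]] by (simp_all add: G.E_self del: op_space_simps)
  then have "complex_vspace (prod_space ?A ?L)"
    using two_normed_spaces.prod_space_normed[of ?A ?L] by (simp add: two_normed_spaces_def complex_normed_space_def)
  then show "subspace_of (prod_space ?A ?L) (rep ` Cspan (gtop G))"
  proof (rule linear_image_subspace)
    show "rep f \<in> carrier (prod_space ?A ?L)" if "f \<in> Cspan (gtop G)" for f
      using G.lambda_rep_mem[OF p that] L_op_mem(1)[OF that] by (simp del: op_space_simps)
    show "rep (\<lambda>x. f x + c * g x) = vadd (prod_space ?A ?L) (rep f) (vscale (prod_space ?A ?L) c (rep g))"
      if "f \<in> Cspan (gtop G)" "g \<in> Cspan (gtop G)" for f g c
      by (simp add: G.lambda_rep_linear[OF p that] L_op_linear[OF that] del: op_space_simps)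
  qed
  show "(compose (carrier EG) a b, compose (carrier EZ) l m) \<in> rep ` Cspan (gtop G)"
    if al: "(a, l) \<in> rep ` Cspan (gtop G)" "(b, m) \<in> rep ` Cspan (gtop G)" for a l b m
  proof -
    obtain f g where f: "f \<in> Cspan (gtop G)" "a = lambda_rep p G f" "l = L_op p f"
      and g: "g \<in> Cspan (gtop G)" "b = lambda_rep p G g" "m = L_op p g" using al by auto
    note fg = G.lambda_rep_mult[OF p f(1) g(1)]
    have "compose (carrier EZ) (L_op p f) (L_op p g) = L_op p (left_mult G (self_corr G) f g)"
      using op_spaceD(1)[OF L_op_mem(1)[OF g(1)]] left_mult_mult[OF f(1) g(1)]
      unfolding compose_def L_op_def by (intro restrict_ext) simp
    then show ?thesis using fg f g by (intro image_eqI[of _ _ "left_mult G (self_corr G) f g"]) auto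
  qed
  show "opnorm EZ EZ l \<le> opnorm EG EG a"
    if "(a, l) \<in> rep ` Cspan (gtop G)" for a l
    using that L_op_mem(2) by auto
  show "compose (carrier EZ) S l \<in> ?SS" if "(a, l) \<in> rep ` Cspan (gtop G)" "S \<in> ?SS" for a l S
    using that compose_S_L[OF p _ _ L_op_mem(1)] right_mult_Cspan by auto
  show "compose (carrier EH) l T \<in> ?TT" if "(a, l) \<in> rep ` Cspan (gtop G)" "T \<in> ?TT" for a l T
    using that compose_L_T[OF p] left_mult_Cspan by auto
qed

lemma fst_rep: "fst ` rep ` Cspan (gtop G) = lambda_rep p G ` Cspan (gtop G)"
  by (simp add: image_image)

lemma Fp_red_eq: "Fp_red p G = ops.AA" "Fp_red p H = ops.BB"
  by (simp_all add: Fp_red_def fst_rep)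

lemma corr_pair_eq: "corr_pair p H Z = ops.PP"
  by (simp add: corr_pair_def op_pair_def X_space_def Y_space_def fun_eq_iff)

lemma pi_corr_eq: "pi_corr p G H Z = ops.action"
  unfolding pi_corr_def
proof (rule the_equality)
  have car: "carrier (Fp_red p G) = ops.A1" by (simp only: Fp_red_eq ops.AA_simps)
  let ?Q = "\<lambda>\<pi>. \<pi> \<in> extensional (carrier (Fp_red p G)) \<and>
     contractive_hom (Fp_red p G) (adjointable_algebra (Fp_red p H) (corr_pair p H Z)) \<pi> \<and>
     (\<forall>a\<in>Cspan (gtop G).
        (\<forall>\<psi>\<in>Cspan (ztop Z).
           fst (\<pi> (lambda_rep p G a)) (S_op p H Z \<psi>) = S_op p H Z (right_mult G Z \<psi> a)) \<and>
        (\<forall>\<phi>\<in>Cspan (ztop Z).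
           snd (\<pi> (lambda_rep p G a)) (T_op p H Z \<phi>) = T_op p H Z (left_mult G Z a \<phi>)))"
  have rep: "rep a \<in> rep ` Cspan (gtop G)" if "a \<in> Cspan (gtop G)" for a using that by blast
  have act: "ops.action (lambda_rep p G a) = ops.mult_pair (L_op p a)" if "a \<in> Cspan (gtop G)" for a
    by (rule ops.action_R[OF rep[OF that]])
  have S1: "S_op p H Z \<psi> \<in> ops.X1" if "\<psi> \<in> Cspan (ztop Z)" for \<psi> using ops.X0c(2) that by blast
  have T1: "T_op p H Z \<phi> \<in> ops.Y1" if "\<phi> \<in> Cspan (ztop Z)" for \<phi> using ops.Y0c(2) that by blast
  show "?Q ops.action"
  proof (intro conjI ballI)
    show "ops.action \<in> extensional (carrier (Fp_red p G))" unfolding car by (simp add: ops.action_def)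
    show "contractive_hom (Fp_red p G) (adjointable_algebra (Fp_red p H) (corr_pair p H Z)) ops.action"
      unfolding Fp_red_eq corr_pair_eq by (rule ops.action_hom)
    fix a assume a: "a \<in> Cspan (gtop G)"
    show "fst (ops.action (lambda_rep p G a)) (S_op p H Z \<psi>) = S_op p H Z (right_mult G Z \<psi> a)"
      if "\<psi> \<in> Cspan (ztop Z)" for \<psi>
      unfolding act[OF a] ops.mult_pair_apply(1)[OF S1[OF that]] by (rule compose_S_L[OF p a that L_op_mem(1)[OF a]])
    show "snd (ops.action (lambda_rep p G a)) (T_op p H Z \<phi>) = T_op p H Z (left_mult G Z a \<phi>)"
      if "\<phi> \<in> Cspan (ztop Z)" for \<phi>
      unfolding act[OF a] ops.mult_pair_apply(2)[OF T1[OF that]] by (rule compose_L_T[OF p a that])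
  qed
  fix \<pi> assume \<pi>: "?Q \<pi>"
  show "\<pi> = ops.action"
  proof (rule ops.action_unique)
    show "\<pi> \<in> extensional ops.A1" using \<pi> unfolding car by blast
    show "contractive_hom ops.AA ops.LL \<pi>" using \<pi> unfolding Fp_red_eq corr_pair_eq by blast
    show "fst (\<pi> a) S = compose (carrier EZ) S l"
      if al: "(a, l) \<in> rep ` Cspan (gtop G)" and S: "S \<in> S_op p H Z ` Cspan (ztop Z)" for a l S
    proof -
      obtain f \<psi> where f: "f \<in> Cspan (gtop G)" "a = lambda_rep p G f" "l = L_op p f"
        and \<psi>: "\<psi> \<in> Cspan (ztop Z)" "S = S_op p H Z \<psi>" using al S by auto
      then show ?thesis using \<pi> compose_S_L[OF p f(1) \<psi>(1) L_op_mem(1)[OF f(1)]] by metis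
    qed
    show "snd (\<pi> a) T = compose (carrier EH) l T"
      if al: "(a, l) \<in> rep ` Cspan (gtop G)" and T: "T \<in> T_op p H Z ` Cspan (ztop Z)" for a l T
    proof -
      obtain f \<phi> where f: "f \<in> Cspan (gtop G)" "a = lambda_rep p G f" "l = L_op p f"
        and \<phi>: "\<phi> \<in> Cspan (ztop Z)" "T = T_op p H Z \<phi>" using al T by auto
      then show ?thesis using \<pi> compose_L_T[OF p f(1) \<phi>(1)] by metis
    qed
  qed
qed

end

section \<open>Functions on the units and nondegeneracy\<close>

context lc_groupoid
begin

lemma unit_bump:
  assumes "compactin (unit_space G) K"
  shows "\<exists>a. bump (gtop G) (units G) a \<and> (\<forall>u\<in>K. a u = 1) \<and> (\<lambda>g. complex_of_real (a g)) \<in> Cspan (gtop G)"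
proof -
  have H: "Hausdorff_space (subtopology (gtop G) (units G))" using Hausdorff_units by (simp add: unit_space_def)
  have "compactin (gtop G) K" "K \<subseteq> units G" using assms by (auto simp: unit_space_def compactin_subtopology)
  from bump_on_compact[OF locally_LCH_arrows units_open H this] obtain a
    where a: "bump (gtop G) (units G) a" "\<forall>u\<in>K. a u = 1" by blast
  then show ?thesis using Cspan_Cc_on[OF units_open H] by (auto simp: bump_def)
qed

end

context lc_correspondence
begin

lemma tilde_units:
  assumes "lc_groupoid K" and b: "\<And>h. h \<notin> units K \<Longrightarrow> b h = 0"
  shows "tilde b K = b"
proof
  interpret K: lc_groupoid K by fact
  fix h
  show "tilde b K h = b h"
  proof (cases "h \<in> units K")
    case False
    have "b (ginv K h) = 0" if "h \<in> arrows K"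
    proof (rule b)
      show "ginv K h \<notin> units K"
      proof
        assume "ginv K h \<in> units K"
        then have "ginv K (ginv K h) \<in> units K" by (simp add: K.inv_unit)
        then show False using False that by (simp add: K.inv_inv)
      qed
    qed
    then show ?thesis using b[OF False] by (simp add: tilde_def)
  qed (simp add: tilde_def K.unit_arrow K.inv_unit)
qed

lemma right_mult_units:
  assumes "\<And>g. g \<notin> units G \<Longrightarrow> a g = 0" and z: "z \<in> points Z"
  shows "right_mult G Z \<zeta> a z = a (ranchor Z z) * \<zeta> z"
proof -
  note u = ranchor_units[OF z]
  have "left.conv a \<zeta> z = a (ranchor Z z) * \<zeta> (lact Z (ranchor Z z) z)"
  proof (rule left.conv_one_term[OF z])
    show "a g = 0" if "gsrc G g = ranchor Z z" "g \<noteq> ranchor Z z" for g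
      using assms(1)[of g] G.src_unit[of g] that by metis
  qed (use u in \<open>simp_all add: G.unit_arrow G.src_unit\<close>)
  then show ?thesis using z by (simp add: right_mult_conv lact_unit)
qed

lemma left_mult_units:
  assumes "\<And>g. g \<notin> units G \<Longrightarrow> a g = 0" and "z \<in> points Z"
  shows "left_mult G Z a \<zeta> z = a (ranchor Z z) * \<zeta> z"
  using right_mult_units[OF assms] by (simp add: left_mult_conv right_mult_conv tilde_units[OF G.lc_groupoid_axioms assms(1)])

lemma right_conv_units:
  assumes "\<And>h. h \<notin> units H \<Longrightarrow> b h = 0" and z: "z \<in> points Z"
  shows "right.conv b \<psi> z = b (sanchor Z z) * \<psi> z"
proof -
  note u = sanchor_units[OF z]
  have "right.conv b \<psi> z = b (sanchor Z z) * \<psi> (ract Z z (sanchor Z z))"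
  proof (rule right.conv_one_term[OF z])
    show "b h = 0" if "grng H h = sanchor Z z" "h \<noteq> sanchor Z z" for h
      using assms(1)[of h] H.rng_unit[of h] that by metis
  qed (use u in \<open>simp_all add: H.unit_arrow H.rng_unit\<close>)
  then show ?thesis using z by (simp add: ract_unit)
qed

text \<open>Functions on the units act as local units on compactly supported functions.\<close>

lemma unit_for_left:
  assumes "\<phi> \<in> Cspan (ztop Z)"
  shows "\<exists>a\<in>Cspan (gtop G). left_mult G Z a \<phi> = \<phi> \<and> right_mult G Z \<phi> a = \<phi>"
proof -
  obtain K where K: "compactin (ztop Z) K" "\<And>z. z \<notin> K \<Longrightarrow> \<phi> z = 0" using Cspan_compact_support[OF assms] by metis
  obtain a where a: "bump (gtop G) (units G) a" "\<And>z. z \<in> K \<Longrightarrow> a (ranchor Z z) = 1"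
    "(\<lambda>g. complex_of_real (a g)) \<in> Cspan (gtop G)"
    using G.unit_bump[OF image_compactin[OF K(1) continuous_ranchor]] by auto
  have a0: "complex_of_real (a g) = 0" if "g \<notin> units G" for g using bump_outside[OF a(1) that] by simp
  show ?thesis
  proof (intro bexI[OF _ a(3)] conjI ext)
    fix z
    show "left_mult G Z (\<lambda>g. complex_of_real (a g)) \<phi> z = \<phi> z"
    proof (cases "z \<in> points Z")
      case True
      show ?thesis using left_mult_units[OF a0 True] a(2)[of z] K(2)[of z] by (cases "z \<in> K") simp_all
    qed (simp add: left_mult_def Cspan_outside[OF assms])
    show "right_mult G Z \<phi> (\<lambda>g. complex_of_real (a g)) z = \<phi> z"
    proof (cases "z \<in> points Z")
      case True
      show ?thesis using right_mult_units[OF a0 True] a(2)[of z] K(2)[of z] by (cases "z \<in> K") simp_all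
    qed (simp add: right_mult_def Cspan_outside[OF assms])
  qed
qed

lemma unit_for_right:
  assumes "\<phi> \<in> Cspan (ztop Z)"
  shows "\<exists>b\<in>Cspan (gtop H). right.conv b \<phi> = \<phi> \<and> right.conv (tilde b H) \<phi> = \<phi>"
proof -
  obtain K where K: "compactin (ztop Z) K" "\<And>z. z \<notin> K \<Longrightarrow> \<phi> z = 0" using Cspan_compact_support[OF assms] by metis
  obtain b where b: "bump (gtop H) (units H) b" "\<And>z. z \<in> K \<Longrightarrow> b (sanchor Z z) = 1"
    "(\<lambda>h. complex_of_real (b h)) \<in> Cspan (gtop H)"
    using H.unit_bump[OF image_compactin[OF K(1) sanchor_cont]] by auto
  have b0: "complex_of_real (b h) = 0" if "h \<notin> units H" for h using bump_outside[OF b(1) that] by simp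
  have "right.conv (\<lambda>h. complex_of_real (b h)) \<phi> = \<phi>"
  proof
    fix z
    show "right.conv (\<lambda>h. complex_of_real (b h)) \<phi> z = \<phi> z"
    proof (cases "z \<in> points Z")
      case True
      show ?thesis using right_conv_units[OF b0 True] b(2)[of z] K(2)[of z] by (cases "z \<in> K") simp_all
    qed (simp add: right.conv_def Cspan_outside[OF assms])
  qed
  moreover have "tilde (\<lambda>h. complex_of_real (b h)) H = (\<lambda>h. complex_of_real (b h))" by (rule tilde_units[OF H.lc_groupoid_axioms b0])
  ultimately show ?thesis using b(3) by (intro bexI[OF _ b(3)]) simp
qed

end

context admissible_correspondence
begin

lemma action_lambda: "f \<in> Cspan (gtop G) \<Longrightarrow> ops.action (lambda_rep p G f) = ops.mult_pair (L_op p f)"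
  by (rule ops.action_R) blast

lemma lambda_A1: "f \<in> Cspan (gtop G) \<Longrightarrow> lambda_rep p G f \<in> ops.A1"
  using ops.A0c(2) unfolding fst_rep by blast

lemma lambda_B1: "f \<in> Cspan (gtop H) \<Longrightarrow> lambda_rep p H f \<in> ops.B1"
  using ops.B0c(2) by blast

lemma S_X1: "\<psi> \<in> Cspan (ztop Z) \<Longrightarrow> S_op p H Z \<psi> \<in> ops.X1"
  using ops.X0c(2) by blast

lemma T_Y1: "\<phi> \<in> Cspan (ztop Z) \<Longrightarrow> T_op p H Z \<phi> \<in> ops.Y1"
  using ops.Y0c(2) by blast

lemma action_apply:
  assumes "f \<in> Cspan (gtop G)"
  shows "\<psi> \<in> Cspan (ztop Z) \<Longrightarrow> fst (ops.action (lambda_rep p G f)) (S_op p H Z \<psi>) = S_op p H Z (right_mult G Z \<psi> f)"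
    and "\<phi> \<in> Cspan (ztop Z) \<Longrightarrow> snd (ops.action (lambda_rep p G f)) (T_op p H Z \<phi>) = T_op p H Z (left_mult G Z f \<phi>)"
  using compose_S_L[OF p assms _ L_op_mem(1)[OF assms]] compose_L_T[OF p assms]
  by (simp_all add: action_lambda[OF assms] ops.mult_pair_apply(1)[OF S_X1] ops.mult_pair_apply(2)[OF T_Y1])

text \<open>All four nondegeneracy conditions hold because the generators are reproduced by local units.\<close>

lemma morita_iff_compact:
  "morita_cycle (Fp_red p G) (Fp_red p H) (corr_pair p H Z) (pi_corr p G H Z)
     \<longleftrightarrow> ops.action ` ops.A1 \<subseteq> compact_operators ops.BB ops.PP"
proof
  assume "morita_cycle (Fp_red p G) (Fp_red p H) (corr_pair p H Z) (pi_corr p G H Z)"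
  from morita_cycle.compact_action[OF this]
  show "ops.action ` ops.A1 \<subseteq> compact_operators ops.BB ops.PP"
    unfolding Fp_red_eq corr_pair_eq pi_corr_eq ops.AA_simps .
next
  assume c: "ops.action ` ops.A1 \<subseteq> compact_operators ops.BB ops.PP"
  have cA: "carrier ops.AA = ops.A1" by (rule ops.AA_simps)
  have cB: "carrier ops.BB = ops.B1" by simp
  have cX: "carrier (lspace ops.PP) = ops.X1" and cY: "carrier (rspace ops.PP) = ops.Y1" by (rule ops.pair_carrier)+
  have mul: "left_mul ops.PP = compose (carrier EZ)" "right_mul ops.PP = compose (carrier EH)"
    by simp_all
  have act: "ops.action a \<in> carrier ops.LL" if "a \<in> ops.A1" for a by (rule ops.action_closed(1)[OF that])
  have actX: "fst (ops.action a) S \<in> ops.X1" if "a \<in> ops.A1" "S \<in> ops.X1" for a S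
    using act[OF that(1)] that(2) op_spaceD(1)[of "fst (ops.action a)" "lspace ops.PP" "lspace ops.PP" S]
    unfolding ops.adjointable_simps cX by (auto simp del: op_space_simps op_pair_simps)
  have actY: "snd (ops.action a) T \<in> ops.Y1" if "a \<in> ops.A1" "T \<in> ops.Y1" for a T
    using act[OF that(1)] that(2) op_spaceD(1)[of "snd (ops.action a)" "rspace ops.PP" "rspace ops.PP" T]
    unfolding ops.adjointable_simps cY by (auto simp del: op_space_simps op_pair_simps)
  show "morita_cycle (Fp_red p G) (Fp_red p H) (corr_pair p H Z) (pi_corr p G H Z)"
    unfolding Fp_red_eq corr_pair_eq pi_corr_eq
  proof (intro morita_cycle.intro ops.banach_correspondence morita_cycle_axioms.intro)
    show "ops.action ` carrier ops.AA \<subseteq> compact_operators ops.BB ops.PP" unfolding cA by (rule c)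
    show "closure_in (lspace ops.PP) (lin_span (lspace ops.PP)
         {left_mul ops.PP b x | b x. b \<in> carrier ops.BB \<and> x \<in> carrier (lspace ops.PP)}) = carrier (lspace ops.PP)"
    proof (rule ops.nondegenerateI(1); unfold cB cX mul; rule subsetI)
      fix S assume "S \<in> S_op p H Z ` Cspan (ztop Z)"
      then obtain \<psi> where \<psi>: "\<psi> \<in> Cspan (ztop Z)" "S = S_op p H Z \<psi>" by blast
      obtain b where b: "b \<in> Cspan (gtop H)" "right.conv b \<psi> = \<psi>" using unit_for_right[OF \<psi>(1)] by blast
      have "S = compose (carrier EZ) (lambda_rep p H b) S"
        using compose_lambda_S(1)[OF p \<psi>(1) b(1)] b(2) \<psi>(2) by simp
      then show "S \<in> {compose (carrier EZ) b x | b x. b \<in> ops.B1 \<and> x \<in> ops.X1}"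
        using lambda_B1[OF b(1)] S_X1[OF \<psi>(1)] \<psi>(2) by blast
    qed (use ops.BX1 in blast)
    show "closure_in (rspace ops.PP) (lin_span (rspace ops.PP)
         {right_mul ops.PP y b | b y. b \<in> carrier ops.BB \<and> y \<in> carrier (rspace ops.PP)}) = carrier (rspace ops.PP)"
    proof (rule ops.nondegenerateI(2); unfold cB cY mul; rule subsetI)
      fix T assume "T \<in> T_op p H Z ` Cspan (ztop Z)"
      then obtain \<phi> where \<phi>: "\<phi> \<in> Cspan (ztop Z)" "T = T_op p H Z \<phi>" by blast
      obtain b where b: "b \<in> Cspan (gtop H)" "right.conv (tilde b H) \<phi> = \<phi>" using unit_for_right[OF \<phi>(1)] by blast
      have "T = compose (carrier EH) T (lambda_rep p H b)"
        using compose_T_lambda(1)[OF p \<phi>(1) b(1)] b(2) \<phi>(2) by simp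
      then show "T \<in> {compose (carrier EH) y b | b y. b \<in> ops.B1 \<and> y \<in> ops.Y1}"
        using lambda_B1[OF b(1)] T_Y1[OF \<phi>(1)] \<phi>(2) by blast
    qed (use ops.YB1 in blast)
    show "closure_in (lspace ops.PP) (lin_span (lspace ops.PP)
         {fst (ops.action a) x | a x. a \<in> carrier ops.AA \<and> x \<in> carrier (lspace ops.PP)}) = carrier (lspace ops.PP)"
    proof (rule ops.nondegenerateI(1); unfold cA cX; rule subsetI)
      fix S assume "S \<in> S_op p H Z ` Cspan (ztop Z)"
      then obtain \<psi> where \<psi>: "\<psi> \<in> Cspan (ztop Z)" "S = S_op p H Z \<psi>" by blast
      obtain a where a: "a \<in> Cspan (gtop G)" "right_mult G Z \<psi> a = \<psi>" using unit_for_left[OF \<psi>(1)] by blast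
      have "S = fst (ops.action (lambda_rep p G a)) S" using action_apply(1)[OF a(1) \<psi>(1)] a(2) \<psi>(2) by simp
      then show "S \<in> {fst (ops.action a) x | a x. a \<in> ops.A1 \<and> x \<in> ops.X1}"
        using lambda_A1[OF a(1)] S_X1[OF \<psi>(1)] \<psi>(2) by blast
    qed (use actX in blast)
    show "closure_in (rspace ops.PP) (lin_span (rspace ops.PP)
         {snd (ops.action a) y | a y. a \<in> carrier ops.AA \<and> y \<in> carrier (rspace ops.PP)}) = carrier (rspace ops.PP)"
    proof (rule ops.nondegenerateI(2); unfold cA cY; rule subsetI)
      fix T assume "T \<in> T_op p H Z ` Cspan (ztop Z)"
      then obtain \<phi> where \<phi>: "\<phi> \<in> Cspan (ztop Z)" "T = T_op p H Z \<phi>" by blast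
      obtain a where a: "a \<in> Cspan (gtop G)" "left_mult G Z a \<phi> = \<phi>" using unit_for_left[OF \<phi>(1)] by blast
      have "T = snd (ops.action (lambda_rep p G a)) T" using action_apply(2)[OF a(1) \<phi>(1)] a(2) \<phi>(2) by simp
      then show "T \<in> {snd (ops.action a) y | a y. a \<in> ops.A1 \<and> y \<in> ops.Y1}"
        using lambda_A1[OF a(1)] T_Y1[OF \<phi>(1)] \<phi>(2) by blast
    qed (use actY in blast)
  qed
qed

end

section \<open>The orbit space and proper correspondences\<close>

context lc_correspondence
begin

lemma right_orbit_self: "z \<in> points Z \<Longrightarrow> z \<in> right_orbit H Z z"
  unfolding right_orbit_def using sanchor_units[of z] ract_unit[of z]
  by (auto intro!: exI[of _ "sanchor Z z"] simp: H.unit_arrow H.rng_unit)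

lemma right_orbitE:
  assumes "w \<in> right_orbit H Z z" "z \<in> points Z"
  obtains h where "h \<in> arrows H" "sanchor Z z = grng H h" "w = ract Z z h" "w \<in> points Z"
  using assms ract_closed by (auto simp: right_orbit_def)

lemma right_orbit_points: "w \<in> right_orbit H Z z \<Longrightarrow> z \<in> points Z \<Longrightarrow> w \<in> points Z"
  by (auto elim: right_orbitE)

lemma right_orbit_eq:
  assumes w: "w \<in> right_orbit H Z z" and z: "z \<in> points Z"
  shows "right_orbit H Z w = right_orbit H Z z"
proof -
  have sub: "right_orbit H Z w \<subseteq> right_orbit H Z z" if w: "w \<in> right_orbit H Z z" and z: "z \<in> points Z" for w z
  proof
    fix x assume x: "x \<in> right_orbit H Z w"
    obtain h where h: "h \<in> arrows H" "sanchor Z z = grng H h" "w = ract Z z h" "w \<in> points Z"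
      using right_orbitE[OF w z] .
    obtain k where k: "k \<in> arrows H" "sanchor Z w = grng H k" "x = ract Z w k" using right_orbitE[OF x h(4)] by metis
    have hk: "gsrc H h = grng H k" using sanchor_ract[OF z h(1,2)] h(3) k(2) by simp
    have "x = ract Z z (gmult H h k)" using ract_ract[OF z h(1) k(1) h(2) hk] k(3) h(3) by simp
    then show "x \<in> right_orbit H Z z"
      unfolding right_orbit_def using h k hk by (auto intro!: exI[of _ "gmult H h k"] simp: H.mult_closed H.rng_mult)
  qed
  have "z \<in> right_orbit H Z w"
  proof -
    obtain h where h: "h \<in> arrows H" "sanchor Z z = grng H h" "w = ract Z z h" using right_orbitE[OF w z] by metis
    then show ?thesis
      unfolding right_orbit_def using ract_inv_cancel[OF z h(1,2)] sanchor_ract[OF z h(1,2)]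
      by (auto intro!: exI[of _ "ginv H h"] simp: H.inv_closed H.rng_inv)
  qed
  then show ?thesis using sub[OF w z] sub[OF _ right_orbit_points[OF w z]] by blast
qed

lemma right_orbit_eq_iff:
  assumes "w \<in> points Z" "z \<in> points Z"
  shows "right_orbit H Z w = right_orbit H Z z \<longleftrightarrow> w \<in> right_orbit H Z z"
  using right_orbit_eq[of w z] right_orbit_self[of w] assms by blast

lemma ranchor_orbit: "w \<in> right_orbit H Z z \<Longrightarrow> z \<in> points Z \<Longrightarrow> ranchor Z w = ranchor Z z"
  by (elim right_orbitE) (simp_all add: ranchor_ract)

lemma r_star_orbit:
  assumes "z \<in> points Z"
  shows "r_star Z (right_orbit H Z z) = ranchor Z z"
proof -
  have "ranchor Z ` right_orbit H Z z = {ranchor Z z}"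
  proof (intro equalityI subsetI)
    fix u assume "u \<in> ranchor Z ` right_orbit H Z z"
    then obtain w where "u = ranchor Z w" "w \<in> right_orbit H Z z" by blast
    then show "u \<in> {ranchor Z z}" using ranchor_orbit[OF _ assms] by simp
  qed (use right_orbit_self[OF assms] in simp)
  then show ?thesis by (simp add: r_star_def)
qed

lemma small_orbit:
  assumes U: "small U" and z: "z \<in> points Z" and w: "w \<in> right_orbit H Z z" "w \<in> U" and w': "w' \<in> right_orbit H Z z" "w' \<in> U"
  shows "w = w'"
proof -
  have wp: "w \<in> points Z" using right_orbit_points[OF w(1) z] .
  have "w' \<in> right_orbit H Z w" using right_orbit_eq[OF w(1) z] w'(1) by simp
  then obtain h where h: "h \<in> arrows H" "sanchor Z w = grng H h" "w' = ract Z w h" using right_orbitE[OF _ wp] by metis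
  then have "h \<in> units H" using U w(2) w'(2) by (auto simp: small_def)
  then have "h = sanchor Z w" using h(2) H.rng_unit by simp
  then show ?thesis using h(3) ract_unit[OF wp] by simp
qed

text \<open>The range map of \<open>H\<close> is open, so moving along arrows close to \<open>h\<close> is possible from all points near \<open>z\<close>.\<close>

lemma saturation_open:
  assumes V: "openin (ztop Z) V"
  shows "openin (ztop Z) {z \<in> points Z. right_orbit H Z z \<inter> V \<noteq> {}}"
proof (subst openin_subopen, intro ballI)
  let ?R = "right_action_space H Z"
  fix z assume "z \<in> {z \<in> points Z. right_orbit H Z z \<inter> V \<noteq> {}}"
  then obtain h where z: "z \<in> points Z" and h: "h \<in> arrows H" "sanchor Z z = grng H h" "ract Z z h \<in> V"
    by (auto simp: right_orbit_def)
  have "openin ?R {q \<in> topspace ?R. (case q of (z, h) \<Rightarrow> ract Z z h) \<in> V}"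
    by (rule openin_continuous_map_preimage[OF continuous_ract V])
  then obtain W where W: "openin (prod_topology (ztop Z) (gtop H)) W"
    "{q \<in> topspace ?R. (case q of (z, h) \<Rightarrow> ract Z z h) \<in> V} = W \<inter> {(z, h). sanchor Z z = grng H h}"
    unfolding right_action_space_def openin_subtopology by (elim exE conjE)
  have "(z, h) \<in> {q \<in> topspace ?R. (case q of (z, h) \<Rightarrow> ract Z z h) \<in> V}"
    using z h by (simp add: right_action_space_def)
  then have "(z, h) \<in> W" unfolding W(2) by blast
  then obtain A B where AB: "openin (ztop Z) A" "openin (gtop H) B" "z \<in> A" "h \<in> B" "A \<times> B \<subseteq> W"
    using W(1) unfolding openin_prod_topology_alt by metis
  let ?N = "A \<inter> {x \<in> points Z. sanchor Z x \<in> grng H ` B}"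
  have "openin (unit_space H) (grng H ` B)"
    using local_homeo_open_map[OF H.rng_local_homeo] AB(2) by (simp add: open_map_def)
  then have "openin (ztop Z) ?N" by (intro openin_Int AB(1) openin_continuous_map_preimage[OF sanchor_cont])
  moreover have "z \<in> ?N" using AB(3,4) z h(2) by simp
  moreover have "?N \<subseteq> {z \<in> points Z. right_orbit H Z z \<inter> V \<noteq> {}}"
  proof
    fix x assume x: "x \<in> ?N"
    then obtain k where k: "k \<in> B" "sanchor Z x = grng H k" by auto
    have "(x, k) \<in> W" using x k(1) AB(5) by blast
    then have "(x, k) \<in> W \<inter> {(z, h). sanchor Z z = grng H h}" using k(2) by simp
    then have "ract Z x k \<in> V" "k \<in> arrows H" unfolding W(2)[symmetric] by (simp_all add: right_action_space_def)
    then show "x \<in> {z \<in> points Z. right_orbit H Z z \<inter> V \<noteq> {}}" using x k(2) by (auto simp: right_orbit_def)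
  qed
  ultimately show "\<exists>T. openin (ztop Z) T \<and> z \<in> T \<and> T \<subseteq> {z \<in> points Z. right_orbit H Z z \<inter> V \<noteq> {}}" by blast
qed

text \<open>The orbit relation is the image of the proper action map, hence closed, and projecting along a
  compact factor is a closed map.\<close>

lemma saturation_closed:
  assumes K: "compactin (ztop Z) K"
  shows "closedin (ztop Z) {z \<in> points Z. right_orbit H Z z \<inter> K \<noteq> {}}"
proof -
  let ?R = "right_action_space H Z" and ?P = "prod_topology (ztop Z) (ztop Z)"
  let ?m = "\<lambda>(z, h). (ract Z z h, z)"
  have KZ: "K \<subseteq> points Z" using K by (simp add: compactin_def)
  have "closed_map ?R ?P ?m" using ract_proper proper_imp_closed_map unfolding proper_right_action_def by blast
  then have cl: "closedin ?P (?m ` topspace ?R)" by (simp add: closed_map_def)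
  have "prod_topology (ztop Z) (subtopology (ztop Z) K) = subtopology ?P (points Z \<times> K)"
    using subtopology_Times[of "ztop Z" "ztop Z" "points Z" K] by simp
  then have "closedin (prod_topology (ztop Z) (subtopology (ztop Z) K)) (?m ` topspace ?R \<inter> (points Z \<times> K))"
    using cl by (auto simp: closedin_subtopology)
  moreover have "compact_space (subtopology (ztop Z) K)" using K compact_space_subtopology by blast
  ultimately have "closedin (ztop Z) (fst ` (?m ` topspace ?R \<inter> (points Z \<times> K)))"
    using closed_map_fst unfolding closed_map_def by blast
  moreover have "fst ` (?m ` topspace ?R \<inter> (points Z \<times> K)) = {z \<in> points Z. right_orbit H Z z \<inter> K \<noteq> {}}"
  proof (intro equalityI subsetI)
    fix x assume "x \<in> fst ` (?m ` topspace ?R \<inter> (points Z \<times> K))"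
    then obtain z h where zh: "z \<in> K" "h \<in> arrows H" "sanchor Z z = grng H h" "x = ract Z z h"
      by (auto simp: right_action_space_def)
    then have x: "x \<in> right_orbit H Z z" by (auto simp: right_orbit_def)
    have z: "z \<in> points Z" using zh(1) KZ by blast
    show "x \<in> {z \<in> points Z. right_orbit H Z z \<inter> K \<noteq> {}}"
      using right_orbit_eq[OF x z] right_orbit_self[OF z] right_orbit_points[OF x z] zh(1) by blast
  next
    fix x assume "x \<in> {z \<in> points Z. right_orbit H Z z \<inter> K \<noteq> {}}"
    then obtain k where k: "x \<in> points Z" "k \<in> right_orbit H Z x" "k \<in> K" by blast
    have kp: "k \<in> points Z" using k(3) KZ by blast
    have "x \<in> right_orbit H Z k" using right_orbit_eq[OF k(2,1)] right_orbit_self[OF k(1)] by simp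
    then obtain h where h: "h \<in> arrows H" "sanchor Z k = grng H h" "x = ract Z k h" using right_orbitE[OF _ kp] by metis
    then have "(x, k) \<in> ?m ` topspace ?R \<inter> (points Z \<times> K)"
      using kp k by (auto simp: right_action_space_def intro!: image_eqI[of _ _ "(k, h)"])
    then show "x \<in> fst ` (?m ` topspace ?R \<inter> (points Z \<times> K))" by (rule image_eqI[rotated]) simp
  qed
  ultimately show ?thesis by simp
qed

lemma orbit_map_quotient: "quotient_map (ztop Z) (orbit_space H Z) (right_orbit H Z)"
  unfolding orbit_space_def by (rule quotient_map_quotient_topology)

lemma orbit_map_continuous: "continuous_map (ztop Z) (orbit_space H Z) (right_orbit H Z)"
  by (rule quotient_imp_continuous_map[OF orbit_map_quotient])

lemma orbit_map_open:
  assumes "openin (ztop Z) V"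
  shows "openin (orbit_space H Z) (right_orbit H Z ` V)"
proof -
  have V: "V \<subseteq> points Z" by (rule openin_subset[OF assms])
  have "{z \<in> points Z. right_orbit H Z z \<in> right_orbit H Z ` V} = {z \<in> points Z. right_orbit H Z z \<inter> V \<noteq> {}}"
    using right_orbit_eq_iff V right_orbit_self right_orbit_eq by blast
  then show ?thesis
    unfolding orbit_space_def openin_quotient_topology using V saturation_open[OF assms] by auto
qed

lemma topspace_orbit_space: "topspace (orbit_space H Z) = right_orbit H Z ` points Z"
  by (simp add: orbit_space_def)

lemma r_star_continuous: "continuous_map (orbit_space H Z) (unit_space G) (r_star Z)"
proof (rule continuous_compose_quotient_map[OF orbit_map_quotient])
  show "continuous_map (ztop Z) (unit_space G) (r_star Z \<circ> right_orbit H Z)"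
    by (rule continuous_map_eq[OF continuous_ranchor]) (simp add: r_star_orbit)
qed

subsection \<open>Averaging over orbits\<close>

text \<open>For a bump supported in a small set an orbit carries at most one nonzero value, and the supremum picks
  it out. The result is constant on orbits by construction.\<close>

definition orbit_sup :: "('z \<Rightarrow> real) \<Rightarrow> 'z \<Rightarrow> real" where
  "orbit_sup \<kappa> z = Sup (\<kappa> ` right_orbit H Z z)"

lemma orbit_sup_orbit: "w \<in> right_orbit H Z z \<Longrightarrow> z \<in> points Z \<Longrightarrow> orbit_sup \<kappa> w = orbit_sup \<kappa> z"
  by (simp add: orbit_sup_def right_orbit_eq)

lemma orbit_sup_eq:
  assumes U: "small U" and \<kappa>: "bump (ztop Z) U \<kappa>" and z: "z \<in> points Z" and w: "w \<in> right_orbit H Z z" "w \<in> U"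
  shows "orbit_sup \<kappa> z = \<kappa> w"
  unfolding orbit_sup_def
proof (rule cSup_eq_maximum)
  show "\<kappa> w \<in> \<kappa> ` right_orbit H Z z" using w(1) by (rule imageI)
  fix y assume "y \<in> \<kappa> ` right_orbit H Z z"
  then obtain x where x: "x \<in> right_orbit H Z z" "y = \<kappa> x" by blast
  show "y \<le> \<kappa> w"
    using small_orbit[OF U z w x(1)] bump_outside[OF \<kappa>, of x] \<kappa> x(2) by (cases "x \<in> U") (auto simp: bump_def)
qed

lemma orbit_sup_eq_0:
  assumes \<kappa>: "bump (ztop Z) U \<kappa>" and z: "z \<in> points Z" and w: "\<And>w. w \<in> right_orbit H Z z \<Longrightarrow> w \<in> U \<Longrightarrow> \<kappa> w = 0"
  shows "orbit_sup \<kappa> z = 0"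
proof -
  have "\<kappa> w = 0" if "w \<in> right_orbit H Z z" for w using w[OF that] bump_outside[OF \<kappa>, of w] by blast
  then have "\<kappa> ` right_orbit H Z z = {0}" using right_orbit_self[OF z] by force
  then show ?thesis by (simp add: orbit_sup_def)
qed

lemma orbit_sup_nonneg:
  assumes U: "small U" and \<kappa>: "bump (ztop Z) U \<kappa>" and z: "z \<in> points Z"
  shows "0 \<le> orbit_sup \<kappa> z"
proof (cases "right_orbit H Z z \<inter> U = {}")
  case True
  then show ?thesis using orbit_sup_eq_0[OF \<kappa> z] by force
next
  case False
  then obtain w where "w \<in> right_orbit H Z z" "w \<in> U" by blast
  then show ?thesis using orbit_sup_eq[OF U \<kappa> z] \<kappa> by (simp add: bump_def)
qed

text \<open>For an open set of values without \<open>0\<close> the preimage is the saturation of an open subset of \<open>U\<close>. If \<open>0\<close>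
  is among the values, the points whose orbits avoid the compact support have to be added, and these form an
  open set since saturations of compact sets are closed. Continuity therefore holds on all of \<open>Z\<close>,
  Hausdorff or not.\<close>

lemma orbit_sup_continuous:
  assumes oU: "openin (ztop Z) U" and U: "small U" and \<kappa>: "bump (ztop Z) U \<kappa>"
  shows "continuous_map (ztop Z) euclideanreal (orbit_sup \<kappa>)"
proof -
  obtain K where K: "compactin (ztop Z) K" "K \<subseteq> U" "\<And>z. z \<notin> K \<Longrightarrow> \<kappa> z = 0"
    using Cc_onD[of "\<lambda>z. complex_of_real (\<kappa> z)" "ztop Z" U] \<kappa> oU unfolding bump_def by (metis of_real_eq_0_iff)
  have UZ: "U \<subseteq> points Z" by (rule openin_subset[OF oU])
  have "openin (ztop Z) {z \<in> points Z. orbit_sup \<kappa> z \<in> V}" if V: "open V" for V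
  proof -
    let ?W = "{w \<in> U. \<kappa> w \<in> V}"
    have "openin (subtopology (ztop Z) U) {w \<in> topspace (subtopology (ztop Z) U). \<kappa> w \<in> V}"
      using openin_continuous_map_preimage[OF bump_continuous[OF \<kappa>], of V] V by simp
    then have oW: "openin (ztop Z) ?W" using oU UZ by (auto simp: Int_absorb1 intro: openin_trans_full)
    let ?S = "{z \<in> points Z. right_orbit H Z z \<inter> ?W \<noteq> {}}"
    have S: "orbit_sup \<kappa> z \<in> V" if "z \<in> ?S" for z
      using that orbit_sup_eq[OF U \<kappa>, of z] by auto
    show ?thesis
    proof (cases "0 \<in> V")
      case True
      let ?C = "{z \<in> points Z. right_orbit H Z z \<inter> K \<noteq> {}}"
      have "{z \<in> points Z. orbit_sup \<kappa> z \<in> V} = (points Z - ?C) \<union> ?S"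
      proof (intro equalityI subsetI)
        fix z assume z: "z \<in> {z \<in> points Z. orbit_sup \<kappa> z \<in> V}"
        show "z \<in> (points Z - ?C) \<union> ?S"
        proof (cases "z \<in> ?C")
          case True
          then obtain w where w: "w \<in> right_orbit H Z z" "w \<in> U" using K(2) by blast
          then show ?thesis using z orbit_sup_eq[OF U \<kappa>, of z w] by auto
        qed (use z in blast)
      next
        fix z assume z: "z \<in> (points Z - ?C) \<union> ?S"
        show "z \<in> {z \<in> points Z. orbit_sup \<kappa> z \<in> V}"
        proof (cases "z \<in> ?S")
          case False
          then have z: "z \<in> points Z" "z \<notin> ?C" using z by blast+
          then have "orbit_sup \<kappa> z = 0" using K(3) by (intro orbit_sup_eq_0[OF \<kappa>]) blast+
          then show ?thesis using True z(1) by simp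
        qed (use S in blast)
      qed
      then show ?thesis
        using openin_Un[OF openin_diff[OF openin_topspace saturation_closed[OF K(1)]] saturation_open[OF oW]] by simp
    next
      case False
      have "{z \<in> points Z. orbit_sup \<kappa> z \<in> V} = ?S"
      proof (intro equalityI subsetI)
        fix z assume z: "z \<in> {z \<in> points Z. orbit_sup \<kappa> z \<in> V}"
        show "z \<in> ?S"
        proof (rule ccontr)
          assume n: "z \<notin> ?S"
          have "orbit_sup \<kappa> z = 0"
          proof (cases "right_orbit H Z z \<inter> U = {}")
            case True
            then show ?thesis using z by (intro orbit_sup_eq_0[OF \<kappa>]) blast+
          next
            case False
            then obtain w where w: "w \<in> right_orbit H Z z" "w \<in> U" by blast
            then have "\<kappa> w \<in> V" using z orbit_sup_eq[OF U \<kappa>, of z w] by auto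
            then show ?thesis using n w z by blast
          qed
          then show False using z False by simp
        qed
      qed (use S in blast)
      then show ?thesis using saturation_open[OF oW] by simp
    qed
  qed
  then show ?thesis by (simp add: continuous_map_def)
qed

end

subsection \<open>Properness implies compactness\<close>

context lc_correspondence
begin

lemma small_Hausdorff:
  assumes "small U"
  shows "Hausdorff_space (subtopology (ztop Z) U)"
proof (rule Hausdorff_space_injective_preimage[OF H.Hausdorff_units])
  show "continuous_map (subtopology (ztop Z) U) (unit_space H) (sanchor Z)"
    by (rule continuous_map_from_subtopology[OF sanchor_cont])
  show "inj_on (sanchor Z) (topspace (subtopology (ztop Z) U))"
    using assms inj_on_subset[of "sanchor Z" U] by (auto simp: small_def)
qed

lemma small_bump:
  assumes "z \<in> points Z"
  shows "\<exists>U \<kappa>. openin (ztop Z) U \<and> small U \<and> z \<in> U \<and> bump (ztop Z) U \<kappa> \<and> \<kappa> z = 1"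
proof -
  obtain U where U: "openin (ztop Z) U" "z \<in> U" "small U" using small_cover[OF assms] by blast
  then show ?thesis using bump_at_point[OF locally_LCH_points U(1) small_Hausdorff[OF U(3)] U(2)] by blast
qed

text \<open>The open sets where the bumps exceed \<open>1/2\<close> have open images in \<open>Z/H\<close>, and finitely many of these cover
  the preimage of \<open>C\<close>, which is compact by properness.\<close>

lemma orbit_bumps:
  assumes Z: "proper_correspondence G H Z" and C: "compactin (unit_space G) C"
  shows "\<exists>(T :: 'z set) U \<kappa>. finite T \<and> (\<forall>t\<in>T. openin (ztop Z) (U t) \<and> small (U t) \<and> bump (ztop Z) (U t) (\<kappa> t)) \<and>
    (\<forall>z\<in>points Z. ranchor Z z \<in> C \<longrightarrow> 1 / 2 < (\<Sum>t\<in>T. orbit_sup (\<kappa> t) z))"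
proof -
  obtain U \<kappa> where U: "\<And>z. z \<in> points Z \<Longrightarrow> openin (ztop Z) (U z) \<and> small (U z) \<and> z \<in> U z \<and> bump (ztop Z) (U z) (\<kappa> z) \<and> \<kappa> z z = 1"
    using small_bump by metis
  define W where "W z = {w \<in> U z. 1 / 2 < \<kappa> z w}" for z
  have W: "openin (ztop Z) (W z)" if z: "z \<in> points Z" for z
  proof -
    have "openin (subtopology (ztop Z) (U z)) {w \<in> topspace (subtopology (ztop Z) (U z)). \<kappa> z w \<in> {1/2<..}}"
      using U[OF z] by (intro openin_continuous_map_preimage[OF bump_continuous]) auto
    then have "openin (ztop Z) {w \<in> topspace (subtopology (ztop Z) (U z)). \<kappa> z w \<in> {1/2<..}}"
      using U[OF z] openin_trans_full by blast
    moreover have "{w \<in> topspace (subtopology (ztop Z) (U z)). \<kappa> z w \<in> {1/2<..}} = W z"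
      using U[OF z] openin_subset[of "ztop Z" "U z"] by (auto simp: W_def)
    ultimately show ?thesis by simp
  qed
  let ?X = "orbit_space H Z"
  let ?q = "right_orbit H Z"
  have "compactin ?X {x \<in> topspace ?X. r_star Z x \<in> C}"
    using Z C unfolding proper_correspondence_def by (intro compactin_proper_map_preimage)
  moreover have "\<forall>V\<in>(\<lambda>z. ?q ` W z) ` points Z. openin ?X V" using orbit_map_open[OF W] by blast
  moreover have "{x \<in> topspace ?X. r_star Z x \<in> C} \<subseteq> \<Union>((\<lambda>z. ?q ` W z) ` points Z)"
  proof
    fix x assume "x \<in> {x \<in> topspace ?X. r_star Z x \<in> C}"
    then obtain z where z: "z \<in> points Z" "x = ?q z" by (auto simp: topspace_orbit_space)
    then have "z \<in> W z" using U[OF z(1)] by (simp add: W_def)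
    then show "x \<in> \<Union>((\<lambda>z. ?q ` W z) ` points Z)" using z by blast
  qed
  ultimately have "\<exists>\<F>. finite \<F> \<and> \<F> \<subseteq> (\<lambda>z. ?q ` W z) ` points Z \<and> {x \<in> topspace ?X. r_star Z x \<in> C} \<subseteq> \<Union>\<F>"
    unfolding compactin_def by meson
  then obtain \<F> where F: "finite \<F>" "\<F> \<subseteq> (\<lambda>z. ?q ` W z) ` points Z" "{x \<in> topspace ?X. r_star Z x \<in> C} \<subseteq> \<Union>\<F>"
    by blast
  then obtain T where T: "finite T" "T \<subseteq> points Z" "\<F> = (\<lambda>z. ?q ` W z) ` T" using finite_subset_image[OF F(1,2)] by blast
  have "1 / 2 < (\<Sum>t\<in>T. orbit_sup (\<kappa> t) z)" if z: "z \<in> points Z" "ranchor Z z \<in> C" for z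
  proof -
    have "?q z \<in> {x \<in> topspace ?X. r_star Z x \<in> C}" using z by (simp add: topspace_orbit_space r_star_orbit)
    then obtain t w where t: "t \<in> T" and w: "w \<in> W t" "?q z = ?q w" using F(3) T(3) by blast
    have tp: "t \<in> points Z" using t T(2) by blast
    have wp: "w \<in> points Z" using w(1) openin_subset[OF W[OF tp]] by blast
    have "w \<in> ?q z" using right_orbit_self[OF wp] w(2) by simp
    then have "orbit_sup (\<kappa> t) z = \<kappa> t w"
      using U[OF tp] w(1) z(1) by (intro orbit_sup_eq[of "U t"]) (auto simp: W_def)
    then have "1 / 2 < orbit_sup (\<kappa> t) z" using w(1) by (simp add: W_def)
    also have "\<dots> \<le> (\<Sum>t\<in>T. orbit_sup (\<kappa> t) z)"
      using t T U z(1) by (intro member_le_sum orbit_sup_nonneg) blast+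
    finally show ?thesis .
  qed
  moreover have "\<forall>t\<in>T. openin (ztop Z) (U t) \<and> small (U t) \<and> bump (ztop Z) (U t) (\<kappa> t)" using T(2) U by blast
  ultimately show ?thesis using T(1) by (intro exI[of _ T] exI[of _ U] exI[of _ \<kappa>]) simp
qed

lemma T_raw_off_orbit:
  assumes "\<And>z. z \<notin> U \<Longrightarrow> \<phi> z = 0" "z \<in> points Z" "right_orbit H Z z \<inter> U = {}"
  shows "T_raw H Z \<phi> \<xi> z = 0"
proof (rule T_raw_small_zero[OF assms(1)])
  have "ract Z z (ginv H h) \<in> right_orbit H Z z" if "h \<in> src_fibre H (sanchor Z z)" for h
    using that H.inv_closed[of h] H.rng_inv[of h] unfolding right_orbit_def by (auto simp: src_fibre_iff)
  then show "\<not> (\<exists>h\<in>src_fibre H (sanchor Z z). ract Z z (ginv H h) \<in> U)" using assms(3) by blast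
qed

text \<open>For functions supported in a small set, \<open>T\<^sub>\<phi> S\<^sub>\<psi>\<close> is a diagonal matrix that is constant along
  orbits.\<close>

lemma T_raw_S_raw_small:
  assumes U: "small U" and \<phi>: "\<And>z. z \<notin> U \<Longrightarrow> \<phi> z = 0" and \<psi>: "\<And>z. z \<notin> U \<Longrightarrow> \<psi> z = 0" and z: "z \<in> points Z"
  shows "w \<in> right_orbit H Z z \<Longrightarrow> w \<in> U \<Longrightarrow> T_raw H Z \<phi> (S_raw H Z \<psi> \<zeta>) z = \<phi> w * \<psi> w * \<zeta> z"
    and "right_orbit H Z z \<inter> U = {} \<Longrightarrow> T_raw H Z \<phi> (S_raw H Z \<psi> \<zeta>) z = 0"
proof -
  assume w: "w \<in> right_orbit H Z z" "w \<in> U"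
  obtain k where k: "k \<in> arrows H" "sanchor Z z = grng H k" "w = ract Z z k" using right_orbitE[OF w(1) z] by metis
  let ?h = "ginv H k"
  have h: "?h \<in> src_fibre H (sanchor Z z)" "ract Z z (ginv H ?h) = w"
    using k by (simp_all add: src_fibre_iff H.inv_closed H.src_inv H.inv_inv)
  have "z \<in> s_fibre Z (gsrc H ?h)" using z h(1) by (simp add: s_fibre_iff src_fibre_iff)
  then have "S_raw H Z \<psi> \<zeta> ?h = \<psi> (ract Z z (ginv H ?h)) * \<zeta> z"
    using h w(2) by (intro S_raw_small[OF U] \<psi>) (simp_all add: src_fibre_iff)
  moreover have "T_raw H Z \<phi> (S_raw H Z \<psi> \<zeta>) z = \<phi> (ract Z z (ginv H ?h)) * S_raw H Z \<psi> \<zeta> ?h"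
    using h w(2) z by (intro T_raw_small[OF U] \<phi>) simp_all
  ultimately show "T_raw H Z \<phi> (S_raw H Z \<psi> \<zeta>) z = \<phi> w * \<psi> w * \<zeta> z" by (simp add: h(2))
next
  assume e: "right_orbit H Z z \<inter> U = {}"
  show "T_raw H Z \<phi> (S_raw H Z \<psi> \<zeta>) z = 0" by (rule T_raw_off_orbit[OF \<phi> z e])
qed

text \<open>After normalisation the functions \<open>orbit_sup \<kappa>\<^sub>t\<close> become an invariant partition of unity over the
  sources of the support of \<open>f\<close>. Each of them is a diagonal operator \<open>T\<^sub>\<phi> S\<^sub>\<psi>\<close>, and \<open>L\<^sub>f\<close> is absorbed by
  \<open>L\<^sub>f T\<^sub>\<phi> = T\<^sub>f\<^sub>\<phi>\<close>.\<close>

theorem left_mult_decomposition: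
  assumes Z: "proper_correspondence G H Z" and f: "f \<in> Cspan (gtop G)"
  shows "\<exists>(T :: 'z set) \<phi> \<psi>. finite T \<and> (\<forall>t\<in>T. \<phi> t \<in> Cspan (ztop Z) \<and> \<psi> t \<in> Cspan (ztop Z)) \<and>
    (\<forall>\<zeta>. left_mult G Z f \<zeta> = (\<lambda>z. \<Sum>t\<in>T. T_raw H Z (\<phi> t) (S_raw H Z (\<psi> t) \<zeta>) z))"
proof -
  obtain C0 where C0: "compactin (gtop G) C0" "\<And>g. g \<notin> C0 \<Longrightarrow> f g = 0" using Cspan_compact_support[OF f] by metis
  obtain a where a: "bump (gtop G) (units G) a" "\<And>g. g \<in> C0 \<Longrightarrow> a (gsrc G g) = 1"
    using G.unit_bump[OF image_compactin[OF C0(1) G.src_cont]] by auto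
  obtain C1 where C1: "compactin (gtop G) C1" "C1 \<subseteq> units G" "\<And>g. g \<notin> C1 \<Longrightarrow> a g = 0"
    using Cc_onD[of "\<lambda>g. complex_of_real (a g)" "gtop G" "units G"] a(1) G.units_open
    unfolding bump_def by (metis of_real_eq_0_iff)
  have "compactin (unit_space G) C1" using C1(1,2) by (simp add: unit_space_def compactin_subtopology)
  from orbit_bumps[OF Z this] obtain T :: "'z set" and U \<kappa>
    where T: "finite T" "\<And>t. t \<in> T \<Longrightarrow> openin (ztop Z) (U t)" "\<And>t. t \<in> T \<Longrightarrow> small (U t)"
      "\<And>t. t \<in> T \<Longrightarrow> bump (ztop Z) (U t) (\<kappa> t)"
    and sum: "\<And>z. z \<in> points Z \<Longrightarrow> ranchor Z z \<in> C1 \<Longrightarrow> 1 / 2 < (\<Sum>t\<in>T. orbit_sup (\<kappa> t) z)"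
    by blast
  define \<sigma> where "\<sigma> z = (\<Sum>t\<in>T. orbit_sup (\<kappa> t) z)" for z
  \<comment> \<open>The maximum avoids division by zero; where \<open>a\<close> does not vanish it equals \<open>\<sigma>\<close>.\<close>
  define m where "m z = a (ranchor Z z) / max (\<sigma> z) (1 / 2)" for z
  have cm: "continuous_map (ztop Z) euclideanreal m"
    unfolding m_def
  proof (rule continuous_map_apply2[where h = "\<lambda>x y :: real. x / max y (1 / 2)"])
    show "continuous_map (ztop Z) euclideanreal (\<lambda>z. a (ranchor Z z))"
      using continuous_map_compose[OF continuous_ranchor, of euclideanreal a] bump_continuous[OF a(1)]
      by (simp add: unit_space_def o_def)
    show "continuous_map (ztop Z) euclideanreal \<sigma>"
      unfolding \<sigma>_def by (intro continuous_map_sum T(1) orbit_sup_continuous[OF T(2,3,4)])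
    show "continuous_on UNIV (\<lambda>p :: real \<times> real. fst p / max (snd p) (1 / 2))"
      by (intro continuous_intros) (auto simp: max_def)
  qed
  have m_orbit: "m w = m z" if "w \<in> right_orbit H Z z" "z \<in> points Z" for w z
    using that by (simp add: m_def \<sigma>_def ranchor_orbit orbit_sup_orbit)
  have m_sum: "m z * \<sigma> z = a (ranchor Z z)" if "z \<in> points Z" for z
    using sum[OF that] C1(3)[of "ranchor Z z"] by (cases "ranchor Z z \<in> C1") (auto simp: m_def \<sigma>_def[symmetric])
  have "\<exists>\<psi>. bump (ztop Z) (U t) \<psi> \<and> (\<forall>z. \<kappa> t z \<noteq> 0 \<longrightarrow> \<psi> z = 1)" if t: "t \<in> T" for t
  proof -
    obtain K where K: "compactin (ztop Z) K" "K \<subseteq> U t" "\<And>z. z \<notin> K \<Longrightarrow> \<kappa> t z = 0"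
      using Cc_onD[of "\<lambda>z. complex_of_real (\<kappa> t z)" "ztop Z" "U t"] T(2,4)[OF t]
      unfolding bump_def by (metis of_real_eq_0_iff)
    from bump_on_compact[OF locally_LCH_points T(2)[OF t] small_Hausdorff[OF T(3)[OF t]] K(1,2)] show ?thesis
      using K(3) by blast
  qed
  then obtain \<psi> where \<psi>: "\<And>t. t \<in> T \<Longrightarrow> bump (ztop Z) (U t) (\<psi> t)" "\<And>t z. t \<in> T \<Longrightarrow> \<kappa> t z \<noteq> 0 \<Longrightarrow> \<psi> t z = 1" by metis
  define \<phi> where "\<phi> t z = complex_of_real (\<kappa> t z) * complex_of_real (m z)" for t z
  have \<phi>C: "\<phi> t \<in> Cspan (ztop Z)" and \<psi>C: "(\<lambda>z. complex_of_real (\<psi> t z)) \<in> Cspan (ztop Z)" if t: "t \<in> T" for t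
  proof -
    note U = T(2)[OF t] small_Hausdorff[OF T(3)[OF t]]
    have "continuous_map (subtopology (ztop Z) (U t)) euclidean (\<lambda>z. complex_of_real (m z))"
      by (intro continuous_map_apply[where h = complex_of_real] continuous_map_from_subtopology[OF cm] continuous_intros)
    then have "\<phi> t \<in> Cc_on (ztop Z) (U t)"
      unfolding \<phi>_def using T(4)[OF t] by (intro Cc_on_times[OF U]) (simp_all add: bump_def)
    then show "\<phi> t \<in> Cspan (ztop Z)" by (rule Cspan_Cc_on[OF U])
    show "(\<lambda>z. complex_of_real (\<psi> t z)) \<in> Cspan (ztop Z)"
      using \<psi>(1)[OF t] Cspan_Cc_on[OF U] by (simp add: bump_def)
  qed
  have summand: "T_raw H Z (\<phi> t) (S_raw H Z (\<lambda>z. complex_of_real (\<psi> t z)) \<zeta>) z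
      = complex_of_real (m z * orbit_sup (\<kappa> t) z) * \<zeta> z" if t: "t \<in> T" and z: "z \<in> points Z" for t z \<zeta>
  proof -
    have \<phi>0: "\<phi> t y = 0" and \<psi>0: "complex_of_real (\<psi> t y) = 0" if "y \<notin> U t" for y
      using bump_outside[OF T(4)[OF t] that] bump_outside[OF \<psi>(1)[OF t] that] by (simp_all add: \<phi>_def)
    note ts = T_raw_S_raw_small[OF T(3)[OF t], where \<phi> = "\<phi> t" and \<psi> = "\<lambda>z. complex_of_real (\<psi> t z)", OF \<phi>0 \<psi>0 z]
    show ?thesis
    proof (cases "right_orbit H Z z \<inter> U t = {}")
      case True
      then have "orbit_sup (\<kappa> t) z = 0" by (intro orbit_sup_eq_0[OF T(4)[OF t] z]) blast
      then show ?thesis using ts(2)[OF _ _ True] by simp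
    next
      case False
      then obtain w where w: "w \<in> right_orbit H Z z" "w \<in> U t" by blast
      show ?thesis
        using ts(1)[OF _ _ w] \<psi>(2)[OF t, of w] m_orbit[OF w(1) z] orbit_sup_eq[OF T(3)[OF t] T(4)[OF t] z w]
        by (cases "\<kappa> t w = 0") (simp_all add: \<phi>_def)
    qed
  qed
  have main: "left_mult G Z f \<zeta> = (\<lambda>z. \<Sum>t\<in>T. T_raw H Z (left_mult G Z f (\<phi> t)) (S_raw H Z (\<lambda>z. complex_of_real (\<psi> t z)) \<zeta>) z)"
    for \<zeta>
  proof -
    let ?X = "\<lambda>t. T_raw H Z (\<phi> t) (S_raw H Z (\<lambda>z. complex_of_real (\<psi> t z)) \<zeta>)"
    \<comment> \<open>Only arrows in the support of \<open>f\<close> contribute, and at their sources \<open>a\<close> is \<open>1\<close>.\<close>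
    have "left_mult G Z f \<zeta> = left_mult G Z f (\<lambda>z. \<Sum>t\<in>T. ?X t z)"
    proof
      fix z
      show "left_mult G Z f \<zeta> z = left_mult G Z f (\<lambda>z. \<Sum>t\<in>T. ?X t z) z"
      proof (cases "z \<in> points Z")
        case z: True
        have "f g * \<zeta> (lact Z (ginv G g) z) = f g * (\<Sum>t\<in>T. ?X t (lact Z (ginv G g) z))"
          if g: "g \<in> arrows G" "grng G g = ranchor Z z" for g
        proof (cases "g \<in> C0")
          case True
          let ?y = "lact Z (ginv G g) z"
          have y: "?y \<in> points Z" by (rule lact_inv_closed(1)[OF z g])
          have ry: "ranchor Z ?y = gsrc G g"
            using ranchor_lact[of "ginv G g" z] z g by (simp add: G.inv_closed G.src_inv G.rng_inv)
          have "(\<Sum>t\<in>T. ?X t ?y) = complex_of_real (m ?y * \<sigma> ?y) * \<zeta> ?y"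
            using summand[OF _ y] by (simp add: \<sigma>_def sum_distrib_left sum_distrib_right)
          then show ?thesis using m_sum[OF y] ry a(2)[OF True] by simp
        qed (simp add: C0(2))
        then show ?thesis using z by (auto simp: left_mult_def intro!: infsum_cong)
      qed (simp add: left_mult_def)
    qed
    also have "\<dots> = (\<lambda>z. \<Sum>t\<in>T. left_mult G Z f (?X t) z)"
      using T(1)
    proof (induction T)
      case empty
      show ?case by (simp add: raw_zero)
    next
      case (insert t T)
      show ?case
        using left_mult_add_right[OF f, of "?X t" 1 "\<lambda>z. \<Sum>t\<in>T. ?X t z"] insert.hyps
        unfolding insert.IH by simp
    qed
    also have "\<dots> = (\<lambda>z. \<Sum>t\<in>T. T_raw H Z (left_mult G Z f (\<phi> t)) (S_raw H Z (\<lambda>z. complex_of_real (\<psi> t z)) \<zeta>) z)"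
      using left_mult_T_raw[OF f \<phi>C] by (intro ext sum.cong) simp_all
    finally show ?thesis .
  qed
  show ?thesis
    using T(1) left_mult_Cspan[OF f \<phi>C] \<psi>C main
    by (intro exI[of _ T] exI[of _ "\<lambda>t. left_mult G Z f (\<phi> t)"] exI[of _ "\<lambda>t z. complex_of_real (\<psi> t z)"]) blast
qed

end

context admissible_correspondence
begin

theorem compact_if_proper:
  assumes "proper_correspondence G H Z"
  shows "ops.action ` ops.A1 \<subseteq> compact_operators ops.BB ops.PP"
proof (rule ops.action_compactI)
  fix b assume "b \<in> fst ` rep ` Cspan (gtop G)"
  then obtain f where f: "f \<in> Cspan (gtop G)" "b = lambda_rep p G f" unfolding fst_rep by blast
  obtain T :: "'z set" and \<phi> \<psi> where T: "finite T" "\<And>t. t \<in> T \<Longrightarrow> \<phi> t \<in> Cspan (ztop Z)" "\<And>t. t \<in> T \<Longrightarrow> \<psi> t \<in> Cspan (ztop Z)"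
    and dec: "\<And>\<zeta>. left_mult G Z f \<zeta> = (\<lambda>z. \<Sum>t\<in>T. T_raw H Z (\<phi> t) (S_raw H Z (\<psi> t) \<zeta>) z)"
    using left_mult_decomposition[OF assms f(1)] by blast
  let ?E = EZ
  have "\<exists>l. ops.mult_pair l \<in> lin_span ops.LL ops.rank_one \<and> ops.preserves l \<and>
      (\<forall>\<zeta>\<in>carrier ?E. l \<zeta> = (\<lambda>z. \<Sum>t\<in>T'. T_raw H Z (\<phi> t) (S_raw H Z (\<psi> t) \<zeta>) z))" if "T' \<subseteq> T" for T'
    using finite_subset[OF that T(1)] that
  proof (induction T')
    case empty
    show ?case
    proof (intro exI[of _ "vzero (op_space ?E ?E)"] conjI ballI)
      show "ops.mult_pair (vzero (op_space ?E ?E)) \<in> lin_span ops.LL ops.rank_one"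
        unfolding ops.mult_pair_zero(1) by (rule lin_span.zero)
      show "ops.preserves (vzero (op_space ?E ?E))" by (rule ops.mult_pair_zero(2))
    qed (simp add: E_corr_simps(3)[OF p])
  next
    case (insert t T')
    then obtain l where l: "ops.mult_pair l \<in> lin_span ops.LL ops.rank_one" "ops.preserves l"
      "\<And>\<zeta>. \<zeta> \<in> carrier ?E \<Longrightarrow> l \<zeta> = (\<lambda>z. \<Sum>t\<in>T'. T_raw H Z (\<phi> t) (S_raw H Z (\<psi> t) \<zeta>) z)" by blast
    have t: "t \<in> T" using insert.prems by blast
    let ?c = "compose (carrier ?E) (T_op p H Z (\<phi> t)) (S_op p H Z (\<psi> t))"
    have c: "?c \<zeta> = T_raw H Z (\<phi> t) (S_raw H Z (\<psi> t) \<zeta>)" if "\<zeta> \<in> carrier ?E" for \<zeta>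
      using that S_raw_mem[OF p T(3)[OF t] that] by (simp add: T_op_raw S_op_raw compose_def)
    show ?case
    proof (intro exI[of _ "vadd (op_space ?E ?E) l ?c"] conjI ballI)
      show "ops.mult_pair (vadd (op_space ?E ?E) l ?c) \<in> lin_span ops.LL ops.rank_one"
        "ops.preserves (vadd (op_space ?E ?E) l ?c)"
        by (rule ops.span_rank_one_add[OF l(1,2) T_Y1[OF T(2)[OF t]] S_X1[OF T(3)[OF t]]])+
      show "vadd (op_space ?E ?E) l ?c \<zeta> = (\<lambda>z. \<Sum>t\<in>insert t T'. T_raw H Z (\<phi> t) (S_raw H Z (\<psi> t) \<zeta>) z)"
        if "\<zeta> \<in> carrier ?E" for \<zeta>
        using that c[OF that] l(3)[OF that] insert.hyps by (simp add: E_corr_simps(2)[OF p] add.commute)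
    qed
  qed
  from this[OF order_refl] obtain l where l: "ops.mult_pair l \<in> lin_span ops.LL ops.rank_one" "ops.preserves l"
    "\<And>\<zeta>. \<zeta> \<in> carrier ?E \<Longrightarrow> l \<zeta> = (\<lambda>z. \<Sum>t\<in>T. T_raw H Z (\<phi> t) (S_raw H Z (\<psi> t) \<zeta>) z)" by blast
  have "l = L_op p f"
  proof (rule extensionalityI[of _ "carrier ?E"])
    show "l \<in> extensional (carrier ?E)" using ops.preservesD(1)[OF l(2)] by simp
    show "L_op p f \<in> extensional (carrier ?E)" by (simp add: L_op_def)
    show "l \<zeta> = L_op p f \<zeta>" if "\<zeta> \<in> carrier ?E" for \<zeta> using l(3)[OF that] dec that by (simp add: L_op_def)
  qed
  then show "ops.action b \<in> lin_span ops.LL ops.rank_one" using l(1) f(2) action_lambda[OF f(1)] by simp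
qed

end

subsection \<open>Compactness implies properness\<close>

context admissible_correspondence
begin

abbreviation "bound T \<xi> \<equiv> opnorm EH EZ T * vnorm EH \<xi>"

text \<open>Operators on \<open>Y\<close> whose results are small, uniformly and relative to the norms, at all points whose
  \<open>H\<close>-orbit avoids a suitable compact set. The second components of compact operators have this property.\<close>

definition vanishing :: "((('z \<Rightarrow> complex) \<Rightarrow> ('h \<Rightarrow> complex)) \<Rightarrow> (('z \<Rightarrow> complex) \<Rightarrow> ('h \<Rightarrow> complex)))
    \<times> ((('h \<Rightarrow> complex) \<Rightarrow> ('z \<Rightarrow> complex)) \<Rightarrow> (('h \<Rightarrow> complex) \<Rightarrow> ('z \<Rightarrow> complex))) \<Rightarrow> bool" where
  "vanishing P \<longleftrightarrow> snd P \<in> carrier (op_space (rspace ops.PP) (rspace ops.PP)) \<and>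
     (\<forall>e>0. \<exists>C. compactin (ztop Z) C \<and> (\<forall>z\<in>points Z. right_orbit H Z z \<inter> C = {} \<longrightarrow>
        (\<forall>T\<in>ops.Y1. \<forall>\<xi>\<in>carrier EH.
           cmod (snd P T \<xi> z) \<le> e * bound T \<xi>)))"

lemma vanishingD:
  assumes "vanishing P" "0 < e"
  obtains C where "compactin (ztop Z) C" "\<And>z T \<xi>. \<lbrakk>z \<in> points Z; right_orbit H Z z \<inter> C = {}; T \<in> ops.Y1; \<xi> \<in> carrier EH\<rbrakk>
    \<Longrightarrow> cmod (snd P T \<xi> z) \<le> e * bound T \<xi>"
  using assms unfolding vanishing_def by meson

lemma norms_nonneg:
  assumes "T \<in> ops.Y1" "\<xi> \<in> carrier EH"
  shows "0 \<le> bound T \<xi>"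
  using ops.VW.opnorm_nonneg[OF op_spaceD(3)[OF ops.Y1c[OF assms(1)]]] ops.V.norm_nonneg[OF assms(2)] by simp

lemma point_evaluation: "\<zeta> \<in> carrier EZ \<Longrightarrow> z \<in> points Z \<Longrightarrow> cmod (\<zeta> z) \<le> vnorm EZ \<zeta>"
  using norm_le_lp_norm[OF p, of "points Z" \<zeta> z] by (simp add: E_corr_norm[OF p]) (simp add: E_corr_mem[OF p])

lemma Y1_value:
  assumes "T \<in> ops.Y1" "\<xi> \<in> carrier EH" "z \<in> points Z"
  shows "cmod (T \<xi> z) \<le> bound T \<xi>"
proof -
  note T = ops.Y1c[OF assms(1)]
  show ?thesis
    using point_evaluation[OF op_spaceD(1)[OF T assms(2)] assms(3)] ops.VW.opnorm_apply[OF op_spaceD(3)[OF T] assms(2)]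
    by (rule order_trans)
qed

text \<open>An element of \<open>Y\<close> is a limit of operators \<open>T\<^sub>\<phi>\<close> with compact support.\<close>

lemma Y1_vanishing:
  assumes w: "w \<in> ops.Y1" and e: "0 < e"
  shows "\<exists>C. compactin (ztop Z) C \<and> (\<forall>z\<in>points Z. right_orbit H Z z \<inter> C = {} \<longrightarrow>
      (\<forall>\<xi>\<in>carrier EH. cmod (w \<xi> z) \<le> e * vnorm EH \<xi>))"
proof -
  let ?Y = "op_space EH EZ"
  obtain \<phi> where \<phi>: "\<phi> \<in> Cspan (ztop Z)" and d: "vnorm ?Y (vdiff ?Y w (T_op p H Z \<phi>)) < e"
    using w e unfolding closure_in_def by blast
  obtain C where C: "compactin (ztop Z) C" "\<And>z. z \<notin> C \<Longrightarrow> \<phi> z = 0" using Cspan_compact_support[OF \<phi>] by metis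
  have "cmod (w \<xi> z) \<le> e * vnorm EH \<xi>"
    if z: "z \<in> points Z" "right_orbit H Z z \<inter> C = {}" and \<xi>: "\<xi> \<in> carrier EH" for z \<xi>
  proof -
    have "T_raw H Z \<phi> \<xi> z = 0" by (rule T_raw_off_orbit[OF C(2) z])
    then have eq: "vdiff ?Y w (T_op p H Z \<phi>) \<xi> z = w \<xi> z"
      using \<xi> by (simp add: vdiff_def T_op_raw E_corr_simps(2,4)[OF p])
    have D: "vdiff ?Y w (T_op p H Z \<phi>) \<in> ops.Y1"
      using ops.Y.vdiff_closed[of w "T_op p H Z \<phi>"] w T_Y1[OF \<phi>] by (simp add: vdiff_def del: op_space_simps)
    have "cmod (w \<xi> z) \<le> opnorm EH EZ (vdiff ?Y w (T_op p H Z \<phi>)) * vnorm EH \<xi>"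
      using Y1_value[OF D \<xi> z(1)] unfolding eq .
    also have "\<dots> \<le> e * vnorm EH \<xi>"
      using d ops.V.norm_nonneg[OF \<xi>] by (intro mult_right_mono) simp_all
    finally show ?thesis .
  qed
  then show ?thesis using C(1) by blast
qed

lemma LL_snd: "P \<in> carrier ops.LL \<Longrightarrow> snd P \<in> carrier (op_space (rspace ops.PP) (rspace ops.PP))"
  unfolding ops.adjointable_simps by (auto simp del: op_space_simps op_pair_simps)

text \<open>The result is \<open>w\<close> applied to some vector, and \<open>w\<close> lies in \<open>Y\<close>.\<close>

lemma rank_one_vanishing:
  assumes "P \<in> ops.rank_one"
  shows "vanishing P"
proof -
  obtain w x where w: "w \<in> ops.Y1" and x: "x \<in> ops.X1" and P: "P = theta ops.PP w x"
    using assms by (auto simp only: ops.pair_carrier)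
  note xc = ops.X1c[OF x]
  let ?x = "opnorm EZ EH x"
  have x0: "0 \<le> ?x" by (rule ops.WV.opnorm_nonneg[OF op_spaceD(3)[OF xc]])
  show ?thesis
    unfolding vanishing_def
  proof (intro conjI allI impI)
    show "snd P \<in> carrier (op_space (rspace ops.PP) (rspace ops.PP))"
      unfolding P ops.theta_eq(1)[OF w x] by (intro LL_snd ops.mult_pair_closed(1) ops.theta_eq(2) w x)
    fix e :: real assume e: "0 < e"
    obtain C where C: "compactin (ztop Z) C" "\<And>z \<xi>. \<lbrakk>z \<in> points Z; right_orbit H Z z \<inter> C = {}; \<xi> \<in> carrier EH\<rbrakk>
        \<Longrightarrow> cmod (w \<xi> z) \<le> e / (?x + 1) * vnorm EH \<xi>"
      using Y1_vanishing[OF w, of "e / (?x + 1)"] e x0 by auto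
    have "cmod (snd P T \<xi> z) \<le> e * bound T \<xi>"
      if z: "z \<in> points Z" "right_orbit H Z z \<inter> C = {}" and T: "T \<in> ops.Y1" and \<xi>: "\<xi> \<in> carrier EH" for z T \<xi>
    proof -
      let ?n = "bound T \<xi>"
      note Tc = ops.Y1c[OF T]
      note T\<xi> = op_spaceD(1)[OF Tc \<xi>]
      have "snd P T \<xi> = w (x (T \<xi>))"
        unfolding P ops.theta_eq(1)[OF w x] ops.mult_pair_apply(2)[OF T] using \<xi> T\<xi> by (simp add: compose_def)
      moreover have xT: "vnorm EH (x (T \<xi>)) \<le> ?x * ?n"
        using ops.WV.opnorm_apply[OF op_spaceD(3)[OF xc] T\<xi>] mult_left_mono[OF ops.VW.opnorm_apply[OF op_spaceD(3)[OF Tc] \<xi>] x0]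
        by linarith
      moreover have "cmod (w (x (T \<xi>)) z) \<le> e / (?x + 1) * vnorm EH (x (T \<xi>))"
        by (rule C(2)[OF z op_spaceD(1)[OF xc T\<xi>]])
      ultimately have "cmod (snd P T \<xi> z) \<le> e / (?x + 1) * (?x * ?n)"
        using mult_left_mono[OF xT, of "e / (?x + 1)"] e x0 by simp
      also have "\<dots> = e * ?n * (?x / (?x + 1))" by simp
      also have "\<dots> \<le> e * ?n * 1" using e x0 norms_nonneg[OF T \<xi>] by (intro mult_left_mono) auto
      finally show ?thesis by simp
    qed
    then show "\<exists>C. compactin (ztop Z) C \<and> (\<forall>z\<in>points Z. right_orbit H Z z \<inter> C = {} \<longrightarrow>
        (\<forall>T\<in>ops.Y1. \<forall>\<xi>\<in>carrier EH.
           cmod (snd P T \<xi> z) \<le> e * bound T \<xi>))"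
      using C(1) by blast
  qed
qed

lemma snd_LL:
  "snd (vadd ops.LL P Q) = vadd (op_space (rspace ops.PP) (rspace ops.PP)) (snd P) (snd Q)"
  "snd (vscale ops.LL c P) = vscale (op_space (rspace ops.PP) (rspace ops.PP)) c (snd P)"
  "snd (vzero ops.LL) = vzero (op_space (rspace ops.PP) (rspace ops.PP))"
  by (simp_all add: adjointable_algebra_def Let_def)

lemma rspace_op_value:
  assumes "T \<in> ops.Y1" "\<xi> \<in> carrier EH"
  shows "vadd (op_space (rspace ops.PP) (rspace ops.PP)) A (vscale (op_space (rspace ops.PP) (rspace ops.PP)) c B) T \<xi> z
      = A T \<xi> z + c * B T \<xi> z"
    and "vzero (op_space (rspace ops.PP) (rspace ops.PP)) T \<xi> z = 0"
  using assms by (simp_all add: E_corr_simps(2,3,4)[OF p])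

lemma vanishing_zero: "vanishing (vzero ops.LL)"
  unfolding vanishing_def snd_LL
  using complex_vspace.zero_closed[of "op_space (rspace ops.PP) (rspace ops.PP)"] ops.YY.op_space_normed
  by (auto simp: rspace_op_value norms_nonneg complex_normed_space_def simp del: op_space_simps op_pair_simps
      intro!: exI[of _ "{}"])

lemma vanishing_add:
  assumes P: "vanishing P" and Q: "vanishing Q"
  shows "vanishing (vadd ops.LL P (vscale ops.LL c Q))"
  unfolding vanishing_def snd_LL
proof (intro conjI allI impI)
  let ?L = "op_space (rspace ops.PP) (rspace ops.PP)"
  interpret L: complex_normed_space ?L by (rule ops.YY.op_space_normed)
  have "snd P \<in> carrier ?L" "snd Q \<in> carrier ?L" using P Q unfolding vanishing_def by blast+
  then show "vadd ?L (snd P) (vscale ?L c (snd Q)) \<in> carrier ?L" by (intro L.add_closed L.scale_closed)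
  fix e :: real assume e: "0 < e"
  define d where "d = e / 2 / (cmod c + 1)"
  have d: "0 < d" "cmod c * d \<le> e / 2"
  proof -
    have c1: "0 < cmod c + 1" using norm_ge_zero[of c] by linarith
    then show "0 < d" using e by (simp add: d_def)
    have "cmod c * d = e / 2 * (cmod c / (cmod c + 1))" by (simp add: d_def)
    also have "\<dots> \<le> e / 2 * 1" using e c1 by (intro mult_left_mono) simp_all
    finally show "cmod c * d \<le> e / 2" by simp
  qed
  obtain C where C: "compactin (ztop Z) C" "\<And>z T \<xi>. \<lbrakk>z \<in> points Z; right_orbit H Z z \<inter> C = {}; T \<in> ops.Y1; \<xi> \<in> carrier EH\<rbrakk>
    \<Longrightarrow> cmod (snd P T \<xi> z) \<le> e / 2 * bound T \<xi>"
    using vanishingD[OF P, of "e / 2"] e by auto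
  obtain D where D: "compactin (ztop Z) D" "\<And>z T \<xi>. \<lbrakk>z \<in> points Z; right_orbit H Z z \<inter> D = {}; T \<in> ops.Y1; \<xi> \<in> carrier EH\<rbrakk>
    \<Longrightarrow> cmod (snd Q T \<xi> z) \<le> d * bound T \<xi>"
    using vanishingD[OF Q d(1)] by auto
  have "cmod (vadd ?L (snd P) (vscale ?L c (snd Q)) T \<xi> z)
      \<le> e * bound T \<xi>"
    if z: "z \<in> points Z" "right_orbit H Z z \<inter> (C \<union> D) = {}" and T: "T \<in> ops.Y1" and \<xi>: "\<xi> \<in> carrier EH" for z T \<xi>
  proof -
    let ?n = "bound T \<xi>"
    have o: "right_orbit H Z z \<inter> C = {}" "right_orbit H Z z \<inter> D = {}" using z(2) by blast+
    have "cmod (snd P T \<xi> z + c * snd Q T \<xi> z) \<le> cmod (snd P T \<xi> z) + cmod c * cmod (snd Q T \<xi> z)"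
      by (metis norm_mult norm_triangle_ineq)
    also have "\<dots> \<le> e / 2 * ?n + cmod c * (d * ?n)"
      by (intro add_mono mult_left_mono C(2)[OF z(1) o(1) T \<xi>] D(2)[OF z(1) o(2) T \<xi>]) simp
    also have "cmod c * (d * ?n) \<le> e / 2 * ?n"
      using mult_right_mono[OF d(2) norms_nonneg[OF T \<xi>]] by (simp add: mult.assoc)
    finally show ?thesis unfolding rspace_op_value(1)[OF T \<xi>] by (simp add: ac_simps)
  qed
  then show "\<exists>C. compactin (ztop Z) C \<and> (\<forall>z\<in>points Z. right_orbit H Z z \<inter> C = {} \<longrightarrow>
      (\<forall>T\<in>ops.Y1. \<forall>\<xi>\<in>carrier EH.
         cmod (vadd ?L (snd P) (vscale ?L c (snd Q)) T \<xi> z)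
           \<le> e * bound T \<xi>))"
    using compactin_Un[OF C(1) D(1)] by blast
qed

text \<open>The property passes from rank one operators to their span and, being uniform, to norm limits.\<close>

lemma compact_vanishing:
  assumes P: "P \<in> compact_operators ops.BB ops.PP"
  shows "vanishing P"
  unfolding vanishing_def
proof (intro conjI allI impI)
  let ?L = "op_space (rspace ops.PP) (rspace ops.PP)"
  interpret L: complex_normed_space ?L by (rule ops.YY.op_space_normed)
  have Pc: "snd P \<in> carrier ?L" using P by (intro LL_snd) (simp add: compact_operators_def closure_in_def)
  then show "snd P \<in> carrier ?L" .
  fix e :: real assume e: "0 < e"
  obtain Q where Q: "Q \<in> lin_span ops.LL ops.rank_one" "vnorm ops.LL (vdiff ops.LL P Q) < e / 2"
    using P e unfolding compact_operators_def closure_in_def by (auto dest!: spec[of _ "e / 2"] simp del: op_pair_simps)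
  have vQ: "vanishing Q"
    using Q(1)
  proof (induction rule: lin_span.induct)
    case zero
    show ?case by (rule vanishing_zero)
  next
    case (add x y c)
    show ?case by (rule vanishing_add[OF add.IH rank_one_vanishing[OF add.hyps(2)]])
  qed
  then have Qc: "snd Q \<in> carrier ?L" unfolding vanishing_def by blast
  obtain C where C: "compactin (ztop Z) C" "\<And>z T \<xi>. \<lbrakk>z \<in> points Z; right_orbit H Z z \<inter> C = {}; T \<in> ops.Y1; \<xi> \<in> carrier EH\<rbrakk>
    \<Longrightarrow> cmod (snd Q T \<xi> z) \<le> e / 2 * bound T \<xi>"
    using vanishingD[OF vQ, of "e / 2"] e by auto
  have "cmod (snd P T \<xi> z) \<le> e * bound T \<xi>"
    if z: "z \<in> points Z" "right_orbit H Z z \<inter> C = {}" and T: "T \<in> ops.Y1" and \<xi>: "\<xi> \<in> carrier EH" for z T \<xi>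
  proof -
    let ?n = "bound T \<xi>"
    define D where "D = vdiff ?L (snd P) (snd Q)"
    have Dc: "D \<in> carrier ?L" unfolding D_def by (rule L.vdiff_closed[OF Pc Qc])
    have nD: "opnorm (rspace ops.PP) (rspace ops.PP) D \<le> e / 2"
      using Q(2) unfolding ops.adjointable_simps(4) vdiff_def snd_LL D_def by simp
    have TY: "T \<in> carrier (rspace ops.PP)" using T by (simp only: ops.pair_carrier)
    have DT: "D T \<in> ops.Y1" using op_spaceD(1)[OF Dc TY] by (simp only: ops.pair_carrier)
    have "opnorm EH EZ (D T) \<le> opnorm (rspace ops.PP) (rspace ops.PP) D * opnorm EH EZ T"
      using ops.YY.opnorm_apply[OF op_spaceD(3)[OF Dc] TY] by (simp only: ops.pair_vnorm)
    also have "\<dots> \<le> e / 2 * opnorm EH EZ T"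
      using ops.VW.opnorm_nonneg[OF op_spaceD(3)[OF ops.Y1c[OF T]]] nD by (intro mult_right_mono)
    finally have "opnorm EH EZ (D T) * vnorm EH \<xi>
        \<le> e / 2 * opnorm EH EZ T * vnorm EH \<xi>"
      using ops.V.norm_nonneg[OF \<xi>] by (rule mult_right_mono)
    then have "opnorm EH EZ (D T) * vnorm EH \<xi> \<le> e / 2 * ?n"
      by (simp only: mult.assoc)
    then have "cmod (D T \<xi> z) \<le> e / 2 * ?n" using Y1_value[OF DT \<xi> z(1)] by linarith
    moreover have "snd P T \<xi> z = D T \<xi> z + snd Q T \<xi> z"
      unfolding D_def vdiff_def rspace_op_value(1)[OF T \<xi>] by simp
    ultimately show ?thesis
      using C(2)[OF z T \<xi>] norm_triangle_ineq[of "D T \<xi> z" "snd Q T \<xi> z"] by simp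
  qed
  then show "\<exists>C. compactin (ztop Z) C \<and> (\<forall>z\<in>points Z. right_orbit H Z z \<inter> C = {} \<longrightarrow>
        (\<forall>T\<in>ops.Y1. \<forall>\<xi>\<in>carrier EH.
           cmod (snd P T \<xi> z) \<le> e * bound T \<xi>))"
    using C(1) by blast
qed

text \<open>Multiplication by a function \<open>a\<close> on the units that is \<open>1\<close> on \<open>K\<close> acts compactly, so there is a compact
  \<open>C\<close> as in \<^const>\<open>vanishing\<close> for the bound \<open>1/2\<close>. At a point over \<open>K\<close> whose orbit avoided \<open>C\<close>, a bump there
  and the point mass at its image under \<open>s\<^sub>Z\<close>, both of norm at most one, would produce the value \<open>1\<close>. The
  preimage of \<open>K\<close> is thus contained in the image of \<open>C\<close>, and it is closed since the units are Hausdorff.\<close>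

theorem proper_if_compact:
  assumes comp: "ops.action ` ops.A1 \<subseteq> compact_operators ops.BB ops.PP"
  shows "proper_correspondence G H Z"
  unfolding proper_correspondence_def
proof (rule compact_imp_proper_map)
  let ?X = "orbit_space H Z"
  show "k_space (unit_space G)" by (rule locally_compact_imp_k_space[OF G.lc_units])
  show "kc_space (unit_space G)" by (rule Hausdorff_imp_kc_space[OF G.Hausdorff_units])
  show "continuous_map ?X (unit_space G) (r_star Z) \<or> kc_space ?X" using r_star_continuous by blast
  show "r_star Z \<in> topspace ?X \<rightarrow> topspace (unit_space G)"
    using r_star_continuous by (simp add: continuous_map_def)
  fix K assume K: "compactin (unit_space G) K"
  obtain a where a: "bump (gtop G) (units G) a" "\<forall>u\<in>K. a u = 1" "(\<lambda>g. complex_of_real (a g)) \<in> Cspan (gtop G)"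
    using G.unit_bump[OF K] by blast
  let ?a = "\<lambda>g. complex_of_real (a g)"
  let ?P = "ops.action (lambda_rep p G ?a)"
  have "?P \<in> compact_operators ops.BB ops.PP" using comp lambda_A1[OF a(3)] by blast
  then have "vanishing ?P" by (rule compact_vanishing)
  then obtain C where C: "compactin (ztop Z) C" "\<And>z T \<xi>. \<lbrakk>z \<in> points Z; right_orbit H Z z \<inter> C = {}; T \<in> ops.Y1; \<xi> \<in> carrier EH\<rbrakk>
    \<Longrightarrow> cmod (snd ?P T \<xi> z) \<le> 1 / 2 * bound T \<xi>"
    using vanishingD[of ?P "1 / 2"] by auto
  have meets: "right_orbit H Z z \<inter> C \<noteq> {}" if z: "z \<in> points Z" "ranchor Z z \<in> K" for z
  proof
    assume e: "right_orbit H Z z \<inter> C = {}"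
    obtain U \<kappa> where U: "openin (ztop Z) U" "small U" "z \<in> U" and \<kappa>: "bump (ztop Z) U \<kappa>" "\<kappa> z = 1"
      using small_bump[OF z(1)] by blast
    let ?k = "\<lambda>z. complex_of_real (\<kappa> z)" and ?d = "\<lambda>h. if h = sanchor Z z then 1 else 0 :: complex"
    have kC: "?k \<in> Cspan (ztop Z)" using Cspan_Cc_on[OF U(1) small_Hausdorff[OF U(2)]] \<kappa>(1) by (simp add: bump_def)
    have k0: "?k y = 0" if "y \<notin> U" for y using bump_outside[OF \<kappa>(1) that] by simp
    have k1: "cmod (?k y) \<le> 1" for y using \<kappa>(1) by (simp add: bump_def)
    have u: "sanchor Z z \<in> units H" by (rule sanchor_units[OF z(1)])
    note pm = lp_point_mass[OF p H.unit_arrow[OF u]]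
    have d: "?d \<in> carrier EH"
      using pm(1) H.unit_arrow[OF u] unfolding H.E_groupoid_mem[OF p] by auto
    have nd: "vnorm EH ?d = 1" using pm(2) by (simp only: H.E_groupoid_norm[OF p d])
    have nT: "opnorm EH EZ (T_op p H Z ?k) \<le> 1"
    proof (rule ops.VW.opnorm_le)
      fix \<xi> assume \<xi>: "\<xi> \<in> carrier EH"
      then have "in_lp p (arrows H) \<xi>" by (simp add: H.E_groupoid_mem[OF p])
      from T_small_bound(2)[OF p U(2) k0 k1 this] T_raw_mem[OF p kC \<xi>] \<xi>
      show "vnorm EZ (T_op p H Z ?k \<xi>) \<le> 1 * vnorm EH \<xi>"
        by (simp add: T_op_raw E_corr_norm[OF p] H.E_groupoid_norm[OF p])
    qed simp
    have "T_raw H Z ?k ?d z = ?k (ract Z z (ginv H (sanchor Z z))) * ?d (sanchor Z z)"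
      using z(1) u U(3)
      by (intro T_raw_small[OF U(2)] k0) (simp_all add: src_fibre_iff H.unit_arrow H.src_unit H.inv_unit ract_unit)
    then have v1: "T_raw H Z ?k ?d z = 1" using u \<kappa>(2) z(1) by (simp add: H.inv_unit ract_unit)
    have a0: "?a g = 0" if "g \<notin> units G" for g using bump_outside[OF a(1) that] by simp
    have "snd ?P (T_op p H Z ?k) ?d z = T_raw H Z (left_mult G Z ?a ?k) ?d z"
      unfolding action_apply(2)[OF a(3) kC] unfolding T_op_raw restrict_apply' [OF d] ..
    also have "\<dots> = left_mult G Z ?a (T_raw H Z ?k ?d) z" unfolding left_mult_T_raw[OF a(3) kC] ..
    also have "\<dots> = 1" using left_mult_units[OF a0 z(1)] a(2) z(2) v1 by simp
    finally have "1 \<le> 1 / 2 * (opnorm EH EZ (T_op p H Z ?k) * 1)"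
      using C(2)[OF z(1) e T_Y1[OF kC] d] nd by simp
    then show False using nT by simp
  qed
  have sub: "{x \<in> topspace ?X. r_star Z x \<in> K} \<subseteq> right_orbit H Z ` C"
  proof
    fix x assume "x \<in> {x \<in> topspace ?X. r_star Z x \<in> K}"
    then obtain z where z: "z \<in> points Z" "x = right_orbit H Z z" "ranchor Z z \<in> K"
      by (auto simp: topspace_orbit_space r_star_orbit)
    then obtain c where c: "c \<in> right_orbit H Z z" "c \<in> C" using meets by blast
    then have "x = right_orbit H Z c" using right_orbit_eq[OF c(1) z(1)] z(2) by simp
    then show "x \<in> right_orbit H Z ` C" using c(2) by blast
  qed
  have "closedin ?X {x \<in> topspace ?X. r_star Z x \<in> K}"
    by (rule closedin_continuous_map_preimage[OF r_star_continuous compactin_imp_closedin[OF G.Hausdorff_units K]])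
  then show "compactin ?X {x \<in> topspace ?X. r_star Z x \<in> K}"
    by (rule closed_compactin[OF image_compactin[OF C(1) orbit_map_continuous] sub])
qed

end

theorem theorem7p14:
  fixes G :: "'g groupoid" and H :: "'h groupoid" and Z :: "('g, 'h, 'z) correspondence"
    and p :: ennreal
  assumes "etale_groupoid G"
    and "locally_compact_space (gtop G)" and "locally_Hausdorff_space (gtop G)"
    and "locally_compact_space (unit_space G)" and "Hausdorff_space (unit_space G)"
    and "etale_groupoid H"
    and "locally_compact_space (gtop H)" and "locally_Hausdorff_space (gtop H)"
    and "locally_compact_space (unit_space H)" and "Hausdorff_space (unit_space H)"
    and "1 \<le> p"
    and "groupoid_correspondence G H Z"
    and "p \<in> {1, \<infinity>} \<or> (1 < p \<and> p < \<infinity> \<and> proper_left_action G Z)"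
  shows "morita_cycle (Fp_red p G) (Fp_red p H) (corr_pair p H Z) (pi_corr p G H Z)
           \<longleftrightarrow> proper_correspondence G H Z"
proof -
  interpret admissible_correspondence G H Z p
    using assms
    by (simp add: admissible_correspondence_def admissible_correspondence_axioms_def lc_correspondence_def
        lc_groupoid_def lc_groupoid_axioms_def)
  show ?thesis unfolding morita_iff_compact using compact_if_proper proper_if_compact by blast
qed

end
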